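(* Let $W$ be a graphon, fix an integer $r\ge 2$, and let $X_n$ denote the number of $r$-cliques (copies of $K_r$) in $\mathbb{G}(n,W)$. Let $t(K_r,W)=\Pr[\mathbb{G}(r,W)=K_r]$ and, for $x\in[0,1]$, $t(x)=\Pr[\mathbb{G}(r,W)=K_r\mid U_1=x]$. Then: (a) If $t(K_r,W)=0$, then almost surely $X_n=0$; if $t(K_r,W)=1$, then almost surely $X_n=\binom nr$. (b) If $t(x)$ is not constant (i.e. not equal to a constant for almost every $x$), then there is a constant $\sigma>0$ such that $\dfrac{X_n-\mathbb{E}[X_n]}{n^{r-1/2}}\to \sigma Z$ in distribution, where $Z$ is a standard normal random variable. (c) If $t(x)$ is constant almost everywhere and $t(K_r,W)\notin\{0,1\}$, then there are real numbers $c_0,c_1,c_2,\dots$ with $\sum_i c_i^2\in(0,\infty)$ such that $\dfrac{X_n-\mathbb{E}[X_n]}{n^{r-1}}\to c_0Z_0+\sum_{i\ge1}c_i(Z_i^2-1)$ in distribution, where $Z_0,Z_1,\dots$ are independent standard normal random variables; the series on the right converges almost surely and in $L^2$.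
   Context: A graphon is a symmetric Lebesgue measurable function $W:[0,1]^2\to[0,1]$. The random graph $\mathbb{G}(n,W)$ on vertex set $[n]=\{1,\dots,n\}$ is generated as follows: draw i.i.d. uniform random "types" $U_1,\dots,U_n\in[0,1]$; then, conditionally on the types, each pair $\{i,j\}$ is joined by an edge independently with probability $W(U_i,U_j)$. A measurable function is called constant if it equals a constant almost everywhere. *)

theory Defs
  imports "HOL-Probability.Probability"
begin

text \<open>Graphons: symmetric Lebesgue measurable functions [0,1]^2 -> [0,1].
  Lebesgue measure on R^2 is the completion of lborel on real x real.\<close>
definition graphon :: "(real \<Rightarrow> real \<Rightarrow> real) \<Rightarrow> bool" where
  "graphon W \<longleftrightarrow>
     (\<lambda>(x, y). W x y) \<in> borel_measurable
        (restrict_space (completion (lborel \<Otimes>\<^sub>M lborel)) ({0..1} \<times> {0..1})) \<and>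
     (\<forall>x\<in>{0..1}. \<forall>y\<in>{0..1}. W x y = W y x \<and> 0 \<le> W x y \<and> W x y \<le> 1)"

definition unif01 :: "real measure" where
  "unif01 = uniform_measure lborel {0..1}"

text \<open>Unordered pairs of vertices of [n] = {0,...,n-1}, encoded as (i,j) with i<j.\<close>
definition vpairs :: "nat \<Rightarrow> (nat \<times> nat) set" where
  "vpairs n = {(i, j). i < j \<and> j < n}"

definition edge_set :: "nat \<Rightarrow> (nat \<times> nat \<Rightarrow> bool) \<Rightarrow> nat set set" where
  "edge_set n e = {{i, j} | i j. i < j \<and> j < n \<and> e (i, j)}"

definition rand_graph ::
  "(real \<Rightarrow> real \<Rightarrow> real) \<Rightarrow> nat \<Rightarrow> (nat \<Rightarrow> real) measure \<Rightarrow> nat set set measure" where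
  "rand_graph W n T =
     T \<bind> (\<lambda>U. distr (PiM (vpairs n)
                        (\<lambda>p. measure_pmf (bernoulli_pmf (W (U (fst p)) (U (snd p))))))
                      (count_space UNIV) (edge_set n))"

definition GnW :: "nat \<Rightarrow> (real \<Rightarrow> real \<Rightarrow> real) \<Rightarrow> nat set set measure" where
  "GnW n W = rand_graph W n (completion (PiM {..<n} (\<lambda>_. unif01)))"

definition complete_graph :: "nat \<Rightarrow> nat set set" where
  "complete_graph r = {{i, j} | i j. i < j \<and> j < r}"

definition tK :: "nat \<Rightarrow> (real \<Rightarrow> real \<Rightarrow> real) \<Rightarrow> real" where
  "tK r W = measure (GnW r W) {complete_graph r}"

text \<open>t(x) = Pr[G(r,W) = K_r | U_1 = x] (vertex 1 of the paper is vertex 0 here):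
  the type of the first vertex is fixed to x, the others are i.i.d. uniform.\<close>
definition tcond :: "nat \<Rightarrow> (real \<Rightarrow> real \<Rightarrow> real) \<Rightarrow> real \<Rightarrow> real" where
  "tcond r W x = measure
     (rand_graph W r (completion (PiM {..<r} (\<lambda>i. if i = 0 then return borel x else unif01))))
     {complete_graph r}"

definition clique_count :: "nat \<Rightarrow> nat \<Rightarrow> nat set set \<Rightarrow> nat" where
  "clique_count n r E =
     card {S. S \<subseteq> {..<n} \<and> card S = r \<and> (\<forall>i\<in>S. \<forall>j\<in>S. i \<noteq> j \<longrightarrow> {i, j} \<in> E)}"

definition mean_cliques :: "nat \<Rightarrow> nat \<Rightarrow> (real \<Rightarrow> real \<Rightarrow> real) \<Rightarrow> real" where
  "mean_cliques n r W = (\<integral>E. real (clique_count n r E) \<partial>GnW n W)"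

definition normalized_law :: "nat \<Rightarrow> nat \<Rightarrow> (real \<Rightarrow> real \<Rightarrow> real) \<Rightarrow> real \<Rightarrow> real measure" where
  "normalized_law n r W a =
     distr (GnW n W) borel (\<lambda>E. (real (clique_count n r E) - mean_cliques n r W) / real n powr a)"

definition std_normal :: "real measure" where
  "std_normal = density lborel std_normal_density"

definition ae_const01 :: "(real \<Rightarrow> real) \<Rightarrow> bool" where
  "ae_const01 f \<longleftrightarrow> (\<exists>c. AE x in lborel. x \<in> {0..1} \<longrightarrow> f x = c)"

end

theory Submission
  imports Defs "HOL-Real_Asymp.Real_Asymp"
begin

text \<open>The clique indicators are functions of i.i.d. uniform variables, one for each vertex and one for each
  pair of vertices, and the proof is the Hoeffding decomposition of their sum. Only the first non-vanishing
  level of the decomposition matters asymptotically. If \<open>t(x)\<close> is not constant, this is the sum over the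
  vertices and the central limit theorem applies. Otherwise it is the sum over the pairs, in which the
  conditional probability that the pair spans a clique splits into its mean given the two types, a degenerate
  kernel \<open>h\<close>, and a noise term of conditional variance \<open>vv\<close> produced by the pair variables. Given the types,
  the noise is asymptotically normal and independent of the rest. The kernel \<open>h\<close> is approximated in mean
  square by kernels \<open>\<Sum>\<^sub>i l\<^sub>i w\<^sub>i(x) w\<^sub>i(y)\<close> with orthonormal centred \<open>w\<^sub>i\<close> (a finite matrix diagonalisation), whose
  U-statistics converge to \<open>\<Sum>\<^sub>i l\<^sub>i (Z\<^sub>i\<^sup>2 - 1) / 2\<close>: by Lindeberg's method the vectors \<open>(w\<^sub>i(U\<^sub>j))\<^sub>i\<close> may be
  exchanged for independent random signs. The coefficients are extracted as a subsequential limit of those of the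
  approximations, so that no spectral theorem for compact operators is needed.\<close>

section \<open>Resampling coordinates of a product measure\<close>

text \<open>All comparisons are made between characteristic functions at a fixed argument, on one
  probability space: a mean square error bounds the difference because the imaginary exponential is
  1-Lipschitz, and Levy's continuity theorem then gives weak convergence. For the degenerate kernel,
  the mean square error of a finite rank approximation is small uniformly in \<open>n\<close>. Hence
  the limits in \<open>n\<close> and in the approximation may be interchanged, and a convergent
  subsequence of approximations determines the limit of the whole sequence in \<open>n\<close>. A
  subsequential limit of coefficients may lose part of the sum of squares to ever smaller
  coefficients. Since \<open>chi_cf \<theta>\<close> is close to
  \<open>exp (- \<theta>\<^sup>2)\<close> near 0, the lost part acts as a normal summand and is
  absorbed in \<open>c 0\<close> together with the edge noise. What remains is to see that the
  \<open>c i\<close> do not all vanish. Independence and conditioning are expressed by resampling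
  coordinates instead of by sub-sigma-algebras: a function of some coordinates is one that does not
  change when the others are replaced by those of a second sample.\<close>

definition mix :: "'i set \<Rightarrow> ('i \<Rightarrow> 'a) \<Rightarrow> ('i \<Rightarrow> 'a) \<Rightarrow> 'i \<Rightarrow> 'a" where
  "mix A x y = (\<lambda>i. if i \<in> A then y i else x i)"

lemma measurable_mix [measurable]:
  "(\<lambda>(x, y). mix A x y) \<in> PiM UNIV M \<Otimes>\<^sub>M PiM UNIV M \<rightarrow>\<^sub>M PiM UNIV M"
  unfolding mix_def
proof (rule measurable_PiM_single')
  fix i
  show "(\<lambda>p. (case p of (x, y) \<Rightarrow> \<lambda>i. if i \<in> A then y i else x i) i)
      \<in> PiM UNIV M \<Otimes>\<^sub>M PiM UNIV M \<rightarrow>\<^sub>M M i"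
    by (cases "i \<in> A") (auto simp: split_beta')
qed (auto simp: space_pair_measure space_PiM PiE_iff)

lemma measurable_mix2 [measurable (raw)]:
  assumes "f \<in> N \<rightarrow>\<^sub>M PiM UNIV M" "g \<in> N \<rightarrow>\<^sub>M PiM UNIV M"
  shows "(\<lambda>z. mix A (f z) (g z)) \<in> N \<rightarrow>\<^sub>M PiM UNIV M"
  using measurable_compose[OF measurable_Pair[OF assms] measurable_mix] by simp

locale full_product = product_prob_space M UNIV for M :: "'i \<Rightarrow> 'a measure"
begin

abbreviation "\<Omega> \<equiv> PiM UNIV M"

text \<open>Coordinates in \<open>A\<close> come from the second sample and the others from the
  first, so a box pulls back to a product of two boxes over disjoint sets of indices, whose measures
  multiply to the measure of the original box.\<close>

lemma distr_mix: "distr (\<Omega> \<Otimes>\<^sub>M \<Omega>) \<Omega> (\<lambda>(x, y). mix A x y) = \<Omega>"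
proof (rule PiM_eq)
  show "sets (distr (\<Omega> \<Otimes>\<^sub>M \<Omega>) \<Omega> (\<lambda>(x, y). mix A x y)) = sets \<Omega>" by simp
next
  fix J F assume J: "finite J" "J \<subseteq> (UNIV :: 'i set)" and F: "\<And>j. j \<in> J \<Longrightarrow> F j \<in> sets (M j)"
  interpret PP: pair_prob_space \<Omega> \<Omega> ..
  have S: "F j \<subseteq> space (M j)" if "j \<in> J" for j using F[OF that] sets.sets_into_space by auto
  have eq: "(\<lambda>(x, y). mix A x y) -` prod_emb UNIV M J (Pi\<^sub>E J F) \<inter> space (\<Omega> \<Otimes>\<^sub>M \<Omega>)
     = prod_emb UNIV M (J - A) (Pi\<^sub>E (J - A) F) \<times> prod_emb UNIV M (J \<inter> A) (Pi\<^sub>E (J \<inter> A) F)"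
    using S by (auto simp: prod_emb_def space_pair_measure space_PiM mix_def PiE_iff
       split: if_splits)
  have "emeasure (distr (\<Omega> \<Otimes>\<^sub>M \<Omega>) \<Omega> (\<lambda>(x, y). mix A x y)) (prod_emb UNIV M J (Pi\<^sub>E J F))
    = emeasure (\<Omega> \<Otimes>\<^sub>M \<Omega>) (prod_emb UNIV M (J - A) (Pi\<^sub>E (J - A) F) \<times> prod_emb UNIV M (J \<inter> A) (Pi\<^sub>E (J \<inter> A) F))"
    using J F by (subst emeasure_distr) (auto simp: eq)
  also have "\<dots> = emeasure \<Omega> (prod_emb UNIV M (J - A) (Pi\<^sub>E (J - A) F)) *
      emeasure \<Omega> (prod_emb UNIV M (J \<inter> A) (Pi\<^sub>E (J \<inter> A) F))"
    using J F by (intro P.emeasure_pair_measure_Times) auto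
  also have "\<dots> = (\<Prod>j\<in>J - A. emeasure (M j) (F j)) * (\<Prod>j\<in>J \<inter> A. emeasure (M j) (F j))"
    using J F by (subst (1 2) emeasure_PiM_emb) auto
  also have "\<dots> = (\<Prod>j\<in>J. emeasure (M j) (F j))"
    using J by (subst prod.union_disjoint[symmetric]) (auto intro!: prod.cong)
  finally show "emeasure (distr (\<Omega> \<Otimes>\<^sub>M \<Omega>) \<Omega> (\<lambda>(x, y). mix A x y)) (prod_emb UNIV M J (Pi\<^sub>E J F))
     = (\<Prod>j\<in>J. emeasure (M j) (F j))" .
qed

sublocale PP: pair_prob_space \<Omega> \<Omega> ..

lemma integrable_mix:
  fixes f :: "_ \<Rightarrow> 'b::{banach, second_countable_topology}"
  assumes "integrable \<Omega> f"
  shows "integrable (\<Omega> \<Otimes>\<^sub>M \<Omega>) (\<lambda>(x, y). f (mix A x y))"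
proof -
  have "integrable (distr (\<Omega> \<Otimes>\<^sub>M \<Omega>) \<Omega> (\<lambda>(x, y). mix A x y)) f"
    using assms by (simp add: distr_mix)
  then show ?thesis
    using assms by (subst (asm) integrable_distr_eq) (auto simp: split_beta')
qed

lemma integral_mix:
  fixes f :: "_ \<Rightarrow> 'b::{banach, second_countable_topology}"
  assumes "integrable \<Omega> f"
  shows "(\<integral>x. f x \<partial>\<Omega>) = (\<integral>x. (\<integral>y. f (mix A x y) \<partial>\<Omega>) \<partial>\<Omega>)"
proof -
  have "(\<integral>x. f x \<partial>\<Omega>) = (\<integral>x. f x \<partial>distr (\<Omega> \<Otimes>\<^sub>M \<Omega>) \<Omega> (\<lambda>(x, y). mix A x y))"
    by (simp add: distr_mix)
  also have "\<dots> = (\<integral>z. f (mix A (fst z) (snd z)) \<partial>(\<Omega> \<Otimes>\<^sub>M \<Omega>))"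
    using assms by (subst integral_distr) (auto simp: split_beta')
  also have "\<dots> = (\<integral>x. (\<integral>y. f (mix A x y) \<partial>\<Omega>) \<partial>\<Omega>)"
    using integrable_mix[OF assms, of A]
    by (subst PP.integral_fst'[symmetric]) (auto simp: split_beta')
  finally show ?thesis .
qed

text \<open>The inner integral is the conditional expectation of \<open>f\<close> given the
  coordinates outside \<open>A\<close>, and \<open>g\<close> is a function of those coordinates:
  this is the defining property of conditional expectation.\<close>

lemma integral_mult_resample:
  fixes f g :: "_ \<Rightarrow> 'b::{real_normed_field, banach, second_countable_topology}"
  assumes "integrable \<Omega> (\<lambda>x. g x * f x)" "\<And>x y. g (mix A x y) = g x"
  shows "(\<integral>x. g x * f x \<partial>\<Omega>) = (\<integral>x. g x * (\<integral>y. f (mix A x y) \<partial>\<Omega>) \<partial>\<Omega>)"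
  by (subst integral_mix[OF assms(1), of A]) (simp add: assms(2))

text \<open>The two invariances say that \<open>g\<close> reads only coordinates outside
  \<open>A\<close> and \<open>f\<close> only coordinates in \<open>A\<close>; resampling
  \<open>A\<close> turns the inner integral into a constant.\<close>

lemma integral_mult_indep:
  fixes f g :: "_ \<Rightarrow> 'b::{real_normed_field, banach, second_countable_topology}"
  assumes "integrable \<Omega> (\<lambda>x. g x * f x)" "\<And>x y. g (mix A x y) = g x"
    "\<And>x y. f (mix A x y) = f y"
  shows "(\<integral>x. g x * f x \<partial>\<Omega>) = (\<integral>x. g x \<partial>\<Omega>) * (\<integral>x. f x \<partial>\<Omega>)"
  using integral_mult_resample[of g f A, OF assms(1,2)] by (simp add: assms(3))

lemma borel_measurable_resample [measurable]:
  fixes f :: "_ \<Rightarrow> 'b::{banach, second_countable_topology}"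
  assumes [measurable]: "f \<in> borel_measurable \<Omega>"
  shows "(\<lambda>x. \<integral>y. f (mix A x y) \<partial>\<Omega>) \<in> borel_measurable \<Omega>"
  by measurable

lemma integral_coordinate:
  fixes f :: "'a \<Rightarrow> 'b::{banach, second_countable_topology}"
  assumes "f \<in> borel_measurable (M i)"
  shows "(\<integral>x. f (x i) \<partial>\<Omega>) = (\<integral>u. f u \<partial>M i)"
  using integral_distr[of "\<lambda>x. x i" \<Omega> "M i" f] assms PiM_component[of i] by simp

lemma distr_reindex:
  assumes "inj \<rho>" "\<And>i. M (\<rho> i) = N"
  shows "distr \<Omega> (PiM UNIV (\<lambda>_. N)) (\<lambda>x i. x (\<rho> i)) = PiM UNIV (\<lambda>_. N)"
  using distr_PiM_reindex[of UNIV M \<rho> UNIV] assms prob_space_axioms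
  by (simp add: restrict_UNIV M.prob_space_axioms)

lemma indep_vars_coordinates: "indep_vars M (\<lambda>i x. x i) UNIV"
  by (subst indep_vars_iff_distr_eq_PiM') (auto simp: PiM_component distr_id2 restrict_UNIV)

lemma integral_prod_coordinates:
  fixes f :: "'i \<Rightarrow> 'a \<Rightarrow> 'b::{real_normed_field, banach, second_countable_topology}"
  assumes "finite J" "\<And>i. i \<in> J \<Longrightarrow> integrable (M i) (f i)"
  shows "(\<integral>x. (\<Prod>i\<in>J. f i (x i)) \<partial>\<Omega>) = (\<Prod>i\<in>J. \<integral>u. f i u \<partial>M i)"
proof -
  have "indep_vars (\<lambda>_. borel) (\<lambda>i x. f i (x i)) J"
    using assms by (intro indep_vars_compose2[OF indep_vars_subset[OF indep_vars_coordinates]]) auto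
  moreover have "integrable \<Omega> (\<lambda>x. f i (x i))" if "i \<in> J" for i
    using integrable_distr_eq[of "\<lambda>x. x i" \<Omega> "M i" "f i"] assms(2)[OF that]
    by (simp add: PiM_component)
  ultimately have "(\<integral>x. (\<Prod>i\<in>J. f i (x i)) \<partial>\<Omega>) = (\<Prod>i\<in>J. \<integral>x. f i (x i) \<partial>\<Omega>)"
    by (intro indep_vars_lebesgue_integral assms(1)) auto
  also have "\<dots> = (\<Prod>i\<in>J. \<integral>u. f i u \<partial>M i)"
    using assms(2) by (intro prod.cong refl integral_coordinate) auto
  finally show ?thesis .
qed

end

section \<open>Second moment of sums over finite sets\<close>

definition ksubsets :: "nat \<Rightarrow> nat \<Rightarrow> nat set set" where
  "ksubsets n r = {S. S \<subseteq> {..<n} \<and> card S = r}"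

lemma finite_ksubsets [simp, intro]: "finite (ksubsets n r)"
  by (auto simp: ksubsets_def)

lemma ksubsets_finite: "S \<in> ksubsets n r \<Longrightarrow> finite S"
  by (auto simp: ksubsets_def intro: finite_subset)

lemma card_ksubsets: "card (ksubsets n r) = n choose r"
  using n_subsets[of "{..<n}" r] by (simp add: ksubsets_def)

lemma binomial_le_power: "n choose k \<le> n ^ k"
proof (cases "k \<le> n")
  case True
  then show ?thesis by (rule binomial_le_pow)
qed (simp add: binomial_eq_0)

lemma card_ksubsets_supset_le:
  assumes "Q \<subseteq> {..<n}" "card Q = q" "q \<le> r"
  shows "card {T \<in> ksubsets n r. Q \<subseteq> T} \<le> n ^ (r - q)"
proof -
  have fQ: "finite Q" using assms(1) finite_subset by blast
  have "card {T \<in> ksubsets n r. Q \<subseteq> T} \<le> card (ksubsets n (r - q))"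
  proof (rule card_inj_on_le[where f="\<lambda>T. T - Q"])
    show "inj_on (\<lambda>T. T - Q) {T \<in> ksubsets n r. Q \<subseteq> T}"
      by (auto simp: inj_on_def)
    show "(\<lambda>T. T - Q) ` {T \<in> ksubsets n r. Q \<subseteq> T} \<subseteq> ksubsets n (r - q)"
      using assms fQ by (auto simp: ksubsets_def card_Diff_subset)
  qed auto
  also have "\<dots> \<le> n ^ (r - q)" by (simp add: card_ksubsets binomial_le_power)
  finally show ?thesis .
qed

text \<open>Choose \<open>S\<close> in at most \<open>n ^ r\<close> ways, a common
  \<open>q\<close>-subset of it in at most \<open>2 ^ r\<close> ways, and the remaining
  \<open>r - q\<close> elements of \<open>T\<close>.\<close>

lemma card_overlapping_pairs_le:
  assumes "q \<le> r"
  shows "card {(S, T). S \<in> ksubsets n r \<and> T \<in> ksubsets n r \<and> q \<le> card (S \<inter> T)} \<le> 2 ^ r * n ^ (2 * r - q)"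
proof -
  let ?B = "\<lambda>S. \<Union>Q\<in>{Q \<in> Pow S. card Q = q}. {T \<in> ksubsets n r. Q \<subseteq> T}"
  have "card {(S, T). S \<in> ksubsets n r \<and> T \<in> ksubsets n r \<and> q \<le> card (S \<inter> T)}
     \<le> card (Sigma (ksubsets n r) ?B)"
  proof (rule card_mono)
    show "finite (Sigma (ksubsets n r) ?B)"
      by (intro finite_SigmaI finite_UN_I) (auto dest: ksubsets_finite)
    show "{(S, T). S \<in> ksubsets n r \<and> T \<in> ksubsets n r \<and> q \<le> card (S \<inter> T)} \<subseteq> Sigma (ksubsets n r) ?B"
    proof (rule subsetI)
      fix p assume p: "p \<in> {(S, T). S \<in> ksubsets n r \<and> T \<in> ksubsets n r \<and> q \<le> card (S \<inter> T)}"
      obtain S T where *: "p = (S, T)" "S \<in> ksubsets n r" "T \<in> ksubsets n r" "q \<le> card (S \<inter> T)"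
        using p by blast
      obtain Q where Q: "Q \<subseteq> S \<inter> T" "card Q = q" by (rule obtain_subset_with_card_n[OF *(4)])
      have "T \<in> ?B S" by (rule UN_I[of Q]) (use Q * in auto)
      then show "p \<in> Sigma (ksubsets n r) ?B" using * by simp
    qed
  qed
  also have "\<dots> = (\<Sum>S\<in>ksubsets n r. card (?B S))"
    by (subst card_SigmaI) (auto dest: ksubsets_finite)
  also have "\<dots> \<le> (\<Sum>S\<in>ksubsets n r. 2 ^ r * n ^ (r - q))"
  proof (rule sum_mono)
    fix S assume S: "S \<in> ksubsets n r"
    then have fS: "finite S" "card S = r" "S \<subseteq> {..<n}" by (auto simp: ksubsets_def intro: finite_subset)
    have "card (?B S) \<le> (\<Sum>Q\<in>{Q \<in> Pow S. card Q = q}. card {T \<in> ksubsets n r. Q \<subseteq> T})"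
      using fS by (intro card_UN_le) auto
    also have "\<dots> \<le> (\<Sum>Q\<in>{Q \<in> Pow S. card Q = q}. n ^ (r - q))"
      using fS assms by (intro sum_mono card_ksubsets_supset_le) auto
    also have "\<dots> \<le> (\<Sum>Q\<in>Pow S. n ^ (r - q))"
      using fS by (intro sum_mono2) auto
    also have "\<dots> = 2 ^ r * n ^ (r - q)" using fS by (simp add: card_Pow)
    finally show "card (?B S) \<le> 2 ^ r * n ^ (r - q)" .
  qed
  also have "\<dots> \<le> n ^ r * (2 ^ r * n ^ (r - q))"
    by (simp add: card_ksubsets binomial_le_power)
  also have "\<dots> = 2 ^ r * n ^ (2 * r - q)"
    using assms by (simp add: power_add[symmetric] mult_2)
  finally show ?thesis .
qed

text \<open>After expanding the square, only pairs of sets with at least \<open>q\<close> common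
  elements survive, and each of their mixed moments is at most \<open>K\<close> by the
  arithmetic-geometric mean inequality. The larger \<open>q\<close>, the smaller the sum: this is
  how every error order in \<open>n\<close> arises, both for clique indicators and for functions of
  pairs.\<close>

lemma (in prob_space) second_moment_sum_ksubsets:
  fixes F :: "nat set \<Rightarrow> 'a \<Rightarrow> real"
  assumes [measurable]: "\<And>S. S \<in> ksubsets n r \<Longrightarrow> F S \<in> borel_measurable M"
    and int: "\<And>S. S \<in> ksubsets n r \<Longrightarrow> integrable M (\<lambda>x. (F S x)\<^sup>2)"
    and K: "\<And>S. S \<in> ksubsets n r \<Longrightarrow> expectation (\<lambda>x. (F S x)\<^sup>2) \<le> K"
    and ort: "\<And>S T. S \<in> ksubsets n r \<Longrightarrow> T \<in> ksubsets n r \<Longrightarrow> card (S \<inter> T) < q \<Longrightarrow>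
       expectation (\<lambda>x. F T x * F S x) = 0"
    and "q \<le> r" "0 \<le> K"
  shows "integrable M (\<lambda>x. (\<Sum>S\<in>ksubsets n r. F S x)\<^sup>2)"
    and "expectation (\<lambda>x. (\<Sum>S\<in>ksubsets n r. F S x)\<^sup>2) \<le> K * 2 ^ r * real n ^ (2 * r - q)"
proof -
  let ?K = "ksubsets n r"
  have abs_prod_le: "\<bar>a * b\<bar> \<le> b\<^sup>2 + a\<^sup>2" for a b :: real
  proof -
    have "2 * (\<bar>a\<bar> * \<bar>b\<bar>) \<le> a\<^sup>2 + b\<^sup>2" "0 \<le> \<bar>a\<bar> * \<bar>b\<bar>"
      using sum_squares_bound[of "\<bar>a\<bar>" "\<bar>b\<bar>"] by (auto simp: mult.assoc)
    then show ?thesis unfolding abs_mult by linarith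
  qed
  have i2: "integrable M (\<lambda>x. F T x * F S x)" if "S \<in> ?K" "T \<in> ?K" for S T
    by (rule Bochner_Integration.integrable_bound[OF Bochner_Integration.integrable_add[OF int[OF that(1)] int[OF that(2)]]])
       (use that abs_prod_le in \<open>auto intro!: AE_I2\<close>)
  have eq: "(\<Sum>S\<in>?K. F S x)\<^sup>2 = (\<Sum>S\<in>?K. \<Sum>T\<in>?K. F T x * F S x)" for x
    by (simp add: power2_eq_square sum_product mult.commute)
  show "integrable M (\<lambda>x. (\<Sum>S\<in>?K. F S x)\<^sup>2)"
    unfolding eq using i2 by (intro Bochner_Integration.integrable_sum) auto
  have le: "expectation (\<lambda>x. F T x * F S x) \<le> K" if "S \<in> ?K" "T \<in> ?K" for S T
  proof -
    have "expectation (\<lambda>x. F T x * F S x) \<le> expectation (\<lambda>x. ((F T x)\<^sup>2 + (F S x)\<^sup>2) / 2)"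
    proof (rule integral_mono)
      show "F T x * F S x \<le> ((F T x)\<^sup>2 + (F S x)\<^sup>2) / 2" for x
        using sum_squares_bound[of "F T x" "F S x"] by simp
    qed (use i2 int that in auto)
    also have "\<dots> = (expectation (\<lambda>x. (F T x)\<^sup>2) + expectation (\<lambda>x. (F S x)\<^sup>2)) / 2"
      using int that by simp
    also have "\<dots> \<le> K" using K[OF that(1)] K[OF that(2)] by simp
    finally show ?thesis .
  qed
  have "expectation (\<lambda>x. (\<Sum>S\<in>?K. F S x)\<^sup>2) = (\<Sum>S\<in>?K. \<Sum>T\<in>?K. expectation (\<lambda>x. F T x * F S x))"
    unfolding eq using i2 by (subst Bochner_Integration.integral_sum; (intro Bochner_Integration.integrable_sum)?)
      (auto intro!: sum.cong Bochner_Integration.integral_sum)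
  also have "\<dots> \<le> (\<Sum>S\<in>?K. \<Sum>T\<in>?K. if q \<le> card (S \<inter> T) then K else 0)"
    by (intro sum_mono) (auto simp: le ort)
  also have "\<dots> = (\<Sum>p\<in>?K \<times> ?K. if q \<le> card (fst p \<inter> snd p) then K else 0)"
    by (simp add: sum.cartesian_product split_beta')
  also have "\<dots> = (\<Sum>p\<in>{(S, T). S \<in> ?K \<and> T \<in> ?K \<and> q \<le> card (S \<inter> T)}. K)"
    by (rule sum.mono_neutral_cong_right) auto
  also have "\<dots> = real (card {(S, T). S \<in> ?K \<and> T \<in> ?K \<and> q \<le> card (S \<inter> T)}) * K" by simp
  also have "\<dots> \<le> real (2 ^ r * n ^ (2 * r - q)) * K"
    using card_overlapping_pairs_le[OF \<open>q \<le> r\<close>, of n] \<open>0 \<le> K\<close>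
    by (intro mult_right_mono) (simp_all only: of_nat_le_iff)
  finally show "expectation (\<lambda>x. (\<Sum>S\<in>?K. F S x)\<^sup>2) \<le> K * 2 ^ r * real n ^ (2 * r - q)"
    by (simp add: mult_ac)
qed

section \<open>Diagonalisation of symmetric matrices\<close>

text \<open>Tychonoff's theorem for an arbitrary index type. It serves twice: for the unit spheres
  on which eigenvectors are sought, and for extracting convergent subsequences of whole coefficient
  sequences.\<close>

lemma compact_fun_box:
  fixes a b :: "'i \<Rightarrow> real"
  shows "compact {x :: 'i \<Rightarrow> real. \<forall>i. a i \<le> x i \<and> x i \<le> b i}"
proof -
  have "compactin (product_topology (\<lambda>_. euclidean) UNIV) (PiE UNIV (\<lambda>i. {a i..b i}))"
    by (subst compactin_PiE) (auto simp: compactin_euclidean_iff)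
  moreover have "PiE UNIV (\<lambda>i. {a i..b i}) = {x. \<forall>i. a i \<le> x i \<and> x i \<le> b i}"
    by (auto simp: PiE_iff)
  ultimately show ?thesis
    by (simp add: euclidean_product_topology compactin_euclidean_iff)
qed

text \<open>Vectors are functions on the naturals of which only the entries below \<open>m\<close>
  count, so that the dimension can be a value obtained inside a proof rather than a type.\<close>

definition ip :: "nat \<Rightarrow> (nat \<Rightarrow> real) \<Rightarrow> (nat \<Rightarrow> real) \<Rightarrow> real" where
  "ip m x y = (\<Sum>a<m. x a * y a)"

definition mv :: "nat \<Rightarrow> (nat \<Rightarrow> nat \<Rightarrow> real) \<Rightarrow> (nat \<Rightarrow> real) \<Rightarrow> nat \<Rightarrow> real" where
  "mv m A x = (\<lambda>a. if a < m then \<Sum>b<m. A a b * x b else 0)"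

definition orthonormal :: "nat \<Rightarrow> nat \<Rightarrow> (nat \<Rightarrow> nat \<Rightarrow> real) \<Rightarrow> bool" where
  "orthonormal m k v \<longleftrightarrow> (\<forall>i<k. \<forall>j<k. ip m (v i) (v j) = (if i = j then 1 else 0))"

lemma ip_commute: "ip m x y = ip m y x"
  by (simp add: ip_def mult.commute)

lemma ip_add_left: "ip m (\<lambda>a. x a + y a) z = ip m x z + ip m y z"
  and ip_diff_left: "ip m (\<lambda>a. x a - y a) z = ip m x z - ip m y z"
  and ip_scale_left: "ip m (\<lambda>a. c * x a) z = c * ip m x z"
  and ip_sum_left: "ip m (\<lambda>a. \<Sum>i\<in>I. f i a) z = (\<Sum>i\<in>I. ip m (f i) z)"
  by (simp_all add: ip_def algebra_simps sum.distrib sum_subtractf sum_distrib_left sum_distrib_right)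
     (rule sum.swap)

lemma ip_add_right: "ip m z (\<lambda>a. x a + y a) = ip m z x + ip m z y"
  and ip_diff_right: "ip m z (\<lambda>a. x a - y a) = ip m z x - ip m z y"
  and ip_scale_right: "ip m z (\<lambda>a. c * x a) = c * ip m z x"
  by (simp_all add: ip_def algebra_simps sum.distrib sum_subtractf sum_distrib_left)

lemma ip_cong: "(\<And>a. a < m \<Longrightarrow> x a = x' a) \<Longrightarrow> (\<And>a. a < m \<Longrightarrow> y a = y' a) \<Longrightarrow> ip m x y = ip m x' y'"
  by (simp add: ip_def)

lemma ip_unit: "a < m \<Longrightarrow> ip m (\<lambda>b. if b = a then 1 else 0) z = z a"
  by (simp add: ip_def if_distrib[of "\<lambda>c. c * _"] cong: if_cong)

lemma ip_nonneg: "0 \<le> ip m x x"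
  by (simp add: ip_def sum_nonneg)

lemma ip_eq_0: "ip m x x = 0 \<Longrightarrow> a < m \<Longrightarrow> x a = 0"
  by (auto simp: ip_def sum_nonneg_eq_0_iff)

lemma ip_mv_symmetric:
  assumes "\<And>a b. a < m \<Longrightarrow> b < m \<Longrightarrow> A a b = A b a"
  shows "ip m (mv m A x) y = ip m x (mv m A y)"
proof -
  have "ip m (mv m A x) y = (\<Sum>a<m. \<Sum>b<m. A a b * x b * y a)"
    by (simp add: ip_def mv_def sum_distrib_right)
  also have "\<dots> = (\<Sum>b<m. \<Sum>a<m. A a b * x b * y a)" by (rule sum.swap)
  also have "\<dots> = ip m x (mv m A y)"
    by (auto simp: ip_def mv_def sum_distrib_left assms mult_ac intro!: sum.cong)
  finally show ?thesis .
qed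

text \<open>\<open>w\<close> is the \<open>a\<close>-th unit vector minus its projection onto the
  span of the \<open>v i\<close>. The norm formula is used in two ways: a positive value yields a
  new orthogonal direction, the value 0 puts the unit vector in the span.\<close>

lemma orthonormal_residual:
  assumes "orthonormal m k v" "a < m"
  defines "w \<equiv> \<lambda>b. (if b = a then 1 else 0) - (\<Sum>i<k. v i a * v i b)"
  shows "\<And>j. j < k \<Longrightarrow> ip m w (v j) = 0" and "ip m w w = 1 - (\<Sum>i<k. (v i a)\<^sup>2)"
proof -
  have 1: "ip m w z = z a - (\<Sum>i<k. v i a * ip m (v i) z)" for z
    unfolding w_def using assms(2) by (simp add: ip_diff_left ip_sum_left ip_scale_left ip_unit)
  show 2: "ip m w (v j) = 0" if "j < k" for j
  proof -
    have "(\<Sum>i<k. v i a * ip m (v i) (v j)) = (\<Sum>i<k. if i = j then v i a else 0)"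
      using assms(1) that by (intro sum.cong) (auto simp: orthonormal_def)
    then show ?thesis using that by (simp add: 1)
  qed
  have "ip m w w = w a - (\<Sum>i<k. v i a * ip m (v i) w)" by (rule 1)
  also have "(\<Sum>i<k. v i a * ip m (v i) w) = 0"
    using 2 by (intro sum.neutral) (auto simp: ip_commute[of m _ w])
  also have "w a - 0 = 1 - (\<Sum>i<k. (v i a)\<^sup>2)" by (simp add: w_def power2_eq_square)
  finally show "ip m w w = 1 - (\<Sum>i<k. (v i a)\<^sup>2)" .
qed

lemma orthonormal_total: "orthonormal m k v \<Longrightarrow> (\<Sum>a<m. \<Sum>i<k. (v i a)\<^sup>2) = real k"
  by (subst sum.swap) (simp add: orthonormal_def ip_def power2_eq_square)

text \<open>The squared norms of the residuals of all unit vectors add up to \<open>m - k\<close>,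
  so for \<open>k < m\<close> one of them is positive and its residual can be normalised.\<close>

lemma orthonormal_extend_vector:
  assumes "orthonormal m k v" "k < m"
  obtains x where "\<And>a. a \<ge> m \<Longrightarrow> x a = 0" "ip m x x = 1" "\<And>i. i < k \<Longrightarrow> ip m x (v i) = 0"
proof -
  have "(\<Sum>a<m. 1 - (\<Sum>i<k. (v i a)\<^sup>2)) > 0"
    using assms orthonormal_total[OF assms(1)] by (simp add: sum_subtractf)
  then have "\<exists>a<m. 1 - (\<Sum>i<k. (v i a)\<^sup>2) > 0"
    using sum_nonpos[of "{..<m}" "\<lambda>a. 1 - (\<Sum>i<k. (v i a)\<^sup>2)"] by force
  then obtain a where a: "a < m" "1 - (\<Sum>i<k. (v i a)\<^sup>2) > 0" by blast
  define w where "w = (\<lambda>b. (if b = a then 1 else 0) - (\<Sum>i<k. v i a * v i b))"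
  define s where "s = sqrt (ip m w w)"
  have w: "ip m w w > 0" "\<And>i. i < k \<Longrightarrow> ip m w (v i) = 0"
    using orthonormal_residual[OF assms(1) a(1)] a(2) by (auto simp: w_def)
  define x where "x = (\<lambda>b. if b < m then inverse s * w b else 0)"
  have x: "ip m x z = inverse s * ip m w z" for z
    unfolding ip_scale_left[symmetric] by (rule ip_cong) (auto simp: x_def)
  have s: "s > 0" "s * s = ip m w w" using w(1) by (auto simp: s_def)
  have "ip m x x = inverse s * (inverse s * ip m w w)"
    by (simp only: x ip_commute[of m w x])
  then have "ip m x x = 1" using s w by (simp add: field_simps)
  moreover have "x a = 0" if "a \<ge> m" for a using that by (simp add: x_def)
  ultimately show thesis using w(2) by (intro that[of x]) (simp_all add: x)
qed

text \<open>Rayleigh's principle: the next eigenvector maximises the quadratic form of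
  \<open>A\<close> over the unit vectors orthogonal to those already found.\<close>

lemma orthonormal_eigenvectors:
  assumes sym: "\<And>a b. a < m \<Longrightarrow> b < m \<Longrightarrow> A a b = A b a" and "k \<le> m"
  shows "\<exists>v l. orthonormal m k v \<and> (\<forall>i<k. \<forall>a<m. mv m A (v i) a = l i * v i a)"
  using \<open>k \<le> m\<close>
proof (induction k)
  case 0
  then show ?case by (auto simp: orthonormal_def)
next
  case (Suc k)
  then obtain v l where v: "orthonormal m k v" "\<And>i a. i < k \<Longrightarrow> a < m \<Longrightarrow> mv m A (v i) a = l i * v i a"
    by auto
  \<comment> \<open>Entries of a unit vector lie between -1 and 1 and those from \<open>m\<close> on
    are 0, so the box only makes the compactness of this sphere visible.\<close>
  define K where "K = {x. (\<forall>a. - (if a < m then 1 else 0) \<le> x a \<and> x a \<le> (if a < m then 1 else 0))}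
     \<inter> {x. ip m x x = 1} \<inter> (\<Inter>i\<in>{..<k}. {x. ip m x (v i) = 0})"
  have cip: "continuous_on UNIV (\<lambda>x. ip m x y)" "continuous_on UNIV (\<lambda>x. ip m x x)"
    "continuous_on UNIV (\<lambda>x. ip m x (mv m A x))" for y
    unfolding ip_def mv_def by (auto intro!: continuous_intros)
  have "compact K"
    unfolding K_def
    by (intro compact_Int_closed compact_fun_box closed_INT ballI closed_Collect_eq cip continuous_on_const)
  have memK: "x \<in> K" if "\<And>a. a \<ge> m \<Longrightarrow> x a = 0" "ip m x x = 1" "\<And>i. i < k \<Longrightarrow> ip m x (v i) = 0" for x
  proof -
    have "\<bar>x a\<bar> \<le> 1" if "a < m" for a
    proof -
      have "(x a)\<^sup>2 \<le> ip m x x" unfolding ip_def power2_eq_square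
        using that by (intro member_le_sum) auto
      then show ?thesis using \<open>ip m x x = 1\<close> by (simp add: abs_square_le_1)
    qed
    then show ?thesis using that by (force simp: K_def abs_le_iff)
  qed
  have "K \<noteq> {}"
    using orthonormal_extend_vector[OF v(1)] Suc.prems memK by (metis Suc_le_lessD empty_iff)
  then obtain x where x: "x \<in> K" "\<And>y. y \<in> K \<Longrightarrow> ip m y (mv m A y) \<le> ip m x (mv m A x)"
    using continuous_attains_sup[OF \<open>compact K\<close>, of "\<lambda>x. ip m x (mv m A x)"] cip(3)
    by (meson continuous_on_subset top_greatest)
  define \<mu> where "\<mu> = ip m x (mv m A x)"
  have xm: "x a = 0" if "a \<ge> m" for a
  proof -
    have "- (if a < m then 1 else 0) \<le> x a \<and> x a \<le> (if a < m then 1 else 0)"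
      using x(1) unfolding K_def by blast
    then show ?thesis using that by simp
  qed
  have x1: "ip m x x = 1" and xv: "\<And>i. i < k \<Longrightarrow> ip m x (v i) = 0"
    using x(1) by (auto simp: K_def)
  \<comment> \<open>The defect of the eigenvalue equation. By symmetry of \<open>A\<close> it is
    orthogonal to \<open>x\<close> and to all earlier eigenvectors, hence an admissible direction in
    which to perturb the maximiser.\<close>
  define w where "w = (\<lambda>a. mv m A x a - \<mu> * x a)"
  define u where "u = ip m w w"
  have wm: "w a = 0" if "a \<ge> m" for a using that xm by (simp add: w_def mv_def)
  have wx: "ip m w x = 0"
    by (simp add: w_def ip_diff_left ip_scale_left x1 \<mu>_def ip_commute)
  have wv: "ip m w (v i) = 0" if "i < k" for i
  proof -
    have "ip m (mv m A x) (v i) = ip m x (mv m A (v i))" by (rule ip_mv_symmetric) (rule sym)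
    also have "\<dots> = ip m x (\<lambda>a. l i * v i a)" using v(2) that by (intro ip_cong) auto
    also have "\<dots> = 0" using xv[OF that] by (simp add: ip_commute[of m x] ip_scale_left)
    finally show ?thesis using xv[OF that] by (simp add: w_def ip_diff_left ip_scale_left)
  qed
  have wA: "ip m w (mv m A x) = u"
  proof -
    have "u = ip m w (\<lambda>a. mv m A x a - \<mu> * x a)" by (simp add: u_def w_def)
    also have "\<dots> = ip m w (mv m A x) - \<mu> * ip m w x" by (simp only: ip_diff_right ip_scale_right)
    finally show ?thesis using wx by simp
  qed
  \<comment> \<open>Maximality of \<open>x\<close> against the normalised vector
    \<open>x + \<epsilon> w\<close>. The gain of first order is \<open>2 * \<epsilon> * u\<close>,
    where \<open>u\<close> is the squared norm of the defect; everything else is of second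
    order.\<close>
  have ineq: "2 * \<epsilon> * u + \<epsilon>\<^sup>2 * ip m w (mv m A w) \<le> \<mu> * \<epsilon>\<^sup>2 * u" for \<epsilon>
  proof -
    define y where "y = (\<lambda>a. x a + \<epsilon> * w a)"
    define s where "s = sqrt (ip m y y)"
    have xw: "ip m x w = 0" using wx by (simp add: ip_commute)
    have yy: "ip m y y = 1 + \<epsilon>\<^sup>2 * u"
      unfolding y_def ip_add_left ip_scale_left ip_add_right ip_scale_right
      by (simp add: x1 wx xw u_def power2_eq_square)
    have u0: "0 \<le> u" by (simp add: u_def ip_nonneg)
    then have s: "s > 0" "s * s = 1 + \<epsilon>\<^sup>2 * u"
      using yy by (simp_all add: s_def add_pos_nonneg)
    define z where "z = (\<lambda>a. inverse s * y a)"
    have mvz: "mv m A z = (\<lambda>a. inverse s * mv m A y a)"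
      by (auto simp: mv_def z_def sum_distrib_left mult_ac)
    have "z \<in> K"
    proof (rule memK)
      have "ip m z z = inverse s * (inverse s * ip m y y)"
        unfolding z_def ip_scale_left ip_scale_right by simp
      then have "ip m z z = inverse s * (inverse s * (s * s))" using s yy by simp
      then show "ip m z z = 1" using s(1) by (simp add: field_simps)
    qed (auto simp: z_def y_def xm wm ip_scale_left ip_add_left wv xv)
    then have "ip m z (mv m A z) \<le> \<mu>" using x(2) \<mu>_def by simp
    moreover have "ip m z (mv m A z) = inverse s * (inverse s * ip m y (mv m A y))"
      unfolding mvz unfolding z_def ip_scale_left ip_scale_right by simp
    ultimately have "inverse s * (inverse s * ip m y (mv m A y)) * (s * s) \<le> \<mu> * (s * s)"
      using s(1) by (intro mult_right_mono) auto
    moreover have "inverse s * (inverse s * ip m y (mv m A y)) * (s * s) = ip m y (mv m A y)"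
      using s(1) by (simp add: field_simps)
    ultimately have "ip m y (mv m A y) \<le> \<mu> * (s * s)" by (simp only:)
    then have "ip m y (mv m A y) \<le> \<mu> * (1 + \<epsilon>\<^sup>2 * u)" using s(2) by simp
    moreover have "mv m A y = (\<lambda>a. mv m A x a + \<epsilon> * mv m A w a)"
      by (auto simp: mv_def y_def sum_distrib_left algebra_simps sum.distrib)
    then have "ip m y (mv m A y) = ip m x (mv m A x) + 2 * \<epsilon> * ip m w (mv m A x) + \<epsilon>\<^sup>2 * ip m w (mv m A w)"
      using ip_mv_symmetric[of m A w x, OF sym] ip_commute[of m "mv m A w" x]
      by (simp add: y_def ip_add_left ip_scale_left ip_add_right ip_scale_right power2_eq_square algebra_simps)
    ultimately show ?thesis by (simp add: wA \<mu>_def[symmetric] algebra_simps)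
  qed
  have "u = 0"
  proof (rule ccontr)
    assume "u \<noteq> 0"
    then have u: "u > 0" using ip_nonneg[of m w] by (simp add: u_def)
    \<comment> \<open>A positive bound for the coefficient of second order. With
      \<open>\<epsilon> = u / D\<close> the second-order term is at most half of the first-order
      gain, a contradiction.\<close>
    define D where "D = \<bar>\<mu> * u - ip m w (mv m A w)\<bar> + 1"
    have D: "D > 0" "\<mu> * u - ip m w (mv m A w) \<le> D" by (auto simp: D_def)
    define \<epsilon> where "\<epsilon> = u / D"
    have e: "\<epsilon> > 0" using u D by (simp add: \<epsilon>_def)
    have "2 * \<epsilon> * u \<le> \<epsilon>\<^sup>2 * (\<mu> * u - ip m w (mv m A w))"
      using ineq[of \<epsilon>] by (simp add: algebra_simps)
    also have "\<dots> \<le> \<epsilon>\<^sup>2 * D" using D by (intro mult_left_mono) auto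
    also have "\<dots> = \<epsilon> * u" using D by (simp add: \<epsilon>_def power2_eq_square)
    finally show False using e u by simp
  qed
  then have eig: "mv m A x a = \<mu> * x a" if "a < m" for a
    using ip_eq_0[of m w a] that by (simp add: u_def w_def)
  define v' l' where "v' = v(k := x)" and "l' = l(k := \<mu>)"
  have "orthonormal m (Suc k) v'"
    using v(1) x1 xv by (auto simp: orthonormal_def v'_def less_Suc_eq ip_commute)
  moreover have "\<forall>i<Suc k. \<forall>a<m. mv m A (v' i) a = l' i * v' i a"
    using v(2) eig by (auto simp: v'_def l'_def less_Suc_eq)
  ultimately show ?case by blast
qed

text \<open>With \<open>m\<close> orthonormal vectors the residual norms of the unit vectors are
  nonnegative and add up to 0, so each vanishes. This gives the completeness relation, and expanding
  a row of \<open>A\<close> in the \<open>v i\<close> gives the spectral form.\<close>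

lemma symmetric_matrix_diagonal:
  fixes A :: "nat \<Rightarrow> nat \<Rightarrow> real"
  assumes sym: "\<And>a b. a < m \<Longrightarrow> b < m \<Longrightarrow> A a b = A b a"
  obtains v l where "\<And>i j. i < m \<Longrightarrow> j < m \<Longrightarrow> (\<Sum>a<m. v i a * v j a) = (if i = j then 1 else 0)"
    and "\<And>a b. a < m \<Longrightarrow> b < m \<Longrightarrow> A a b = (\<Sum>i<m. l i * v i a * v i b)"
proof -
  obtain v l where v: "orthonormal m m v" "\<And>i a. i < m \<Longrightarrow> a < m \<Longrightarrow> mv m A (v i) a = l i * v i a"
    using orthonormal_eigenvectors[of m A m, OF sym order_refl] by blast
  have le: "1 - (\<Sum>i<m. (v i a)\<^sup>2) \<ge> 0" if "a < m" for a
    unfolding orthonormal_residual(2)[OF v(1) that, symmetric] by (rule ip_nonneg)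
  have "(\<Sum>a<m. 1 - (\<Sum>i<m. (v i a)\<^sup>2)) = 0"
    using orthonormal_total[OF v(1)] by (simp add: sum_subtractf)
  then have 0: "1 - (\<Sum>i<m. (v i a)\<^sup>2) = 0" if "a < m" for a
    using le that by (subst (asm) sum_nonneg_eq_0_iff) auto
  have complete: "(\<Sum>i<m. v i a * v i b) = (if b = a then 1 else 0)" if "a < m" "b < m" for a b
    using ip_eq_0[OF trans[OF orthonormal_residual(2)[OF v(1) that(1)] 0[OF that(1)]] that(2)] by simp
  have "A a b = (\<Sum>i<m. l i * v i a * v i b)" if ab: "a < m" "b < m" for a b
  proof -
    have "(\<Sum>i<m. l i * v i a * v i b) = (\<Sum>i<m. (\<Sum>c<m. A a c * v i c) * v i b)"
    proof (rule sum.cong)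
      fix i assume "i \<in> {..<m}"
      then have "l i * v i a = (\<Sum>c<m. A a c * v i c)" using v(2)[of i a] ab by (simp add: mv_def)
      then show "l i * v i a * v i b = (\<Sum>c<m. A a c * v i c) * v i b" by simp
    qed simp
    also have "\<dots> = (\<Sum>c<m. A a c * (\<Sum>i<m. v i b * v i c))"
      by (subst sum_distrib_right, subst sum.swap) (simp add: sum_distrib_left mult_ac)
    also have "\<dots> = (\<Sum>c<m. if c = b then A a c else 0)"
      using complete ab by (intro sum.cong) auto
    also have "\<dots> = A a b" using ab by simp
    finally show ?thesis by simp
  qed
  then show thesis
    using v(1) by (intro that[of v l]) (auto simp: orthonormal_def ip_def)
qed

section \<open>Finite rank approximation of kernels\<close>

text \<open>The bound holds at every point, so it survives resampling and relabelling of the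
  arguments, and integrability over a finite measure follows without further conditions.\<close>

definition bm :: "'a measure \<Rightarrow> ('a \<Rightarrow> real) \<Rightarrow> bool" where
  "bm M f \<longleftrightarrow> f \<in> borel_measurable M \<and> (\<exists>K. \<forall>x. \<bar>f x\<bar> \<le> K)"

lemma bm_measurable [measurable_dest]: "bm M f \<Longrightarrow> f \<in> borel_measurable M"
  by (simp add: bm_def)

lemma bmI: "f \<in> borel_measurable M \<Longrightarrow> (\<And>x. \<bar>f x\<bar> \<le> K) \<Longrightarrow> bm M f"
  by (auto simp: bm_def)

lemma bm_const [simp, intro]: "bm M (\<lambda>_. c)"
  by (rule bmI[of _ _ "\<bar>c\<bar>"]) auto

lemma bm_add [simp, intro]: assumes "bm M f" "bm M g" shows "bm M (\<lambda>x. f x + g x)"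
proof -
  obtain K L where "\<And>x. \<bar>f x\<bar> \<le> K" "\<And>x. \<bar>g x\<bar> \<le> L" using assms by (auto simp: bm_def)
  then show ?thesis using assms
    by (intro bmI[of _ _ "K + L"]) (auto simp: bm_def intro: order_trans[OF abs_triangle_ineq] add_mono)
qed

lemma bm_mult [simp, intro]: assumes "bm M f" "bm M g" shows "bm M (\<lambda>x. f x * g x)"
proof -
  obtain K L where *: "\<And>x. \<bar>f x\<bar> \<le> K" "\<And>x. \<bar>g x\<bar> \<le> L" using assms by (auto simp: bm_def)
  moreover have "0 \<le> K" using *(1) abs_ge_zero order_trans by blast
  ultimately show ?thesis using assms
    by (intro bmI[of _ _ "K * L"]) (auto simp: bm_def abs_mult intro!: mult_mono)
qed

lemma bm_diff [simp, intro]: assumes "bm M f" "bm M g" shows "bm M (\<lambda>x. f x - g x)"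
  using bm_add[OF assms(1) bm_mult[OF bm_const[of M "-1"] assms(2)]] by simp

lemma bm_sum [simp, intro]: "(\<And>i. i \<in> I \<Longrightarrow> bm M (f i)) \<Longrightarrow> bm M (\<lambda>x. \<Sum>i\<in>I. f i x)"
  by (induction I rule: infinite_finite_induct) auto

lemma bm_power [simp, intro]: "bm M f \<Longrightarrow> bm M (\<lambda>x. f x ^ n)"
  by (induction n) auto

lemma bm_divide [simp, intro]: "bm M f \<Longrightarrow> bm M (\<lambda>x. f x / c)"
  using bm_mult[of M f "\<lambda>_. 1 / c"] by simp

lemma bm_fst [intro]: "bm M f \<Longrightarrow> bm (M \<Otimes>\<^sub>M N) (\<lambda>p. f (fst p))"
  by (auto simp: bm_def)

lemma bm_snd [intro]: "bm N f \<Longrightarrow> bm (M \<Otimes>\<^sub>M N) (\<lambda>p. f (snd p))"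
  by (auto simp: bm_def)

lemma (in finite_measure) bm_integrable [simp, intro]: "bm M f \<Longrightarrow> integrable M f"
  unfolding bm_def by (elim conjE exE) (rule integrable_const_bound, auto)

lemma integral_sum2:
  fixes f :: "'i \<Rightarrow> 'j \<Rightarrow> 'a \<Rightarrow> 'b::{banach, second_countable_topology}"
  assumes "\<And>i j. i \<in> I \<Longrightarrow> j \<in> J \<Longrightarrow> integrable M (f i j)"
  shows "(\<integral>x. (\<Sum>i\<in>I. \<Sum>j\<in>J. f i j x) \<partial>M) = (\<Sum>i\<in>I. \<Sum>j\<in>J. \<integral>x. f i j x \<partial>M)"
proof -
  have "(\<integral>x. (\<Sum>i\<in>I. \<Sum>j\<in>J. f i j x) \<partial>M) = (\<Sum>i\<in>I. \<integral>x. (\<Sum>j\<in>J. f i j x) \<partial>M)"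
    using assms by (intro Bochner_Integration.integral_sum Bochner_Integration.integrable_sum)
  also have "\<dots> = (\<Sum>i\<in>I. \<Sum>j\<in>J. \<integral>x. f i j x \<partial>M)"
    using assms by (intro sum.cong refl Bochner_Integration.integral_sum)
  finally show ?thesis .
qed

text \<open>Valid for arbitrary coefficients \<kappa>: it is applied to unknown coefficients, to see
  that Fourier coefficients do at least as well, and then to the Fourier coefficients
  themselves.\<close>

lemma (in finite_measure) integral_square_expand:
  assumes "finite P" "bm M h" "\<And>p. p \<in> P \<Longrightarrow> bm M (e p)"
    and ort: "\<And>p q. p \<in> P \<Longrightarrow> q \<in> P \<Longrightarrow> (\<integral>x. e p x * e q x \<partial>M) = (if p = q then 1 else 0)"
  shows "(\<integral>x. (h x - (\<Sum>p\<in>P. \<kappa> p * e p x))\<^sup>2 \<partial>M)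
    = (\<integral>x. (h x)\<^sup>2 \<partial>M) - 2 * (\<Sum>p\<in>P. \<kappa> p * (\<integral>x. h x * e p x \<partial>M)) + (\<Sum>p\<in>P. (\<kappa> p)\<^sup>2)"
proof -
  have "(h x - (\<Sum>p\<in>P. \<kappa> p * e p x))\<^sup>2 = (h x)\<^sup>2 - 2 * (\<Sum>p\<in>P. \<kappa> p * (h x * e p x))
     + (\<Sum>p\<in>P. \<Sum>q\<in>P. \<kappa> p * \<kappa> q * (e p x * e q x))" for x
  proof -
    have "(\<Sum>p\<in>P. \<kappa> p * e p x)\<^sup>2 = (\<Sum>p\<in>P. \<Sum>q\<in>P. \<kappa> p * \<kappa> q * (e p x * e q x))"
      unfolding power2_eq_square sum_product by (intro sum.cong refl) (simp add: mult_ac)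
    moreover have "h x * (\<Sum>p\<in>P. \<kappa> p * e p x) = (\<Sum>p\<in>P. \<kappa> p * (h x * e p x))"
      unfolding sum_distrib_left by (intro sum.cong refl) (simp add: mult_ac)
    ultimately show ?thesis by (simp add: power2_diff algebra_simps)
  qed
  then have "(\<integral>x. (h x - (\<Sum>p\<in>P. \<kappa> p * e p x))\<^sup>2 \<partial>M) = (\<integral>x. (h x)\<^sup>2 - 2 * (\<Sum>p\<in>P. \<kappa> p * (h x * e p x))
     + (\<Sum>p\<in>P. \<Sum>q\<in>P. \<kappa> p * \<kappa> q * (e p x * e q x)) \<partial>M)" by simp
  also have "\<dots> = (\<integral>x. (h x)\<^sup>2 \<partial>M) - (\<integral>x. 2 * (\<Sum>p\<in>P. \<kappa> p * (h x * e p x)) \<partial>M)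
     + (\<integral>x. (\<Sum>p\<in>P. \<Sum>q\<in>P. \<kappa> p * \<kappa> q * (e p x * e q x)) \<partial>M)"
    using assms(1-3) by (subst Bochner_Integration.integral_add Bochner_Integration.integral_diff; (intro bm_integrable)?; auto intro!: bm_diff bm_mult)+
  also have "(\<integral>x. 2 * (\<Sum>p\<in>P. \<kappa> p * (h x * e p x)) \<partial>M) = 2 * (\<Sum>p\<in>P. \<kappa> p * (\<integral>x. h x * e p x \<partial>M))"
    using assms(1-3) by (simp add: Bochner_Integration.integral_sum)
  also have "(\<integral>x. (\<Sum>p\<in>P. \<Sum>q\<in>P. \<kappa> p * \<kappa> q * (e p x * e q x)) \<partial>M)
     = (\<Sum>p\<in>P. \<Sum>q\<in>P. \<kappa> p * \<kappa> q * (\<integral>x. e p x * e q x \<partial>M))"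
    using assms(1-3) by (simp add: Bochner_Integration.integral_sum)
  also have "\<dots> = (\<Sum>p\<in>P. \<Sum>q\<in>P. if p = q then \<kappa> p * \<kappa> q else 0)"
    using ort by (intro sum.cong refl) auto
  also have "\<dots> = (\<Sum>p\<in>P. (\<kappa> p)\<^sup>2)" using assms(1) by (simp add: power2_eq_square)
  finally show ?thesis .
qed

text \<open>The constant function is forced to come first, so that orthogonality to
  \<open>u 0\<close> means having mean 0. A function whose residual has norm 0 adds no basis
  element, which is why the expansions hold only almost everywhere.\<close>

lemma (in prob_space) gram_schmidt:
  assumes "\<forall>f\<in>set fs. bm M f"
  shows "\<exists>(m::nat) u. (\<forall>i\<le>m. bm M (u i)) \<and> u 0 = (\<lambda>_. 1) \<and>
    (\<forall>i\<le>m. \<forall>j\<le>m. (\<integral>x. u i x * u j x \<partial>M) = (if i = j then 1 else 0)) \<and>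
    (\<forall>f\<in>set fs. \<exists>\<alpha>. AE x in M. f x = (\<Sum>i\<le>m. \<alpha> i * u i x))"
  using assms
proof (induction fs)
  case Nil
  show ?case
    by (intro exI[of _ 0] exI[of _ "\<lambda>_ _. 1"]) (auto simp: prob_space)
next
  case (Cons f fs)
  obtain m :: nat and u where *:
    "(\<forall>i\<le>m. bm M (u i)) \<and> u 0 = (\<lambda>_. 1) \<and>
    (\<forall>i\<le>m. \<forall>j\<le>m. (\<integral>x. u i x * u j x \<partial>M) = (if i = j then 1 else 0)) \<and>
    (\<forall>f\<in>set fs. \<exists>\<alpha>. AE x in M. f x = (\<Sum>i\<le>m. \<alpha> i * u i x))"
  proof -
    have "\<forall>f\<in>set fs. bm M f" using Cons.prems by simp
    note Cons.IH[OF this]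
    then show thesis by (elim exE) (rule that)
  qed
  have u: "\<And>i. i \<le> m \<Longrightarrow> bm M (u i)" "u 0 = (\<lambda>_. 1)"
    "\<And>i j. i \<le> m \<Longrightarrow> j \<le> m \<Longrightarrow> (\<integral>x. u i x * u j x \<partial>M) = (if i = j then 1 else 0)"
    "\<And>f. f \<in> set fs \<Longrightarrow> \<exists>\<alpha>. AE x in M. f x = (\<Sum>i\<le>m. \<alpha> i * u i x)"
    using * by simp_all
  have f: "bm M f" using Cons.prems by simp
  define a where "a i = (\<integral>x. f x * u i x \<partial>M)" for i
  define g where "g x = f x - (\<Sum>i\<le>m. a i * u i x)" for x
  have g: "bm M g" unfolding g_def using f u(1) by (intro bm_diff bm_sum bm_mult) auto
  have gu: "(\<integral>x. g x * u j x \<partial>M) = 0" if j: "j \<le> m" for j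
  proof -
    have "(\<integral>x. g x * u j x \<partial>M) = (\<integral>x. f x * u j x - (\<Sum>i\<le>m. a i * (u i x * u j x)) \<partial>M)"
      by (simp add: g_def algebra_simps sum_distrib_left)
    also have "\<dots> = a j - (\<integral>x. (\<Sum>i\<le>m. a i * (u i x * u j x)) \<partial>M)"
      unfolding a_def using f u(1) j by (subst Bochner_Integration.integral_diff) (auto intro!: bm_integrable)
    also have "(\<integral>x. (\<Sum>i\<le>m. a i * (u i x * u j x)) \<partial>M) = (\<Sum>i\<le>m. a i * (\<integral>x. u i x * u j x \<partial>M))"
      using u(1) j by (subst Bochner_Integration.integral_sum) (auto intro!: bm_integrable)
    also have "\<dots> = (\<Sum>i\<le>m. if i = j then a i else 0)" using u(3) j by (intro sum.cong) auto
    also have "\<dots> = a j" using j by simp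
    finally show ?thesis by simp
  qed
  define s where "s = (\<integral>x. (g x)\<^sup>2 \<partial>M)"
  show ?case
  proof (cases "s = 0")
    case True
    then have "AE x in M. (g x)\<^sup>2 = 0"
      using g unfolding s_def by (subst (asm) integral_nonneg_eq_0_iff_AE) auto
    then have "AE x in M. f x = (\<Sum>i\<le>m. a i * u i x)" by (auto simp: g_def)
    then show ?thesis using u by (intro exI[of _ m] exI[of _ u]) auto
  next
    case False
    then have s: "s > 0" unfolding s_def by (simp add: order_less_le)
    define u' where "u' = u(Suc m := \<lambda>x. g x / sqrt s)"
    have 1: "\<And>i. i \<le> Suc m \<Longrightarrow> bm M (u' i)" using u(1) g by (auto simp: u'_def le_Suc_eq)
    have gg: "(\<integral>x. g x / sqrt s * (g x / sqrt s) \<partial>M) = 1"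
    proof -
      have "(\<integral>x. g x / sqrt s * (g x / sqrt s) \<partial>M) = (\<integral>x. (g x)\<^sup>2 / s \<partial>M)"
        using s by (intro Bochner_Integration.integral_cong) (auto simp: power2_eq_square)
      also have "\<dots> = 1" using s by (simp add: s_def)
      finally show ?thesis .
    qed
    have 3: "(\<integral>x. u' i x * u' j x \<partial>M) = (if i = j then 1 else 0)" if "i \<le> Suc m" "j \<le> Suc m" for i j
      using that u(3) gu gg by (auto simp: u'_def le_Suc_eq mult.commute)
    have sum': "(\<Sum>i\<le>Suc m. (\<alpha>(Suc m := c)) i * u' i x) = (\<Sum>i\<le>m. \<alpha> i * u i x) + c * (g x / sqrt s)" for \<alpha> c x
      by (simp add: u'_def)
    have 4: "\<exists>\<alpha>. AE x in M. f' x = (\<Sum>i\<le>Suc m. \<alpha> i * u' i x)" if f': "f' \<in> set (f # fs)" for f'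
    proof (cases "f' = f")
      case True
      show ?thesis
        using s by (intro exI[of _ "a(Suc m := sqrt s)"]) (simp only: sum', simp add: True g_def)
    next
      case False
      then obtain \<alpha> where "AE x in M. f' x = (\<Sum>i\<le>m. \<alpha> i * u i x)" using f' u(4) by auto
      then show ?thesis by (intro exI[of _ "\<alpha>(Suc m := 0)"]) (simp only: sum', simp)
    qed
    show ?thesis
      using 1 3 4 u(2) by (intro exI[of _ "Suc m"] exI[of _ u']) (auto simp: u'_def)
  qed
qed

section \<open>Density of finite rank kernels in mean square\<close>

definition rank_kernel :: "(('a \<Rightarrow> real) \<times> ('b \<Rightarrow> real)) list \<Rightarrow> 'a \<times> 'b \<Rightarrow> real" where
  "rank_kernel fs p = (\<Sum>(a, b)\<leftarrow>fs. a (fst p) * b (snd p))"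

lemma rank_kernel_simps [simp]:
  "rank_kernel [] p = 0"
  "rank_kernel ((a, b) # fs) p = a (fst p) * b (snd p) + rank_kernel fs p"
  "rank_kernel (fs @ gs) p = rank_kernel fs p + rank_kernel gs p"
  by (simp_all add: rank_kernel_def)

lemma bm_rank_kernel:
  "(\<And>a b. (a, b) \<in> set fs \<Longrightarrow> bm M a \<and> bm N b) \<Longrightarrow> bm (M \<Otimes>\<^sub>M N) (rank_kernel fs)"
proof (induction fs)
  case (Cons f fs)
  obtain a b where f: "f = (a, b)" by (cases f)
  have "bm M a" "bm N b" using Cons.prems[of a b] f by auto
  then have "bm (M \<Otimes>\<^sub>M N) (\<lambda>p. a (fst p) * b (snd p) + rank_kernel fs p)"
    using Cons by (intro bm_add bm_mult bm_fst bm_snd) auto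
  then show ?case by (simp add: f rank_kernel_def[abs_def])
qed (simp add: rank_kernel_def[abs_def])

definition rank_approx :: "'a measure \<Rightarrow> 'b measure \<Rightarrow> ('a \<times> 'b \<Rightarrow> real) \<Rightarrow> bool" where
  "rank_approx M N h \<longleftrightarrow> bm (M \<Otimes>\<^sub>M N) h \<and> (\<forall>\<epsilon>>0. \<exists>fs. (\<forall>a b. (a, b) \<in> set fs \<longrightarrow> bm M a \<and> bm N b) \<and>
     (\<integral>p. (h p - rank_kernel fs p)\<^sup>2 \<partial>(M \<Otimes>\<^sub>M N)) \<le> \<epsilon>)"

context pair_prob_space
begin

abbreviation "PM \<equiv> M1 \<Otimes>\<^sub>M M2"

lemma square_diff_triangle:
  assumes "bm PM f" "bm PM g" "bm PM h"
  shows "(\<integral>p. (f p - h p)\<^sup>2 \<partial>PM) \<le> 2 * (\<integral>p. (f p - g p)\<^sup>2 \<partial>PM) + 2 * (\<integral>p. (g p - h p)\<^sup>2 \<partial>PM)"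
proof -
  have "(a - c)\<^sup>2 \<le> 2 * (a - b)\<^sup>2 + 2 * (b - c)\<^sup>2" for a b c :: real
    using zero_le_power2[of "(a - b) - (b - c)"] by (simp add: power2_eq_square algebra_simps)
  then have "(\<integral>p. (f p - h p)\<^sup>2 \<partial>PM) \<le> (\<integral>p. 2 * (f p - g p)\<^sup>2 + 2 * (g p - h p)\<^sup>2 \<partial>PM)"
    using assms by (intro integral_mono) (auto intro!: bm_integrable)
  also have "\<dots> = 2 * (\<integral>p. (f p - g p)\<^sup>2 \<partial>PM) + 2 * (\<integral>p. (g p - h p)\<^sup>2 \<partial>PM)"
    using assms by (subst Bochner_Integration.integral_add) (auto intro!: bm_integrable)
  finally show ?thesis .
qed

text \<open>The approximable kernels form a closed class; the quarters compensate the factor 2 in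
  \<open>square_diff_triangle\<close>.\<close>

lemma rank_approx_limit:
  assumes "bm PM h" "\<And>\<epsilon>. \<epsilon> > 0 \<Longrightarrow> \<exists>g. rank_approx M1 M2 g \<and> (\<integral>p. (h p - g p)\<^sup>2 \<partial>PM) \<le> \<epsilon>"
  shows "rank_approx M1 M2 h"
  unfolding rank_approx_def
proof (intro conjI allI impI assms(1))
  fix \<epsilon> :: real assume e: "\<epsilon> > 0"
  obtain g where g: "rank_approx M1 M2 g" "(\<integral>p. (h p - g p)\<^sup>2 \<partial>PM) \<le> \<epsilon> / 4"
    using assms(2)[of "\<epsilon> / 4"] e by auto
  obtain fs where fs: "\<And>a b. (a, b) \<in> set fs \<Longrightarrow> bm M1 a \<and> bm M2 b"
    "(\<integral>p. (g p - rank_kernel fs p)\<^sup>2 \<partial>PM) \<le> \<epsilon> / 4"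
    using g(1) e unfolding rank_approx_def by (metis divide_pos_pos zero_less_numeral)
  show "\<exists>fs. (\<forall>a b. (a, b) \<in> set fs \<longrightarrow> bm M1 a \<and> bm M2 b) \<and> (\<integral>p. (h p - rank_kernel fs p)\<^sup>2 \<partial>PM) \<le> \<epsilon>"
    using square_diff_triangle[of h g "rank_kernel fs"] assms(1) bm_rank_kernel[of fs M1 M2] g fs
    by (intro exI[of _ fs]) (auto simp: rank_approx_def)
qed

lemma rank_approx_add:
  assumes "rank_approx M1 M2 f" "rank_approx M1 M2 g"
  shows "rank_approx M1 M2 (\<lambda>p. f p + g p)"
  unfolding rank_approx_def
proof (intro conjI allI impI)
  show "bm PM (\<lambda>p. f p + g p)" using assms by (auto simp: rank_approx_def)
  fix \<epsilon> :: real assume e: "\<epsilon> > 0"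
  obtain fs where fs: "\<And>a b. (a, b) \<in> set fs \<Longrightarrow> bm M1 a \<and> bm M2 b"
    "(\<integral>p. (f p - rank_kernel fs p)\<^sup>2 \<partial>PM) \<le> \<epsilon> / 4"
    using assms(1) e unfolding rank_approx_def by (metis divide_pos_pos zero_less_numeral)
  obtain gs where gs: "\<And>a b. (a, b) \<in> set gs \<Longrightarrow> bm M1 a \<and> bm M2 b"
    "(\<integral>p. (g p - rank_kernel gs p)\<^sup>2 \<partial>PM) \<le> \<epsilon> / 4"
    using assms(2) e unfolding rank_approx_def by (metis divide_pos_pos zero_less_numeral)
  have b: "bm PM f" "bm PM g" "bm PM (rank_kernel fs)" "bm PM (rank_kernel gs)"
    using assms bm_rank_kernel[OF fs(1)] bm_rank_kernel[OF gs(1)] by (auto simp: rank_approx_def)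
  have "(\<integral>p. (f p + g p - rank_kernel (fs @ gs) p)\<^sup>2 \<partial>PM)
     \<le> 2 * (\<integral>p. (f p + g p - (rank_kernel fs p + g p))\<^sup>2 \<partial>PM)
      + 2 * (\<integral>p. (rank_kernel fs p + g p - (rank_kernel fs p + rank_kernel gs p))\<^sup>2 \<partial>PM)"
    using square_diff_triangle[of "\<lambda>p. f p + g p" "\<lambda>p. rank_kernel fs p + g p" "\<lambda>p. rank_kernel fs p + rank_kernel gs p"] b
    by simp
  also have "\<dots> \<le> \<epsilon>" using fs(2) gs(2) by simp
  finally show "\<exists>fs. (\<forall>a b. (a, b) \<in> set fs \<longrightarrow> bm M1 a \<and> bm M2 b) \<and> (\<integral>p. (f p + g p - rank_kernel fs p)\<^sup>2 \<partial>PM) \<le> \<epsilon>"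
    using fs(1) gs(1) by (intro exI[of _ "fs @ gs"]) auto
qed

lemma rank_approx_rank_kernel:
  assumes "\<And>a b. (a, b) \<in> set fs \<Longrightarrow> bm M1 a \<and> bm M2 b"
  shows "rank_approx M1 M2 (rank_kernel fs)"
  unfolding rank_approx_def using assms bm_rank_kernel[of fs M1 M2] by (auto intro!: exI[of _ fs])

lemma rank_approx_scale:
  assumes "rank_approx M1 M2 f" shows "rank_approx M1 M2 (\<lambda>p. c * f p)"
proof (rule rank_approx_limit)
  show "bm PM (\<lambda>p. c * f p)" using assms by (auto simp: rank_approx_def)
  fix \<epsilon> :: real assume e: "\<epsilon> > 0"
  \<comment> \<open>The summand 1 keeps the denominator positive when \<open>c = 0\<close>.\<close>
  have "\<epsilon> / (c\<^sup>2 + 1) > 0" using e by (intro divide_pos_pos) (auto simp: add_nonneg_pos)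
  then obtain fs where fs: "\<And>a b. (a, b) \<in> set fs \<Longrightarrow> bm M1 a \<and> bm M2 b"
    "(\<integral>p. (f p - rank_kernel fs p)\<^sup>2 \<partial>PM) \<le> \<epsilon> / (c\<^sup>2 + 1)"
    using assms unfolding rank_approx_def by meson
  let ?gs = "map (\<lambda>(a, b). (\<lambda>x. c * a x, b)) fs"
  have eq: "rank_kernel ?gs p = c * rank_kernel fs p" for p
    by (induction fs) (auto simp: algebra_simps)
  have "(\<integral>p. (c * f p - rank_kernel ?gs p)\<^sup>2 \<partial>PM) = (\<integral>p. c\<^sup>2 * (f p - rank_kernel fs p)\<^sup>2 \<partial>PM)"
    by (intro Bochner_Integration.integral_cong refl) (simp add: eq power2_eq_square algebra_simps)
  also have "\<dots> = c\<^sup>2 * (\<integral>p. (f p - rank_kernel fs p)\<^sup>2 \<partial>PM)" by simp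
  also have "\<dots> \<le> (c\<^sup>2 + 1) * (\<epsilon> / (c\<^sup>2 + 1))"
    using fs(2) by (intro mult_mono) auto
  also have "\<dots> = \<epsilon>" by (simp add: add_nonneg_eq_0_iff)
  finally show "\<exists>g. rank_approx M1 M2 g \<and> (\<integral>p. (c * f p - g p)\<^sup>2 \<partial>PM) \<le> \<epsilon>"
    using fs(1) by (intro exI[of _ "rank_kernel ?gs"] conjI rank_approx_rank_kernel) auto
qed

lemma rank_approx_sum:
  "(\<And>i. i \<in> I \<Longrightarrow> rank_approx M1 M2 (f i)) \<Longrightarrow> rank_approx M1 M2 (\<lambda>p. \<Sum>i\<in>I. f i p)"
proof (induction I rule: infinite_finite_induct)
  case (insert x F)
  then show ?case by (auto intro!: rank_approx_add)
qed (use rank_approx_rank_kernel[of "[]"] in \<open>auto simp: rank_kernel_def[abs_def]\<close>)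

lemma rank_approx_Times:
  assumes "A \<in> sets M1" "B \<in> sets M2"
  shows "rank_approx M1 M2 (indicator (A \<times> B))"
proof -
  have "rank_approx M1 M2 (rank_kernel [(indicator A, indicator B)])"
    using assms by (intro rank_approx_rank_kernel) (auto intro!: bmI[of _ _ 1] simp: indicator_def)
  moreover have "rank_kernel [(indicator A, indicator B)] = indicator (A \<times> B)"
    by (auto simp: fun_eq_iff indicator_def)
  ultimately show ?thesis by simp
qed

lemma bm_indicator: "A \<in> sets PM \<Longrightarrow> bm PM (indicator A)"
  by (auto intro!: bmI[of _ _ 1] simp: indicator_def)

text \<open>Dynkin argument: rectangles have rank one, complements are handled by linearity, and a
  disjoint union is the mean square limit of its finite partial unions by dominated
  convergence.\<close>

lemma rank_approx_indicator:
  assumes "A \<in> sets PM"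
  shows "rank_approx M1 M2 (indicator A)"
  using Int_stable_pair_measure_generator pair_measure_closed assms[unfolded sets_pair_measure]
proof (induction rule: sigma_sets_induct_disjoint)
  case (basic A)
  then show ?case using rank_approx_Times by auto
next
  case empty
  then show ?case using rank_approx_rank_kernel[of "[]"] by (simp add: rank_kernel_def[abs_def] indicator_def[abs_def])
next
  case (compl A)
  have A: "A \<in> sets PM" using compl by (simp add: sets_pair_measure)
  have "rank_approx M1 M2 (\<lambda>p. indicator (space M1 \<times> space M2) p + (-1) * indicator A p)"
    using compl by (intro rank_approx_add rank_approx_scale rank_approx_Times) auto
  moreover have "(\<lambda>p. indicator (space M1 \<times> space M2) p + (-1) * indicator A p :: real) = indicator (space M1 \<times> space M2 - A)"
    using sets.sets_into_space[OF A] by (auto simp: fun_eq_iff indicator_def space_pair_measure)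
  ultimately show ?case by simp
next
  case (union A)
  have A: "A i \<in> sets PM" for i using union(2) unfolding sets_pair_measure by auto
  show ?case
  proof (rule rank_approx_limit)
    show "bm PM (indicator (\<Union>i. A i))" using A by (intro bm_indicator) auto
    fix \<epsilon> :: real assume e: "\<epsilon> > 0"
    let ?f = "\<lambda>n p. (indicator (\<Union>i. A i) p - (\<Sum>i<n. indicator (A i) p))\<^sup>2 :: real"
    have part: "(\<Sum>i<n. indicator (A i) p) = (indicator (\<Union>i<n. A i) p :: real)" for n p
      using union(1) by (subst indicator_UN_disjoint) (auto intro: disjoint_family_on_mono)
    have "(\<lambda>n. \<integral>p. ?f n p \<partial>PM) \<longlonglongrightarrow> (\<integral>p. 0 \<partial>PM)"
    proof (rule integral_dominated_convergence[where w="\<lambda>_. 1"])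
      show "AE p in PM. (\<lambda>n. ?f n p) \<longlonglongrightarrow> 0"
      proof (rule AE_I2)
        fix p
        show "(\<lambda>n. ?f n p) \<longlonglongrightarrow> 0"
        proof (cases "p \<in> (\<Union>i. A i)")
          case True
          then obtain k where k: "p \<in> A k" by auto
          have "?f n p = 0" if "n > k" for n
            using that k True unfolding part by (auto simp: indicator_def)
          then show ?thesis by (intro tendsto_eventually) (auto simp: eventually_at_top_dense)
        qed (simp add: part indicator_def)
      qed
      show "AE p in PM. norm (?f n p) \<le> 1" for n
        unfolding part by (intro AE_I2) (auto simp: indicator_def)
    qed (use A in measurable)
    then have "\<forall>\<^sub>F n in sequentially. (\<integral>p. ?f n p \<partial>PM) < \<epsilon>"
      using e by (intro order_tendstoD) auto
    then obtain n where "(\<integral>p. ?f n p \<partial>PM) < \<epsilon>"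
      by (meson eventually_happens' sequentially_bot)
    then show "\<exists>g. rank_approx M1 M2 g \<and> (\<integral>p. (indicator (\<Union>i. A i) p - g p)\<^sup>2 \<partial>PM) \<le> \<epsilon>"
      using union(3) by (intro exI[of _ "\<lambda>p. \<Sum>i<n. indicator (A i) p"] conjI rank_approx_sum) auto
  qed
qed

text \<open>Rounding the values of \<open>h\<close> down to multiples of \<open>1 / n\<close> gives
  a finite combination of indicators at uniform distance at most \<open>1 / n\<close>; boundedness
  of \<open>h\<close> makes the number of levels finite.\<close>

theorem rank_approx_bounded:
  assumes h: "bm PM h" shows "rank_approx M1 M2 h"
proof (rule rank_approx_limit[OF h])
  fix \<epsilon> :: real assume e: "\<epsilon> > 0"
  have [measurable]: "h \<in> borel_measurable PM" using h by (simp add: bm_def)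
  obtain K where K: "\<And>x. \<bar>h x\<bar> \<le> K" using h by (auto simp: bm_def)
  obtain n :: nat where n: "n > 0" "1 / real n < min \<epsilon> 1"
    using e by (metis min_less_iff_conj nat_approx_posE of_nat_Suc zero_less_Suc zero_less_one)
  define B where "B = \<lceil>real n * K\<rceil> + 1"
  define g where "g p = (\<Sum>k\<in>{-B..B}. (of_int k / real n) * indicator {p \<in> space PM. \<lfloor>real n * h p\<rfloor> = k} p)" for p
  have g: "rank_approx M1 M2 g"
    unfolding g_def by (intro rank_approx_sum rank_approx_scale rank_approx_indicator) measurable
  have "(h p - g p)\<^sup>2 \<le> \<epsilon>" if p: "p \<in> space PM" for p
  proof -
    have "\<bar>real n * h p\<bar> \<le> real n * K" using K n by (simp add: abs_mult)
    then have "\<lfloor>real n * h p\<rfloor> \<in> {-B..B}" unfolding B_def by (simp, linarith)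
    then have "g p = of_int \<lfloor>real n * h p\<rfloor> / real n"
      unfolding g_def using p
      by (subst sum.mono_neutral_cong_right[of _ "{\<lfloor>real n * h p\<rfloor>}"]) (auto simp: indicator_def)
    then have "real n * (h p - g p) = real n * h p - of_int \<lfloor>real n * h p\<rfloor>"
      using n by (simp add: field_simps)
    then have "0 \<le> real n * (h p - g p)" "real n * (h p - g p) \<le> 1" by linarith+
    then have "0 \<le> h p - g p" "h p - g p \<le> 1 / real n"
      using n by (auto simp: zero_le_mult_iff field_simps)
    then have "(h p - g p)\<^sup>2 \<le> (1 / real n)\<^sup>2" by (intro power_mono)
    also have "\<dots> \<le> 1 / real n" using n by (intro power_le_one_iff[THEN iffD2] | simp add: power2_eq_square field_simps)+
    finally show ?thesis using n by simp
  qed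
  then have "(\<integral>p. (h p - g p)\<^sup>2 \<partial>PM) \<le> (\<integral>p. \<epsilon> \<partial>PM)"
    using g h by (intro integral_mono) (auto simp: rank_approx_def intro!: bm_integrable)
  then show "\<exists>g. rank_approx M1 M2 g \<and> (\<integral>p. (h p - g p)\<^sup>2 \<partial>PM) \<le> \<epsilon>"
    using g by (auto simp: prob_space)
qed

lemma integral_product_bm:
  assumes "bm M1 f" "bm M2 g"
  shows "(\<integral>p. f (fst p) * g (snd p) \<partial>PM) = (\<integral>x. f x \<partial>M1) * (\<integral>y. g y \<partial>M2)"
proof -
  have "integrable PM (\<lambda>p. f (fst p) * g (snd p))"
    using assms by (intro bm_integrable bm_mult bm_fst bm_snd)
  then have "(\<integral>p. f (fst p) * g (snd p) \<partial>PM) = (\<integral>x. (\<integral>y. f x * g y \<partial>M2) \<partial>M1)"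
    by (subst integral_fst'[symmetric]) (auto simp: split_beta')
  then show ?thesis by simp
qed

end

text \<open>A finite rank approximation spans finitely many functions, and in an orthonormal basis
  \<open>u\<close> of that span the best approximation has the Fourier coefficients of
  \<open>h\<close> as its matrix. This matrix is symmetric, and degeneracy kills the row and the
  column of the constant function; diagonalising what is left gives the centred \<open>w i\<close>.
  The last conclusion is Pythagoras and ties the sum of the \<open>(l i)\<^sup>2\<close> to the norm
  of \<open>h\<close>.\<close>

theorem (in prob_space) kernel_diagonal_approx:
  assumes h: "bm (M \<Otimes>\<^sub>M M) h" and sym: "\<And>x y. h (x, y) = h (y, x)"
    and deg: "AE x in M. (\<integral>y. h (x, y) \<partial>M) = 0" and e: "\<epsilon> > 0"
  obtains m :: nat and l :: "nat \<Rightarrow> real" and w :: "nat \<Rightarrow> 'a \<Rightarrow> real"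
  where "\<And>i. i < m \<Longrightarrow> bm M (w i)" "\<And>i. i < m \<Longrightarrow> (\<integral>x. w i x \<partial>M) = 0"
    "\<And>i j. i < m \<Longrightarrow> j < m \<Longrightarrow> (\<integral>x. w i x * w j x \<partial>M) = (if i = j then 1 else 0)"
    "(\<integral>p. (h p - (\<Sum>i<m. l i * (w i (fst p) * w i (snd p))))\<^sup>2 \<partial>(M \<Otimes>\<^sub>M M)) \<le> \<epsilon>"
    "(\<integral>p. (h p - (\<Sum>i<m. l i * (w i (fst p) * w i (snd p))))\<^sup>2 \<partial>(M \<Otimes>\<^sub>M M)) = (\<integral>p. (h p)\<^sup>2 \<partial>(M \<Otimes>\<^sub>M M)) - (\<Sum>i<m. (l i)\<^sup>2)"
proof -
  interpret P: pair_prob_space M M ..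
  obtain fs where fs: "\<And>a b. (a, b) \<in> set fs \<Longrightarrow> bm M a \<and> bm M b"
    "(\<integral>p. (h p - rank_kernel fs p)\<^sup>2 \<partial>(M \<Otimes>\<^sub>M M)) \<le> \<epsilon>"
    using P.rank_approx_bounded[OF h] e unfolding rank_approx_def by meson
  have fsb: "\<forall>f\<in>set (map fst fs @ map snd fs). bm M f" using fs(1) by auto
  obtain m :: nat and u where *:
    "(\<forall>i\<le>m. bm M (u i)) \<and> u 0 = (\<lambda>_. 1) \<and>
    (\<forall>i\<le>m. \<forall>j\<le>m. (\<integral>x. u i x * u j x \<partial>M) = (if i = j then 1 else 0)) \<and>
    (\<forall>f\<in>set (map fst fs @ map snd fs). \<exists>\<alpha>. AE x in M. f x = (\<Sum>i\<le>m. \<alpha> i * u i x))"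
  proof -
    note gram_schmidt[of "map fst fs @ map snd fs", OF fsb]
    then show thesis by (elim exE) (rule that)
  qed
  have u: "\<And>i. i \<le> m \<Longrightarrow> bm M (u i)" "u 0 = (\<lambda>_. 1)"
    "\<And>i j. i \<le> m \<Longrightarrow> j \<le> m \<Longrightarrow> (\<integral>x. u i x * u j x \<partial>M) = (if i = j then 1 else 0)"
    "\<And>f. f \<in> set (map fst fs @ map snd fs) \<Longrightarrow> \<exists>\<alpha>. AE x in M. f x = (\<Sum>i\<le>m. \<alpha> i * u i x)"
    using * by (simp_all only: simp_thms)
  define P where "P = {..m} \<times> {..m}"
  define e where "e q p = u (fst q) (fst p) * u (snd q) (snd p)" for q p
  define A where "A i j = (\<integral>p. h p * (u i (fst p) * u j (snd p)) \<partial>(M \<Otimes>\<^sub>M M))" for i j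
  have be: "bm (M \<Otimes>\<^sub>M M) (e q)" if "q \<in> P" for q
    unfolding e_def using that u(1) by (intro bm_mult bm_fst bm_snd) (auto simp: P_def)
  have orte: "(\<integral>p. e q p * e q' p \<partial>(M \<Otimes>\<^sub>M M)) = (if q = q' then 1 else 0)" if "q \<in> P" "q' \<in> P" for q q'
  proof -
    have "(\<integral>p. e q p * e q' p \<partial>(M \<Otimes>\<^sub>M M)) = (\<integral>p. (u (fst q) (fst p) * u (fst q') (fst p)) * (u (snd q) (snd p) * u (snd q') (snd p)) \<partial>(M \<Otimes>\<^sub>M M))"
      by (simp add: e_def mult_ac)
    also have "\<dots> = (\<integral>x. u (fst q) x * u (fst q') x \<partial>M) * (\<integral>y. u (snd q) y * u (snd q') y \<partial>M)"
      using that u(1) by (intro P.integral_product_bm bm_mult) (auto simp: P_def)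
    also have "\<dots> = (if q = q' then 1 else 0)"
      using that u(3) by (auto simp: P_def prod_eq_iff)
    finally show ?thesis .
  qed
  have AE_fst: "AE p in M \<Otimes>\<^sub>M M. f (fst p) = g (fst p)" and AE_snd: "AE p in M \<Otimes>\<^sub>M M. f (snd p) = g (snd p)"
    if [measurable]: "f \<in> borel_measurable M" "g \<in> borel_measurable M" and *: "AE x in M. f x = g x" for f g :: "'a \<Rightarrow> real"
  proof -
    have "AE x in M. AE y in M. f (fst (x, y)) = g (fst (x, y))" using * by eventually_elim simp
    then show "AE p in M \<Otimes>\<^sub>M M. f (fst p) = g (fst p)" by (intro P.AE_pair_measure) auto
    have "AE x in M. AE y in M. f (snd (x, y)) = g (snd (x, y))" using * by simp
    then show "AE p in M \<Otimes>\<^sub>M M. f (snd p) = g (snd p)" by (intro P.AE_pair_measure) auto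
  qed
  have "\<exists>\<kappa>. AE p in M \<Otimes>\<^sub>M M. rank_kernel gs p = (\<Sum>q\<in>P. \<kappa> q * e q p)" if "set gs \<subseteq> set fs" for gs
    using that
  proof (induction gs)
    case Nil
    show ?case by (intro exI[of _ "\<lambda>_. 0"]) simp
  next
    case (Cons f gs)
    obtain a b where f: "f = (a, b)" by (cases f)
    have ab: "(a, b) \<in> set fs" "set gs \<subseteq> set fs" using Cons.prems f by auto
    obtain \<kappa> where k: "AE p in M \<Otimes>\<^sub>M M. rank_kernel gs p = (\<Sum>q\<in>P. \<kappa> q * e q p)" using Cons.IH[OF ab(2)] by auto
    have "a \<in> set (map fst fs @ map snd fs)" "b \<in> set (map fst fs @ map snd fs)" using ab(1) by (auto simp: image_iff Bex_def)
    note u(4)[OF this(1)] u(4)[OF this(2)]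
    then obtain \<alpha> \<beta> where al: "AE x in M. a x = (\<Sum>i\<le>m. \<alpha> i * u i x)" and bt: "AE x in M. b x = (\<Sum>i\<le>m. \<beta> i * u i x)"
      by (elim exE) (rule that)
    have ms: "(\<lambda>x. \<Sum>i\<le>m. c i * u i x) \<in> borel_measurable M" for c :: "nat \<Rightarrow> real"
      using u(1) by (intro borel_measurable_sum borel_measurable_times) (auto simp: bm_def)
    have mab: "a \<in> borel_measurable M" "b \<in> borel_measurable M" using fs(1)[OF ab(1)] by (auto simp: bm_def)
    have "AE p in M \<Otimes>\<^sub>M M. rank_kernel (f # gs) p = (\<Sum>q\<in>P. (\<alpha> (fst q) * \<beta> (snd q) + \<kappa> q) * e q p)"
      using k AE_fst[OF mab(1) ms al] AE_snd[OF mab(2) ms bt]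
    proof eventually_elim
      case (elim p)
      have "(\<Sum>i\<le>m. \<alpha> i * u i (fst p)) * (\<Sum>i\<le>m. \<beta> i * u i (snd p)) = (\<Sum>q\<in>P. (\<alpha> (fst q) * \<beta> (snd q)) * e q p)"
        unfolding sum_product P_def e_def sum.cartesian_product by (intro sum.cong refl) (auto simp: mult_ac)
      then show ?case using elim by (simp add: f distrib_right sum.distrib)
    qed
    then show ?case by (rule exI[of _ "\<lambda>q. \<alpha> (fst q) * \<beta> (snd q) + \<kappa> q"])
  qed
  from this[OF order_refl] obtain \<kappa> where k: "AE p in M \<Otimes>\<^sub>M M. rank_kernel fs p = (\<Sum>q\<in>P. \<kappa> q * e q p)"
    by (elim exE) (rule that)
  have [measurable]: "h \<in> borel_measurable (M \<Otimes>\<^sub>M M)" "rank_kernel fs \<in> borel_measurable (M \<Otimes>\<^sub>M M)"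
    using h bm_rank_kernel[of fs M M] fs(1) by (auto simp: bm_def)
  have ms: "(\<lambda>p. \<Sum>q\<in>P. \<kappa> q * e q p) \<in> borel_measurable (M \<Otimes>\<^sub>M M)"
    using be by (intro borel_measurable_sum borel_measurable_times) (auto simp: bm_def)
  have "(\<integral>p. (h p - rank_kernel fs p)\<^sup>2 \<partial>(M \<Otimes>\<^sub>M M)) = (\<integral>p. (h p - (\<Sum>q\<in>P. \<kappa> q * e q p))\<^sup>2 \<partial>(M \<Otimes>\<^sub>M M))"
    using k by (intro integral_cong_AE) (auto intro!: borel_measurable_power borel_measurable_diff ms)
  also have "\<dots> = (\<integral>p. (h p)\<^sup>2 \<partial>(M \<Otimes>\<^sub>M M)) - 2 * (\<Sum>q\<in>P. \<kappa> q * (\<integral>p. h p * e q p \<partial>(M \<Otimes>\<^sub>M M))) + (\<Sum>q\<in>P. (\<kappa> q)\<^sup>2)"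
    by (rule P.integral_square_expand) (auto simp: P_def[symmetric] be orte h, simp add: P_def)
  \<comment> \<open>Completing the square: the Fourier coefficients \<open>A\<close> do at least as
    well as the coefficients of the given approximation.\<close>
  also have "\<dots> = (\<integral>p. (h p)\<^sup>2 \<partial>(M \<Otimes>\<^sub>M M)) - (\<Sum>q\<in>P. (A (fst q) (snd q))\<^sup>2) + (\<Sum>q\<in>P. (\<kappa> q - A (fst q) (snd q))\<^sup>2)"
    by (simp add: A_def e_def power2_diff sum.distrib sum_subtractf sum_distrib_left mult_ac)
  also have "\<dots> \<ge> (\<integral>p. (h p)\<^sup>2 \<partial>(M \<Otimes>\<^sub>M M)) - (\<Sum>q\<in>P. (A (fst q) (snd q))\<^sup>2)"
    by (simp add: sum_nonneg)
  finally have Abound: "(\<integral>p. (h p)\<^sup>2 \<partial>(M \<Otimes>\<^sub>M M)) - (\<Sum>q\<in>P. (A (fst q) (snd q))\<^sup>2) \<le> \<epsilon>"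
    using fs(2) by simp
  have Asym: "A i j = A j i" if "i \<le> m" "j \<le> m" for i j
  proof -
    have [measurable]: "u i \<in> borel_measurable M" "u j \<in> borel_measurable M" using u(1) that by (auto simp: bm_def)
    have "A i j = (\<integral>(x, y). h (y, x) * (u i y * u j x) \<partial>(M \<Otimes>\<^sub>M M))"
      unfolding A_def by (subst P.integral_product_swap[symmetric]) (auto simp: split_beta')
    also have "\<dots> = A j i" unfolding A_def by (intro Bochner_Integration.integral_cong refl) (auto simp: sym split_beta' mult_ac)
    finally show ?thesis .
  qed
  have A0: "A i 0 = 0" if "i \<le> m" for i
  proof -
    have [measurable]: "u i \<in> borel_measurable M" using u(1) that by (auto simp: bm_def)
    have "integrable (M \<Otimes>\<^sub>M M) (\<lambda>p. h p * (u i (fst p) * u 0 (snd p)))"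
      using h u(1) that by (intro P.bm_integrable bm_mult bm_fst bm_snd) auto
    then have "A i 0 = (\<integral>x. (\<integral>y. h (x, y) * u i x \<partial>M) \<partial>M)"
      unfolding A_def by (subst P.integral_fst'[symmetric]) (auto simp: u(2))
    also have "\<dots> = (\<integral>x. (\<integral>y. h (x, y) \<partial>M) * u i x \<partial>M)" by simp
    also have "\<dots> = (\<integral>x. 0 \<partial>M)" using deg by (intro integral_cong_AE) auto
    finally show ?thesis by simp
  qed
  \<comment> \<open>The shift by one removes the constant function \<open>u 0\<close>, so every
    combination of the remaining basis functions has mean 0.\<close>
  define A' where "A' i j = A (Suc i) (Suc j)" for i j
  have "\<And>a b. a < m \<Longrightarrow> b < m \<Longrightarrow> A' a b = A' b a" unfolding A'_def by (rule Asym) auto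
  from symmetric_matrix_diagonal[of m A', OF this] obtain v l where
    v: "\<And>i j. i < m \<Longrightarrow> j < m \<Longrightarrow> (\<Sum>a<m. v i a * v j a) = (if i = j then 1 else 0)"
    and A': "\<And>a b. a < m \<Longrightarrow> b < m \<Longrightarrow> A' a b = (\<Sum>i<m. l i * v i a * v i b)" by blast
  define w where "w k x = (\<Sum>i<m. v k i * u (Suc i) x)" for k x
  have bw: "bm M (w k)" for k unfolding w_def using u(1) by (intro bm_sum bm_mult) auto
  have w0: "(\<integral>x. w k x \<partial>M) = 0" for k
  proof -
    have "(\<integral>x. w k x \<partial>M) = (\<Sum>i<m. v k i * (\<integral>x. u (Suc i) x * u 0 x \<partial>M))"
      unfolding w_def using u(1) by (subst Bochner_Integration.integral_sum) (auto simp: u(2))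
    also have "\<dots> = 0" using u(3) by (intro sum.neutral) auto
    finally show ?thesis .
  qed
  have ww: "(\<integral>x. w k x * w k' x \<partial>M) = (if k = k' then 1 else 0)" if "k < m" "k' < m" for k k'
  proof -
    have "(\<integral>x. w k x * w k' x \<partial>M) = (\<integral>x. (\<Sum>i<m. \<Sum>j<m. v k i * v k' j * (u (Suc i) x * u (Suc j) x)) \<partial>M)"
      unfolding w_def sum_product by (intro Bochner_Integration.integral_cong sum.cong refl) (simp add: mult_ac)
    also have "\<dots> = (\<Sum>i<m. \<Sum>j<m. v k i * v k' j * (\<integral>x. u (Suc i) x * u (Suc j) x \<partial>M))"
      using u(1) by (subst integral_sum2) (auto intro!: bm_integrable)
    also have "\<dots> = (\<Sum>i<m. \<Sum>j<m. if i = j then v k i * v k' j else 0)"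
      using u(3) by (intro sum.cong refl) auto
    also have "\<dots> = (if k = k' then 1 else 0)" using v that by simp
    finally show ?thesis .
  qed
  have vAv: "(\<Sum>i<m. \<Sum>j<m. v k i * v k j * A' i j) = l k" if "k < m" for k
  proof -
    have "(\<Sum>i<m. \<Sum>j<m. v k i * v k j * A' i j) = (\<Sum>i<m. \<Sum>j<m. \<Sum>n<m. l n * (v k i * v n i) * (v k j * v n j))"
      using A' by (intro sum.cong refl) (simp add: sum_distrib_left mult_ac)
    also have "\<dots> = (\<Sum>i<m. \<Sum>n<m. \<Sum>j<m. l n * (v k i * v n i) * (v k j * v n j))"
      by (intro sum.cong refl sum.swap)
    also have "\<dots> = (\<Sum>n<m. \<Sum>i<m. \<Sum>j<m. l n * (v k i * v n i) * (v k j * v n j))"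
      by (rule sum.swap)
    also have "\<dots> = (\<Sum>n<m. l n * (\<Sum>i<m. v k i * v n i) * (\<Sum>j<m. v k j * v n j))"
      by (simp add: sum_distrib_left sum_distrib_right mult_ac sum_product)
    also have "\<dots> = (\<Sum>n<m. if n = k then l n else 0)" using v that by (intro sum.cong refl) auto
    also have "\<dots> = l k" using that by simp
    finally show ?thesis .
  qed
  define E where "E k p = w k (fst p) * w k (snd p)" for k p
  have bE: "bm (M \<Otimes>\<^sub>M M) (E k)" for k unfolding E_def using bw by (intro bm_mult bm_fst bm_snd)
  have ortE: "(\<integral>p. E k p * E k' p \<partial>(M \<Otimes>\<^sub>M M)) = (if k = k' then 1 else 0)" if "k < m" "k' < m" for k k'
  proof -
    have "(\<integral>p. E k p * E k' p \<partial>(M \<Otimes>\<^sub>M M)) = (\<integral>p. (w k (fst p) * w k' (fst p)) * (w k (snd p) * w k' (snd p)) \<partial>(M \<Otimes>\<^sub>M M))"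
      by (simp add: E_def mult_ac)
    also have "\<dots> = (\<integral>x. w k x * w k' x \<partial>M) * (\<integral>x. w k x * w k' x \<partial>M)"
      using bw by (intro P.integral_product_bm bm_mult)
    finally show ?thesis using ww that by simp
  qed
  have hE: "(\<integral>p. h p * E k p \<partial>(M \<Otimes>\<^sub>M M)) = l k" if "k < m" for k
  proof -
    have "(\<integral>p. h p * E k p \<partial>(M \<Otimes>\<^sub>M M)) = (\<integral>p. (\<Sum>i<m. \<Sum>j<m. v k i * v k j * (h p * (u (Suc i) (fst p) * u (Suc j) (snd p)))) \<partial>(M \<Otimes>\<^sub>M M))"
      unfolding E_def w_def sum_product
      by (intro Bochner_Integration.integral_cong refl) (simp add: sum_distrib_left mult_ac)
    also have "\<dots> = (\<Sum>i<m. \<Sum>j<m. v k i * v k j * A' i j)"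
    proof -
      have "bm (M \<Otimes>\<^sub>M M) (\<lambda>p. v k i * v k j * (h p * (u (Suc i) (fst p) * u (Suc j) (snd p))))" if "i < m" "j < m" for i j
        using h u(1) that by (intro bm_mult bm_fst bm_snd bm_const) auto
      then have "integrable (M \<Otimes>\<^sub>M M) (\<lambda>p. v k i * v k j * (h p * (u (Suc i) (fst p) * u (Suc j) (snd p))))" if "i < m" "j < m" for i j
        using that by (intro P.bm_integrable)
      then show ?thesis
        by (subst integral_sum2) (simp_all only: lessThan_iff A'_def A_def integral_mult_right_zero)
    qed
    also have "\<dots> = l k" by (rule vAv[OF that])
    finally show ?thesis .
  qed
  have "(\<integral>p. (h p - (\<Sum>k<m. l k * E k p))\<^sup>2 \<partial>(M \<Otimes>\<^sub>M M))
     = (\<integral>p. (h p)\<^sup>2 \<partial>(M \<Otimes>\<^sub>M M)) - 2 * (\<Sum>k<m. l k * (\<integral>p. h p * E k p \<partial>(M \<Otimes>\<^sub>M M))) + (\<Sum>k<m. (l k)\<^sup>2)"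
    by (rule P.integral_square_expand) (auto simp: h bE ortE)
  then have err: "(\<integral>p. (h p - (\<Sum>k<m. l k * E k p))\<^sup>2 \<partial>(M \<Otimes>\<^sub>M M)) = (\<integral>p. (h p)\<^sup>2 \<partial>(M \<Otimes>\<^sub>M M)) - (\<Sum>k<m. (l k)\<^sup>2)"
    by (simp add: hE power2_eq_square)
  \<comment> \<open>The eigenvalues carry the whole sum of squared matrix entries, so passing to the
    eigenbasis does not increase the error.\<close>
  have "(\<Sum>k<m. (l k)\<^sup>2) = (\<Sum>k<m. l k * (\<Sum>i<m. \<Sum>j<m. v k i * v k j * A' i j))"
    using vAv by (intro sum.cong) (auto simp: power2_eq_square)
  also have "\<dots> = (\<Sum>k<m. \<Sum>i<m. \<Sum>j<m. A' i j * (l k * v k i * v k j))"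
    by (simp add: sum_distrib_left mult_ac)
  also have "\<dots> = (\<Sum>i<m. \<Sum>k<m. \<Sum>j<m. A' i j * (l k * v k i * v k j))" by (rule sum.swap)
  also have "\<dots> = (\<Sum>i<m. \<Sum>j<m. \<Sum>k<m. A' i j * (l k * v k i * v k j))" by (intro sum.cong refl sum.swap)
  also have "\<dots> = (\<Sum>i<m. \<Sum>j<m. (A' i j)\<^sup>2)"
    using A' by (intro sum.cong refl) (simp add: sum_distrib_left[symmetric] power2_eq_square)
  also have "\<dots> = (\<Sum>q\<in>P. (A (fst q) (snd q))\<^sup>2)"
  proof -
    have "(\<Sum>q\<in>P. (A (fst q) (snd q))\<^sup>2) = (\<Sum>i\<le>m. \<Sum>j\<le>m. (A i j)\<^sup>2)"
      by (simp add: P_def sum.cartesian_product split_beta')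
    also have "\<dots> = (\<Sum>i<m. \<Sum>j<m. (A' i j)\<^sup>2)"
      using A0 Asym[of 0] by (simp add: A'_def sum.atMost_shift)
    finally show ?thesis by simp
  qed
  finally have "(\<integral>p. (h p - (\<Sum>k<m. l k * E k p))\<^sup>2 \<partial>(M \<Otimes>\<^sub>M M)) \<le> \<epsilon>"
    using Abound err by simp
  then show thesis using err bw w0 ww by (intro that[of m w l]) (auto simp: E_def)
qed

section \<open>The limit law\<close>

lemma exp_neg_quadratic_bounds:
  fixes x :: real assumes "x \<ge> 0"
  shows "\<bar>exp (- x) - (1 - x)\<bar> \<le> x\<^sup>2 / 2"
proof -
  have "1 + x + x\<^sup>2 / 2 \<le> exp x" by (rule exp_lower_Taylor_quadratic[OF assms])
  then have "(1 + x + x\<^sup>2 / 2) * exp (- x) \<le> 1"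
    using mult_right_mono[of _ "exp x" "exp (- x)"] by (simp add: exp_minus_inverse)
  \<comment> \<open>The product equals \<open>1 + x ^ 4 / 4\<close>.\<close>
  also have "1 \<le> (1 + x + x\<^sup>2 / 2) * (1 - x + x\<^sup>2 / 2)"
    using assms by (simp add: algebra_simps power2_eq_square)
  finally have "exp (- x) \<le> 1 - x + x\<^sup>2 / 2"
    using assms by (subst (asm) mult_le_cancel_left_pos) (auto simp: add_pos_nonneg)
  moreover have "1 - x \<le> exp (- x)" using exp_ge_add_one_self[of "- x"] by simp
  ultimately show ?thesis by simp
qed

lemma iexp_taylor2: "cmod (iexp x - (1 + \<i> * x - x\<^sup>2 / 2)) \<le> \<bar>x\<bar> ^ 3 / 6"
proof -
  have "(\<Sum>k\<le>2. (\<i> * x) ^ k / fact k) = 1 + \<i> * x - x\<^sup>2 / 2"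
    by (simp add: numeral_eq_Suc power_mult_distrib)
  then show ?thesis using iexp_approx1[of x 2] by (simp add: numeral_eq_Suc)
qed

lemma iexp_lipschitz: "cmod (iexp x - iexp y) \<le> \<bar>x - y\<bar>"
proof -
  have "iexp x - iexp y = iexp y * (iexp (x - y) - 1)"
    by (simp add: algebra_simps exp_add[symmetric])
  then have "cmod (iexp x - iexp y) = cmod (iexp (x - y) - 1)" by (simp add: norm_mult)
  also have "\<dots> \<le> \<bar>x - y\<bar>" using iexp_approx1[of "x - y" 0] by simp
  finally show ?thesis .
qed

text \<open>Both the characteristic function and its normal counterpart are compared with
  \<open>1 - v / 2\<close>, where \<open>v\<close> is the variance: a Taylor expansion costs the
  third moment, the real exponential costs \<open>v\<^sup>2 / 8\<close>. It is needed for small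
  chi-square coefficients and for the edge noise.\<close>

lemma (in prob_space) iexp_normal_approx:
  fixes Y :: "'a \<Rightarrow> real"
  assumes [measurable]: "Y \<in> borel_measurable M" and 3: "integrable M (\<lambda>x. \<bar>Y x\<bar> ^ 3)"
    and mean: "expectation Y = 0"
  shows "cmod ((\<integral>x. iexp (Y x) \<partial>M) - exp (- expectation (\<lambda>x. (Y x)\<^sup>2) / 2))
     \<le> expectation (\<lambda>x. \<bar>Y x\<bar> ^ 3) / 6 + (expectation (\<lambda>x. (Y x)\<^sup>2))\<^sup>2 / 8"
proof -
  have p: "\<bar>y\<bar> \<le> 1 + \<bar>y\<bar> ^ 3" "y\<^sup>2 \<le> 1 + \<bar>y\<bar> ^ 3" for y :: real
  proof -
    have "\<bar>y\<bar> ^ k \<le> 1 + \<bar>y\<bar> ^ 3" if "k \<le> 3" for k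
    proof (cases "\<bar>y\<bar> \<le> 1")
      case True
      then show ?thesis using power_le_one[of "\<bar>y\<bar>" k] by (smt (verit) zero_le_power abs_ge_zero)
    next
      case False
      then have "\<bar>y\<bar> ^ k \<le> \<bar>y\<bar> ^ 3" using that by (intro power_increasing) auto
      then show ?thesis by simp
    qed
    from this[of 1] this[of 2] show "\<bar>y\<bar> \<le> 1 + \<bar>y\<bar> ^ 3" "y\<^sup>2 \<le> 1 + \<bar>y\<bar> ^ 3" by auto
  qed
  have i1: "integrable M Y"
    by (rule Bochner_Integration.integrable_bound[of M "\<lambda>x. 1 + \<bar>Y x\<bar> ^ 3"]) (use 3 p in \<open>auto intro!: AE_I2\<close>)
  have i2: "integrable M (\<lambda>x. (Y x)\<^sup>2)"
    by (rule Bochner_Integration.integrable_bound[of M "\<lambda>x. 1 + \<bar>Y x\<bar> ^ 3"]) (use 3 p in \<open>auto intro!: AE_I2\<close>)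
  let ?v = "expectation (\<lambda>x. (Y x)\<^sup>2)"
  have ie: "integrable M (\<lambda>x. iexp (Y x))" by (rule integrable_iexp) auto
  have iq: "integrable M (\<lambda>x. 1 + \<i> * Y x - (Y x)\<^sup>2 / 2)"
    using i1 i2 by (intro Bochner_Integration.integrable_add Bochner_Integration.integrable_diff) (auto simp flip: of_real_power)
  have "(\<integral>x. 1 + \<i> * Y x - (Y x)\<^sup>2 / 2 \<partial>M) = complex_of_real (1 - ?v / 2)"
    using i1 i2 mean by (simp add: prob_space flip: of_real_power)
  then have "(\<integral>x. iexp (Y x) \<partial>M) - complex_of_real (1 - ?v / 2) = (\<integral>x. iexp (Y x) - (1 + \<i> * Y x - (Y x)\<^sup>2 / 2) \<partial>M)"
    using ie iq by simp
  also have "cmod \<dots> \<le> (\<integral>x. cmod (iexp (Y x) - (1 + \<i> * Y x - (Y x)\<^sup>2 / 2)) \<partial>M)" by (rule integral_norm_bound)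
  also have "\<dots> \<le> (\<integral>x. \<bar>Y x\<bar> ^ 3 / 6 \<partial>M)"
    using iexp_taylor2 3 ie iq by (intro integral_mono) auto
  finally have 1: "cmod ((\<integral>x. iexp (Y x) \<partial>M) - complex_of_real (1 - ?v / 2)) \<le> expectation (\<lambda>x. \<bar>Y x\<bar> ^ 3) / 6"
    by simp
  have "cmod (complex_of_real (1 - ?v / 2) - exp (- ?v / 2)) = \<bar>exp (- (?v / 2)) - (1 - ?v / 2)\<bar>"
    by (simp only: of_real_diff[symmetric] norm_of_real minus_divide_left abs_minus_commute)
  also have "\<dots> \<le> (?v / 2)\<^sup>2 / 2" by (rule exp_neg_quadratic_bounds) simp
  finally have 2: "cmod (complex_of_real (1 - ?v / 2) - exp (- ?v / 2)) \<le> ?v\<^sup>2 / 8" by (simp add: power_divide)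
  show ?thesis using norm_triangle_ineq[of "(\<integral>x. iexp (Y x) \<partial>M) - complex_of_real (1 - ?v / 2)" "complex_of_real (1 - ?v / 2) - exp (- ?v / 2)"] 1 2
    by simp
qed

text \<open>The characteristic function of the centred chi-square law with one degree of
  freedom.\<close>

definition chi_cf :: "real \<Rightarrow> complex" where
  "chi_cf \<theta> = (\<integral>z. iexp (\<theta> * (z\<^sup>2 - 1)) \<partial>std_normal)"

lemma prob_space_std_normal: "prob_space std_normal"
  unfolding std_normal_def by (rule prob_space_normal_density) simp

lemma sets_std_normal [measurable_cong, simp]: "sets std_normal = sets borel"
  by (simp add: std_normal_def)

lemma space_std_normal [simp]: "space std_normal = UNIV"
  by (simp add: std_normal_def)

lemma chi_moments:
  shows "integrable std_normal (\<lambda>z. z\<^sup>2 - 1)" "(\<integral>z. z\<^sup>2 - 1 \<partial>std_normal) = 0"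
    "integrable std_normal (\<lambda>z. (z\<^sup>2 - 1)\<^sup>2)" "(\<integral>z. (z\<^sup>2 - 1)\<^sup>2 \<partial>std_normal) = 2"
    "integrable std_normal (\<lambda>z. \<bar>z\<^sup>2 - 1\<bar> ^ 3)"
proof -
  interpret prob_space std_normal by (rule prob_space_std_normal)
  have [simp]: "prob UNIV = 1" using prob_space by simp
  have i [simp]: "integrable std_normal (\<lambda>z. z ^ k)" for k
    unfolding std_normal_def by (rule integrable_std_normal_distribution_moment)
  have 2: "(\<integral>z. z\<^sup>2 \<partial>std_normal) = 1" and 4: "(\<integral>z. z ^ 4 \<partial>std_normal) = 3"
    using std_normal_distribution_even_moments(1)[of 1] std_normal_distribution_even_moments(1)[of 2]
    by (simp_all add: std_normal_def fact_numeral)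
  show "integrable std_normal (\<lambda>z. z\<^sup>2 - 1)" by simp
  show "(\<integral>z. z\<^sup>2 - 1 \<partial>std_normal) = 0" using 2 by (simp add: prob_space)
  have eq: "(z\<^sup>2 - 1)\<^sup>2 = z ^ 4 - 2 * z\<^sup>2 + 1" for z :: real
    by (simp add: power2_eq_square power4_eq_xxxx algebra_simps)
  show "integrable std_normal (\<lambda>z. (z\<^sup>2 - 1)\<^sup>2)" "(\<integral>z. (z\<^sup>2 - 1)\<^sup>2 \<partial>std_normal) = 2"
    unfolding eq using 2 4 by (simp_all add: prob_space)
  show "integrable std_normal (\<lambda>z. \<bar>z\<^sup>2 - 1\<bar> ^ 3)"
  proof (rule Bochner_Integration.integrable_bound)
    show "integrable std_normal (\<lambda>z. z ^ 6 + 3 * z ^ 4 + 3 * z\<^sup>2 + 1 :: real)" by simp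
    have "\<bar>z\<^sup>2 - 1\<bar> ^ 3 \<le> z ^ 6 + 3 * z ^ 4 + 3 * z\<^sup>2 + 1" for z :: real
    proof -
      have "\<bar>z\<^sup>2 - 1\<bar> ^ 3 \<le> (z\<^sup>2 + 1) ^ 3" by (intro power_mono) (auto simp: abs_le_iff)
      also have "\<dots> = z ^ 6 + 3 * z ^ 4 + 3 * z\<^sup>2 + 1" by (simp add: numeral_eq_Suc algebra_simps)
      finally show ?thesis .
    qed
    then show "AE z in std_normal. norm (\<bar>z\<^sup>2 - 1\<bar> ^ 3) \<le> norm (z ^ 6 + 3 * z ^ 4 + 3 * z\<^sup>2 + 1)"
      by (auto intro!: AE_I2 order_trans[OF _ abs_ge_self])
  qed simp
qed

lemma chi_cf_eq_char: "chi_cf = char (distr std_normal borel (\<lambda>z. z\<^sup>2 - 1))"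
  by (auto simp: fun_eq_iff chi_cf_def char_def integral_distr)

lemma real_distribution_chi: "real_distribution (distr std_normal borel (\<lambda>z. z\<^sup>2 - 1))"
proof -
  interpret prob_space std_normal by (rule prob_space_std_normal)
  show ?thesis by (rule real_distribution_distr) simp
qed

lemma chi_cf_0 [simp]: "chi_cf 0 = 1"
  unfolding chi_cf_eq_char by (rule real_distribution.char_zero[OF real_distribution_chi])

lemma cmod_chi_cf: "cmod (chi_cf \<theta>) \<le> 1"
  unfolding chi_cf_eq_char by (rule real_distribution.cmod_char_le_1[OF real_distribution_chi])

lemma isCont_chi_cf: "isCont chi_cf \<theta>"
  unfolding chi_cf_eq_char by (rule real_distribution.isCont_char[OF real_distribution_chi])

text \<open>The centred chi-square law has variance 2, so the matching normal factor is
  \<open>exp (- \<theta>\<^sup>2)\<close>. The cubic error is what makes many small coefficients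
  with bounded sum of squares look normal.\<close>

lemma chi_cf_approx:
  obtains C where "C \<ge> 0" "\<And>\<theta>. \<bar>\<theta>\<bar> \<le> 1 \<Longrightarrow> cmod (chi_cf \<theta> - exp (- \<theta>\<^sup>2)) \<le> C * \<bar>\<theta>\<bar> ^ 3"
proof
  interpret prob_space std_normal by (rule prob_space_std_normal)
  define m3 where "m3 = (\<integral>z. \<bar>z\<^sup>2 - 1\<bar> ^ 3 \<partial>std_normal)"
  show "m3 / 6 + 1 / 2 \<ge> 0" unfolding m3_def by simp
  fix \<theta> :: real assume th: "\<bar>\<theta>\<bar> \<le> 1"
  have "cmod ((\<integral>z. iexp (\<theta> * (z\<^sup>2 - 1)) \<partial>std_normal) - exp (- expectation (\<lambda>z. (\<theta> * (z\<^sup>2 - 1))\<^sup>2) / 2))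
     \<le> expectation (\<lambda>z. \<bar>\<theta> * (z\<^sup>2 - 1)\<bar> ^ 3) / 6 + (expectation (\<lambda>z. (\<theta> * (z\<^sup>2 - 1))\<^sup>2))\<^sup>2 / 8"
    using chi_moments by (intro iexp_normal_approx) (auto simp: abs_mult power_mult_distrib)
  moreover have "expectation (\<lambda>z. (\<theta> * (z\<^sup>2 - 1))\<^sup>2) = 2 * \<theta>\<^sup>2"
    using chi_moments by (simp add: power_mult_distrib)
  moreover have "expectation (\<lambda>z. \<bar>\<theta> * (z\<^sup>2 - 1)\<bar> ^ 3) = \<bar>\<theta>\<bar> ^ 3 * m3"
    by (simp add: abs_mult power_mult_distrib m3_def)
  moreover have "(2 * \<theta>\<^sup>2)\<^sup>2 / 8 \<le> \<bar>\<theta>\<bar> ^ 3 / 2"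
  proof -
    have "\<bar>\<theta>\<bar> ^ 4 \<le> \<bar>\<theta>\<bar> ^ 3" using th by (intro power_decreasing) auto
    then show ?thesis by (simp add: power_mult_distrib power_mult[symmetric])
  qed
  ultimately show "cmod (chi_cf \<theta> - exp (- \<theta>\<^sup>2)) \<le> (m3 / 6 + 1 / 2) * \<bar>\<theta>\<bar> ^ 3"
    by (simp add: chi_cf_def algebra_simps)
qed

text \<open>Weak limits of the laws of \<open>\<Sum>\<^sub>l a\<^sub>l (Z\<^sub>l\<^sup>2 - 1)\<close>: the part of \<open>\<Sum>\<^sub>l a\<^sub>l\<^sup>2\<close> that is carried by
  ever smaller coefficients is not lost but turns into a normal summand.\<close>

lemma chi_products_subsequence:
  fixes a :: "nat \<Rightarrow> nat \<Rightarrow> real" and m :: "nat \<Rightarrow> nat"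
  assumes a0: "\<And>k l. l \<ge> m k \<Longrightarrow> a k l = 0"
    and dec: "\<And>k i j. i \<le> j \<Longrightarrow> \<bar>a k j\<bar> \<le> \<bar>a k i\<bar>"
    and lim: "(\<lambda>k. \<Sum>l<m k. (a k l)\<^sup>2) \<longlonglongrightarrow> Q"
  obtains \<rho> c where "strict_mono \<rho>" "summable (\<lambda>l. (c l)\<^sup>2)" "(\<Sum>l. (c l)\<^sup>2) \<le> Q"
    "\<And>s L. (\<lambda>N. \<Prod>l<N. chi_cf (s * c l)) \<longlonglongrightarrow> L \<Longrightarrow>
      (\<lambda>k. \<Prod>l<m (\<rho> k). chi_cf (s * a (\<rho> k) l)) \<longlonglongrightarrow> complex_of_real (exp (- s\<^sup>2 * (Q - (\<Sum>l. (c l)\<^sup>2)))) * L"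
proof -
  define q where "q k = (\<Sum>l<m k. (a k l)\<^sup>2)" for k
  have "Bseq q" using lim unfolding q_def by (intro convergent_imp_Bseq) (auto simp: convergent_def)
  then obtain B where B: "B > 0" "\<And>k. q k \<le> B" unfolding Bseq_def by (auto simp: abs_le_iff)
  have part: "(\<Sum>l<N. (a k l)\<^sup>2) \<le> q k" for N k
  proof -
    have "(\<Sum>l<N. (a k l)\<^sup>2) \<le> (\<Sum>l<max N (m k). (a k l)\<^sup>2)" by (rule sum_mono2) auto
    also have "\<dots> = q k" unfolding q_def using a0 by (intro sum.mono_neutral_right) auto
    finally show ?thesis .
  qed
  \<comment> \<open>The first \<open>N + 1\<close> coefficients are at least as large in modulus as
    \<open>a k l\<close>, and their squares add up to at most \<open>B\<close>: a bound on the tail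
    coefficients that is uniform in \<open>k\<close>.\<close>
  have small: "\<bar>a k l\<bar> \<le> sqrt (B / (real N + 1))" if "l \<ge> N" for k l N
  proof -
    have "(real N + 1) * (a k l)\<^sup>2 = (\<Sum>i<Suc N. (a k l)\<^sup>2)" by simp
    also have "\<dots> \<le> (\<Sum>i<Suc N. (a k i)\<^sup>2)"
      using that by (intro sum_mono power2_le_iff_abs_le[THEN iffD2] abs_le_square_iff[THEN iffD1] dec) auto
    also have "\<dots> \<le> B" using part[of k "Suc N"] B(2)[of k] by simp
    finally have "(a k l)\<^sup>2 \<le> B / (real N + 1)" by (simp add: field_simps)
    then show ?thesis by (intro real_le_rsqrt) simp
  qed
  \<comment> \<open>All coefficient sequences lie in one compact box of the product space, so one
    subsequence makes every single coefficient converge.\<close>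
  let ?K = "{x :: nat \<Rightarrow> real. \<forall>i. - sqrt B \<le> x i \<and> x i \<le> sqrt B}"
  have "a k \<in> ?K" for k using small[of 0 _ k] by (auto simp: abs_le_iff minus_le_iff)
  moreover have "seq_compact ?K"
    using compact_fun_box by (rule compact_imp_seq_compact)
  ultimately obtain c \<rho> where r: "strict_mono \<rho>" "(a \<circ> \<rho>) \<longlonglongrightarrow> c"
    unfolding seq_compact_def by blast
  have conv: "(\<lambda>k. a (\<rho> k) l) \<longlonglongrightarrow> c l" for l
  proof -
    have "isCont (\<lambda>x :: nat \<Rightarrow> real. x l) c"
      using continuous_on_eq_continuous_at[OF open_UNIV, of "\<lambda>x :: nat \<Rightarrow> real. x l"] by simp
    from isCont_tendsto_compose[OF this r(2)] show ?thesis by (simp add: o_def)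
  qed
  have qlim: "(\<lambda>k. q (\<rho> k)) \<longlonglongrightarrow> Q"
    using LIMSEQ_subseq_LIMSEQ[OF lim r(1)] by (simp add: o_def q_def)
  have cQ: "(\<Sum>l<N. (c l)\<^sup>2) \<le> Q" for N
    by (rule LIMSEQ_le[of "\<lambda>k. \<Sum>l<N. (a (\<rho> k) l)\<^sup>2" _ "\<lambda>k. q (\<rho> k)"])
       (auto intro!: tendsto_intros conv qlim part)
  have sc: "summable (\<lambda>l. (c l)\<^sup>2)" by (rule summableI_nonneg_bounded[OF _ cQ]) simp
  have csum: "(\<Sum>l. (c l)\<^sup>2) \<le> Q" by (rule suminf_le_const[OF sc cQ])
  obtain C where C: "C \<ge> 0" "\<And>\<theta>. \<bar>\<theta>\<bar> \<le> 1 \<Longrightarrow> cmod (chi_cf \<theta> - exp (- \<theta>\<^sup>2)) \<le> C * \<bar>\<theta>\<bar> ^ 3"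
    by (rule chi_cf_approx) (rule that)
  show thesis
  proof (rule that[OF r(1) sc csum])
    fix s L assume L: "(\<lambda>N. \<Prod>l<N. chi_cf (s * c l)) \<longlonglongrightarrow> L"
    let ?b = "\<lambda>N. sqrt (B / (real N + 1))"
    \<comment> \<open>Bound for the total cubic error of the tail factors: the largest tail
      coefficient times the sum of squares.\<close>
    define \<delta> where "\<delta> N = C * \<bar>s\<bar> ^ 3 * ?b N * B" for N :: nat
    \<comment> \<open>The first \<open>N\<close> factors are kept, the rest is replaced by a normal
      factor of equal variance; \<open>E N\<close> below is the limit of this hybrid along the
      subsequence.\<close>
    define D where "D N k = (\<Prod>l<N. chi_cf (s * a k l)) * exp (- s\<^sup>2 * (q k - (\<Sum>l<N. (a k l)\<^sup>2)))" for N k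
    define E where "E N = (\<Prod>l<N. chi_cf (s * c l)) * exp (- s\<^sup>2 * (Q - (\<Sum>l<N. (c l)\<^sup>2)))" for N
    have b0: "?b \<longlonglongrightarrow> 0" using B(1) by real_asymp
    have est: "cmod ((\<Prod>l<m k. chi_cf (s * a k l)) - D N k) \<le> \<delta> N" if N: "\<bar>s\<bar> * ?b N \<le> 1" for N k
    proof -
      define m' where "m' = max N (m k)"
      have 1: "(\<Prod>l<m k. chi_cf (s * a k l)) = (\<Prod>l<N. chi_cf (s * a k l)) * (\<Prod>l\<in>{N..<m'}. chi_cf (s * a k l))"
      proof -
        have "(\<Prod>l<m k. chi_cf (s * a k l)) = (\<Prod>l<m'. chi_cf (s * a k l))"
          using a0 by (intro prod.mono_neutral_left) (auto simp: m'_def)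
        also have "{..<m'} = {..<N} \<union> {N..<m'}" by (auto simp: m'_def)
        finally show ?thesis by (subst (asm) prod.union_disjoint) auto
      qed
      have 2: "q k - (\<Sum>l<N. (a k l)\<^sup>2) = (\<Sum>l\<in>{N..<m'}. (a k l)\<^sup>2)"
      proof -
        have "q k = (\<Sum>l<m'. (a k l)\<^sup>2)"
          unfolding q_def using a0 by (intro sum.mono_neutral_left) (auto simp: m'_def)
        also have "{..<m'} = {..<N} \<union> {N..<m'}" by (auto simp: m'_def)
        finally show ?thesis by (subst (asm) sum.union_disjoint) auto
      qed
      have 3: "exp (- s\<^sup>2 * (q k - (\<Sum>l<N. (a k l)\<^sup>2))) = (\<Prod>l\<in>{N..<m'}. exp (- (s * a k l)\<^sup>2))"
        unfolding 2 by (simp add: sum_distrib_left exp_sum power_mult_distrib sum_negf[symmetric])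
      have "(\<Prod>l<m k. chi_cf (s * a k l)) - D N k = (\<Prod>l<N. chi_cf (s * a k l)) *
         ((\<Prod>l\<in>{N..<m'}. chi_cf (s * a k l)) - (\<Prod>l\<in>{N..<m'}. complex_of_real (exp (- (s * a k l)\<^sup>2))))"
        unfolding D_def 1 3 by (simp add: algebra_simps)
      then have "cmod ((\<Prod>l<m k. chi_cf (s * a k l)) - D N k) = cmod (\<Prod>l<N. chi_cf (s * a k l)) *
         cmod ((\<Prod>l\<in>{N..<m'}. chi_cf (s * a k l)) - (\<Prod>l\<in>{N..<m'}. complex_of_real (exp (- (s * a k l)\<^sup>2))))"
        by (simp only: norm_mult)
      also have "\<dots> \<le> 1 * (\<Sum>l\<in>{N..<m'}. cmod (chi_cf (s * a k l) - complex_of_real (exp (- (s * a k l)\<^sup>2))))"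
      proof (intro mult_mono norm_prod_diff)
        show "cmod (\<Prod>l<N. chi_cf (s * a k l)) \<le> 1"
          unfolding prod_norm[symmetric] by (intro prod_le_1) (auto simp: cmod_chi_cf)
      qed (auto simp: cmod_chi_cf)
      also have "\<dots> \<le> (\<Sum>l\<in>{N..<m'}. C * \<bar>s\<bar> ^ 3 * ?b N * (a k l)\<^sup>2)"
      proof (subst mult_1, rule sum_mono)
        fix l assume l: "l \<in> {N..<m'}"
        have al: "\<bar>a k l\<bar> \<le> ?b N" using l by (intro small) auto
        then have "\<bar>s * a k l\<bar> \<le> 1"
          using N mult_left_mono[OF al, of "\<bar>s\<bar>"] by (simp add: abs_mult)
        then have "cmod (chi_cf (s * a k l) - exp (- (s * a k l)\<^sup>2)) \<le> C * \<bar>s * a k l\<bar> ^ 3" by (rule C(2))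
        also have "\<dots> = C * \<bar>s\<bar> ^ 3 * \<bar>a k l\<bar> * (a k l)\<^sup>2"
        proof -
          have "\<bar>a k l\<bar> ^ 3 = \<bar>a k l\<bar> * \<bar>a k l\<bar>\<^sup>2" by (simp only: numeral_eq_Suc power_Suc pred_numeral_simps)
          then show ?thesis by (simp add: abs_mult power_mult_distrib)
        qed
        also have "\<dots> \<le> C * \<bar>s\<bar> ^ 3 * ?b N * (a k l)\<^sup>2"
          using al C(1) by (intro mult_right_mono mult_left_mono) auto
        finally show "cmod (chi_cf (s * a k l) - complex_of_real (exp (- (s * a k l)\<^sup>2))) \<le> C * \<bar>s\<bar> ^ 3 * ?b N * (a k l)\<^sup>2" .
      qed
      also have "\<dots> = C * \<bar>s\<bar> ^ 3 * ?b N * (q k - (\<Sum>l<N. (a k l)\<^sup>2))"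
        unfolding 2 by (simp add: sum_distrib_left)
      also have "\<dots> \<le> C * \<bar>s\<bar> ^ 3 * ?b N * B"
        using C(1) B sum_nonneg[of "{..<N}" "\<lambda>l. (a k l)\<^sup>2"] by (intro mult_left_mono) (auto intro: order_trans[OF _ B(2)[of k]])
      finally show ?thesis by (simp add: \<delta>_def)
    qed
    have DE: "(\<lambda>k. D N (\<rho> k)) \<longlonglongrightarrow> E N" for N
      unfolding D_def E_def
      by (intro tendsto_intros isCont_tendsto_compose[OF isCont_chi_cf] conv qlim)
    have EL: "E \<longlonglongrightarrow> complex_of_real (exp (- s\<^sup>2 * (Q - (\<Sum>l. (c l)\<^sup>2)))) * L"
      unfolding E_def by (subst mult.commute, intro tendsto_intros L summable_LIMSEQ sc)
    have d0: "\<delta> \<longlonglongrightarrow> 0" unfolding \<delta>_def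
      using tendsto_mult_right_zero[OF tendsto_mult_left_zero[OF b0]] by (intro tendsto_mult_left_zero tendsto_mult_right_zero b0)
    show "(\<lambda>k. \<Prod>l<m (\<rho> k). chi_cf (s * a (\<rho> k) l)) \<longlonglongrightarrow> complex_of_real (exp (- s\<^sup>2 * (Q - (\<Sum>l. (c l)\<^sup>2)))) * L"
    proof (rule tendstoI)
      fix \<epsilon> :: real assume e: "\<epsilon> > 0"
      \<comment> \<open>\<open>N\<close> is fixed first, which is possible because
        \<open>est\<close> is uniform in \<open>k\<close>; only then is \<open>k\<close> sent to
        infinity.\<close>
      have "\<forall>\<^sub>F N in sequentially. \<bar>s\<bar> * ?b N < 1"
        using tendsto_mult_right_zero[OF b0, of "\<bar>s\<bar>"] by (rule order_tendstoD) simp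
      moreover have "\<forall>\<^sub>F N in sequentially. \<delta> N < \<epsilon> / 3" using e d0 by (intro order_tendstoD) auto
      moreover have "\<forall>\<^sub>F N in sequentially. dist (E N) (complex_of_real (exp (- s\<^sup>2 * (Q - (\<Sum>l. (c l)\<^sup>2)))) * L) < \<epsilon> / 3"
        using tendstoD[OF EL, of "\<epsilon> / 3"] e by simp
      ultimately have "\<forall>\<^sub>F N in sequentially. \<bar>s\<bar> * ?b N < 1 \<and> \<delta> N < \<epsilon> / 3 \<and> dist (E N) (complex_of_real (exp (- s\<^sup>2 * (Q - (\<Sum>l. (c l)\<^sup>2)))) * L) < \<epsilon> / 3"
        by eventually_elim auto
      then obtain N where N: "\<bar>s\<bar> * ?b N < 1" "\<delta> N < \<epsilon> / 3" "dist (E N) (complex_of_real (exp (- s\<^sup>2 * (Q - (\<Sum>l. (c l)\<^sup>2)))) * L) < \<epsilon> / 3"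
        by (auto simp: eventually_sequentially)
      have "\<forall>\<^sub>F k in sequentially. dist (D N (\<rho> k)) (E N) < \<epsilon> / 3"
        using tendstoD[OF DE, of "\<epsilon> / 3"] e by simp
      then show "\<forall>\<^sub>F k in sequentially. dist (\<Prod>l<m (\<rho> k). chi_cf (s * a (\<rho> k) l)) (complex_of_real (exp (- s\<^sup>2 * (Q - (\<Sum>l. (c l)\<^sup>2)))) * L) < \<epsilon>"
      proof eventually_elim
        case (elim k)
        have "dist (\<Prod>l<m (\<rho> k). chi_cf (s * a (\<rho> k) l)) (D N (\<rho> k)) \<le> \<delta> N"
          unfolding dist_norm using N by (intro est) auto
        moreover have "dist (\<Prod>l<m (\<rho> k). chi_cf (s * a (\<rho> k) l)) (complex_of_real (exp (- s\<^sup>2 * (Q - (\<Sum>l. (c l)\<^sup>2)))) * L)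
          \<le> dist (\<Prod>l<m (\<rho> k). chi_cf (s * a (\<rho> k) l)) (D N (\<rho> k)) + (dist (D N (\<rho> k)) (E N) + dist (E N) (complex_of_real (exp (- s\<^sup>2 * (Q - (\<Sum>l. (c l)\<^sup>2)))) * L))"
          by (rule order_trans[OF dist_triangle[of _ _ "D N (\<rho> k)"] add_left_mono[OF dist_triangle]])
        ultimately show ?case using elim N by linarith
      qed
    qed
  qed
qed

subsection \<open>Almost sure convergence of independent series\<close>

text \<open>Kolmogorov's setting of independent centred terms with summable variances, realised on
  the coordinates of a product space.\<close>

locale independent_series = full_product M for M :: "nat \<Rightarrow> 'a measure" +
  fixes f :: "nat \<Rightarrow> 'a \<Rightarrow> real"
  assumes f_meas [measurable]: "\<And>i. f i \<in> borel_measurable (M i)"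
    and f_sq: "\<And>i. integrable (M i) (\<lambda>x. (f i x)\<^sup>2)"
    and f_mean: "\<And>i. (\<integral>x. f i x \<partial>M i) = 0"
    and f_summable: "summable (\<lambda>i. \<integral>x. (f i x)\<^sup>2 \<partial>M i)"
begin

definition v where "v i = (\<integral>x. (f i x)\<^sup>2 \<partial>M i)"

definition T where "T I z = (\<Sum>i\<in>I. f i (z i))"

lemma X_meas [measurable]: "(\<lambda>z. f i (z i)) \<in> borel_measurable \<Omega>"
  by measurable

lemma T_meas [measurable]: "T I \<in> borel_measurable \<Omega>"
  unfolding T_def[abs_def] by measurable

lemma v_nonneg: "0 \<le> v i"
  by (simp add: v_def)

lemma X_sq: "integrable \<Omega> (\<lambda>z. (f i (z i))\<^sup>2)" and X_sq_int: "(\<integral>z. (f i (z i))\<^sup>2 \<partial>\<Omega>) = v i"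
  using integrable_distr_eq[of "\<lambda>x. x i" \<Omega> "M i" "\<lambda>x. (f i x)\<^sup>2"] integral_coordinate[of "\<lambda>x. (f i x)\<^sup>2" i] f_sq
  by (simp_all add: PiM_component v_def)

lemma X_mean: "(\<integral>z. f i (z i) \<partial>\<Omega>) = 0"
  using integral_coordinate[of "f i" i] f_mean by simp

lemma integrable_mult_L2:
  assumes [measurable]: "g \<in> borel_measurable \<Omega>" "h \<in> borel_measurable \<Omega>"
    and "integrable \<Omega> (\<lambda>z. (g z)\<^sup>2)" "integrable \<Omega> (\<lambda>z. (h z :: real)\<^sup>2)"
  shows "integrable \<Omega> (\<lambda>z. g z * h z)"
proof (rule Bochner_Integration.integrable_bound[OF Bochner_Integration.integrable_add[OF assms(3,4)]])
  have "\<bar>a * b\<bar> \<le> \<bar>a\<^sup>2 + b\<^sup>2\<bar>" for a b :: real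
  proof -
    have "2 * (\<bar>a\<bar> * \<bar>b\<bar>) \<le> a\<^sup>2 + b\<^sup>2" "0 \<le> \<bar>a\<bar> * \<bar>b\<bar>"
      using sum_squares_bound[of "\<bar>a\<bar>" "\<bar>b\<bar>"] by (auto simp: mult.assoc)
    then show ?thesis unfolding abs_mult by linarith
  qed
  then show "AE z in \<Omega>. norm (g z * h z) \<le> norm ((g z)\<^sup>2 + (h z)\<^sup>2)" by simp
qed simp

lemma T_sq:
  assumes "finite I"
  shows "integrable \<Omega> (\<lambda>z. (T I z)\<^sup>2)" and "(\<integral>z. (T I z)\<^sup>2 \<partial>\<Omega>) = (\<Sum>i\<in>I. v i)"
  using assms
proof (induction I rule: finite_induct)
  case empty
  { case 1 show ?case by (simp add: T_def) }
  { case 2 show ?case by (simp add: T_def) }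
next
  case (insert i I)
  have eq: "(T (insert i I) z)\<^sup>2 = (T I z)\<^sup>2 + 2 * (T I z * f i (z i)) + (f i (z i))\<^sup>2" for z
    using insert(1,2) by (simp add: T_def power2_sum algebra_simps)
  have ip: "integrable \<Omega> (\<lambda>z. T I z * f i (z i))"
    using insert.IH X_sq by (intro integrable_mult_L2) auto
  have "(\<integral>z. T I z * f i (z i) \<partial>\<Omega>) = (\<integral>z. T I z \<partial>\<Omega>) * (\<integral>z. f i (z i) \<partial>\<Omega>)"
    using insert(2) by (intro integral_mult_indep[where A="{i}"] ip) (auto simp: T_def mix_def intro!: sum.cong)
  then have c0: "(\<integral>z. T I z * f i (z i) \<partial>\<Omega>) = 0" by (simp add: X_mean)
  { case 1 show ?case unfolding eq using insert.IH ip X_sq by simp }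
  { case 2 show ?case unfolding eq using insert ip X_sq by (simp add: c0 X_sq_int) }
qed

text \<open>Split according to the first index \<open>k\<close> at which \<epsilon> is reached. That
  event and the partial sum up to \<open>k\<close> read only earlier coordinates, while the
  remaining sum is independent of them and centred, so the cross term vanishes.\<close>

lemma kolmogorov_maximal:
  assumes e: "\<epsilon> > 0"
  shows "P.prob {z \<in> space \<Omega>. \<exists>k\<le>n. \<epsilon> \<le> \<bar>T {N..<N+k} z\<bar>} \<le> (\<Sum>i\<in>{N..<N+n}. v i) / \<epsilon>\<^sup>2"
proof -
  let ?T = "\<lambda>k. T {N..<N+k}"
  define A where "A k = {z \<in> space \<Omega>. \<epsilon> \<le> \<bar>?T k z\<bar> \<and> (\<forall>j<k. \<bar>?T j z\<bar> < \<epsilon>)}" for k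
  have A [measurable]: "A k \<in> sets \<Omega>" for k unfolding A_def by measurable
  \<comment> \<open>The indicator of \<open>A k\<close> without the condition of membership in the
    space, so that its invariance under \<open>mix\<close> holds for all arguments.\<close>
  define I where "I k z = (if \<epsilon> \<le> \<bar>?T k z\<bar> \<and> (\<forall>j<k. \<bar>?T j z\<bar> < \<epsilon>) then 1 else 0 :: real)" for k z
  have I [measurable]: "I k \<in> borel_measurable \<Omega>" for k unfolding I_def by measurable
  have IA: "I k z = indicator (A k) z" if "z \<in> space \<Omega>" for k z using that by (simp add: I_def A_def)
  have I01: "I k z = 0 \<or> I k z = 1" for k z by (simp add: I_def)
  have Isq: "I k z * I k z = I k z" for k z using I01[of k z] by auto
  have PA: "P.prob (A k) = (\<integral>z. I k z \<partial>\<Omega>)" for k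
    using IA by (subst Bochner_Integration.integral_cong[OF refl, of _ _ "indicator (A k)"]) auto
  have disj: "disjoint_family_on A {..n}"
    unfolding disjoint_family_on_def A_def by (auto, metis linorder_neqE_nat not_le)
  have un: "{z \<in> space \<Omega>. \<exists>k\<le>n. \<epsilon> \<le> \<bar>?T k z\<bar>} = (\<Union>k\<le>n. A k)"
  proof (intro set_eqI iffI)
    fix z assume z: "z \<in> {z \<in> space \<Omega>. \<exists>k\<le>n. \<epsilon> \<le> \<bar>?T k z\<bar>}"
    define k where "k = (LEAST k. \<epsilon> \<le> \<bar>?T k z\<bar>)"
    obtain k0 where k0: "k0 \<le> n" "\<epsilon> \<le> \<bar>?T k0 z\<bar>" using z by auto
    have "\<epsilon> \<le> \<bar>?T k z\<bar>" unfolding k_def by (rule LeastI[of _ k0]) (rule k0)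
    moreover have "\<bar>?T j z\<bar> < \<epsilon>" if "j < k" for j using not_less_Least[OF that[unfolded k_def]] by simp
    moreover have "k \<le> n" using Least_le[of "\<lambda>k. \<epsilon> \<le> \<bar>?T k z\<bar>" k0] k0 by (simp add: k_def)
    ultimately show "z \<in> (\<Union>k\<le>n. A k)" using z by (auto simp: A_def)
  qed (auto simp: A_def)
  have sq [simp]: "integrable \<Omega> (\<lambda>z. (T J z)\<^sup>2)" if "finite J" for J by (rule T_sq(1)[OF that])
  have ii: "integrable \<Omega> (\<lambda>z. I k z * (T J z)\<^sup>2)" if "finite J" for J k
    using sq[OF that] by (rule Bochner_Integration.integrable_bound) (use I01 in \<open>auto intro!: AE_I2 simp: abs_mult I_def\<close>)
  have iI: "integrable \<Omega> (I k)" for k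
    by (rule P.integrable_const_bound[of _ 1]) (auto simp: I_def)
  have step: "\<epsilon>\<^sup>2 * P.prob (A k) \<le> (\<integral>z. I k z * (?T n z)\<^sup>2 \<partial>\<Omega>)" if k: "k \<le> n" for k
  proof -
    define R where "R = T {N+k..<N+n}"
    have split: "?T n z = ?T k z + R z" for z
      unfolding T_def R_def using k by (subst sum.union_disjoint[symmetric]) (auto intro!: sum.cong)
    have R_sq: "integrable \<Omega> (\<lambda>z. (R z)\<^sup>2)" unfolding R_def by simp
    have ir: "integrable \<Omega> (\<lambda>z. (I k z * ?T k z) * R z)"
      using R_sq ii[of "{N..<N+k}" k] by (intro integrable_mult_L2) (auto simp: R_def power_mult_distrib power2_eq_square[of "I k _"] Isq)
    have "(\<integral>z. (I k z * ?T k z) * R z \<partial>\<Omega>) = (\<integral>z. I k z * ?T k z \<partial>\<Omega>) * (\<integral>z. R z \<partial>\<Omega>)"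
    proof (rule integral_mult_indep[where A="{N+k..}", OF ir])
      have T': "?T j (mix {N+k..} x y) = ?T j x" if "j \<le> k" for j x y
        unfolding T_def using that by (intro sum.cong) (auto simp: mix_def)
      show "I k (mix {N+k..} x y) * ?T k (mix {N+k..} x y) = I k x * ?T k x" for x y
        by (simp add: I_def T')
      show "R (mix {N+k..} x y) = R y" for x y
        unfolding R_def T_def by (intro sum.cong) (auto simp: mix_def)
    qed
    also have "(\<integral>z. R z \<partial>\<Omega>) = 0"
      unfolding R_def T_def by (subst Bochner_Integration.integral_sum) (auto simp: X_mean intro!: P.square_integrable_imp_integrable X_sq)
    finally have cross: "(\<integral>z. (I k z * ?T k z) * R z \<partial>\<Omega>) = 0" by simp
    have "\<epsilon>\<^sup>2 * P.prob (A k) = (\<integral>z. \<epsilon>\<^sup>2 * I k z \<partial>\<Omega>)" by (simp add: PA)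
    also have "\<dots> \<le> (\<integral>z. I k z * (?T k z)\<^sup>2 \<partial>\<Omega>)"
    proof (rule integral_mono)
      fix z
      have "\<epsilon>\<^sup>2 \<le> (?T k z)\<^sup>2" if "\<epsilon> \<le> \<bar>?T k z\<bar>"
        using that e by (auto simp: abs_le_square_iff[symmetric])
      then show "\<epsilon>\<^sup>2 * I k z \<le> I k z * (?T k z)\<^sup>2" by (auto simp: I_def)
    qed (auto simp: ii iI)
    also have "\<dots> = (\<integral>z. I k z * (?T k z)\<^sup>2 \<partial>\<Omega>) + 2 * (\<integral>z. (I k z * ?T k z) * R z \<partial>\<Omega>)"
      by (simp add: cross)
    also have "\<dots> = (\<integral>z. I k z * (?T k z)\<^sup>2 + 2 * ((I k z * ?T k z) * R z) \<partial>\<Omega>)"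
      using ir ii by simp
    \<comment> \<open>The square of the remaining sum \<open>R\<close> is nonnegative and is
      dropped.\<close>
    also have "\<dots> \<le> (\<integral>z. I k z * (?T n z)\<^sup>2 \<partial>\<Omega>)"
    proof (rule integral_mono)
      fix z
      have "I k z * (?T n z)\<^sup>2 = I k z * (?T k z)\<^sup>2 + 2 * ((I k z * ?T k z) * R z) + I k z * (R z)\<^sup>2"
        unfolding split power2_sum by (simp add: algebra_simps)
      moreover have "0 \<le> I k z * (R z)\<^sup>2" by (simp add: I_def)
      ultimately show "I k z * (?T k z)\<^sup>2 + 2 * ((I k z * ?T k z) * R z) \<le> I k z * (?T n z)\<^sup>2" by linarith
    qed (use ir ii in auto)
    finally show ?thesis .
  qed
  have "\<epsilon>\<^sup>2 * P.prob (\<Union>k\<le>n. A k) = (\<Sum>k\<le>n. \<epsilon>\<^sup>2 * P.prob (A k))"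
    using disj by (subst P.finite_measure_finite_Union) (auto simp: sum_distrib_left)
  also have "\<dots> \<le> (\<Sum>k\<le>n. \<integral>z. I k z * (?T n z)\<^sup>2 \<partial>\<Omega>)"
    by (intro sum_mono step) auto
  also have "\<dots> = (\<integral>z. (\<Sum>k\<le>n. I k z * (?T n z)\<^sup>2) \<partial>\<Omega>)"
    by (subst Bochner_Integration.integral_sum) (auto simp: ii)
  also have "\<dots> \<le> (\<integral>z. (?T n z)\<^sup>2 \<partial>\<Omega>)"
  proof (rule integral_mono)
    fix z assume z: "z \<in> space \<Omega>"
    have "(\<Sum>k\<le>n. I k z) = (indicator (\<Union>k\<le>n. A k) z :: real)"
      using disj by (subst indicator_UN_disjoint) (auto simp: IA[OF z])
    then have "(\<Sum>k\<le>n. I k z * (?T n z)\<^sup>2) = indicator (\<Union>k\<le>n. A k) z * (?T n z)\<^sup>2"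
      by (simp only: sum_distrib_right[symmetric])
    then show "(\<Sum>k\<le>n. I k z * (?T n z)\<^sup>2) \<le> (?T n z)\<^sup>2"
      by (simp add: indicator_def)
  qed (auto intro!: Bochner_Integration.integrable_sum ii)
  also have "\<dots> = (\<Sum>i\<in>{N..<N+n}. v i)" by (simp add: T_sq(2))
  finally show ?thesis using e unfolding un by (simp add: field_simps)
qed

text \<open>Letting the length of the block grow in the maximal inequality bounds the probability of
  ever reaching \<epsilon> after \<open>N\<close> by the tail variance over
  \<open>\<epsilon>\<^sup>2\<close>, which tends to 0 with growing \<open>N\<close>.\<close>

lemma AE_small_oscillation:
  assumes e: "\<epsilon> > 0"
  shows "AE z in \<Omega>. \<exists>N. \<forall>k. \<bar>T {N..<N+k} z\<bar> < \<epsilon>"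
proof -
  define tail where "tail N = (\<Sum>i. v (i + N))" for N
  have sv: "summable v" using f_summable by (simp add: v_def[abs_def])
  have tl: "tail \<longlonglongrightarrow> 0" using suminf_exist_split2[OF sv] by (simp add: tail_def[abs_def])
  define B where "B N = {z \<in> space \<Omega>. \<exists>k. \<epsilon> \<le> \<bar>T {N..<N+k} z\<bar>}" for N
  have B [measurable]: "B N \<in> sets \<Omega>" for N unfolding B_def by measurable
  have PB: "P.prob (B N) \<le> tail N / \<epsilon>\<^sup>2" for N
  proof -
    define C where "C n = {z \<in> space \<Omega>. \<exists>k\<le>n. \<epsilon> \<le> \<bar>T {N..<N+k} z\<bar>}" for n
    have "(\<lambda>n. P.prob (C n)) \<longlonglongrightarrow> P.prob (\<Union>n. C n)"
      by (rule P.finite_Lim_measure_incseq) (auto simp: C_def incseq_def intro: order_trans)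
    moreover have "(\<Union>n. C n) = B N" by (auto simp: C_def B_def)
    moreover have "P.prob (C n) \<le> tail N / \<epsilon>\<^sup>2" for n
    proof -
      have "(\<Sum>i\<in>{N..<N+n}. v i) = (\<Sum>i<n. v (i + N))"
        by (rule sum.reindex_bij_witness[of _ "\<lambda>i. i + N" "\<lambda>i. i - N"]) auto
      also have "\<dots> \<le> tail N" unfolding tail_def using sv v_nonneg
        by (intro sum_le_suminf) (auto simp: summable_iff_shift)
      finally show ?thesis using kolmogorov_maximal[OF e, of n N] e
        by (auto simp: C_def elim!: order_trans intro!: divide_right_mono)
    qed
    ultimately show ?thesis by (intro LIMSEQ_le_const2[where X="\<lambda>n. P.prob (C n)"]) auto
  qed
  have "P.prob (\<Inter>N. B N) \<le> 0"
  proof (rule LIMSEQ_le_const[where X="\<lambda>N. tail N / \<epsilon>\<^sup>2"])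
    show "(\<lambda>N. tail N / \<epsilon>\<^sup>2) \<longlonglongrightarrow> 0" using tendsto_divide[OF tl tendsto_const[of "\<epsilon>\<^sup>2"]] e by simp
    show "\<exists>N0. \<forall>N\<ge>N0. P.prob (\<Inter>N. B N) \<le> tail N / \<epsilon>\<^sup>2"
      using PB by (auto intro!: exI[of _ 0] order_trans[OF P.finite_measure_mono PB])
  qed
  then have "P.prob (\<Inter>N. B N) = 0" by (simp add: antisym)
  then have "AE z in \<Omega>. z \<notin> (\<Inter>N. B N)"
    by (subst P.prob_eq_0[symmetric]) auto
  then show ?thesis using AE_space
    by eventually_elim (auto simp: B_def not_le)
qed

lemma AE_summable: "AE z in \<Omega>. summable (\<lambda>i. f i (z i))"
proof -
  have "AE z in \<Omega>. \<forall>j::nat. \<exists>N. \<forall>k. \<bar>T {N..<N+k} z\<bar> < 1 / (real j + 1)"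
    by (subst AE_all_countable) (auto intro!: AE_small_oscillation)
  then show ?thesis
  proof eventually_elim
    case (elim z)
    show ?case unfolding summable_Cauchy
    proof (intro allI impI)
      fix e :: real assume "e > 0"
      \<comment> \<open>Half of \<open>e\<close>, since a block of terms is the difference of two
        sums that both start at \<open>N\<close>.\<close>
      then obtain j :: nat where j: "1 / (real j + 1) < e / 2"
        using nat_approx_posE[of "e / 2"] by (auto simp: add.commute)
      obtain N where N: "\<And>k. \<bar>T {N..<N+k} z\<bar> < 1 / (real j + 1)" using elim by blast
      have "norm (\<Sum>i\<in>{m..<n}. f i (z i)) < e" if "m \<ge> N" for m n
      proof (cases "m \<le> n")
        case True
        have "(\<Sum>i\<in>{m..<n}. f i (z i)) = T {N..<N+(n-N)} z - T {N..<N+(m-N)} z"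
          using True that sum.atLeastLessThan_concat[of N m n "\<lambda>i. f i (z i)"] by (simp add: T_def)
        then show ?thesis using N[of "n - N"] N[of "m - N"] j unfolding real_norm_def by linarith
      qed (use \<open>e > 0\<close> in simp)
      then show "\<exists>N. \<forall>m\<ge>N. \<forall>n. norm (sum (\<lambda>i. f i (z i)) {m..<n}) < e" by blast
    qed
  qed
qed

text \<open>Almost surely the limit is the limit of partial sums, so Fatou's lemma carries the
  variance bound for finite blocks over to the tail of the series.\<close>

lemma L2_convergence:
  "(\<lambda>N. \<integral>z. ((\<Sum>i<N. f i (z i)) - (\<Sum>i. f i (z i)))\<^sup>2 \<partial>\<Omega>) \<longlonglongrightarrow> 0"
proof -
  define tail where "tail N = (\<Sum>i. v (i + N))" for N
  have sv: "summable v" using f_summable by (simp add: v_def[abs_def])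
  have tl: "tail \<longlonglongrightarrow> 0" using suminf_exist_split2[OF sv] by (simp add: tail_def[abs_def])
  let ?D = "\<lambda>N z. ((\<Sum>i<N. f i (z i)) - (\<Sum>i. f i (z i)))\<^sup>2"
  have bound: "(\<integral>z. ?D N z \<partial>\<Omega>) \<le> tail N" for N
  proof -
    have part: "(\<integral>\<^sup>+z. ennreal (((\<Sum>i<N. f i (z i)) - (\<Sum>i<N+k. f i (z i)))\<^sup>2) \<partial>\<Omega>) \<le> ennreal (tail N)" for k
    proof -
      have eq: "((\<Sum>i<N. f i (z i)) - (\<Sum>i<N+k. f i (z i)))\<^sup>2 = (T {N..<N+k} z)\<^sup>2" for z
      proof -
        have "(\<Sum>i<N+k. f i (z i)) = (\<Sum>i<N. f i (z i)) + T {N..<N+k} z"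
          unfolding T_def by (subst sum.union_disjoint[symmetric]) (auto intro!: sum.cong)
        then show ?thesis by simp
      qed
      have "(\<integral>\<^sup>+z. ennreal ((T {N..<N+k} z)\<^sup>2) \<partial>\<Omega>) = ennreal (\<Sum>i\<in>{N..<N+k}. v i)"
        using T_sq[of "{N..<N+k}"] by (subst nn_integral_eq_integral) auto
      also have "(\<Sum>i\<in>{N..<N+k}. v i) = (\<Sum>i<k. v (i + N))"
        by (rule sum.reindex_bij_witness[of _ "\<lambda>i. i + N" "\<lambda>i. i - N"]) auto
      also have "ennreal \<dots> \<le> ennreal (tail N)" unfolding tail_def using sv v_nonneg
        by (intro ennreal_leI sum_le_suminf) (auto simp: summable_iff_shift)
      finally show ?thesis by (simp add: eq)
    qed
    have "(\<integral>\<^sup>+z. ennreal (?D N z) \<partial>\<Omega>) = (\<integral>\<^sup>+z. liminf (\<lambda>k. ennreal (((\<Sum>i<N. f i (z i)) - (\<Sum>i<N+k. f i (z i)))\<^sup>2)) \<partial>\<Omega>)"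
    proof (rule nn_integral_cong_AE, use AE_summable in eventually_elim)
      case (elim z)
      have "(\<lambda>k. \<Sum>i<N+k. f i (z i)) \<longlonglongrightarrow> (\<Sum>i. f i (z i))"
        using LIMSEQ_ignore_initial_segment[OF summable_LIMSEQ[OF elim], of N] by (simp add: add.commute)
      then have "(\<lambda>k. ennreal (((\<Sum>i<N. f i (z i)) - (\<Sum>i<N+k. f i (z i)))\<^sup>2)) \<longlonglongrightarrow> ennreal (?D N z)"
        by (intro tendsto_intros)
      then show ?case by (rule lim_imp_Liminf[OF sequentially_bot, symmetric])
    qed
    also have "\<dots> \<le> liminf (\<lambda>k. \<integral>\<^sup>+z. ennreal (((\<Sum>i<N. f i (z i)) - (\<Sum>i<N+k. f i (z i)))\<^sup>2) \<partial>\<Omega>)"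
      by (rule nn_integral_liminf) measurable
    also have "\<dots> \<le> ennreal (tail N)"
      using part by (intro Liminf_le) auto
    finally have *: "(\<integral>\<^sup>+z. ennreal (?D N z) \<partial>\<Omega>) \<le> ennreal (tail N)" .
    have "0 \<le> tail N" unfolding tail_def using sv v_nonneg by (intro suminf_nonneg) (auto simp: summable_iff_shift)
    then show ?thesis
      using * by (subst integral_eq_nn_integral) (auto intro!: enn2real_leI)
  qed
  show ?thesis
    by (rule tendsto_sandwich[OF _ _ tendsto_const tl]) (auto simp: bound)
qed

end

subsection \<open>The law of the Gaussian chaos\<close>

abbreviation normals :: "(nat \<Rightarrow> real) measure" where
  "normals \<equiv> PiM UNIV (\<lambda>_. std_normal)"

interpretation normals: full_product "\<lambda>_::nat. std_normal"
proof -
  interpret prob_space std_normal by (rule prob_space_std_normal)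
  show "full_product (\<lambda>_::nat. std_normal)"
    unfolding full_product_def by unfold_locales
qed

text \<open>Coordinate 0 is reserved for the linear summand, so the quadratic series gets a zero
  term there and its indices agree with those of the coordinates.\<close>

definition chaos_term :: "(nat \<Rightarrow> real) \<Rightarrow> nat \<Rightarrow> real \<Rightarrow> real" where
  "chaos_term c i x = (if i = 0 then 0 else c i * (x\<^sup>2 - 1))"

lemma independent_series_chaos:
  assumes "summable (\<lambda>i. (c i)\<^sup>2)"
  shows "independent_series (\<lambda>_. std_normal) (chaos_term c)"
proof
  have eq: "(\<lambda>x. (chaos_term c i x)\<^sup>2) = (if i = 0 then (\<lambda>_. 0) else (\<lambda>x. (c i)\<^sup>2 * (x\<^sup>2 - 1)\<^sup>2))" for i
    by (auto simp: chaos_term_def fun_eq_iff power_mult_distrib)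
  show "chaos_term c i \<in> borel_measurable std_normal" for i
    by (cases "i = 0") (auto simp: chaos_term_def[abs_def])
  show "integrable std_normal (\<lambda>x. (chaos_term c i x)\<^sup>2)" for i
    unfolding eq using chi_moments by auto
  show "(\<integral>x. chaos_term c i x \<partial>std_normal) = 0" for i
    using chi_moments by (cases "i = 0") (auto simp: chaos_term_def)
  have "(\<integral>x. (chaos_term c i x)\<^sup>2 \<partial>std_normal) = (if i = 0 then 0 else 2 * (c i)\<^sup>2)" for i
    unfolding eq using chi_moments by auto
  moreover have "summable (\<lambda>i. if i = 0 then 0 else 2 * (c i)\<^sup>2)"
    by (rule summable_comparison_test'[OF summable_mult[OF assms, of 2], of 0]) auto
  ultimately show "summable (\<lambda>i. \<integral>x. (chaos_term c i x)\<^sup>2 \<partial>std_normal)" by simp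
qed

lemma chaos_sum_shift: "(\<Sum>i<Suc N. chaos_term c i (z i)) = (\<Sum>i<N. c (Suc i) * ((z (Suc i))\<^sup>2 - 1))"
  by (subst sum.lessThan_Suc_shift) (simp add: chaos_term_def)

lemma chaos_summable_shift:
  "summable (\<lambda>i. chaos_term c i (z i)) \<longleftrightarrow> summable (\<lambda>i. c (Suc i) * ((z (Suc i))\<^sup>2 - 1))"
  by (subst summable_Suc_iff[symmetric]) (simp add: chaos_term_def)

lemma chaos_AE_summable:
  assumes "summable (\<lambda>i. (c i)\<^sup>2)"
  shows "AE z in normals. summable (\<lambda>i. c (Suc i) * ((z (Suc i))\<^sup>2 - 1))"
  using independent_series.AE_summable[OF independent_series_chaos[OF assms]] unfolding chaos_summable_shift .

lemma chaos_L2_convergence: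
  assumes "summable (\<lambda>i. (c i)\<^sup>2)"
  shows "(\<lambda>N. \<integral>z. ((\<Sum>i<N. c (Suc i) * ((z (Suc i))\<^sup>2 - 1)) - (\<Sum>i. c (Suc i) * ((z (Suc i))\<^sup>2 - 1)))\<^sup>2 \<partial>normals) \<longlonglongrightarrow> 0"
proof -
  have m: "chaos_term c i \<in> borel_measurable borel" for i
    by (cases "i = 0") (auto simp: chaos_term_def[abs_def])
  have [measurable]: "(\<lambda>z. chaos_term c i (z i)) \<in> borel_measurable normals" for i
    using m by measurable
  have "(\<lambda>N. \<integral>z. ((\<Sum>i<Suc N. chaos_term c i (z i)) - (\<Sum>i. chaos_term c i (z i)))\<^sup>2 \<partial>normals) \<longlonglongrightarrow> 0"
    using LIMSEQ_Suc[OF independent_series.L2_convergence[OF independent_series_chaos[OF assms]]] .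
  moreover have "(\<integral>z. ((\<Sum>i<Suc N. chaos_term c i (z i)) - (\<Sum>i. chaos_term c i (z i)))\<^sup>2 \<partial>normals)
     = (\<integral>z. ((\<Sum>i<N. c (Suc i) * ((z (Suc i))\<^sup>2 - 1)) - (\<Sum>i. c (Suc i) * ((z (Suc i))\<^sup>2 - 1)))\<^sup>2 \<partial>normals)" for N
  proof (rule integral_cong_AE)
    show "AE z in normals. ((\<Sum>i<Suc N. chaos_term c i (z i)) - (\<Sum>i. chaos_term c i (z i)))\<^sup>2
      = ((\<Sum>i<N. c (Suc i) * ((z (Suc i))\<^sup>2 - 1)) - (\<Sum>i. c (Suc i) * ((z (Suc i))\<^sup>2 - 1)))\<^sup>2"
      using chaos_AE_summable[OF assms]
    proof eventually_elim
      case (elim z)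
      have "(\<Sum>i. chaos_term c (Suc i) (z (Suc i))) = (\<Sum>i. chaos_term c i (z i)) - chaos_term c 0 (z 0)"
        using elim by (intro suminf_split_head) (simp add: chaos_summable_shift)
      then show ?case unfolding chaos_sum_shift by (simp add: chaos_term_def)
    qed
  qed measurable
  ultimately show ?thesis by simp
qed

text \<open>For finite sums the characteristic function factors over the coordinates; almost sure
  convergence of the series and dominated convergence give the limit. As a by-product the infinite
  product of the \<open>chi_cf\<close> factors is seen to converge.\<close>

lemma chaos_char:
  assumes "summable (\<lambda>i. (c i)\<^sup>2)"
  shows "(\<lambda>N. complex_of_real (exp (- (t * c 0)\<^sup>2 / 2)) * (\<Prod>i<N. chi_cf (t * c (Suc i))))
    \<longlonglongrightarrow> char (distr normals borel (\<lambda>z. c 0 * z 0 + (\<Sum>i. c (Suc i) * ((z (Suc i))\<^sup>2 - 1)))) t"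
proof -
  define f where "f i x = (if i = 0 then iexp (t * c 0 * x) else iexp (t * c i * (x\<^sup>2 - 1)))" for i :: nat and x :: real
  have fm: "f i \<in> borel_measurable std_normal" for i
    by (cases "i = 0") (auto simp: f_def[abs_def])
  have "(\<integral>z. iexp (t * (c 0 * z 0 + (\<Sum>i<N. c (Suc i) * ((z (Suc i))\<^sup>2 - 1)))) \<partial>normals)
    = complex_of_real (exp (- (t * c 0)\<^sup>2 / 2)) * (\<Prod>i<N. chi_cf (t * c (Suc i)))" for N
  proof -
    have "iexp (t * (c 0 * z 0 + (\<Sum>i<N. c (Suc i) * ((z (Suc i))\<^sup>2 - 1)))) = (\<Prod>i<Suc N. f i (z i))" for z :: "nat \<Rightarrow> real"
      by (subst prod.lessThan_Suc_shift)
         (simp add: f_def distrib_left exp_add exp_sum sum_distrib_left mult.assoc)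
    then have "(\<integral>z. iexp (t * (c 0 * z 0 + (\<Sum>i<N. c (Suc i) * ((z (Suc i))\<^sup>2 - 1)))) \<partial>normals) = (\<integral>z. (\<Prod>i<Suc N. f i (z i)) \<partial>normals)"
      by simp
    also have "\<dots> = (\<Prod>i<Suc N. \<integral>x. f i x \<partial>std_normal)"
      using fm by (intro normals.integral_prod_coordinates normals.M.integrable_const_bound[of _ 1]) (auto simp: f_def)
    also have "\<dots> = (\<integral>x. f 0 x \<partial>std_normal) * (\<Prod>i<N. \<integral>x. f (Suc i) x \<partial>std_normal)"
      by (rule prod.lessThan_Suc_shift)
    also have "(\<integral>x. f 0 x \<partial>std_normal) = char std_normal_distribution (t * c 0)"
      by (simp add: f_def char_def std_normal_def)
    also have "\<dots> = complex_of_real (exp (- (t * c 0)\<^sup>2 / 2))" by (simp add: char_std_normal_distribution)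
    also have "(\<Prod>i<N. \<integral>x. f (Suc i) x \<partial>std_normal) = (\<Prod>i<N. chi_cf (t * c (Suc i)))"
      by (simp add: f_def chi_cf_def)
    finally show ?thesis .
  qed
  moreover have "(\<lambda>N. \<integral>z. iexp (t * (c 0 * z 0 + (\<Sum>i<N. c (Suc i) * ((z (Suc i))\<^sup>2 - 1)))) \<partial>normals)
    \<longlonglongrightarrow> (\<integral>z. iexp (t * (c 0 * z 0 + (\<Sum>i. c (Suc i) * ((z (Suc i))\<^sup>2 - 1)))) \<partial>normals)"
  proof (rule integral_dominated_convergence[where w="\<lambda>_. 1"])
    show "AE z in normals. (\<lambda>N. iexp (t * (c 0 * z 0 + (\<Sum>i<N. c (Suc i) * ((z (Suc i))\<^sup>2 - 1)))))
      \<longlonglongrightarrow> iexp (t * (c 0 * z 0 + (\<Sum>i. c (Suc i) * ((z (Suc i))\<^sup>2 - 1))))"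
      using chaos_AE_summable[OF assms]
    proof eventually_elim
      case (elim z)
      show ?case by (intro tendsto_intros summable_LIMSEQ elim)
    qed
  qed auto
  ultimately show ?thesis by (simp add: char_def integral_distr)
qed

lemma real_distribution_chaos:
  "real_distribution (distr normals borel (\<lambda>z. c 0 * z 0 + (\<Sum>i. c (Suc i) * ((z (Suc i))\<^sup>2 - 1))))"
  by (rule normals.P.real_distribution_distr) measurable

section \<open>Degenerate quadratic statistics\<close>

lemma (in finite_measure) integrable_iexp_bm:
  assumes [measurable]: "a \<in> borel_measurable M" and "bm M r"
  shows "integrable M (\<lambda>x. iexp (a x) * complex_of_real (r x))"
proof -
  obtain K where "\<And>x. \<bar>r x\<bar> \<le> K" using assms(2) by (auto simp: bm_def)
  moreover have [measurable]: "r \<in> borel_measurable M" using assms(2) by (simp add: bm_def)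
  ultimately show ?thesis by (intro integrable_const_bound[of _ K]) (auto simp: norm_mult)
qed

lemma sum_sq_le: "(\<Sum>i<m. c i :: real)\<^sup>2 \<le> real m * (\<Sum>i<m. (c i)\<^sup>2)"
proof (induction m)
  case (Suc m)
  show ?case
  proof (cases "m = 0")
    case False
    have "0 \<le> (\<Sum>i<m. (c i - c m)\<^sup>2)" by (simp add: sum_nonneg)
    also have "\<dots> = (\<Sum>i<m. (c i)\<^sup>2) - 2 * (\<Sum>i<m. c i) * c m + real m * (c m)\<^sup>2"
      by (simp add: power2_diff sum.distrib sum_subtractf sum_distrib_left sum_distrib_right mult_ac)
    finally have "2 * (\<Sum>i<m. c i) * c m \<le> (\<Sum>i<m. (c i)\<^sup>2) + real m * (c m)\<^sup>2" by simp
    then show ?thesis using Suc by (simp add: power2_sum algebra_simps)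
  qed simp
qed simp

lemma sum_pow4_le: "(\<Sum>i<m. c i :: real) ^ 4 \<le> real m ^ 3 * (\<Sum>i<m. c i ^ 4)"
proof -
  have "(\<Sum>i<m. c i) ^ 4 = ((\<Sum>i<m. c i)\<^sup>2)\<^sup>2" by (simp flip: power_mult)
  also have "\<dots> \<le> (real m * (\<Sum>i<m. (c i)\<^sup>2))\<^sup>2" by (intro power_mono sum_sq_le) auto
  also have "\<dots> = (real m)\<^sup>2 * (\<Sum>i<m. (c i)\<^sup>2)\<^sup>2" by (simp add: power_mult_distrib)
  also have "\<dots> \<le> (real m)\<^sup>2 * (real m * (\<Sum>i<m. ((c i)\<^sup>2)\<^sup>2))" by (intro mult_left_mono sum_sq_le) auto
  also have "\<dots> = real m ^ 3 * (\<Sum>i<m. c i ^ 4)" by (simp add: power3_eq_cube power2_eq_square[of "real m"] flip: power_mult)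
  finally show ?thesis .
qed

text \<open>From \<open>0 \<le> (d * \<bar>y\<bar> - y\<^sup>2)\<^sup>2\<close>. Absolute third
  moments of sums are thereby reduced to even moments, which can be expanded using independence;
  \<open>d\<close> is free for balancing.\<close>

lemma (in prob_space) third_moment_le:
  assumes "bm M x" "d > 0"
  shows "expectation (\<lambda>z. \<bar>x z\<bar> ^ 3) \<le> (d * expectation (\<lambda>z. (x z)\<^sup>2) + expectation (\<lambda>z. x z ^ 4) / d) / 2"
proof -
  have p: "\<bar>y\<bar> ^ 3 \<le> (d * y\<^sup>2 + y ^ 4 / d) / 2" for y :: real
  proof -
    have c3: "\<bar>y\<bar> ^ 3 = \<bar>y\<bar> * \<bar>y\<bar>\<^sup>2" by (simp only: numeral_eq_Suc power_Suc pred_numeral_simps)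
    have "0 \<le> (d * \<bar>y\<bar> - y\<^sup>2)\<^sup>2" by simp
    also have "\<dots> = d\<^sup>2 * y\<^sup>2 - 2 * d * \<bar>y\<bar> * y\<^sup>2 + y ^ 4"
      by (simp add: power2_diff power_mult_distrib mult_ac flip: power_mult)
    finally have "2 * d * \<bar>y\<bar> ^ 3 \<le> d\<^sup>2 * y\<^sup>2 + y ^ 4" by (simp add: c3 mult.assoc)
    then show ?thesis using assms(2) by (simp add: field_simps power2_eq_square)
  qed
  have "bm M (\<lambda>z. \<bar>x z\<bar>)" using assms(1) by (auto simp: bm_def)
  then have "expectation (\<lambda>z. \<bar>x z\<bar> ^ 3) \<le> expectation (\<lambda>z. (d * (x z)\<^sup>2 + x z ^ 4 / d) / 2)"
    using assms by (intro integral_mono bm_integrable bm_power bm_divide bm_add bm_mult p) auto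
  also have "\<dots> = (d * expectation (\<lambda>z. (x z)\<^sup>2) + expectation (\<lambda>z. x z ^ 4) / d) / 2"
    using assms by (simp add: bm_integrable)
  finally show ?thesis .
qed

section \<open>Independent blocks of coordinates and the exchange of blocks\<close>

locale block_product = full_product M for M :: "'i \<Rightarrow> 'a measure" +
  fixes A :: "nat \<Rightarrow> 'i set"
  assumes disj: "j \<noteq> k \<Longrightarrow> A j \<inter> A k = {}"
begin

text \<open>Since \<open>mix (A j) x y\<close> agrees with \<open>y\<close> on \<open>A j\<close>,
  the equation says that \<open>f\<close> is a function of the coordinates in the block
  \<open>A j\<close> alone.\<close>

definition block :: "nat \<Rightarrow> (('i \<Rightarrow> 'a) \<Rightarrow> real) \<Rightarrow> bool" where
  "block j f \<longleftrightarrow> bm \<Omega> f \<and> (\<forall>x y. f (mix (A j) x y) = f y)"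

lemma blockD: "block j f \<Longrightarrow> bm \<Omega> f" "block j f \<Longrightarrow> f (mix (A j) x y) = f y"
  by (auto simp: block_def)

text \<open>Changing the block \<open>A k\<close> leaves \<open>A j\<close> untouched, so
  \<open>x\<close> itself can be written as a mixture over \<open>A j\<close> of \<open>x\<close>
  with the changed point, and \<open>f\<close> sees only the latter.\<close>

lemma mix_other_block:
  assumes "\<And>x y. f (mix (A j) x y) = f y" "j \<noteq> k" shows "f (mix (A k) x y) = f x"
proof -
  have "mix (A j) x (mix (A k) x y) = x"
    using disj[OF assms(2)] by (auto simp: mix_def fun_eq_iff)
  then show ?thesis using assms(1)[of x "mix (A k) x y"] by simp
qed

lemma block_other: "block j f \<Longrightarrow> j \<noteq> k \<Longrightarrow> f (mix (A k) x y) = f x"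
  by (rule mix_other_block) (auto dest: blockD)

lemma integral_prod_blocks:
  fixes f :: "nat \<Rightarrow> ('i \<Rightarrow> 'a) \<Rightarrow> complex"
  assumes m: "\<And>i. f i \<in> borel_measurable \<Omega>" and "\<And>i x. norm (f i x) \<le> 1"
    and A: "\<And>i x y. f i (mix (A i) x y) = f i y"
  shows "(\<integral>x. (\<Prod>i<m. f i x) \<partial>\<Omega>) = (\<Prod>i<m. \<integral>x. f i x \<partial>\<Omega>)"
proof (induction m)
  case (Suc m)
  note m [measurable]
  have n1: "norm (\<Prod>i<k. f i x) \<le> 1" for k x
    unfolding prod_norm[symmetric] using assms(2) by (intro prod_le_1) auto
  have "integrable \<Omega> (\<lambda>x. (\<Prod>i<m. f i x) * f m x)"
    using n1[of _ "Suc m"] by (intro P.integrable_const_bound[of _ 1]) auto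
  moreover have "(\<Prod>i<m. f i (mix (A m) x y)) = (\<Prod>i<m. f i x)" for x y
    by (intro prod.cong refl mix_other_block[OF A]) auto
  ultimately have "(\<integral>x. (\<Prod>i<m. f i x) * f m x \<partial>\<Omega>) = (\<integral>x. (\<Prod>i<m. f i x) \<partial>\<Omega>) * (\<integral>x. f m x \<partial>\<Omega>)"
    by (intro integral_mult_indep[where A="A m"]) (simp_all add: A)
  then show ?case by (simp add: Suc)
qed (simp add: P.prob_space)

text \<open>Induction on the number of blocks: in the binomial expansion every term with an odd
  power of the new variable or of the old sum contains a centred factor or is multiplied by one, and
  only the even terms remain.\<close>

lemma block_moments:
  assumes "finite J" "\<And>j. j \<in> J \<Longrightarrow> block j (Z j)" "\<And>j x. j \<in> J \<Longrightarrow> \<bar>Z j x\<bar> \<le> K"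
    "\<And>j. j \<in> J \<Longrightarrow> (\<integral>x. Z j x \<partial>\<Omega>) = 0" "0 \<le> K"
  shows "(\<integral>x. (\<Sum>j\<in>J. Z j x)\<^sup>2 \<partial>\<Omega>) \<le> real (card J) * K\<^sup>2 \<and>
    (\<integral>x. (\<Sum>j\<in>J. Z j x) ^ 4 \<partial>\<Omega>) \<le> 3 * (real (card J))\<^sup>2 * K ^ 4"
  using assms
proof (induction J rule: finite_induct)
  case (insert k J)
  let ?S = "\<lambda>x. \<Sum>j\<in>J. Z j x"
  have bS: "bm \<Omega> ?S" using insert.prems by (intro bm_sum) (auto dest: blockD)
  have bk: "bm \<Omega> (Z k)" using insert.prems(1)[of k] by (auto dest: blockD)
  have inv: "?S (mix (A k) x y) = ?S x" for x y
    using insert.prems(1) insert.hyps by (intro sum.cong refl block_other) auto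
  have Zk: "Z k (mix (A k) x y) = Z k y" for x y using insert.prems(1)[of k] by (auto dest: blockD)
  have prod: "(\<integral>x. ?S x ^ a * Z k x ^ b \<partial>\<Omega>) = (\<integral>x. ?S x ^ a \<partial>\<Omega>) * (\<integral>x. Z k x ^ b \<partial>\<Omega>)" for a b
    using bS bk by (intro integral_mult_indep[where A="A k"] P.bm_integrable bm_mult bm_power) (simp_all only: inv Zk)
  have Z0: "(\<integral>x. Z k x \<partial>\<Omega>) = 0" using insert.prems(3) by simp
  have Zle: "(\<integral>x. Z k x ^ b \<partial>\<Omega>) \<le> K ^ b" for b
  proof -
    have "(\<integral>x. Z k x ^ b \<partial>\<Omega>) \<le> (\<integral>x. K ^ b \<partial>\<Omega>)"
    proof (intro integral_mono)
      fix x
      have "Z k x ^ b \<le> \<bar>Z k x\<bar> ^ b" by (simp add: power_abs[symmetric])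
      also have "\<dots> \<le> K ^ b" using insert.prems(2)[of k x] by (intro power_mono) auto
      finally show "Z k x ^ b \<le> K ^ b" .
    qed (use bk in \<open>auto intro!: P.bm_integrable\<close>)
    then show ?thesis by (simp add: P.prob_space)
  qed
  have IH: "(\<integral>x. (?S x)\<^sup>2 \<partial>\<Omega>) \<le> real (card J) * K\<^sup>2" "(\<integral>x. ?S x ^ 4 \<partial>\<Omega>) \<le> 3 * (real (card J))\<^sup>2 * K ^ 4"
    using insert.IH insert.prems by auto
  have i: "integrable \<Omega> (\<lambda>x. ?S x ^ a * Z k x ^ b)" for a b
    using bS bk by (intro P.bm_integrable bm_mult bm_power)
  have "(\<integral>x. (\<Sum>j\<in>insert k J. Z j x)\<^sup>2 \<partial>\<Omega>) = (\<integral>x. ?S x ^ 2 * Z k x ^ 0 + 2 * (?S x ^ 1 * Z k x ^ 1) + ?S x ^ 0 * Z k x ^ 2 \<partial>\<Omega>)"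
    using insert.hyps by (intro Bochner_Integration.integral_cong refl) (simp add: power2_sum algebra_simps)
  also have "\<dots> = (\<integral>x. (?S x)\<^sup>2 \<partial>\<Omega>) + (\<integral>x. Z k x ^ 2 \<partial>\<Omega>)"
    by (subst Bochner_Integration.integral_add Bochner_Integration.integral_mult_right_zero prod; (intro Bochner_Integration.integrable_add integrable_mult_right i)?)+
       (simp add: Z0 P.prob_space)
  also have "\<dots> \<le> real (card J) * K\<^sup>2 + K\<^sup>2" using IH Zle by (intro add_mono)
  finally have 2: "(\<integral>x. (\<Sum>j\<in>insert k J. Z j x)\<^sup>2 \<partial>\<Omega>) \<le> real (card (insert k J)) * K\<^sup>2"
    using insert.hyps by (simp add: algebra_simps)
  have "(\<integral>x. (\<Sum>j\<in>insert k J. Z j x) ^ 4 \<partial>\<Omega>) = (\<integral>x. ?S x ^ 4 * Z k x ^ 0 + 4 * (?S x ^ 3 * Z k x ^ 1) + 6 * (?S x ^ 2 * Z k x ^ 2)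
     + 4 * (?S x ^ 1 * Z k x ^ 3) + ?S x ^ 0 * Z k x ^ 4 \<partial>\<Omega>)"
    using insert.hyps by (intro Bochner_Integration.integral_cong refl) (simp add: numeral_eq_Suc algebra_simps)
  also have "\<dots> = (\<integral>x. ?S x ^ 4 \<partial>\<Omega>) + 6 * ((\<integral>x. (?S x)\<^sup>2 \<partial>\<Omega>) * (\<integral>x. Z k x ^ 2 \<partial>\<Omega>)) + 4 * ((\<integral>x. ?S x \<partial>\<Omega>) * (\<integral>x. Z k x ^ 3 \<partial>\<Omega>)) + (\<integral>x. Z k x ^ 4 \<partial>\<Omega>)"
    by (subst Bochner_Integration.integral_add Bochner_Integration.integral_mult_right_zero prod; (intro Bochner_Integration.integrable_add integrable_mult_right i)?)+
       (simp add: Z0 P.prob_space)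
  also have "(\<integral>x. ?S x \<partial>\<Omega>) = 0"
    using insert.prems(1,3) by (subst Bochner_Integration.integral_sum) (auto intro!: P.bm_integrable dest: blockD)
  also have "(\<integral>x. ?S x ^ 4 \<partial>\<Omega>) + 6 * ((\<integral>x. (?S x)\<^sup>2 \<partial>\<Omega>) * (\<integral>x. Z k x ^ 2 \<partial>\<Omega>)) + 4 * (0 * (\<integral>x. Z k x ^ 3 \<partial>\<Omega>)) + (\<integral>x. Z k x ^ 4 \<partial>\<Omega>)
      \<le> 3 * (real (card J))\<^sup>2 * K ^ 4 + 6 * ((real (card J) * K\<^sup>2) * K\<^sup>2) + 4 * 0 + K ^ 4"
    using IH Zle by (intro add_mono mult_left_mono mult_mono) auto
  \<comment> \<open>With \<open>c\<close> blocks so far,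
    \<open>3 c\<^sup>2 + 6 c + 1 \<le> 3 (c + 1)\<^sup>2\<close>.\<close>
  also have "\<dots> \<le> 3 * (real (card (insert k J)))\<^sup>2 * K ^ 4"
    using insert.hyps insert.prems(4) by (simp add: algebra_simps power2_eq_square numeral_eq_Suc)
  finally show ?case using 2 by simp
qed simp

text \<open>Taylor expansion in the block \<open>p\<close>, from which \<open>a\<close> and
  \<open>b\<close> are independent. The linear term vanishes with the means and the quadratic one
  depends on the \<open>X i\<close> only through their covariances, so two families with equal
  covariances have the same main term.\<close>

lemma iexp_second_order:
  assumes am [measurable]: "a \<in> borel_measurable \<Omega>"
    and inv: "\<And>x y. a (mix (A p) x y) = a x" "\<And>i x y. i < m \<Longrightarrow> b i (mix (A p) x y) = b i x"
    and b: "\<And>i. i < m \<Longrightarrow> bm \<Omega> (b i)" and X: "\<And>i. i < m \<Longrightarrow> block p (X i)"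
    and mean: "\<And>i. i < m \<Longrightarrow> (\<integral>x. X i x \<partial>\<Omega>) = 0"
  shows "cmod ((\<integral>x. iexp (a x + (\<Sum>i<m. b i x * X i x)) \<partial>\<Omega>) -
      ((\<integral>x. iexp (a x) \<partial>\<Omega>) - (\<Sum>i<m. \<Sum>j<m. (\<integral>x. iexp (a x) * complex_of_real (b i x * b j x) \<partial>\<Omega>) * complex_of_real (\<integral>x. X i x * X j x \<partial>\<Omega>)) / 2))
    \<le> (\<integral>x. \<bar>\<Sum>i<m. b i x * X i x\<bar> ^ 3 \<partial>\<Omega>) / 6"
proof -
  let ?s = "\<lambda>x. \<Sum>i<m. b i x * X i x"
  have bX: "bm \<Omega> (X i)" if "i < m" for i using X[OF that] by (rule blockD)
  have bs: "bm \<Omega> ?s" using b bX by (intro bm_sum bm_mult) auto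
  have sm [measurable]: "?s \<in> borel_measurable \<Omega>" using bs by (simp add: bm_def)
  have factor: "(\<integral>x. iexp (a x) * complex_of_real (c x * Y x) \<partial>\<Omega>) = (\<integral>x. iexp (a x) * complex_of_real (c x) \<partial>\<Omega>) * complex_of_real (\<integral>x. Y x \<partial>\<Omega>)"
    if "bm \<Omega> c" "bm \<Omega> Y" "\<And>x y. c (mix (A p) x y) = c x" "\<And>x y. Y (mix (A p) x y) = Y y" for c Y
  proof -
    have "(\<integral>x. (iexp (a x) * complex_of_real (c x)) * complex_of_real (Y x) \<partial>\<Omega>) = (\<integral>x. iexp (a x) * complex_of_real (c x) \<partial>\<Omega>) * (\<integral>x. complex_of_real (Y x) \<partial>\<Omega>)"
      using P.integrable_iexp_bm[of a "\<lambda>x. c x * Y x"] that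
      by (intro integral_mult_indep[where A="A p"]) (simp_all add: mult.assoc inv(1))
    then show ?thesis by (simp add: mult.assoc)
  qed
  have 1: "(\<integral>x. iexp (a x) * complex_of_real (?s x) \<partial>\<Omega>) = 0"
  proof -
    have "(\<integral>x. iexp (a x) * complex_of_real (?s x) \<partial>\<Omega>) = (\<integral>x. (\<Sum>i<m. iexp (a x) * complex_of_real (b i x * X i x)) \<partial>\<Omega>)"
      by (simp add: sum_distrib_left)
    also have "\<dots> = (\<Sum>i<m. \<integral>x. iexp (a x) * complex_of_real (b i x * X i x) \<partial>\<Omega>)"
      using b bX by (intro Bochner_Integration.integral_sum P.integrable_iexp_bm bm_mult) auto
    also have "\<dots> = (\<Sum>i<m. (\<integral>x. iexp (a x) * complex_of_real (b i x) \<partial>\<Omega>) * complex_of_real (\<integral>x. X i x \<partial>\<Omega>))"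
      using b bX inv(2) blockD(2)[OF X] by (intro sum.cong refl factor) auto
    also have "\<dots> = 0" using mean by simp
    finally show ?thesis .
  qed
  have 2: "(\<integral>x. iexp (a x) * complex_of_real ((?s x)\<^sup>2) \<partial>\<Omega>) = (\<Sum>i<m. \<Sum>j<m. (\<integral>x. iexp (a x) * complex_of_real (b i x * b j x) \<partial>\<Omega>) * complex_of_real (\<integral>x. X i x * X j x \<partial>\<Omega>))"
  proof -
    have "(\<integral>x. iexp (a x) * complex_of_real ((?s x)\<^sup>2) \<partial>\<Omega>) = (\<integral>x. (\<Sum>i<m. \<Sum>j<m. iexp (a x) * complex_of_real ((b i x * b j x) * (X i x * X j x))) \<partial>\<Omega>)"
    proof (intro Bochner_Integration.integral_cong refl)
      fix x
      have "(?s x)\<^sup>2 = (\<Sum>i<m. \<Sum>j<m. (b i x * b j x) * (X i x * X j x))"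
        unfolding power2_eq_square sum_product by (intro sum.cong refl) (simp add: mult_ac)
      then show "iexp (a x) * complex_of_real ((?s x)\<^sup>2) = (\<Sum>i<m. \<Sum>j<m. iexp (a x) * complex_of_real ((b i x * b j x) * (X i x * X j x)))"
        by (simp only: of_real_sum sum_distrib_left)
    qed
    also have "\<dots> = (\<Sum>i<m. \<Sum>j<m. \<integral>x. iexp (a x) * complex_of_real ((b i x * b j x) * (X i x * X j x)) \<partial>\<Omega>)"
      using b bX by (intro integral_sum2 P.integrable_iexp_bm bm_mult) auto
    also have "\<dots> = (\<Sum>i<m. \<Sum>j<m. (\<integral>x. iexp (a x) * complex_of_real (b i x * b j x) \<partial>\<Omega>) * complex_of_real (\<integral>x. X i x * X j x \<partial>\<Omega>))"
      using b bX inv(2) blockD(2)[OF X] by (intro sum.cong refl factor bm_mult) auto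
    finally show ?thesis .
  qed
  have ib: "integrable \<Omega> (\<lambda>x. iexp (a x) * complex_of_real (r x))" if "bm \<Omega> r" for r
    using that by (rule P.integrable_iexp_bm[OF am])
  have ie: "integrable \<Omega> (\<lambda>x. iexp (a x))" by (rule P.integrable_iexp) auto
  have is': "integrable \<Omega> (\<lambda>x. iexp (a x + ?s x))"
    using P.integrable_iexp_bm[of "\<lambda>x. a x + ?s x" "\<lambda>_. 1"] am sm by simp
  let ?q = "\<lambda>x. iexp (a x) + \<i> * (iexp (a x) * complex_of_real (?s x)) - (iexp (a x) * complex_of_real ((?s x)\<^sup>2)) / 2"
  have iq: "integrable \<Omega> ?q"
    using ib[OF bs] ib[OF bm_power[OF bs, of 2]] ie by (intro Bochner_Integration.integrable_add Bochner_Integration.integrable_diff) auto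
  have "(\<integral>x. ?q x \<partial>\<Omega>) = (\<integral>x. iexp (a x) \<partial>\<Omega>) + \<i> * (\<integral>x. iexp (a x) * complex_of_real (?s x) \<partial>\<Omega>) - (\<integral>x. iexp (a x) * complex_of_real ((?s x)\<^sup>2) \<partial>\<Omega>) / 2"
    using ib[OF bs] ib[OF bm_power[OF bs, of 2]] ie by (simp del: of_real_sum of_real_power)
  also have "\<dots> = (\<integral>x. iexp (a x) \<partial>\<Omega>) - (\<integral>x. iexp (a x) * complex_of_real ((?s x)\<^sup>2) \<partial>\<Omega>) / 2" by (simp only: 1) simp
  finally have q: "(\<integral>x. ?q x \<partial>\<Omega>) = (\<integral>x. iexp (a x) \<partial>\<Omega>) - (\<integral>x. iexp (a x) * complex_of_real ((?s x)\<^sup>2) \<partial>\<Omega>) / 2" .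
  have "cmod ((\<integral>x. iexp (a x + ?s x) \<partial>\<Omega>) - (\<integral>x. ?q x \<partial>\<Omega>)) = cmod (\<integral>x. iexp (a x + ?s x) - ?q x \<partial>\<Omega>)"
    using is' iq by simp
  also have "\<dots> \<le> (\<integral>x. cmod (iexp (a x + ?s x) - ?q x) \<partial>\<Omega>)" by (rule integral_norm_bound)
  also have "\<dots> \<le> (\<integral>x. \<bar>?s x\<bar> ^ 3 / 6 \<partial>\<Omega>)"
  proof (rule integral_mono)
    fix x
    have "iexp (a x + ?s x) - ?q x = iexp (a x) * (iexp (?s x) - (1 + \<i> * ?s x - (?s x)\<^sup>2 / 2))"
      by (simp add: algebra_simps exp_add[symmetric] del: of_real_sum)
    then have "cmod (iexp (a x + ?s x) - ?q x) = cmod (iexp (?s x) - (1 + \<i> * ?s x - (?s x)\<^sup>2 / 2))"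
      by (simp add: norm_mult del: of_real_sum)
    also have "\<dots> \<le> \<bar>?s x\<bar> ^ 3 / 6" by (rule iexp_taylor2)
    finally show "cmod (iexp (a x + ?s x) - ?q x) \<le> \<bar>?s x\<bar> ^ 3 / 6" .
  next
    have "bm \<Omega> (\<lambda>x. \<bar>?s x\<bar>)" using bs by (auto simp: bm_def)
    then show "integrable \<Omega> (\<lambda>x. \<bar>?s x\<bar> ^ 3 / 6)" by (intro P.bm_integrable bm_divide bm_power)
  qed (use is' iq in auto)
  finally show ?thesis unfolding q 2 by simp
qed

text \<open>The sum over \<open>i\<close> of \<open>l i\<close> times the sum of
  \<open>z j i * z k i\<close> over \<open>j < k\<close>, written as a square minus its
  diagonal.\<close>

definition quad :: "nat \<Rightarrow> nat \<Rightarrow> (nat \<Rightarrow> real) \<Rightarrow> (nat \<Rightarrow> nat \<Rightarrow> ('i \<Rightarrow> 'a) \<Rightarrow> real) \<Rightarrow> ('i \<Rightarrow> 'a) \<Rightarrow> real" where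
  "quad n m l z x = (\<Sum>i<m. l i / 2 * ((\<Sum>j<n. z j i x)\<^sup>2 - (\<Sum>j<n. (z j i x)\<^sup>2)))"

lemma quad_split:
  assumes "p < n"
  shows "quad n m l z x = (\<Sum>i<m. l i / 2 * ((\<Sum>j\<in>{..<n} - {p}. z j i x)\<^sup>2 - (\<Sum>j\<in>{..<n} - {p}. (z j i x)\<^sup>2)))
    + (\<Sum>i<m. l i * (\<Sum>j\<in>{..<n} - {p}. z j i x) * z p i x)"
proof -
  have "(\<Sum>j<n. f j) = f p + (\<Sum>j\<in>{..<n} - {p}. f j)" for f :: "nat \<Rightarrow> real"
    using assms by (intro sum.remove) auto
  then show ?thesis
    unfolding quad_def sum.distrib[symmetric]
    by (intro sum.cong refl) (simp add: power2_sum algebra_simps)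
qed

text \<open>Replacing one block of a hybrid at a time; the quadratic form is off-diagonal, hence affine in
  each block, and the first two moments of the blocks agree.\<close>

lemma lindeberg_exchange:
  fixes X Y :: "nat \<Rightarrow> nat \<Rightarrow> ('i \<Rightarrow> 'a) \<Rightarrow> real"
  assumes X: "\<And>j i. i < m \<Longrightarrow> block j (X j i)" "\<And>j i x. i < m \<Longrightarrow> \<bar>X j i x\<bar> \<le> K" "\<And>j i. i < m \<Longrightarrow> (\<integral>x. X j i x \<partial>\<Omega>) = 0"
    and Y: "\<And>j i. i < m \<Longrightarrow> block j (Y j i)" "\<And>j i x. i < m \<Longrightarrow> \<bar>Y j i x\<bar> \<le> K" "\<And>j i. i < m \<Longrightarrow> (\<integral>x. Y j i x \<partial>\<Omega>) = 0"
    and cov: "\<And>j i i'. i < m \<Longrightarrow> i' < m \<Longrightarrow> (\<integral>x. X j i x * X j i' x \<partial>\<Omega>) = (\<integral>x. Y j i x * Y j i' x \<partial>\<Omega>)"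
    and n: "n > 0" and K: "K \<ge> 0"
  shows "cmod ((\<integral>x. iexp (s / n * quad n m l X x) \<partial>\<Omega>) - (\<integral>x. iexp (s / n * quad n m l Y x) \<partial>\<Omega>))
    \<le> (real m * K ^ 4 * s\<^sup>2 * (\<Sum>i<m. (l i)\<^sup>2) + 3 * real m ^ 3 * K ^ 8 * s ^ 4 * (\<Sum>i<m. l i ^ 4)) / (6 * sqrt n)"
proof -
  define C1 C2 where "C1 = real m * K ^ 4 * s\<^sup>2 * (\<Sum>i<m. (l i)\<^sup>2)" and "C2 = 3 * real m ^ 3 * K ^ 8 * s ^ 4 * (\<Sum>i<m. l i ^ 4)"
  define \<theta> where "\<theta> = s / real n"
  \<comment> \<open>The hybrid in which the blocks below \<open>p\<close> are already
    exchanged.\<close>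
  define Z where "Z p j i = (if j < p then Y j i else X j i)" for p j i :: nat
  have Z: "block j (Z p j i)" "\<bar>Z p j i x\<bar> \<le> K" "(\<integral>x. Z p j i x \<partial>\<Omega>) = 0" if "i < m" for p j i x
    using X Y that by (auto simp: Z_def)
  define F where "F p = (\<integral>x. iexp (\<theta> * quad n m l (Z p) x) \<partial>\<Omega>)" for p
  have step: "cmod (F p - F (Suc p)) \<le> (C1 + C2) / (6 * (real n * sqrt n))" if p: "p < n" for p
  proof -
    define J where "J = {..<n} - {p}"
    define S where "S i x = (\<Sum>j\<in>J. Z p j i x)" for i x
    \<comment> \<open>The part of the statistic that is free of block \<open>p\<close>;
      \<open>b i\<close> is the coefficient with which the \<open>i\<close>-th entry of that block
      enters.\<close>
    define a where "a x = \<theta> * (\<Sum>i<m. l i / 2 * ((S i x)\<^sup>2 - (\<Sum>j\<in>J. (Z p j i x)\<^sup>2)))" for x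
    define b where "b i x = \<theta> * l i * S i x" for i x
    have bS: "bm \<Omega> (S i)" if "i < m" for i unfolding S_def using blockD(1)[OF Z(1)] that by (intro bm_sum) auto
    have bb: "bm \<Omega> (b i)" if "i < m" for i unfolding b_def using bS that by (intro bm_mult) auto
    have "bm \<Omega> a" unfolding a_def using bS blockD(1)[OF Z(1)] by (intro bm_mult bm_sum bm_diff bm_power) auto
    then have am [measurable]: "a \<in> borel_measurable \<Omega>" by (simp add: bm_def)
    have Zinv: "Z p j i (mix (A p) x y) = Z p j i x" if "j \<in> J" "i < m" for i j x y
      using Z(1) that by (intro block_other) (auto simp: J_def)
    have ainv: "a (mix (A p) x y) = a x" for x y
      unfolding a_def S_def using Zinv by (intro arg_cong2[of _ _ _ _ times] sum.cong refl arg_cong2[of _ _ _ _ "(-)"] arg_cong[of _ _ "\<lambda>x. x\<^sup>2"]) auto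
    have binv: "b i (mix (A p) x y) = b i x" if "i < m" for i x y
      unfolding b_def S_def using Zinv that by (intro arg_cong2[of _ _ _ _ times] sum.cong refl) auto
    have FX: "F p = (\<integral>x. iexp (a x + (\<Sum>i<m. b i x * X p i x)) \<partial>\<Omega>)"
    proof -
      have Zp: "Z p p i = X p i" for i by (simp add: Z_def)
      have "\<theta> * quad n m l (Z p) x = a x + (\<Sum>i<m. b i x * X p i x)" for x
        unfolding quad_split[OF p] a_def b_def S_def J_def[symmetric] distrib_left Zp
        by (simp add: sum_distrib_left[of \<theta>] mult.assoc)
      then show ?thesis by (simp only: F_def)
    qed
    have FY: "F (Suc p) = (\<integral>x. iexp (a x + (\<Sum>i<m. b i x * Y p i x)) \<partial>\<Omega>)"
    proof -
      have ZSp: "Z (Suc p) p i = Y p i" for i by (simp add: Z_def)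
      have ZS: "Z (Suc p) j i = Z p j i" if "j \<in> J" for j i using that by (auto simp: Z_def J_def)
      have "\<theta> * quad n m l (Z (Suc p)) x = a x + (\<Sum>i<m. b i x * Y p i x)" for x
        unfolding quad_split[OF p] a_def b_def S_def J_def[symmetric] distrib_left ZSp
        using ZS by (simp add: sum_distrib_left[of \<theta>] mult.assoc cong: sum.cong)
      then show ?thesis by (simp only: F_def)
    qed
    \<comment> \<open>A third moment of order \<open>n\<close> to the power \<open>-3/2\<close> for
      each exchanged block, so that \<open>n\<close> exchanges cost only
      \<open>1 / sqrt n\<close>.\<close>
    have third: "(\<integral>x. \<bar>\<Sum>i<m. b i x * V i x\<bar> ^ 3 \<partial>\<Omega>) \<le> (C1 + C2) / (2 * (real n * sqrt n))"
      if V: "\<And>i. i < m \<Longrightarrow> bm \<Omega> (V i)" "\<And>i x. i < m \<Longrightarrow> \<bar>V i x\<bar> \<le> K" for V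
    proof -
      have mom: "(\<integral>x. (S i x)\<^sup>2 \<partial>\<Omega>) \<le> real n * K\<^sup>2" "(\<integral>x. S i x ^ 4 \<partial>\<Omega>) \<le> 3 * (real n)\<^sup>2 * K ^ 4" if i: "i < m" for i
      proof -
        have cJ: "card J \<le> n" unfolding J_def using p by simp
        have bmo: "(\<integral>x. (\<Sum>j\<in>J. Z p j i x)\<^sup>2 \<partial>\<Omega>) \<le> real (card J) * K\<^sup>2 \<and> (\<integral>x. (\<Sum>j\<in>J. Z p j i x) ^ 4 \<partial>\<Omega>) \<le> 3 * (real (card J))\<^sup>2 * K ^ 4"
          using Z[OF i] K by (intro block_moments) (auto simp: J_def)
        have "real (card J) * K\<^sup>2 \<le> real n * K\<^sup>2" using cJ by (intro mult_right_mono) auto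
        moreover have "3 * (real (card J))\<^sup>2 * K ^ 4 \<le> 3 * (real n)\<^sup>2 * K ^ 4" using cJ K by (intro mult_right_mono mult_left_mono power_mono) auto
        ultimately show "(\<integral>x. (S i x)\<^sup>2 \<partial>\<Omega>) \<le> real n * K\<^sup>2" "(\<integral>x. S i x ^ 4 \<partial>\<Omega>) \<le> 3 * (real n)\<^sup>2 * K ^ 4"
          using bmo by (auto simp: S_def)
      qed
      let ?s = "\<lambda>x. \<Sum>i<m. b i x * V i x"
      have bs: "bm \<Omega> ?s" using bb V(1) by (intro bm_sum bm_mult) auto
      have t: "\<theta>\<^sup>2 * (real n * K\<^sup>2) = s\<^sup>2 * K\<^sup>2 / real n" "\<theta> ^ 4 * (3 * (real n)\<^sup>2 * K ^ 4) = 3 * s ^ 4 * K ^ 4 / (real n)\<^sup>2"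
        using n by (simp_all add: \<theta>_def power_divide field_simps power2_eq_square power4_eq_xxxx)
      have "(\<integral>x. (?s x)\<^sup>2 \<partial>\<Omega>) \<le> (\<integral>x. real m * (\<Sum>i<m. K\<^sup>2 * (\<theta>\<^sup>2 * (l i)\<^sup>2 * (S i x)\<^sup>2)) \<partial>\<Omega>)"
      proof (rule integral_mono)
        fix x
        have "(?s x)\<^sup>2 \<le> real m * (\<Sum>i<m. (b i x * V i x)\<^sup>2)" by (rule sum_sq_le)
        also have "\<dots> \<le> real m * (\<Sum>i<m. K\<^sup>2 * (\<theta>\<^sup>2 * (l i)\<^sup>2 * (S i x)\<^sup>2))"
        proof (intro mult_left_mono sum_mono)
          fix i assume "i \<in> {..<m}"
          then have "(V i x)\<^sup>2 \<le> K\<^sup>2" using V(2)[of i x] K by (simp add: abs_le_square_iff[symmetric])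
          then have "(b i x)\<^sup>2 * (V i x)\<^sup>2 \<le> (b i x)\<^sup>2 * K\<^sup>2" by (intro mult_left_mono) auto
          then show "(b i x * V i x)\<^sup>2 \<le> K\<^sup>2 * (\<theta>\<^sup>2 * (l i)\<^sup>2 * (S i x)\<^sup>2)" by (simp add: b_def power_mult_distrib mult_ac)
        qed simp
        finally show "(?s x)\<^sup>2 \<le> real m * (\<Sum>i<m. K\<^sup>2 * (\<theta>\<^sup>2 * (l i)\<^sup>2 * (S i x)\<^sup>2))" .
      qed (use bs bS in \<open>auto intro!: P.bm_integrable bm_mult bm_sum bm_power\<close>)
      also have "\<dots> = real m * (\<Sum>i<m. K\<^sup>2 * (\<theta>\<^sup>2 * (l i)\<^sup>2 * (\<integral>x. (S i x)\<^sup>2 \<partial>\<Omega>)))"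
        using bS by (simp add: Bochner_Integration.integral_sum P.bm_integrable)
      also have "\<dots> \<le> real m * (\<Sum>i<m. K\<^sup>2 * (\<theta>\<^sup>2 * (l i)\<^sup>2 * (real n * K\<^sup>2)))"
        using mom by (intro mult_left_mono sum_mono) auto
      also have "\<dots> = real m * (\<Sum>i<m. K\<^sup>2 * ((l i)\<^sup>2 * (\<theta>\<^sup>2 * (real n * K\<^sup>2))))" by (simp add: mult_ac)
      also have "\<dots> = C1 / real n"
        unfolding t C1_def by (simp add: sum_distrib_left sum_divide_distrib power4_eq_xxxx power2_eq_square mult_ac)
      finally have m2: "(\<integral>x. (?s x)\<^sup>2 \<partial>\<Omega>) \<le> C1 / real n" .
      have "(\<integral>x. ?s x ^ 4 \<partial>\<Omega>) \<le> (\<integral>x. real m ^ 3 * (\<Sum>i<m. K ^ 4 * (\<theta> ^ 4 * l i ^ 4 * S i x ^ 4)) \<partial>\<Omega>)"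
      proof (rule integral_mono)
        fix x
        have "?s x ^ 4 \<le> real m ^ 3 * (\<Sum>i<m. (b i x * V i x) ^ 4)" by (rule sum_pow4_le)
        also have "\<dots> \<le> real m ^ 3 * (\<Sum>i<m. K ^ 4 * (\<theta> ^ 4 * l i ^ 4 * S i x ^ 4))"
        proof (intro mult_left_mono sum_mono)
          fix i assume "i \<in> {..<m}"
          then have "\<bar>V i x\<bar> ^ 4 \<le> K ^ 4" using V(2)[of i x] K by (intro power_mono) auto
          then have "b i x ^ 4 * V i x ^ 4 \<le> b i x ^ 4 * K ^ 4" by (intro mult_left_mono) auto
          then show "(b i x * V i x) ^ 4 \<le> K ^ 4 * (\<theta> ^ 4 * l i ^ 4 * S i x ^ 4)" by (simp add: b_def power_mult_distrib mult_ac)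
        qed simp
        finally show "?s x ^ 4 \<le> real m ^ 3 * (\<Sum>i<m. K ^ 4 * (\<theta> ^ 4 * l i ^ 4 * S i x ^ 4))" .
      qed (use bs bS in \<open>auto intro!: P.bm_integrable bm_mult bm_sum bm_power\<close>)
      also have "\<dots> = real m ^ 3 * (\<Sum>i<m. K ^ 4 * (\<theta> ^ 4 * l i ^ 4 * (\<integral>x. S i x ^ 4 \<partial>\<Omega>)))"
        using bS by (simp add: Bochner_Integration.integral_sum P.bm_integrable)
      also have "\<dots> \<le> real m ^ 3 * (\<Sum>i<m. K ^ 4 * (\<theta> ^ 4 * l i ^ 4 * (3 * (real n)\<^sup>2 * K ^ 4)))"
        using mom by (intro mult_left_mono sum_mono) auto
      also have "\<dots> = real m ^ 3 * (\<Sum>i<m. K ^ 4 * (l i ^ 4 * (\<theta> ^ 4 * (3 * (real n)\<^sup>2 * K ^ 4))))" by (simp add: mult_ac)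
      also have "\<dots> = C2 / (real n)\<^sup>2"
      proof -
        have "K ^ 8 = K ^ 4 * K ^ 4" by (simp flip: power_add)
        then show ?thesis unfolding t C2_def by (simp add: sum_distrib_left sum_divide_distrib mult_ac)
      qed
      finally have m4: "(\<integral>x. ?s x ^ 4 \<partial>\<Omega>) \<le> C2 / (real n)\<^sup>2" .
      \<comment> \<open>The second moment is of order \<open>1 / n\<close> and the fourth of order
        \<open>1 / n\<^sup>2\<close>; the weight \<open>1 / sqrt n\<close> balances the two.\<close>
      have "(\<integral>x. \<bar>?s x\<bar> ^ 3 \<partial>\<Omega>) \<le> ((1 / sqrt n) * (\<integral>x. (?s x)\<^sup>2 \<partial>\<Omega>) + (\<integral>x. ?s x ^ 4 \<partial>\<Omega>) / (1 / sqrt n)) / 2"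
        using n by (intro P.third_moment_le bs) auto
      also have "\<dots> \<le> ((1 / sqrt n) * (C1 / real n) + (C2 / (real n)\<^sup>2) / (1 / sqrt n)) / 2"
        using m2 m4 n by (intro divide_right_mono add_mono mult_left_mono) auto
      also have "\<dots> = (C1 + C2) / (2 * (real n * sqrt n))"
      proof -
        have "sqrt n * sqrt n = real n" by simp
        then have "C2 * sqrt n / (real n)\<^sup>2 = C2 / (real n * sqrt n)"
          using n by (simp add: field_simps power2_eq_square)
        then show ?thesis using n by (simp add: field_simps)
      qed
      finally show ?thesis .
    qed
    let ?main = "\<lambda>V. (\<integral>x. iexp (a x) \<partial>\<Omega>) - (\<Sum>i<m. \<Sum>j<m. (\<integral>x. iexp (a x) * complex_of_real (b i x * b j x) \<partial>\<Omega>) * complex_of_real (\<integral>x. V i x * V j x \<partial>\<Omega>)) / 2"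
    \<comment> \<open>Equality of the covariances makes the expansions of both hybrids agree up to
      the third-order errors.\<close>
    have eqm: "?main (X p) = ?main (Y p)" using cov by simp
    have dX: "cmod (F p - ?main (X p)) \<le> (C1 + C2) / (2 * (real n * sqrt n)) / 6"
      unfolding FX using X(2) blockD(1)[OF X(1)]
      by (intro order_trans[OF iexp_second_order[OF am ainv binv bb X(1) X(3)]] divide_right_mono third) auto
    have dY: "cmod (F (Suc p) - ?main (Y p)) \<le> (C1 + C2) / (2 * (real n * sqrt n)) / 6"
      unfolding FY using Y(2) blockD(1)[OF Y(1)]
      by (intro order_trans[OF iexp_second_order[OF am ainv binv bb Y(1) Y(3)]] divide_right_mono third) auto
    have "F p - F (Suc p) = (F p - ?main (X p)) - (F (Suc p) - ?main (Y p))" unfolding eqm by simp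
    then have "cmod (F p - F (Suc p)) \<le> cmod (F p - ?main (X p)) + cmod (F (Suc p) - ?main (Y p))"
      by (simp only: norm_triangle_ineq4)
    also have "\<dots> \<le> (C1 + C2) / (6 * (real n * sqrt n))" using dX dY by (simp add: field_simps)
    finally show ?thesis .
  qed
  have "cmod (F 0 - F n) = cmod (\<Sum>p<n. F p - F (Suc p))"
    by (simp only: sum_lessThan_telescope')
  also have "\<dots> \<le> (\<Sum>p<n. cmod (F p - F (Suc p)))" by (rule norm_sum)
  also have "\<dots> \<le> (\<Sum>p<n. (C1 + C2) / (6 * (real n * sqrt n)))" by (intro sum_mono step) auto
  also have "\<dots> = (C1 + C2) / (6 * sqrt n)" using n by (simp add: field_simps)
  finally have "cmod (F 0 - F n) \<le> (C1 + C2) / (6 * sqrt n)" .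
  moreover have "F 0 = (\<integral>x. iexp (s / n * quad n m l X x) \<partial>\<Omega>)"
    unfolding F_def \<theta>_def by (intro Bochner_Integration.integral_cong refl) (simp add: quad_def Z_def)
  moreover have "F n = (\<integral>x. iexp (s / n * quad n m l Y x) \<partial>\<Omega>)"
    unfolding F_def \<theta>_def by (intro Bochner_Integration.integral_cong refl) (simp add: quad_def Z_def)
  ultimately show ?thesis by (simp add: C1_def C2_def)
qed

end

subsection \<open>Uniform coordinates\<close>

lemma prob_space_unif01: "prob_space unif01"
  unfolding unif01_def by (rule prob_space_uniform_measure) auto

lemma sets_unif01 [measurable_cong, simp]: "sets unif01 = sets borel"
  by (simp add: unif01_def)

lemma space_unif01 [simp]: "space unif01 = UNIV"
  by (simp add: unif01_def)

lemma measurable_unif01: "measurable unif01 N = measurable borel N"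
  by (rule measurable_cong_sets) auto

lemma measure_unif01_atMost: "0 \<le> p \<Longrightarrow> p \<le> 1 \<Longrightarrow> measure unif01 {..p} = p"
proof -
  assume p: "0 \<le> p" "p \<le> 1"
  have "{0..1} \<inter> {..p} = {0..p}" using p by auto
  then show ?thesis using p by (simp add: unif01_def measure_uniform_measure)
qed

lemma measure_unif01_greaterThan: "0 \<le> p \<Longrightarrow> p \<le> 1 \<Longrightarrow> measure unif01 {p<..} = 1 - p"
proof -
  interpret prob_space unif01 by (rule prob_space_unif01)
  assume p: "0 \<le> p" "p \<le> 1"
  have "prob (UNIV - {..p}) = 1 - prob {..p}" using prob_compl[of "{..p}"] by simp
  moreover have "UNIV - {..p} = {p<..}" by auto
  ultimately show ?thesis using measure_unif01_atMost[OF p] by simp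
qed

abbreviation unifs :: "('i \<Rightarrow> real) measure" where
  "unifs \<equiv> PiM UNIV (\<lambda>_. unif01)"

interpretation unifs: full_product "\<lambda>_::'i. unif01"
proof -
  interpret prob_space unif01 by (rule prob_space_unif01)
  show "full_product (\<lambda>_::'i. unif01)"
    unfolding full_product_def by unfold_locales
qed

text \<open>Statistics live on families indexed by naturals, by vertex sets, or by a disjoint sum;
  an injection of indices moves an expectation from one to another.\<close>

lemma integral_unifs_reindex:
  fixes f :: "('i \<Rightarrow> real) \<Rightarrow> 'b::{banach, second_countable_topology}"
  assumes "inj \<rho>" "f \<in> borel_measurable unifs"
  shows "(\<integral>x. f (\<lambda>i. x (\<rho> i)) \<partial>unifs) = (\<integral>x. f x \<partial>unifs)"
proof -
  have "(\<integral>x. f x \<partial>distr unifs unifs (\<lambda>x i. x (\<rho> i))) = (\<integral>x. f (\<lambda>i. x (\<rho> i)) \<partial>unifs)"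
    using assms(2) by (intro integral_distr measurable_PiM_single') auto
  then show ?thesis using unifs.distr_reindex[OF assms(1)] by simp
qed

definition rad :: "real \<Rightarrow> real" where
  "rad u = (if u \<le> 1 / 2 then 1 else - 1)"

lemma rad_measurable [measurable]: "rad \<in> borel_measurable borel"
  unfolding rad_def[abs_def] by measurable

lemma rad_simps [simp]: "rad u * rad u = 1" "\<bar>rad u\<bar> = 1" "(rad u)\<^sup>2 = 1"
  by (auto simp: rad_def)

lemma integral_rad: "(\<integral>u. rad u \<partial>unif01) = 0"
proof -
  have "(\<integral>u. rad u \<partial>unif01) = (\<integral>u. 2 * indicator {..1/2} u - 1 \<partial>unif01)"
    by (intro Bochner_Integration.integral_cong refl) (auto simp: rad_def indicator_def)
  also have "\<dots> = 2 * measure unif01 {..1/2} - 1"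
  proof -
    have "integrable unif01 (indicator {..1/2} :: real \<Rightarrow> real)"
      by (rule unifs.M.integrable_const_bound[of _ 1]) (auto simp: indicator_def)
    then show ?thesis using unifs.M.prob_space by simp
  qed
  finally show ?thesis by (simp add: measure_unif01_atMost)
qed

text \<open>Signs have square 1, so the diagonal of the quadratic form is exactly \<open>n\<close>
  and the form is a continuous function of the normalised sum, to which the central limit theorem
  applies.\<close>

lemma rademacher_limit:
  "(\<lambda>n. \<integral>x. iexp (\<theta> * ((\<Sum>j<n. rad (x j))\<^sup>2 / real n - 1)) \<partial>(unifs :: (nat \<Rightarrow> real) measure)) \<longlonglongrightarrow> chi_cf \<theta>"
proof -
  let ?X = "\<lambda>(j::nat) x. rad (x j)"
  let ?D = "\<lambda>n. distr unifs borel (\<lambda>x. (\<Sum>j<n. ?X j x) / sqrt (real n * 1\<^sup>2))"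
  have mean: "(\<integral>x. ?X j x \<partial>unifs) = 0" for j
    using unifs.integral_coordinate[of rad j] integral_rad by simp
  have "weak_conv_m ?D std_normal_distribution"
  proof (rule unifs.P.central_limit_theorem_zero_mean[where \<mu>="distr unif01 borel rad"])
    show "unifs.P.indep_vars (\<lambda>_. borel) ?X UNIV"
      by (rule unifs.P.indep_vars_compose2[OF unifs.indep_vars_coordinates]) auto
    show "distr unifs borel (?X n) = distr unif01 borel rad" for n :: nat
    proof -
      have "distr (distr unifs unif01 (\<lambda>x. x n)) borel rad = distr unifs borel (rad \<circ> (\<lambda>x. x n))"
        by (rule distr_distr) auto
      then show ?thesis using unifs.PiM_component[of n] by (simp add: o_def)
    qed
    show "unifs.P.variance (?X n) = 1\<^sup>2" for n :: nat
      unfolding mean by (simp add: unifs.P.prob_space[simplified])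
  qed (auto simp: mean)
  moreover have "real_distribution (?D n)" for n
    by (rule unifs.P.real_distribution_distr) measurable
  ultimately have "(\<lambda>n. \<integral>y. iexp (\<theta> * (y\<^sup>2 - 1)) \<partial>?D n) \<longlonglongrightarrow> (\<integral>y. iexp (\<theta> * (y\<^sup>2 - 1)) \<partial>std_normal_distribution)"
    using real_dist_normal_dist
    by (intro weak_conv_imp_integral_bdd_continuous_conv[of ?D std_normal_distribution _ 1]) (auto intro!: continuous_intros)
  moreover have "(\<integral>y. iexp (\<theta> * (y\<^sup>2 - 1)) \<partial>?D n) = (\<integral>x. iexp (\<theta> * ((\<Sum>j<n. rad (x j))\<^sup>2 / real n - 1)) \<partial>unifs)" for n
    by (subst integral_distr) (auto simp: power_divide)
  ultimately show ?thesis by (simp add: chi_cf_def std_normal_def)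
qed

text \<open>On an enlarged index set, \<open>Inl j\<close> carries the \<open>j\<close>-th sample
  point and \<open>Inr (j, i)\<close> the sign that replaces the value of \<open>w i\<close> there.
  The blocks \<open>A j\<close> collect what belongs to one sample point and are exchanged one by
  one; after the exchange the statistic is a sum over \<open>i\<close> of functions of the disjoint
  blocks \<open>B i\<close>, hence its characteristic function factors.\<close>

theorem degenerate_quadratic_limit:
  fixes w :: "nat \<Rightarrow> real \<Rightarrow> real"
  assumes w: "\<And>i. i < m \<Longrightarrow> bm unif01 (w i)" "\<And>i. i < m \<Longrightarrow> (\<integral>x. w i x \<partial>unif01) = 0"
    "\<And>i j. i < m \<Longrightarrow> j < m \<Longrightarrow> (\<integral>x. w i x * w j x \<partial>unif01) = (if i = j then 1 else 0)"
  shows "(\<lambda>n. \<integral>x. iexp (s / real n * (\<Sum>i<m. l i / 2 * ((\<Sum>j<n. w i (x j))\<^sup>2 - (\<Sum>j<n. (w i (x j))\<^sup>2)))) \<partial>(unifs :: (nat \<Rightarrow> real) measure))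
    \<longlonglongrightarrow> (\<Prod>i<m. chi_cf (s * l i / 2))"
proof -
  define A :: "nat \<Rightarrow> (nat + nat \<times> nat) set" where "A j = insert (Inl j) (range (\<lambda>i. Inr (j, i)))" for j
  define B :: "nat \<Rightarrow> (nat + nat \<times> nat) set" where "B i = range (\<lambda>j. Inr (j, i))" for i
  interpret A: block_product "\<lambda>_. unif01" A by standard (auto simp: A_def)
  interpret B: block_product "\<lambda>_. unif01" B by standard (auto simp: B_def)
  define X where "X j i x = w i (x (Inl j))" for j i and x :: "nat + nat \<times> nat \<Rightarrow> real"
  define Y where "Y j i x = rad (x (Inr (j, i)))" for j i and x :: "nat + nat \<times> nat \<Rightarrow> real"
  have "\<exists>K. \<forall>x. \<bar>w i x\<bar> \<le> K" if "i < m" for i using w(1)[OF that] by (auto simp: bm_def)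
  then obtain k where k: "\<And>i x. i < m \<Longrightarrow> \<bar>w i x\<bar> \<le> k i" by metis
  have kpos: "i < m \<Longrightarrow> 0 \<le> k i" for i using k[of i 0] by linarith
  \<comment> \<open>A common bound for the \<open>w i\<close>; the summand 1 makes it a bound for
    the signs too.\<close>
  define K where "K = 1 + (\<Sum>i<m. k i)"
  have K: "K \<ge> 1" unfolding K_def using kpos sum_nonneg[of "{..<m}" k] by auto
  have wK: "\<bar>w i x\<bar> \<le> K" if "i < m" for i x
  proof -
    have "k i \<le> (\<Sum>i<m. k i)" using that kpos by (intro member_le_sum) auto
    then show ?thesis using k[OF that, of x] by (simp add: K_def)
  qed
  have wm [measurable]: "i < m \<Longrightarrow> w i \<in> borel_measurable borel" for i using w(1)[of i] by (simp add: bm_def measurable_unif01)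
  define C where "C = real m * K ^ 4 * s\<^sup>2 * (\<Sum>i<m. (l i)\<^sup>2) + 3 * real m ^ 3 * K ^ 8 * s ^ 4 * (\<Sum>i<m. l i ^ 4)"
  have exch: "cmod ((\<integral>x. iexp (s / n * A.quad n m l X x) \<partial>unifs) - (\<integral>x. iexp (s / n * A.quad n m l Y x) \<partial>unifs)) \<le> C / (6 * sqrt n)"
    if "n > 0" for n :: nat
    unfolding C_def
  proof (rule A.lindeberg_exchange)
    show "A.block j (X j i)" if "i < m" for j i
      unfolding A.block_def X_def using wK[OF that] wm[OF that] by (auto intro!: bmI[of _ _ K] simp: mix_def A_def)
    show "A.block j (Y j i)" for j i
      unfolding A.block_def Y_def by (auto intro!: bmI[of _ _ 1] simp: mix_def A_def)
    show "(\<integral>x. X j i x \<partial>unifs) = 0" if "i < m" for j i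
      unfolding X_def using unifs.integral_coordinate[of "w i" "Inl j :: nat + nat \<times> nat"] w that wm[OF that] by simp
    show "(\<integral>x. Y j i x \<partial>unifs) = 0" for j i
      unfolding Y_def using unifs.integral_coordinate[of rad "Inr (j, i) :: nat + nat \<times> nat"] integral_rad by simp
    show "(\<integral>x. X j i x * X j i' x \<partial>unifs) = (\<integral>x. Y j i x * Y j i' x \<partial>unifs)" if i: "i < m" "i' < m" for j i i'
    proof -
      have "(\<integral>x. X j i x * X j i' x \<partial>unifs) = (if i = i' then 1 else 0)"
        unfolding X_def using unifs.integral_coordinate[of "\<lambda>u. w i u * w i' u" "Inl j :: nat + nat \<times> nat"] w(3)[OF i] wm i by simp
      moreover have "(\<integral>x. Y j i x * Y j i' x \<partial>unifs) = (if i = i' then 1 else 0)"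
      proof (cases "i = i'")
        case True
        then show ?thesis unfolding Y_def by (simp add: unifs.P.prob_space[simplified])
      next
        case False
        have "(\<integral>x. Y j i x * Y j i' x \<partial>unifs) = (\<integral>x. Y j i x \<partial>unifs) * (\<integral>x. Y j i' x \<partial>unifs)"
        proof (rule unifs.integral_mult_indep[where A="{Inr (j, i')}"])
          show "integrable unifs (\<lambda>x. Y j i x * Y j i' x)"
            by (rule unifs.P.integrable_const_bound[of _ 1]) (auto simp: Y_def abs_mult)
        qed (use False in \<open>auto simp: Y_def mix_def\<close>)
        also have "(\<integral>x. Y j i x \<partial>unifs) = 0"
          unfolding Y_def using unifs.integral_coordinate[of rad "Inr (j, i) :: nat + nat \<times> nat"] integral_rad by simp
        finally show ?thesis using False by simp
      qed
      ultimately show ?thesis by simp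
    qed
  qed (use that K wK in \<open>auto simp: X_def Y_def\<close>)
  define f where "f n i x = iexp (s * l i / 2 * ((\<Sum>j<n. Y j i x)\<^sup>2 / real n - 1))" for n i x
  have fY: "(\<integral>x. iexp (s / n * A.quad n m l Y x) \<partial>unifs) = (\<Prod>i<m. \<integral>x. f n i x \<partial>unifs)" if n: "n > 0" for n :: nat
  proof -
    have "iexp (s / n * A.quad n m l Y x) = (\<Prod>i<m. f n i x)" for x
    proof -
      have "s / n * A.quad n m l Y x = (\<Sum>i<m. s * l i / 2 * ((\<Sum>j<n. Y j i x)\<^sup>2 / real n - 1))"
        unfolding A.quad_def Y_def sum_distrib_left using n by (intro sum.cong refl) (simp add: field_simps)
      then show ?thesis unfolding f_def exp_sum[symmetric, OF finite_lessThan] by (simp only: of_real_sum sum_distrib_left)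
    qed
    then have "(\<integral>x. iexp (s / n * A.quad n m l Y x) \<partial>unifs) = (\<integral>x. (\<Prod>i<m. f n i x) \<partial>unifs)" by simp
    also have "\<dots> = (\<Prod>i<m. \<integral>x. f n i x \<partial>unifs)"
    proof (rule B.integral_prod_blocks)
      show "f n i \<in> borel_measurable unifs" for i unfolding f_def[abs_def] Y_def by measurable
      show "f n i (mix (B i) x y) = f n i y" for i x y
        unfolding f_def Y_def by (simp add: mix_def B_def)
    qed (simp add: f_def)
    finally show ?thesis .
  qed
  have fn: "(\<integral>x. f n i x \<partial>unifs) = (\<integral>x. iexp (s * l i / 2 * ((\<Sum>j<n. rad (x j))\<^sup>2 / real n - 1)) \<partial>(unifs :: (nat \<Rightarrow> real) measure))" for n i
    unfolding f_def Y_def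
    by (rule integral_unifs_reindex[of "\<lambda>j. Inr (j, i)" "\<lambda>x. iexp (s * l i / 2 * ((\<Sum>j<n. rad (x j))\<^sup>2 / real n - 1))"])
       (auto simp: inj_on_def)
  have limY: "(\<lambda>n. \<Prod>i<m. \<integral>x. f n i x \<partial>unifs) \<longlonglongrightarrow> (\<Prod>i<m. chi_cf (s * l i / 2))"
    unfolding fn by (intro tendsto_prod rademacher_limit)
  have fX: "(\<integral>x. iexp (s / real n * (\<Sum>i<m. l i / 2 * ((\<Sum>j<n. w i (x j))\<^sup>2 - (\<Sum>j<n. (w i (x j))\<^sup>2)))) \<partial>(unifs :: (nat \<Rightarrow> real) measure))
     = (\<integral>x. iexp (s / n * A.quad n m l X x) \<partial>unifs)" for n
    unfolding A.quad_def X_def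
    by (rule integral_unifs_reindex[symmetric, of "\<lambda>j. Inl j"
        "\<lambda>x. iexp (s / real n * (\<Sum>i<m. l i / 2 * ((\<Sum>j<n. w i (x j))\<^sup>2 - (\<Sum>j<n. (w i (x j))\<^sup>2))))"])
       (use wm in \<open>auto intro!: borel_measurable_sum borel_measurable_times borel_measurable_diff borel_measurable_power measurable_compose[OF measurable_component_singleton]
          measurable_compose[OF _ borel_measurable_exp] borel_measurable_const measurable_compose[OF _ borel_measurable_of_real]\<close>)
  have "(\<lambda>n. (\<integral>x. iexp (s / n * A.quad n m l X x) \<partial>unifs) - (\<Prod>i<m. \<integral>x. f n i x \<partial>unifs)) \<longlonglongrightarrow> 0"
  proof (rule Lim_null_comparison)
    show "\<forall>\<^sub>F n in sequentially. norm ((\<integral>x. iexp (s / n * A.quad n m l X x) \<partial>unifs) - (\<Prod>i<m. \<integral>x. f n i x \<partial>unifs)) \<le> C / (6 * sqrt n)"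
      using eventually_gt_at_top[of 0] by eventually_elim (use exch fY in auto)
    show "(\<lambda>n. C / (6 * sqrt n)) \<longlonglongrightarrow> 0" by real_asymp
  qed
  from tendsto_add[OF this limY] show ?thesis unfolding fX by simp
qed

section \<open>Projections of the clique count\<close>

text \<open>The relabelling has to be injective on all vertices, because it acts on all coordinates
  at once: what \<open>S\<close> displaces in \<open>S'\<close> is sent back to \<open>S\<close>,
  and everything else stays fixed.\<close>

lemma extend_partial_identity:
  fixes S S' D :: "nat set"
  assumes "finite S" "finite S'" "card S = card S'" "D \<subseteq> S" "D \<subseteq> S'"
  obtains \<pi> :: "nat \<Rightarrow> nat" where "inj \<pi>" "\<pi> ` S = S'" "\<And>x. x \<in> D \<Longrightarrow> \<pi> x = x"
proof -
  have fD: "finite D" using assms finite_subset by blast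
  have "card (S - D) = card (S' - D)" using assms fD by (simp add: card_Diff_subset)
  then obtain g where g: "bij_betw g (S - D) (S' - D)" using assms finite_same_card_bij[of "S - D" "S' - D"] by auto
  have "card (S' - S) = card (S - S')"
    using assms by (metis card_le_sym_Diff card_le_sym_Diff le_antisym order_refl)
  then obtain h where h: "bij_betw h (S' - S) (S - S')" using assms finite_same_card_bij[of "S' - S" "S - S'"] by auto
  define \<pi> where "\<pi> x = (if x \<in> D then x else if x \<in> S then g x else if x \<in> S' then h x else x)" for x
  have 1: "bij_betw \<pi> D D" by (rule bij_betw_cong[THEN iffD1, OF _ bij_betw_id[unfolded id_def]]) (auto simp: \<pi>_def)
  have 2: "bij_betw \<pi> (S - D) (S' - D)" by (rule bij_betw_cong[THEN iffD1, OF _ g]) (auto simp: \<pi>_def)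
  have 3: "bij_betw \<pi> (S' - S) (S - S')" by (rule bij_betw_cong[THEN iffD1, OF _ h]) (use assms in \<open>auto simp: \<pi>_def\<close>)
  have 4: "bij_betw \<pi> (- (S \<union> S')) (- (S \<union> S'))" by (rule bij_betw_cong[THEN iffD1, OF _ bij_betw_id[unfolded id_def]]) (use assms in \<open>auto simp: \<pi>_def\<close>)
  have 12: "bij_betw \<pi> (D \<union> (S - D)) (D \<union> (S' - D))" by (rule bij_betw_combine[OF 1 2]) auto
  then have S: "bij_betw \<pi> S S'" using assms by (simp add: Un_absorb1)
  have "bij_betw \<pi> (S \<union> (S' - S)) (S' \<union> (S - S'))" by (rule bij_betw_combine[OF S 3]) auto
  then have "bij_betw \<pi> ((S \<union> (S' - S)) \<union> (- (S \<union> S'))) ((S' \<union> (S - S')) \<union> (- (S \<union> S')))"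
    by (rule bij_betw_combine[OF _ 4]) auto
  moreover have "(S \<union> (S' - S)) \<union> (- (S \<union> S')) = UNIV" by auto
  ultimately have "inj \<pi>" by (auto simp: bij_betw_def)
  then show thesis using S by (intro that[of \<pi>]) (auto simp: bij_betw_def \<pi>_def)
qed

section \<open>Conditional expectations and relabelling of vertices\<close>

definition pairs :: "nat set \<Rightarrow> nat set set" where
  "pairs S = {p. p \<subseteq> S \<and> card p = 2}"

lemma finite_pairs [simp]: "finite S \<Longrightarrow> finite (pairs S)"
  by (auto simp: pairs_def)

lemma pairs_image: "inj \<pi> \<Longrightarrow> pairs (\<pi> ` S) = (\<lambda>p. \<pi> ` p) ` pairs S"
proof (intro set_eqI iffI)
  fix p assume pi: "inj \<pi>" and p: "p \<in> pairs (\<pi> ` S)"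
  then obtain q where q: "q \<subseteq> S" "p = \<pi> ` q" by (auto simp: pairs_def subset_image_iff)
  then show "p \<in> (\<lambda>p. \<pi> ` p) ` pairs S"
    using p pi by (auto simp: pairs_def card_image inj_on_subset[OF pi])
qed (auto simp: pairs_def card_image inj_on_subset)

definition act :: "(nat \<Rightarrow> nat) \<Rightarrow> (nat set \<Rightarrow> real) \<Rightarrow> nat set \<Rightarrow> real" where
  "act \<pi> \<omega> = (\<lambda>s. \<omega> (\<pi> ` s))"

definition Cond :: "nat set \<Rightarrow> ((nat set \<Rightarrow> real) \<Rightarrow> real) \<Rightarrow> (nat set \<Rightarrow> real) \<Rightarrow> real" where
  "Cond C f \<omega> = (\<integral>y. f (mix (- Pow C) \<omega> y) \<partial>unifs)"

lemma bm_mix: "bm unifs f \<Longrightarrow> bm unifs (\<lambda>y. f (mix A (x :: 'i \<Rightarrow> real) y))"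
  unfolding bm_def by (auto intro!: measurable_compose[of _ _ unifs f] measurable_mix2 simp: space_PiM)

lemma bm_Cond: assumes "bm unifs f" shows "bm unifs (Cond C f)"
proof -
  obtain K where K: "\<And>x. \<bar>f x\<bar> \<le> K" using assms by (auto simp: bm_def)
  have [measurable]: "f \<in> borel_measurable unifs" using assms by (simp add: bm_def)
  show ?thesis
  proof (rule bmI[of _ _ K])
    show "Cond C f \<in> borel_measurable unifs" unfolding Cond_def[abs_def] by measurable
    fix x
    have "\<bar>Cond C f x\<bar> \<le> (\<integral>y. \<bar>f (mix (- Pow C) x y)\<bar> \<partial>unifs)" unfolding Cond_def by (rule integral_abs_bound)
    also have "\<dots> \<le> (\<integral>y. K \<partial>(unifs :: (nat set \<Rightarrow> real) measure))"
      using K bm_mix[OF assms, of "- Pow C" x]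
      by (intro integral_mono integrable_abs unifs.P.bm_integrable) auto
    finally show "\<bar>Cond C f x\<bar> \<le> K" by (simp add: unifs.P.prob_space[simplified])
  qed
qed

lemma Cond_cong:
  assumes "\<And>s. s \<subseteq> C \<Longrightarrow> x s = y s" shows "Cond C f x = Cond C f y"
proof -
  have "mix (- Pow C) x z = mix (- Pow C) y z" for z using assms by (auto simp: mix_def fun_eq_iff)
  then show ?thesis by (simp add: Cond_def)
qed

lemma Cond_mix: "D \<subseteq> C \<Longrightarrow> Cond D f (mix (- Pow C) x y) = Cond D f x"
  by (rule Cond_cong) (auto simp: mix_def)

text \<open>A vertex set is contained in both \<open>C\<close> and \<open>D\<close> iff it is
  contained in their intersection, so resampling twice amounts to resampling everything outside the
  subsets of \<open>C \<inter> D\<close>.\<close>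

lemma Cond_Cond:
  assumes "bm unifs f" shows "Cond C (Cond D f) x = Cond (C \<inter> D) f x"
proof -
  have "mix (- Pow D) (mix (- Pow C) x y) z = mix (- Pow (C \<inter> D)) x (mix (- Pow D) y z)" for y z
    by (auto simp: mix_def fun_eq_iff)
  then have "Cond C (Cond D f) x = (\<integral>y. (\<integral>z. f (mix (- Pow (C \<inter> D)) x (mix (- Pow D) y z)) \<partial>unifs) \<partial>unifs)"
    by (simp add: Cond_def)
  also have "\<dots> = Cond (C \<inter> D) f x"
    unfolding Cond_def using bm_mix[OF assms, of "- Pow (C \<inter> D)" x]
    by (intro unifs.integral_mix[symmetric] unifs.P.bm_integrable)
  finally show ?thesis .
qed

text \<open>An injective relabelling acts injectively on vertex sets, hence preserves the product
  measure and carries the coordinates inside \<open>D\<close> to those inside the image of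
  \<open>D\<close>.\<close>

lemma Cond_act:
  assumes "inj \<pi>" "bm unifs f"
  shows "Cond D f (act \<pi> x) = Cond (\<pi> ` D) (\<lambda>x. f (act \<pi> x)) x"
proof -
  have "act \<pi> (mix (- Pow (\<pi> ` D)) x y) = mix (- Pow D) (act \<pi> x) (act \<pi> y)" for y
    using assms(1) by (auto simp: act_def mix_def fun_eq_iff inj_image_subset_iff)
  then have "Cond (\<pi> ` D) (\<lambda>x. f (act \<pi> x)) x = (\<integral>y. f (mix (- Pow D) (act \<pi> x) (act \<pi> y)) \<partial>unifs)"
    by (simp add: Cond_def)
  also have "\<dots> = (\<integral>y. f (mix (- Pow D) (act \<pi> x) y) \<partial>unifs)"
  proof -
    have "inj ((`) \<pi>)" using inj_image_eq_iff[OF assms(1)] by (simp add: inj_on_def)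
    then show ?thesis
      using bm_mix[OF assms(2), of "- Pow D" "act \<pi> x"] unfolding act_def
      by (intro integral_unifs_reindex[where f="\<lambda>y. f (mix (- Pow D) (\<lambda>s. x (\<pi> ` s)) y)"]) (auto simp: bm_def)
  qed
  finally show ?thesis by (simp add: Cond_def)
qed

locale borel_graphon =
  fixes W :: "real \<Rightarrow> real \<Rightarrow> real" and r :: nat
  assumes W_meas: "(\<lambda>p. W (fst p) (snd p)) \<in> borel_measurable (borel \<Otimes>\<^sub>M borel)"
    and W_sym: "W x y = W y x" and W_nonneg: "0 \<le> W x y" and W_le: "W x y \<le> 1"
    and r2: "r \<ge> 2"
begin

text \<open>All randomness is driven by i.i.d. uniform variables indexed by sets of vertices: \<open>\<omega> {i}\<close> is the type
  of vertex \<open>i\<close>, and the edge \<open>{i, j}\<close> is present iff \<open>\<omega> {i, j} \<le> W (\<omega> {i}) (\<omega> {j})\<close>. Conditioning on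
  everything that concerns a vertex set \<open>C\<close> is then \<open>Cond C\<close>, i.e. resampling outside \<open>Pow C\<close>.\<close>

definition edge :: "(nat set \<Rightarrow> real) \<Rightarrow> nat set \<Rightarrow> real" where
  "edge \<omega> p = (if \<omega> p \<le> W (\<omega> {Min p}) (\<omega> {Max p}) then 1 else 0)"

definition H :: "nat set \<Rightarrow> (nat set \<Rightarrow> real) \<Rightarrow> real" where
  "H S \<omega> = (\<Prod>p\<in>pairs S. edge \<omega> p)"

definition tt :: real where
  "tt = (\<integral>\<omega>. H {..<r} \<omega> \<partial>unifs)"

lemma W_meas2 [measurable (raw)]:
  assumes "f \<in> borel_measurable M" "g \<in> borel_measurable M"
  shows "(\<lambda>x. W (f x) (g x)) \<in> borel_measurable M"
  using measurable_compose[OF measurable_Pair[OF assms] W_meas] by simp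

lemma edge_doubleton: "i \<noteq> j \<Longrightarrow> edge \<omega> {i, j} = (if \<omega> {i, j} \<le> W (\<omega> {i}) (\<omega> {j}) then 1 else 0)"
  by (cases "i < j") (auto simp: edge_def min_def max_def W_sym)

lemma edge_act: "inj \<pi> \<Longrightarrow> card p = 2 \<Longrightarrow> edge (act \<pi> \<omega>) p = edge \<omega> (\<pi> ` p)"
  by (auto simp: card_2_iff edge_doubleton act_def inj_eq)

lemma edge_measurable [measurable]: "(\<lambda>\<omega>. edge \<omega> p) \<in> borel_measurable unifs"
  unfolding edge_def by measurable

lemma H_measurable [measurable]: "H S \<in> borel_measurable unifs"
  unfolding H_def[abs_def] by measurable

lemma edge_01: "edge \<omega> p = 0 \<or> edge \<omega> p = 1"
  by (simp add: edge_def)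

lemma H_nonneg: "0 \<le> H S \<omega>" and H_le: "H S \<omega> \<le> 1"
  unfolding H_def by (intro prod_nonneg prod_le_1; auto simp: edge_def)+

lemma bm_H [simp]: "bm unifs (H S)"
  using H_nonneg H_le by (intro bmI[of _ _ 1]) (auto simp: abs_le_iff intro: order_trans[of _ 0])

text \<open>The coordinate of the empty set is never read. It lies in every \<open>Pow C\<close> and
  is therefore never resampled, so having it exempted lets conditioning on no vertex be identified
  with plain integration.\<close>

lemma H_cong:
  assumes "\<And>s. s \<subseteq> S \<Longrightarrow> s \<noteq> {} \<Longrightarrow> x s = y s" shows "H S x = H S y"
  unfolding H_def
proof (rule prod.cong[OF refl])
  fix p assume "p \<in> pairs S"
  then obtain i j where "p = {i, j}" "i \<noteq> j" "i \<in> S" "j \<in> S" by (auto simp: pairs_def card_2_iff)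
  then show "edge x p = edge y p" using assms by (simp add: edge_doubleton)
qed

lemma H_act:
  assumes "inj \<pi>" shows "H S (act \<pi> \<omega>) = H (\<pi> ` S) \<omega>"
proof -
  have "H (\<pi> ` S) \<omega> = (\<Prod>p\<in>pairs S. edge \<omega> (\<pi> ` p))"
    unfolding H_def pairs_image[OF assms]
    using inj_image_eq_iff[OF assms] by (subst prod.reindex) (auto simp: inj_on_def)
  also have "\<dots> = H S (act \<pi> \<omega>)"
    unfolding H_def using edge_act[OF assms] by (intro prod.cong) (auto simp: pairs_def)
  finally show ?thesis by simp
qed

definition enlarge :: "nat set \<Rightarrow> nat set" where
  "enlarge D = (SOME S. D \<subseteq> S \<and> finite S \<and> card S = r)"

text \<open>The conditional probability that an \<open>r\<close>-set containing \<open>D\<close>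
  spans a clique, given everything inside \<open>D\<close>. It does not depend on the superset, so
  choosing one makes \<open>D\<close> the only index.\<close>

definition J :: "nat set \<Rightarrow> (nat set \<Rightarrow> real) \<Rightarrow> real" where
  "J D = Cond D (H (enlarge D))"

lemma enlarge:
  assumes "finite D" "card D \<le> r"
  shows "D \<subseteq> enlarge D" "finite (enlarge D)" "card (enlarge D) = r"
proof -
  obtain E where "finite E" "card E = r - card D" "E \<subseteq> - D"
    using infinite_arbitrarily_large[of "- D" "r - card D"] assms(1) by (metis finite_Diff2 Compl_eq_Diff_UNIV infinite_UNIV_nat)
  then have "D \<subseteq> D \<union> E \<and> finite (D \<union> E) \<and> card (D \<union> E) = r"
    using assms by (subst card_Un_disjoint) auto
  then show "D \<subseteq> enlarge D" "finite (enlarge D)" "card (enlarge D) = r"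
    unfolding enlarge_def by (metis (mono_tags, lifting) someI_ex)+
qed

lemma bm_J [simp]: "bm unifs (J D)"
  unfolding J_def by (intro bm_Cond bm_H)

lemma J_measurable [measurable]: "J D \<in> borel_measurable unifs"
  using bm_J by (simp add: bm_def)

text \<open>A relabelling that fixes \<open>D\<close> pointwise carries \<open>S\<close> to the
  chosen superset, and the conditional expectation given \<open>D\<close> is blind to it.\<close>

lemma Cond_H_subset:
  assumes "D \<subseteq> S" "finite S" "card S = r"
  shows "Cond D (H S) x = J D x"
proof -
  have fD: "finite D" "card D \<le> r" using assms by (auto intro: finite_subset card_mono)
  obtain \<pi> where pi: "inj \<pi>" "\<pi> ` S = enlarge D" "\<And>x. x \<in> D \<Longrightarrow> \<pi> x = x"
    by (rule extend_partial_identity[of S "enlarge D" D]) (use assms enlarge[OF fD] in auto)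
  have D: "\<pi> ` s = s" if "s \<subseteq> D" for s using that pi(3) by force
  have "Cond D (H S) x = Cond D (H S) (act \<pi> x)" by (rule Cond_cong) (auto simp: act_def D)
  also have "\<dots> = Cond (\<pi> ` D) (\<lambda>x. H S (act \<pi> x)) x" by (rule Cond_act[OF pi(1) bm_H])
  also have "\<dots> = J D x" by (simp add: D H_act[OF pi(1)] pi(2) J_def)
  finally show ?thesis .
qed

lemma Cond_H:
  assumes "finite S" "card S = r" shows "Cond C (H S) x = J (C \<inter> S) x"
proof -
  have "H S (mix (- Pow C) x y) = H S (mix (- Pow (C \<inter> S)) x y)" for y
    by (rule H_cong) (auto simp: mix_def)
  then have "Cond C (H S) x = Cond (C \<inter> S) (H S) x" by (simp add: Cond_def)
  also have "\<dots> = J (C \<inter> S) x" using assms by (intro Cond_H_subset) auto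
  finally show ?thesis .
qed

lemma Cond_J:
  assumes "finite D" "card D \<le> r" shows "Cond C (J D) x = J (C \<inter> D) x"
proof -
  have "Cond C (J D) x = Cond (C \<inter> D) (H (enlarge D)) x" unfolding J_def by (rule Cond_Cond) simp
  also have "\<dots> = J (C \<inter> D) x" using enlarge[OF assms] by (intro Cond_H_subset) auto
  finally show ?thesis .
qed

lemma J_act:
  assumes "finite D" "card D \<le> r" "inj \<pi>" shows "J D (act \<pi> x) = J (\<pi> ` D) x"
proof -
  have "J D (act \<pi> x) = Cond (\<pi> ` D) (\<lambda>x. H (enlarge D) (act \<pi> x)) x"
    unfolding J_def by (rule Cond_act[OF assms(3) bm_H])
  also have "\<dots> = Cond (\<pi> ` D) (H (\<pi> ` enlarge D)) x" by (simp add: H_act[OF assms(3)])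
  also have "\<dots> = J (\<pi> ` D) x"
    using enlarge[OF assms(1,2)] assms(3) by (intro Cond_H_subset) (auto simp: card_image inj_on_subset)
  finally show ?thesis .
qed

lemma J_mix: "D \<subseteq> C \<Longrightarrow> J D (mix (- Pow C) x y) = J D x"
  unfolding J_def by (rule Cond_mix)

lemma J_empty: "J {} x = tt"
proof -
  have "J {} x = Cond {} (H {..<r}) x" by (rule Cond_H_subset[symmetric]) auto
  also have "\<dots> = (\<integral>y. H {..<r} y \<partial>unifs)"
    unfolding Cond_def by (intro Bochner_Integration.integral_cong refl H_cong) (auto simp: mix_def)
  finally show ?thesis by (simp add: tt_def)
qed

lemma integral_Cond: assumes "bm unifs f" shows "(\<integral>x. Cond C f x \<partial>unifs) = (\<integral>x. f x \<partial>unifs)"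
  unfolding Cond_def using assms by (intro unifs.integral_mix[symmetric] unifs.P.bm_integrable)

lemma integral_H: assumes "finite S" "card S = r" shows "(\<integral>x. H S x \<partial>unifs) = tt"
proof -
  have "(\<integral>x. H S x \<partial>unifs) = (\<integral>x. Cond {} (H S) x \<partial>unifs)" by (simp add: integral_Cond)
  also have "\<dots> = tt" using assms by (simp add: Cond_H_subset J_empty unifs.P.prob_space[simplified])
  finally show ?thesis .
qed

lemma integral_J: assumes "finite D" "card D \<le> r" shows "(\<integral>x. J D x \<partial>unifs) = tt"
  unfolding J_def using enlarge[OF assms] by (simp add: integral_Cond integral_H)

lemma tt_bounds: "0 \<le> tt" "tt \<le> 1"
proof -
  show "0 \<le> tt" unfolding tt_def using H_nonneg by (intro integral_nonneg_AE) auto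
  have "tt \<le> (\<integral>\<omega>. 1 \<partial>(unifs :: (nat set \<Rightarrow> real) measure))"
    unfolding tt_def using H_le by (intro integral_mono unifs.P.bm_integrable) auto
  then show "tt \<le> 1" by (simp add: unifs.P.prob_space[simplified])
qed

lemma J_bounds: "0 \<le> J D x" "J D x \<le> 1"
proof -
  show "0 \<le> J D x" unfolding J_def Cond_def using H_nonneg by (intro integral_nonneg_AE) auto
  have "J D x \<le> (\<integral>\<omega>. 1 \<partial>(unifs :: (nat set \<Rightarrow> real) measure))"
    unfolding J_def Cond_def using H_le bm_mix[OF bm_H] by (intro integral_mono unifs.P.bm_integrable) auto
  then show "J D x \<le> 1" by (simp add: unifs.P.prob_space[simplified])
qed

section \<open>Hoeffding projections of the clique count\<close>

lemma ksubsets_card: "S \<in> ksubsets n k \<Longrightarrow> card S = k"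
  by (simp add: ksubsets_def)

definition X :: "nat \<Rightarrow> (nat set \<Rightarrow> real) \<Rightarrow> real" where
  "X n \<omega> = (\<Sum>S\<in>ksubsets n r. H S \<omega>)"

lemma X_measurable [measurable]: "X n \<in> borel_measurable unifs"
  unfolding X_def[abs_def] by measurable

lemma integral_X: "(\<integral>\<omega>. X n \<omega> \<partial>unifs) = real (n choose r) * tt"
proof -
  have "(\<integral>\<omega>. X n \<omega> \<partial>unifs) = (\<Sum>S\<in>ksubsets n r. \<integral>\<omega>. H S \<omega> \<partial>unifs)"
    unfolding X_def by (intro Bochner_Integration.integral_sum unifs.P.bm_integrable bm_H)
  also have "\<dots> = (\<Sum>S\<in>ksubsets n r. tt)"
    by (intro sum.cong refl integral_H ksubsets_finite ksubsets_card)
  finally show ?thesis by (simp add: card_ksubsets)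
qed

text \<open>What remains of a clique indicator after its mean and its level-\<open>d\<close>
  projections are removed; meaningful when all lower levels vanish.\<close>

definition R :: "nat \<Rightarrow> nat set \<Rightarrow> (nat set \<Rightarrow> real) \<Rightarrow> real" where
  "R d S \<omega> = H S \<omega> - tt - (\<Sum>D\<in>{D. D \<subseteq> S \<and> card D = d}. J D \<omega> - tt)"

lemma bm_R [simp]: "bm unifs (R d S)"
  unfolding R_def[abs_def] by (intro bm_diff bm_sum bm_H bm_J bm_const)

text \<open>Conditioning on \<open>T\<close> replaces every set by its intersection with
  \<open>T\<close>. If \<open>S\<close> and \<open>T\<close> share fewer than \<open>d\<close>
  vertices all terms are degenerate; if they share exactly \<open>d\<close>, the only surviving
  projection is that of the intersection itself, and it cancels the conditioned indicator.\<close>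

lemma R_orthogonal:
  assumes deg: "\<And>D. finite D \<Longrightarrow> card D < d \<Longrightarrow> AE \<omega> in unifs. J D \<omega> = tt"
    and S: "finite S" "card S = r" and T: "finite T" "card T = r" and "d \<le> r" and ST: "card (S \<inter> T) \<le> d"
  shows "(\<integral>\<omega>. R d T \<omega> * R d S \<omega> \<partial>unifs) = 0"
proof -
  let ?D = "{D. D \<subseteq> S \<and> card D = d}"
  have fD: "finite ?D" using S(1) by simp
  have Rm: "R d T (mix (- Pow T) x y) = R d T x" for x y
  proof -
    have "H T (mix (- Pow T) x y) = H T x" by (rule H_cong) (auto simp: mix_def)
    moreover have "(\<Sum>D\<in>{D. D \<subseteq> T \<and> card D = d}. J D (mix (- Pow T) x y) - tt) = (\<Sum>D\<in>{D. D \<subseteq> T \<and> card D = d}. J D x - tt)"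
      by (intro sum.cong refl) (simp add: J_mix)
    ultimately show ?thesis by (simp add: R_def)
  qed
  have cR: "Cond T (R d S) x = J (T \<inter> S) x - tt - (\<Sum>D\<in>?D. J (T \<inter> D) x - tt)" for x
  proof -
    have i: "integrable unifs (\<lambda>y. H S (mix (- Pow T) x y))" "\<And>D. integrable unifs (\<lambda>y. J D (mix (- Pow T) x y))"
      by (intro unifs.P.bm_integrable bm_mix bm_H bm_J)+
    have "Cond T (R d S) x = Cond T (H S) x - tt - (\<Sum>D\<in>?D. Cond T (J D) x - tt)"
      unfolding Cond_def R_def using i by (simp add: unifs.P.prob_space[simplified])
    also have "\<dots> = J (T \<inter> S) x - tt - (\<Sum>D\<in>?D. J (T \<inter> D) x - tt)"
    proof -
      have "(\<Sum>D\<in>?D. Cond T (J D) x - tt) = (\<Sum>D\<in>?D. J (T \<inter> D) x - tt)"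
        using S(1) \<open>d \<le> r\<close> by (intro sum.cong refl) (auto simp: Cond_J finite_subset)
      then show ?thesis using S by (simp add: Cond_H)
    qed
    finally show ?thesis .
  qed
  have "AE x in unifs. Cond T (R d S) x = 0"
  proof -
    have "AE x in unifs. \<forall>E\<in>{E. E \<subseteq> S \<and> card E < d}. J E x = tt"
      using S(1) deg by (intro AE_finite_allI) (auto intro: finite_subset)
    then show ?thesis
    proof eventually_elim
      case (elim x)
      have e: "J E x = tt" if "E \<subseteq> S" "card E < d" for E using elim that by auto
      show ?case
      proof (cases "card (T \<inter> S) < d")
        case True
        have "J (T \<inter> D) x = tt" if "D \<in> ?D" for D
        proof -
          have "card (T \<inter> D) \<le> card (T \<inter> S)" using that S(1) by (intro card_mono) auto
          then show ?thesis using that True by (intro e) auto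
        qed
        then show ?thesis unfolding cR using e[of "T \<inter> S"] True by simp
      next
        case False
        then have c: "card (T \<inter> S) = d" using ST by (simp add: Int_commute)
        have "J (T \<inter> D) x - tt = (if D = T \<inter> S then J (T \<inter> S) x - tt else 0)" if D: "D \<in> ?D" for D
        proof (cases "D = T \<inter> S")
          case True
          then show ?thesis by (simp add: Int_absorb1)
        next
          case False
          have "T \<inter> D \<noteq> D"
          proof
            assume "T \<inter> D = D"
            then have "D \<subseteq> T \<inter> S" using D by auto
            then show False using False D c S(1) card_subset_eq[of "T \<inter> S" D] by auto
          qed
          then have "T \<inter> D \<subset> D" by auto
          then have "card (T \<inter> D) < d" using D S(1) psubset_card_mono[of D "T \<inter> D"] finite_subset[of D S] by auto
          then show ?thesis using False D e[of "T \<inter> D"] by auto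
        qed
        then have "(\<Sum>D\<in>?D. J (T \<inter> D) x - tt) = (\<Sum>D\<in>?D. if D = T \<inter> S then J (T \<inter> S) x - tt else 0)"
          by (intro sum.cong) auto
        also have "\<dots> = J (T \<inter> S) x - tt" using fD c by (subst sum.delta) auto
        finally show ?thesis unfolding cR by simp
      qed
    qed
  qed
  moreover have "(\<integral>\<omega>. R d T \<omega> * R d S \<omega> \<partial>unifs) = (\<integral>\<omega>. R d T \<omega> * Cond T (R d S) \<omega> \<partial>unifs)"
    unfolding Cond_def by (intro unifs.integral_mult_resample unifs.P.bm_integrable bm_mult bm_R Rm)
  moreover have [measurable]: "R d T \<in> borel_measurable unifs" "Cond T (R d S) \<in> borel_measurable unifs"
    using bm_R bm_Cond[OF bm_R] by (auto simp: bm_def)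
  ultimately have "(\<integral>\<omega>. R d T \<omega> * R d S \<omega> \<partial>unifs) = (\<integral>\<omega>. 0 \<partial>(unifs :: (nat set \<Rightarrow> real) measure))"
    by (simp only:) (intro integral_cong_AE; auto)
  then show ?thesis by simp
qed

lemma R_bound: assumes "finite S" "card S = r" shows "\<bar>R d S \<omega>\<bar> \<le> 2 + 2 ^ r"
proof -
  have j: "\<bar>J D \<omega> - tt\<bar> \<le> 1" for D using J_bounds[of D \<omega>] tt_bounds by (simp add: abs_le_iff)
  have "\<bar>\<Sum>D\<in>{D. D \<subseteq> S \<and> card D = d}. J D \<omega> - tt\<bar> \<le> (\<Sum>D\<in>{D. D \<subseteq> S \<and> card D = d}. 1)"
    by (intro order_trans[OF sum_abs] sum_mono j)
  also have "\<dots> \<le> real (card (Pow S))"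
    using assms(1) by (simp, intro card_mono) auto
  also have "\<dots> = 2 ^ r" using assms by (simp add: card_Pow)
  finally show ?thesis using H_nonneg[of S \<omega>] H_le[of S \<omega>] tt_bounds unfolding R_def by (simp add: abs_le_iff) 
qed

text \<open>Double counting: each \<open>d\<close>-set lies in \<open>(n - d) choose (r - d)\<close>
  of the \<open>r\<close>-sets.\<close>

lemma sum_R:
  assumes "d \<le> r"
  shows "(\<Sum>S\<in>ksubsets n r. R d S \<omega>) = X n \<omega> - real (n choose r) * tt - real ((n - d) choose (r - d)) * (\<Sum>D\<in>ksubsets n d. J D \<omega> - tt)"
proof -
  have "(\<Sum>S\<in>ksubsets n r. \<Sum>D\<in>{D. D \<subseteq> S \<and> card D = d}. J D \<omega> - tt) = (\<Sum>S\<in>ksubsets n r. \<Sum>D\<in>{D\<in>ksubsets n d. D \<subseteq> S}. J D \<omega> - tt)"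
    by (intro sum.cong refl) (auto simp: ksubsets_def)
  also have "\<dots> = (\<Sum>D\<in>ksubsets n d. \<Sum>S\<in>{S\<in>ksubsets n r. D \<subseteq> S}. J D \<omega> - tt)"
    by (rule sum.swap_restrict) auto
  also have "\<dots> = (\<Sum>D\<in>ksubsets n d. real ((n - d) choose (r - d)) * (J D \<omega> - tt))"
  proof (intro sum.cong refl)
    fix D assume D: "D \<in> ksubsets n d"
    then have D': "D \<subseteq> {..<n}" "finite D" "card D = d" by (auto simp: ksubsets_def intro: finite_subset)
    have "bij_betw (\<lambda>S. S - D) {S\<in>ksubsets n r. D \<subseteq> S} {E. E \<subseteq> {..<n} - D \<and> card E = r - d}"
    proof (rule bij_betw_byWitness[where f'="\<lambda>E. E \<union> D"])
      show "(\<lambda>S. S - D) ` {S\<in>ksubsets n r. D \<subseteq> S} \<subseteq> {E. E \<subseteq> {..<n} - D \<and> card E = r - d}"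
        using D' by (auto simp: ksubsets_def card_Diff_subset)
      have "card (E \<union> D) = r" if "E \<subseteq> {..<n} - D" "card E = r - d" for E
      proof -
        have "finite E" using that(1) by (rule finite_subset) simp
        then show ?thesis using that D' assms by (subst card_Un_disjoint) auto
      qed
      then show "(\<lambda>E. E \<union> D) ` {E. E \<subseteq> {..<n} - D \<and> card E = r - d} \<subseteq> {S\<in>ksubsets n r. D \<subseteq> S}"
        using D' by (auto simp: ksubsets_def)
    qed auto
    then have "card {S\<in>ksubsets n r. D \<subseteq> S} = card {E. E \<subseteq> {..<n} - D \<and> card E = r - d}" by (rule bij_betw_same_card)
    also have "\<dots> = (n - d) choose (r - d)" using D' by (simp add: n_subsets card_Diff_subset)
    finally show "(\<Sum>S\<in>{S\<in>ksubsets n r. D \<subseteq> S}. J D \<omega> - tt) = real ((n - d) choose (r - d)) * (J D \<omega> - tt)" by simp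
  qed
  finally show ?thesis
    unfolding R_def X_def by (simp add: sum_subtractf card_ksubsets sum_distrib_left right_diff_distrib)
qed

text \<open>Remainders are orthogonal unless the sets share at least \<open>d + 1\<close> vertices,
  so the error is one power of \<open>n\<close> below the order \<open>2 * r - d\<close> that the
  normalisation takes out.\<close>

theorem projection_error:
  assumes deg: "\<And>D. finite D \<Longrightarrow> card D < d \<Longrightarrow> AE \<omega> in unifs. J D \<omega> = tt" and "d \<le> r"
  shows "(\<integral>\<omega>. (X n \<omega> - real (n choose r) * tt - real ((n - d) choose (r - d)) * (\<Sum>D\<in>ksubsets n d. J D \<omega> - tt))\<^sup>2 \<partial>unifs)
    \<le> (2 + 2 ^ r)\<^sup>2 * 2 ^ r * real n ^ (2 * r - (d + 1))"
proof (cases "d = r")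
  \<comment> \<open>Here the overlap \<open>d + 1\<close> would exceed \<open>r\<close>; the
    level-\<open>r\<close> projection is the clique indicator itself and the remainder is
    identically 0.\<close>
  case True
  have "R d S \<omega> = 0" if "finite S" "card S = r" for S \<omega>
  proof -
    have "{D. D \<subseteq> S \<and> card D = d} = {S}" using that True by (auto dest: card_subset_eq)
    moreover have "J S \<omega> = H S \<omega>"
    proof -
      have "H S (mix (- Pow S) \<omega> y) = H S \<omega>" for y by (rule H_cong) (auto simp: mix_def)
      then have "Cond S (H S) \<omega> = H S \<omega>" by (simp add: Cond_def unifs.P.prob_space[simplified])
      then show ?thesis using Cond_H_subset[of S S \<omega>] that by simp
    qed
    ultimately show ?thesis by (simp add: R_def)
  qed
  then have "(\<Sum>S\<in>ksubsets n r. R d S \<omega>) = 0" for \<omega>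
    by (intro sum.neutral ballI) (metis ksubsets_finite ksubsets_card)
  then have "X n \<omega> - real (n choose r) * tt - real ((n - d) choose (r - d)) * (\<Sum>D\<in>ksubsets n d. J D \<omega> - tt) = 0" for \<omega>
    using sum_R[OF assms(2), of \<omega> n] by simp
  then show ?thesis by (simp only:) simp
next
  case False
  then have d: "d < r" using assms(2) by simp
  have ks: "finite S" "card S = r" if "S \<in> ksubsets n r" for S using that by (auto simp: ksubsets_def intro: finite_subset)
  have "(\<integral>\<omega>. (\<Sum>S\<in>ksubsets n r. R d S \<omega>)\<^sup>2 \<partial>unifs) \<le> (2 + 2 ^ r)\<^sup>2 * 2 ^ r * real n ^ (2 * r - (d + 1))"
  proof (rule unifs.P.second_moment_sum_ksubsets(2))
    show "R d S \<in> borel_measurable unifs" for S using bm_R by (simp add: bm_def)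
    show "integrable unifs (\<lambda>x. (R d S x)\<^sup>2)" for S by (intro unifs.P.bm_integrable bm_power bm_R)
    show "(\<integral>x. (R d S x)\<^sup>2 \<partial>unifs) \<le> (2 + 2 ^ r)\<^sup>2" if S: "S \<in> ksubsets n r" for S
    proof -
      have "(\<integral>x. (R d S x)\<^sup>2 \<partial>unifs) \<le> (\<integral>x. (2 + 2 ^ r)\<^sup>2 \<partial>(unifs :: (nat set \<Rightarrow> real) measure))"
      proof (intro integral_mono unifs.P.bm_integrable bm_power bm_R bm_const)
        show "(R d S x)\<^sup>2 \<le> (2 + 2 ^ r)\<^sup>2" for x
          using R_bound[OF ks[OF S], of d x] power_mono[of "\<bar>R d S x\<bar>" "2 + 2 ^ r" 2] by simp
      qed
      then show ?thesis by (simp add: unifs.P.prob_space[simplified])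
    qed
    show "(\<integral>x. R d T x * R d S x \<partial>unifs) = 0" if "S \<in> ksubsets n r" "T \<in> ksubsets n r" "card (S \<inter> T) < d + 1" for S T
      using ks that d by (intro R_orthogonal deg) auto
  qed (use d in auto)
  then show ?thesis using d by (simp add: sum_R)
qed

end

section \<open>The random graph as a function of uniform variables\<close>

text \<open>A graphon is only Lebesgue measurable, so the law of the edges as a function of the
  types is merely almost everywhere equal to a measurable one; this is where the completion of the
  law of the types enters.\<close>

lemma measurable_completion_AE:
  fixes f g :: "'a \<Rightarrow> 'b::topological_space"
  assumes g: "g \<in> borel_measurable M" and eq: "AE x in M. f x = g x"
  shows "f \<in> borel_measurable (completion M)"
proof (rule measurableI)
  fix B :: "'b set" assume B: "B \<in> sets borel"
  obtain N where N: "N \<in> null_sets M" "{x \<in> space M. f x \<noteq> g x} \<subseteq> N"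
    using eq by (auto elim!: AE_E simp: null_sets_def)
  have "f -` B \<inter> space (completion M) = (g -` B \<inter> space M - N) \<union> (f -` B \<inter> space M \<inter> N)"
    using N(2) by auto
  moreover have "g -` B \<inter> space M - N \<in> sets M"
    using measurable_sets[OF g B] N(1) by auto
  ultimately show "f -` B \<inter> space (completion M) \<in> sets (completion M)"
    using N(1) by (intro sets_completionI[of _ _ _ N]) auto
qed simp

text \<open>Fubini on two independent coordinates. The exceptional set is described by its sections
  because the same description has to serve when the first type is frozen, as in
  \<open>tcond\<close>.\<close>

lemma AE_two_coordinates:
  fixes s s' :: 'i
  assumes [measurable]: "N \<in> sets (borel \<Otimes>\<^sub>M borel)" and "s \<noteq> s'"
    and N: "AE x in unif01. AE y in unif01. (x, y) \<notin> N"
  shows "AE \<omega> in unifs. (\<omega> s, \<omega> s') \<notin> N"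
proof -
  let ?f = "\<lambda>\<omega>. indicator N (\<omega> s, \<omega> s') :: real"
  have i: "integrable unifs ?f"
    by (rule unifs.P.integrable_const_bound[of _ 1]) (auto simp: indicator_def)
  have "(\<integral>\<omega>. ?f \<omega> \<partial>unifs) = (\<integral>x. (\<integral>y. ?f (mix {s'} x y) \<partial>unifs) \<partial>unifs)" by (rule unifs.integral_mix[OF i])
  also have "\<dots> = (\<integral>x. (\<integral>y. indicator N (x s, y s') \<partial>unifs) \<partial>unifs)" using assms(2) by (simp add: mix_def)
  also have "\<dots> = (\<integral>x. (\<integral>u. indicator N (x s, u) \<partial>unif01) \<partial>unifs)"
    by (subst unifs.integral_coordinate[of "\<lambda>u. indicator N (_, u)"]) auto
  also have "\<dots> = (\<integral>v. (\<integral>u. indicator N (v, u) \<partial>unif01) \<partial>unif01)"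
    by (rule unifs.integral_coordinate) measurable
  also have "\<dots> = (\<integral>v. 0 \<partial>unif01)"
  proof (rule integral_cong_AE)
    show "AE v in unif01. (\<integral>u. indicator N (v, u) \<partial>unif01) = (0::real)"
      using N
    proof eventually_elim
      case (elim v)
      then have "(\<integral>u. indicator N (v, u) \<partial>unif01) = (\<integral>u. 0 \<partial>unif01 :: real)"
        by (intro integral_cong_AE) (auto elim!: eventually_mono)
      then show ?case by simp
    qed
  qed measurable
  finally have "(\<integral>\<omega>. ?f \<omega> \<partial>unifs) = 0" by simp
  then have "AE \<omega> in unifs. ?f \<omega> = 0"
    using integral_nonneg_eq_0_iff_AE[OF i] by auto
  then show ?thesis by (auto elim!: eventually_mono simp: indicator_def split: if_splits)
qed

section \<open>Replacing a graphon by a Borel version\<close>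

lemma AE_unif01_iff: "(AE x in unif01. P x) \<longleftrightarrow> (AE x in lborel. x \<in> {0..1} \<longrightarrow> P x)"
  unfolding unif01_def by (rule AE_uniform_measure) auto

text \<open>A Borel function equal to \<open>W\<close> almost everywhere is truncated to the unit
  interval and made symmetric by evaluating it at the ordered pair; this yields a function with the
  required properties everywhere, not only off a null set.\<close>

lemma graphon_borel_version:
  assumes W: "graphon W" and "r \<ge> 2"
  obtains W' N where "borel_graphon W' r" "N \<in> sets (borel \<Otimes>\<^sub>M borel)"
    "AE x in unif01. AE y in unif01. (x, y) \<notin> N" "\<And>x y. (x, y) \<notin> N \<Longrightarrow> W x y = W' x y"
proof -
  let ?Q = "{0..1::real} \<times> {0..1::real}"
  let ?L = "lborel \<Otimes>\<^sub>M lborel :: (real \<times> real) measure"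
  have Q: "?Q \<in> sets ?L" by simp
  have "(\<lambda>(x, y). W x y) \<in> borel_measurable (restrict_space (completion ?L) ?Q)"
    using W by (simp add: graphon_def)
  then have "(\<lambda>p. indicator ?Q p *\<^sub>R (case p of (x, y) \<Rightarrow> W x y)) \<in> borel_measurable (completion ?L)"
    using Q by (subst (asm) borel_measurable_restrict_space_iff) auto
  from completion_ex_borel_measurable_real[OF this]
  obtain g where g [measurable]: "g \<in> borel_measurable ?L"
    and ae: "AE p in ?L. indicator ?Q p *\<^sub>R (case p of (x, y) \<Rightarrow> W x y) = g p" by blast
  obtain N0 where N0': "{p \<in> space ?L. \<not> indicator ?Q p *\<^sub>R (case p of (x, y) \<Rightarrow> W x y) = g p} \<subseteq> N0" "emeasure ?L N0 = 0" "N0 \<in> sets ?L"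
    using ae by (rule AE_E)
  have N0: "N0 \<in> null_sets ?L" "indicator ?Q p *\<^sub>R (case p of (x, y) \<Rightarrow> W x y) = g p" if "p \<notin> N0" for p
  proof -
    show "N0 \<in> null_sets ?L" using N0'(2,3) by (simp add: null_sets_def)
    have "p \<in> space ?L" by (simp add: space_pair_measure)
    then show "indicator ?Q p *\<^sub>R (case p of (x, y) \<Rightarrow> W x y) = g p" using N0'(1) that by blast
  qed
  have N0null: "N0 \<in> null_sets ?L" using N0'(2,3) by (simp add: null_sets_def)
  define W2 where "W2 x y = min 1 (max 0 (g (x, y)))" for x y
  define W' where "W' x y = W2 (min x y) (max x y)" for x y
  \<comment> \<open>Symmetrisation may read the Borel function at the mirrored point, so the mirror
    image of the exceptional set is excluded too, and so is everything outside the unit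
    square.\<close>
  define N where "N = N0 \<union> {p. (snd p, fst p) \<in> N0} \<union> (UNIV - ?Q)"
  have [measurable]: "N0 \<in> sets (borel \<Otimes>\<^sub>M borel)" "g \<in> borel_measurable (borel \<Otimes>\<^sub>M borel)"
    using N0'(3) g by (simp_all cong: sets_pair_measure_cong measurable_cong_sets)
  have bg: "borel_graphon W' r"
  proof
    show "(\<lambda>p. W' (fst p) (snd p)) \<in> borel_measurable (borel \<Otimes>\<^sub>M borel)"
      unfolding W'_def W2_def by measurable
  qed (auto simp: W'_def W2_def min.commute max.commute \<open>r \<ge> 2\<close>)
  have "{p. (snd p, fst p) \<in> N0} = (\<lambda>p. (snd p, fst p)) -` N0 \<inter> space (borel \<Otimes>\<^sub>M borel)"
    by (auto simp: space_pair_measure)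
  also have "\<dots> \<in> sets (borel \<Otimes>\<^sub>M borel)" by measurable
  finally have sw: "{p. (snd p, fst p) \<in> N0} \<in> sets (borel \<Otimes>\<^sub>M borel)" .
  have N: "N \<in> sets (borel \<Otimes>\<^sub>M borel)"
  proof -
    have "?Q \<in> sets (borel \<Otimes>\<^sub>M borel)" by (rule pair_measureI) auto
    then have "space (borel \<Otimes>\<^sub>M borel) - ?Q \<in> sets (borel \<Otimes>\<^sub>M borel)" by (rule sets.compl_sets)
    then have "UNIV - ?Q \<in> sets (borel \<Otimes>\<^sub>M borel)" by (simp add: space_pair_measure)
    then show ?thesis unfolding N_def using sw by (intro sets.Un) auto
  qed
  have "AE p in ?L. p \<notin> N0" using N0null by (rule AE_not_in)
  then have ae1: "AE x in lborel. AE y in lborel. (x, y) \<notin> N0" by (rule lborel_pair.AE_pair)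
  have "{p \<in> space ?L. (fst p, snd p) \<notin> N0} = space ?L - N0" by auto
  then have "{p \<in> space ?L. (fst p, snd p) \<notin> N0} \<in> sets ?L" using N0'(3) by (simp only: sets.compl_sets)
  from lborel_pair.AE_commute[OF this] ae1 have ae2: "AE y in lborel. AE x in lborel. (x, y) \<notin> N0" by simp
  have Win: "W x y = W' x y" if "(x, y) \<notin> N" for x y
  proof -
    have xy: "x \<in> {0..1}" "y \<in> {0..1}" "(x, y) \<notin> N0" "(y, x) \<notin> N0" using that by (auto simp: N_def)
    then have W01: "W x y = W y x" "0 \<le> W x y" "W x y \<le> 1" using W by (auto simp: graphon_def)
    have "g (x, y) = W x y" "g (y, x) = W x y" using N0(2)[OF xy(3)] N0(2)[OF xy(4)] xy(1,2) W01(1) by auto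
    then show ?thesis using W01 by (auto simp: W'_def W2_def min_def max_def)
  qed
  have "AE x in lborel. x \<in> {0..1} \<longrightarrow> (AE y in unif01. (x, y) \<notin> N)"
    using ae1 ae2
  proof eventually_elim
    case (elim x)
    have "AE y in lborel. y \<in> {0..1} \<longrightarrow> x \<in> {0..1} \<longrightarrow> (x, y) \<notin> N"
      using elim by eventually_elim (auto simp: N_def)
    then have "AE y in unif01. x \<in> {0..1} \<longrightarrow> (x, y) \<notin> N"
      unfolding unif01_def by (intro AE_uniform_measureI) auto
    then show ?case by (auto elim!: eventually_mono)
  qed
  then have "AE x in unif01. AE y in unif01. (x, y) \<notin> N"
    unfolding unif01_def by (intro AE_uniform_measureI) auto
  then show thesis using bg N Win by (intro that)
qed

section \<open>Edges as thresholds of uniform variables\<close>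

lemma bernoulli_uniform:
  assumes "0 \<le> w" "w \<le> 1"
  shows "measure_pmf (bernoulli_pmf w) = distr unif01 (count_space UNIV) (\<lambda>u. u \<le> w)"
proof (rule measure_eqI_countable[of _ UNIV])
  fix b :: bool
  show "emeasure (measure_pmf (bernoulli_pmf w)) {b} = emeasure (distr unif01 (count_space UNIV) (\<lambda>u. u \<le> w)) {b}"
  proof (cases b)
    case True
    have "(\<lambda>u. u \<le> w) -` {True} \<inter> space unif01 = {..w}" by auto
    then show ?thesis
      using assms True measure_unif01_atMost[OF assms]
      by (subst emeasure_distr) (simp_all add: emeasure_pmf_single unifs.M.emeasure_eq_measure)
  next
    case nb: False
    have "(\<lambda>u. u \<le> w) -` {False} \<inter> space unif01 = {w<..}" by (intro set_eqI) (simp add: not_le)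
    then show ?thesis
      using assms \<open>\<not> b\<close> measure_unif01_greaterThan[OF assms]
      by (subst emeasure_distr) (simp_all add: emeasure_pmf_single unifs.M.emeasure_eq_measure)
  qed
qed auto

lemma finite_vpairs [simp]: "finite (vpairs n)"
  by (rule finite_subset[of _ "{..<n} \<times> {..<n}"]) (auto simp: vpairs_def)

lemma edge_set_image: "edge_set n e = (\<lambda>p. {fst p, snd p}) ` {p \<in> vpairs n. e p}"
proof (intro set_eqI iffI)
  fix s assume "s \<in> edge_set n e"
  then obtain i j where "s = {i, j}" "i < j" "j < n" "e (i, j)" by (auto simp: edge_set_def)
  then show "s \<in> (\<lambda>p. {fst p, snd p}) ` {p \<in> vpairs n. e p}"
    by (intro image_eqI[of _ _ "(i, j)"]) (auto simp: vpairs_def)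
next
  fix s assume "s \<in> (\<lambda>p. {fst p, snd p}) ` {p \<in> vpairs n. e p}"
  then obtain i j where "s = {i, j}" "(i, j) \<in> vpairs n" "e (i, j)" by auto
  then show "s \<in> edge_set n e" unfolding edge_set_def vpairs_def by blast
qed

text \<open>The target carries the discrete sigma-algebra of an uncountable type; measurability
  holds because the map factors through the finite set of subsets of
  \<open>vpairs n\<close>.\<close>

lemma measurable_edge_set:
  assumes [measurable]: "\<And>p. p \<in> vpairs n \<Longrightarrow> Measurable.pred M (\<lambda>x. e x p)"
  shows "(\<lambda>x. edge_set n (e x)) \<in> measurable M (count_space UNIV)"
proof -
  have "(\<lambda>x. {p \<in> vpairs n. e x p}) \<in> measurable M (count_space (Pow (vpairs n)))"
  proof (subst measurable_count_space_eq2, simp, intro conjI ballI)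
    fix B assume B: "B \<in> Pow (vpairs n)"
    have "(\<lambda>x. {p \<in> vpairs n. e x p}) -` {B} \<inter> space M = {x \<in> space M. \<forall>p\<in>vpairs n. e x p \<longleftrightarrow> p \<in> B}"
      using B by auto
    also have "\<dots> \<in> sets M" by measurable
    finally show "(\<lambda>x. {p \<in> vpairs n. e x p}) -` {B} \<inter> space M \<in> sets M" .
  qed auto
  then show ?thesis unfolding edge_set_image by (rule measurable_compose) simp
qed

context borel_graphon
begin

definition Ugraph :: "nat \<Rightarrow> (nat \<Rightarrow> real) \<Rightarrow> (nat \<times> nat \<Rightarrow> real) \<Rightarrow> nat set set" where
  "Ugraph n U y = edge_set n (\<lambda>p. y p \<le> W (U (fst p)) (U (snd p)))"

lemma measurable_Ugraph:
  assumes D: "\<And>i. i < n \<Longrightarrow> sets (D i) = sets borel"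
  shows "(\<lambda>z. Ugraph n (fst z) (snd z)) \<in> measurable (PiM {..<n} D \<Otimes>\<^sub>M PiM (vpairs n) (\<lambda>_. unif01)) (count_space UNIV)"
  unfolding Ugraph_def
proof (rule measurable_edge_set)
  fix p assume p: "p \<in> vpairs n"
  then have pn: "fst p < n" "snd p < n" by (auto simp: vpairs_def)
  let ?M = "PiM {..<n} D \<Otimes>\<^sub>M PiM (vpairs n) (\<lambda>_. unif01)"
  have c: "(\<lambda>z. fst z i) \<in> borel_measurable ?M" if "i < n" for i
    using measurable_compose[OF measurable_fst measurable_component_singleton[of i "{..<n}" D]] that D[OF that]
    by (simp cong: measurable_cong_sets)
  have [measurable]: "(\<lambda>z. fst z (fst p)) \<in> borel_measurable ?M" "(\<lambda>z. fst z (snd p)) \<in> borel_measurable ?M"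
    using c[of "fst p"] c[of "snd p"] pn by auto
  have [measurable]: "(\<lambda>z. snd z p) \<in> borel_measurable ?M"
    using measurable_compose[OF measurable_snd measurable_component_singleton[of p "vpairs n" "\<lambda>_. unif01"]] p
    by (simp cong: measurable_cong_sets)
  show "Measurable.pred ?M (\<lambda>z. snd z p \<le> W (fst z (fst p)) (fst z (snd p)))" by measurable
qed

lemma bernoulli_graph:
  "distr (PiM (vpairs n) (\<lambda>p. measure_pmf (bernoulli_pmf (W (U (fst p)) (U (snd p)))))) (count_space UNIV) (edge_set n)
    = distr (PiM (vpairs n) (\<lambda>_. unif01)) (count_space UNIV) (Ugraph n U)"
proof -
  let ?V = "vpairs n" and ?w = "\<lambda>p. W (U (fst p)) (U (snd p))"
  let ?B = "\<lambda>p. measure_pmf (bernoulli_pmf (?w p))"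
  let ?h = "\<lambda>y. \<lambda>p\<in>?V. y p \<le> ?w p"
  have hm: "?h \<in> measurable (PiM ?V (\<lambda>_. unif01)) (PiM ?V ?B)"
    by (rule measurable_restrict) measurable
  interpret B: product_prob_space ?B ?V by (intro product_prob_spaceI prob_space_measure_pmf)
  have "distr (PiM ?V (\<lambda>_. unif01)) (PiM ?V ?B) ?h = PiM ?V ?B"
  proof (rule B.PiM_eqI)
    fix A
    have pre: "?h -` Pi\<^sub>E ?V A \<inter> space (PiM ?V (\<lambda>_. unif01)) = Pi\<^sub>E ?V (\<lambda>p. {u. (u \<le> ?w p) \<in> A p})"
      by (force simp: space_PiM PiE_iff extensional_def)
    have m: "{u. (u \<le> ?w p) \<in> A p} \<in> sets borel" for p
    proof -
      have "{u. (u \<le> ?w p) \<in> A p} = (\<lambda>u. u \<le> ?w p) -` A p \<inter> space borel" by auto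
      also have "\<dots> \<in> sets borel" by (rule measurable_sets[of _ _ "count_space UNIV"]) auto
      finally show ?thesis .
    qed
    have "emeasure (distr (PiM ?V (\<lambda>_. unif01)) (PiM ?V ?B) ?h) (Pi\<^sub>E ?V A) = emeasure (PiM ?V (\<lambda>_. unif01)) (Pi\<^sub>E ?V (\<lambda>p. {u. (u \<le> ?w p) \<in> A p}))"
      using hm by (subst emeasure_distr) (auto simp: pre intro!: sets_PiM_I_finite)
    also have "\<dots> = (\<Prod>p\<in>?V. emeasure unif01 {u. (u \<le> ?w p) \<in> A p})"
      using m by (intro unifs.emeasure_PiM) auto
    also have "\<dots> = (\<Prod>p\<in>?V. emeasure (?B p) (A p))"
      using W_nonneg W_le by (intro prod.cong refl) (simp add: bernoulli_uniform emeasure_distr vimage_def)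
    finally show "emeasure (distr (PiM ?V (\<lambda>_. unif01)) (PiM ?V ?B) ?h) (Pi\<^sub>E ?V A) = (\<Prod>p\<in>?V. emeasure (?B p) (A p))" .
  qed auto
  moreover have "edge_set n \<in> measurable (PiM ?V ?B) (count_space UNIV)"
    by (rule measurable_edge_set) (use measurable_component_singleton[of _ ?V ?B] in \<open>simp cong: measurable_cong_sets\<close>)
  ultimately have "distr (PiM ?V ?B) (count_space UNIV) (edge_set n) = distr (PiM ?V (\<lambda>_. unif01)) (count_space UNIV) (edge_set n \<circ> ?h)"
    using distr_distr[of "edge_set n" "PiM ?V ?B" "count_space UNIV" ?h "PiM ?V (\<lambda>_. unif01)"] hm by simp
  moreover have "edge_set n \<circ> ?h = Ugraph n U"
    by (rule ext) (auto simp: Ugraph_def edge_set_image)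
  ultimately show ?thesis by (simp only:)
qed

text \<open>Almost every family of types has the same edge law under \<open>W0\<close> as under
  \<open>W\<close>, the edge laws are threshold images of one fixed product, and the bind over the
  types becomes a product measure. The laws \<open>D i\<close> are general so that a frozen type is
  covered.\<close>

lemma rand_graph_law:
  assumes D: "\<And>i. prob_space (D i)" "\<And>i. sets (D i) = sets borel"
    and eq: "AE U in PiM {..<n} D. \<forall>i j. i < j \<longrightarrow> j < n \<longrightarrow> W0 (U i) (U j) = W (U i) (U j)"
  shows "rand_graph W0 n (completion (PiM {..<n} D))
    = distr (PiM {..<n} D \<Otimes>\<^sub>M PiM (vpairs n) (\<lambda>_. unif01)) (count_space UNIV) (\<lambda>z. Ugraph n (fst z) (snd z))"
proof -
  let ?T = "PiM {..<n} D" and ?Y = "PiM (vpairs n) (\<lambda>_. unif01)"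
  let ?G = "\<lambda>z. Ugraph n (fst z) (snd z)"
  define K where "K V U = distr (PiM (vpairs n) (\<lambda>p. measure_pmf (bernoulli_pmf (V (U (fst p)) (U (snd p)))))) (count_space UNIV) (edge_set n)" for V :: "real \<Rightarrow> real \<Rightarrow> real" and U
  interpret T: prob_space ?T using D(1) by (intro prob_space_PiM)
  interpret Y: prob_space ?Y by (intro prob_space_PiM prob_space_unif01)
  note G [measurable] = measurable_Ugraph[of n D, OF D(2)]
  have em: "edge_set n \<in> measurable (PiM (vpairs n) (\<lambda>p. measure_pmf (B p))) (count_space UNIV)" for B :: "nat \<times> nat \<Rightarrow> bool pmf"
    by (rule measurable_edge_set) (use measurable_component_singleton[of _ "vpairs n" "\<lambda>p. measure_pmf (B p)"] in \<open>simp cong: measurable_cong_sets\<close>)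
  have Kp: "prob_space (K V U)" for V U
    unfolding K_def by (intro prob_space.prob_space_distr prob_space_PiM prob_space_measure_pmf em)
  have Ks: "sets (K V U) = sets (count_space UNIV)" for V U by (simp add: K_def)
  have KW: "emeasure (K W U) A = emeasure ?Y (Pair U -` (?G -` A \<inter> space (?T \<Otimes>\<^sub>M ?Y)))" if U: "U \<in> space ?T" for U A
  proof -
    have "(\<lambda>y. Ugraph n U y) \<in> measurable ?Y (count_space UNIV)"
      using measurable_compose[OF measurable_Pair1'[OF U] G] by simp
    then have "emeasure (K W U) A = emeasure ?Y (Ugraph n U -` A \<inter> space ?Y)"
      unfolding K_def bernoulli_graph by (subst emeasure_distr) auto
    also have "Ugraph n U -` A \<inter> space ?Y = Pair U -` (?G -` A \<inter> space (?T \<Otimes>\<^sub>M ?Y))"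
      using U by (auto simp: space_pair_measure)
    finally show ?thesis .
  qed
  have Q: "?G -` A \<inter> space (?T \<Otimes>\<^sub>M ?Y) \<in> sets (?T \<Otimes>\<^sub>M ?Y)" for A
    using G by (rule measurable_sets) simp
  have KWm: "(\<lambda>U. emeasure (K W U) A) \<in> borel_measurable ?T" for A
    using Y.measurable_emeasure_Pair[OF Q[of A]] by (simp add: KW cong: measurable_cong)
  have KK: "AE U in ?T. K W0 U = K W U"
    using eq
  proof eventually_elim
    case (elim U)
    then show ?case unfolding K_def
      by (intro arg_cong[where f="\<lambda>M. distr M _ _"] PiM_cong refl) (auto simp: vpairs_def)
  qed
  have Km: "K W0 \<in> measurable (completion ?T) (subprob_algebra (count_space UNIV))"
  proof (rule measurable_subprob_algebra)
    show "subprob_space (K W0 U)" for U using Kp by (rule prob_space_imp_subprob_space)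
    show "(\<lambda>U. emeasure (K W0 U) A) \<in> borel_measurable (completion ?T)" for A
      by (rule measurable_completion_AE[OF KWm[of A]]) (use KK in eventually_elim, simp)
  qed (rule Ks)
  have rg: "rand_graph W0 n (completion ?T) = completion ?T \<bind> K W0"
    by (simp add: rand_graph_def K_def[abs_def])
  show ?thesis
  proof (rule measure_eqI)
    have ne: "space (completion ?T) \<noteq> {}" using T.not_empty by simp
    show s: "sets (rand_graph W0 n (completion ?T)) = sets (distr (?T \<Otimes>\<^sub>M ?Y) (count_space UNIV) ?G)"
      unfolding rg using sets_bind[OF Ks ne] by simp
    fix A assume "A \<in> sets (rand_graph W0 n (completion ?T))"
    have "emeasure (rand_graph W0 n (completion ?T)) A = (\<integral>\<^sup>+U. emeasure (K W0 U) A \<partial>completion ?T)"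
      unfolding rg by (rule emeasure_bind[OF ne Km]) simp
    also have "\<dots> = (\<integral>\<^sup>+U. emeasure (K W0 U) A \<partial>?T)" by (rule nn_integral_completion)
    also have "\<dots> = (\<integral>\<^sup>+U. emeasure ?Y (Pair U -` (?G -` A \<inter> space (?T \<Otimes>\<^sub>M ?Y))) \<partial>?T)"
      by (rule nn_integral_cong_AE) (use KK AE_space in eventually_elim, simp add: KW)
    also have "\<dots> = emeasure (?T \<Otimes>\<^sub>M ?Y) (?G -` A \<inter> space (?T \<Otimes>\<^sub>M ?Y))"
      by (rule Y.emeasure_pair_measure_alt[symmetric, OF Q])
    also have "\<dots> = emeasure (distr (?T \<Otimes>\<^sub>M ?Y) (count_space UNIV) ?G) A"
      using G by (subst emeasure_distr) auto
    finally show "emeasure (rand_graph W0 n (completion ?T)) A = emeasure (distr (?T \<Otimes>\<^sub>M ?Y) (count_space UNIV) ?G) A" .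
  qed
qed

text \<open>Each type is a function \<open>\<phi> i\<close> of a uniform variable: the identity for
  an ordinary vertex, a constant for a vertex whose type is prescribed. One family of uniform
  variables thus drives both the random graph and its conditioned version.\<close>

lemma distr_types_edges:
  fixes \<phi> :: "nat \<Rightarrow> real \<Rightarrow> real" and n :: nat
  assumes phi [measurable]: "\<And>i. \<phi> i \<in> borel_measurable borel"
  defines "T \<equiv> PiM {..<n} (\<lambda>i. distr unif01 borel (\<phi> i))" and "Y \<equiv> PiM (vpairs n) (\<lambda>_. unif01)"
    and "u \<equiv> \<lambda>\<omega>. \<lambda>i\<in>{..<n}. \<phi> i (\<omega> {i})" and "y \<equiv> \<lambda>\<omega>. \<lambda>p\<in>vpairs n. \<omega> {fst p, snd p}"
  shows "distr unifs T u = T" and "distr unifs (T \<Otimes>\<^sub>M Y) (\<lambda>\<omega>. (u \<omega>, y \<omega>)) = T \<Otimes>\<^sub>M Y"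
    and "u \<in> measurable unifs T" and "y \<in> measurable unifs Y"
proof -
  have pD: "prob_space (distr unif01 borel (\<phi> i))" for i
    using phi by (intro prob_space.prob_space_distr prob_space_unif01) (simp add: measurable_unif01)
  interpret TP: product_prob_space "\<lambda>i. distr unif01 borel (\<phi> i)" "{..<n}" by (intro product_prob_spaceI pD)
  interpret T: prob_space T unfolding T_def using pD by (intro prob_space_PiM)
  interpret Y: prob_space Y unfolding Y_def by (intro prob_space_PiM prob_space_unif01)
  show um: "u \<in> measurable unifs T" unfolding u_def T_def
    by (rule measurable_restrict) measurable
  show ym: "y \<in> measurable unifs Y" unfolding y_def Y_def
    by (rule measurable_restrict) measurable
  show uT: "distr unifs T u = T"
    unfolding T_def
  proof (rule TP.PiM_eqI)
    fix A assume A: "\<And>i. i \<in> {..<n} \<Longrightarrow> A i \<in> sets (distr unif01 borel (\<phi> i))"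
    let ?J = "(\<lambda>i. {i}) ` {..<n}" and ?X = "\<lambda>s. \<phi> (the_elem s) -` A (the_elem s)"
    have Am: "\<phi> i -` A i \<in> sets borel" if "i < n" for i
      using measurable_sets[OF phi, of "A i" i] A[of i] that by simp
    have uA: "u x \<in> Pi\<^sub>E {..<n} A \<longleftrightarrow> (\<forall>s\<in>?J. x s \<in> ?X s)" for x
      unfolding u_def restrict_PiE_iff by simp
    have "u -` Pi\<^sub>E {..<n} A \<inter> space unifs = {x \<in> space unifs. \<forall>s\<in>?J. x s \<in> ?X s}"
      unfolding vimage_def uA by blast
    then have "emeasure (distr unifs (PiM {..<n} (\<lambda>i. distr unif01 borel (\<phi> i))) u) (Pi\<^sub>E {..<n} A) = emeasure unifs {x \<in> space unifs. \<forall>s\<in>?J. x s \<in> ?X s}"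
      using um A by (subst emeasure_distr) (auto simp: T_def intro!: sets_PiM_I_finite)
    also have "\<dots> = (\<Prod>s\<in>?J. emeasure unif01 (?X s))"
      using Am by (intro unifs.emeasure_PiM_Collect) auto
    also have "\<dots> = (\<Prod>i<n. emeasure unif01 (\<phi> i -` A i))"
      by (subst prod.reindex) (auto simp: inj_on_def)
    also have "\<dots> = (\<Prod>i<n. emeasure (distr unif01 borel (\<phi> i)) (A i))"
      using A by (intro prod.cong refl) (simp add: emeasure_distr measurable_unif01)
    finally show "emeasure (distr unifs (PiM {..<n} (\<lambda>i. distr unif01 borel (\<phi> i))) u) (Pi\<^sub>E {..<n} A) = (\<Prod>i<n. emeasure (distr unif01 borel (\<phi> i)) (A i))" .
  qed auto
  have inj: "inj_on (\<lambda>p. {fst p, snd p}) (vpairs n)"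
    by (auto simp: inj_on_def vpairs_def doubleton_eq_iff)
  have yY: "distr unifs Y y = Y"
    unfolding Y_def y_def using distr_PiM_reindex[of UNIV "\<lambda>_. unif01" "\<lambda>p. {fst p, snd p}" "vpairs n"] inj prob_space_unif01 by simp
  show "distr unifs (T \<Otimes>\<^sub>M Y) (\<lambda>\<omega>. (u \<omega>, y \<omega>)) = T \<Otimes>\<^sub>M Y"
  proof (rule pair_measure_eqI[symmetric])
    fix A B assume A: "A \<in> sets T" and B: "B \<in> sets Y"
    let ?f = "\<lambda>\<omega>. indicator A (u \<omega>) :: real" and ?g = "\<lambda>\<omega>. indicator B (y \<omega>) :: real"
    note [measurable] = um ym A B
    have "measure unifs ((\<lambda>\<omega>. (u \<omega>, y \<omega>)) -` (A \<times> B) \<inter> space unifs) = (\<integral>\<omega>. ?f \<omega> * ?g \<omega> \<partial>unifs)"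
    proof -
      have "(\<integral>\<omega>. ?f \<omega> * ?g \<omega> \<partial>unifs) = (\<integral>\<omega>. indicator ((\<lambda>\<omega>. (u \<omega>, y \<omega>)) -` (A \<times> B) \<inter> space unifs) \<omega> \<partial>unifs)"
        by (intro Bochner_Integration.integral_cong refl) (auto simp: indicator_def)
      also have "\<dots> = measure unifs ((\<lambda>\<omega>. (u \<omega>, y \<omega>)) -` (A \<times> B) \<inter> space unifs)" by simp
      finally show ?thesis by simp
    qed
    also have "\<dots> = (\<integral>\<omega>. ?f \<omega> \<partial>unifs) * (\<integral>\<omega>. ?g \<omega> \<partial>unifs)"
    \<comment> \<open>Types sit at singletons and edge variables at two-element sets, so resampling
      all two-element sets keeps the former and replaces all of the latter.\<close>
    proof (rule unifs.integral_mult_indep[where A="{s. card s = 2}"])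
      show "integrable unifs (\<lambda>\<omega>. ?f \<omega> * ?g \<omega>)"
        by (rule unifs.P.integrable_const_bound[of _ 1]) (auto simp: indicator_def)
      have "u (mix {s. card s = 2} x z) = u x" for x z by (auto simp: u_def mix_def fun_eq_iff)
      then show "?f (mix {s. card s = 2} x z) = ?f x" for x z by simp
      have "y (mix {s. card s = 2} x z) = y z" for x z by (auto simp: y_def mix_def fun_eq_iff vpairs_def)
      then show "?g (mix {s. card s = 2} x z) = ?g z" for x z by simp
    qed
    also have "(\<integral>\<omega>. ?f \<omega> \<partial>unifs) = measure (distr unifs T u) A"
      by (subst measure_distr) (auto simp: indicator_vimage[symmetric] simp del: indicator_vimage intro!: Bochner_Integration.integral_cong[THEN trans] )
    also have "(\<integral>\<omega>. ?g \<omega> \<partial>unifs) = measure (distr unifs Y y) B"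
      by (subst measure_distr) (auto simp: indicator_vimage[symmetric] simp del: indicator_vimage)
    finally have "measure unifs ((\<lambda>\<omega>. (u \<omega>, y \<omega>)) -` (A \<times> B) \<inter> space unifs) = measure T A * measure Y B"
      by (simp add: uT yY)
    then have "emeasure unifs ((\<lambda>\<omega>. (u \<omega>, y \<omega>)) -` (A \<times> B) \<inter> space unifs) = emeasure T A * emeasure Y B"
      by (simp add: unifs.P.emeasure_eq_measure T.emeasure_eq_measure Y.emeasure_eq_measure ennreal_mult)
    then show "emeasure T A * emeasure Y B = emeasure (distr unifs (T \<Otimes>\<^sub>M Y) (\<lambda>\<omega>. (u \<omega>, y \<omega>))) (A \<times> B)"
      by (subst emeasure_distr) auto
  qed (auto intro: T.sigma_finite_measure_axioms Y.sigma_finite_measure_axioms)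
qed

theorem rand_graph_uniform:
  fixes \<phi> :: "nat \<Rightarrow> real \<Rightarrow> real"
  assumes phi [measurable]: "\<And>i. \<phi> i \<in> borel_measurable borel"
    and N [measurable]: "N \<in> sets (borel \<Otimes>\<^sub>M borel)" and W0: "\<And>x y. (x, y) \<notin> N \<Longrightarrow> W0 x y = W x y"
    and AE: "\<And>i j. i < j \<Longrightarrow> j < n \<Longrightarrow> AE \<omega> in unifs. (\<phi> i (\<omega> {i}), \<phi> j (\<omega> {j})) \<notin> N"
  shows "rand_graph W0 n (completion (PiM {..<n} (\<lambda>i. distr unif01 borel (\<phi> i))))
    = distr unifs (count_space UNIV) (\<lambda>\<omega>. Ugraph n (\<lambda>i. \<phi> i (\<omega> {i})) (\<lambda>p. \<omega> {fst p, snd p}))"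
proof -
  let ?D = "\<lambda>i. distr unif01 borel (\<phi> i)"
  let ?T = "PiM {..<n} ?D" and ?Y = "PiM (vpairs n) (\<lambda>_. unif01)"
  let ?u = "\<lambda>\<omega>. \<lambda>i\<in>{..<n}. \<phi> i (\<omega> {i})" and ?y = "\<lambda>\<omega>. \<lambda>p\<in>vpairs n. \<omega> {fst p, snd p}"
  have pD: "prob_space (?D i)" for i
    using phi by (intro prob_space.prob_space_distr prob_space_unif01) (simp add: measurable_unif01)
  note d = distr_types_edges[of \<phi> n, OF phi]
  have "AE U in ?T. (U i, U j) \<notin> N" if ij: "i < j" "j < n" for i j
  proof -
    have [measurable]: "(\<lambda>U. U i) \<in> borel_measurable ?T" "(\<lambda>U. U j) \<in> borel_measurable ?T"
      using ij measurable_component_singleton[of i "{..<n}" ?D] measurable_component_singleton[of j "{..<n}" ?D]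
      by (auto cong: measurable_cong_sets)
    have "AE U in distr unifs ?T ?u. (U i, U j) \<notin> N"
      using AE[OF ij] ij by (subst AE_distr_iff[OF d(3)]) auto
    then show ?thesis by (simp only: d(1))
  qed
  then have "AE U in ?T. \<forall>j\<in>{..<n}. \<forall>i\<in>{..<j}. (U i, U j) \<notin> N"
    by (intro AE_finite_allI) auto
  then have "AE U in ?T. \<forall>i j. i < j \<longrightarrow> j < n \<longrightarrow> W0 (U i) (U j) = W (U i) (U j)"
    by eventually_elim (auto simp: W0)
  then have "rand_graph W0 n (completion ?T) = distr (?T \<Otimes>\<^sub>M ?Y) (count_space UNIV) (\<lambda>z. Ugraph n (fst z) (snd z))"
    by (intro rand_graph_law pD) auto
  also have "\<dots> = distr (distr unifs (?T \<Otimes>\<^sub>M ?Y) (\<lambda>\<omega>. (?u \<omega>, ?y \<omega>))) (count_space UNIV) (\<lambda>z. Ugraph n (fst z) (snd z))"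
    by (simp only: d(2))
  also have "\<dots> = distr unifs (count_space UNIV) ((\<lambda>z. Ugraph n (fst z) (snd z)) \<circ> (\<lambda>\<omega>. (?u \<omega>, ?y \<omega>)))"
    using d(3,4) by (intro distr_distr measurable_Ugraph measurable_Pair) auto
  also have "(\<lambda>z. Ugraph n (fst z) (snd z)) \<circ> (\<lambda>\<omega>. (?u \<omega>, ?y \<omega>)) = (\<lambda>\<omega>. Ugraph n (\<lambda>i. \<phi> i (\<omega> {i})) (\<lambda>p. \<omega> {fst p, snd p}))"
    by (auto simp: fun_eq_iff Ugraph_def edge_set_image vpairs_def)
  finally show ?thesis .
qed

end

lemma integral_two_coordinates:
  fixes f :: "real \<Rightarrow> real \<Rightarrow> 'b::{banach, second_countable_topology}" and s s' :: 'i
  assumes [measurable]: "(\<lambda>p. f (fst p) (snd p)) \<in> borel_measurable (borel \<Otimes>\<^sub>M borel)"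
    and bound: "\<And>x y. norm (f x y) \<le> K" and "s \<noteq> s'"
  shows "(\<integral>\<omega>. f (\<omega> s) (\<omega> s') \<partial>unifs) = (\<integral>x. (\<integral>y. f x y \<partial>unif01) \<partial>unif01)"
proof -
  have m2: "(\<lambda>z. f (g z) (h z)) \<in> borel_measurable M" if "g \<in> borel_measurable M" "h \<in> borel_measurable M" for g h and M :: "'c measure"
    using measurable_compose[OF measurable_Pair[OF that] assms(1)] by simp
  have [measurable]: "(\<lambda>\<omega>. f (\<omega> s) (\<omega> s')) \<in> borel_measurable unifs" by (intro m2) measurable
  have "integrable unifs (\<lambda>\<omega>. f (\<omega> s) (\<omega> s'))"
    by (rule unifs.P.integrable_const_bound[of _ K]) (auto simp: bound)
  then have "(\<integral>\<omega>. f (\<omega> s) (\<omega> s') \<partial>unifs) = (\<integral>x. (\<integral>y. f (mix {s'} x y s) (mix {s'} x y s') \<partial>unifs) \<partial>unifs)"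
    by (rule unifs.integral_mix)
  also have "\<dots> = (\<integral>x. (\<integral>y. f (x s) (y s') \<partial>unifs) \<partial>unifs)" using assms(3) by (simp add: mix_def)
  also have "\<dots> = (\<integral>x. (\<integral>u. f (x s) u \<partial>unif01) \<partial>unifs)"
  proof (intro Bochner_Integration.integral_cong refl)
    fix x :: "'i \<Rightarrow> real"
    have "f (x s) \<in> borel_measurable unif01" using m2[of "\<lambda>_. x s" unif01 "\<lambda>u. u"] by simp
    then show "(\<integral>y. f (x s) (y s') \<partial>unifs) = (\<integral>u. f (x s) u \<partial>unif01)" by (rule unifs.integral_coordinate)
  qed
  also have "\<dots> = (\<integral>x. (\<integral>y. f x y \<partial>unif01) \<partial>unif01)"
  proof (rule unifs.integral_coordinate)
    have "(\<lambda>p. f (fst p) (snd p)) \<in> borel_measurable (unif01 \<Otimes>\<^sub>M unif01)" by measurable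
    then show "(\<lambda>x. \<integral>y. f x y \<partial>unif01) \<in> borel_measurable unif01"
      by (intro unifs.M.borel_measurable_lebesgue_integral) (simp add: split_beta')
  qed
  finally show ?thesis .
qed

section \<open>Comparison of characteristic functions in mean square\<close>

lemma (in prob_space) L1_le_L2:
  fixes Y :: "'a \<Rightarrow> real"
  assumes [measurable]: "Y \<in> borel_measurable M" and i: "integrable M (\<lambda>x. (Y x)\<^sup>2)"
  shows "expectation (\<lambda>x. \<bar>Y x\<bar>) \<le> sqrt (expectation (\<lambda>x. (Y x)\<^sup>2))"
proof (rule real_le_rsqrt)
  have i1: "integrable M Y" by (rule square_integrable_imp_integrable[OF _ i]) simp
  have "0 \<le> variance (\<lambda>x. \<bar>Y x\<bar>)" by simp
  also have "\<dots> = expectation (\<lambda>x. \<bar>Y x\<bar>\<^sup>2) - (expectation (\<lambda>x. \<bar>Y x\<bar>))\<^sup>2"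
    using i1 i by (intro variance_eq) auto
  finally show "(expectation (\<lambda>x. \<bar>Y x\<bar>))\<^sup>2 \<le> expectation (\<lambda>x. (Y x)\<^sup>2)" by simp
qed

text \<open>The imaginary exponential is 1-Lipschitz; through this inequality second moment
  estimates become statements about laws.\<close>

lemma (in prob_space) char_diff_L2:
  fixes A B :: "'a \<Rightarrow> real"
  assumes [measurable]: "A \<in> borel_measurable M" "B \<in> borel_measurable M"
    and i: "integrable M (\<lambda>x. (A x - B x)\<^sup>2)"
  shows "cmod ((\<integral>x. iexp (A x) \<partial>M) - (\<integral>x. iexp (B x) \<partial>M)) \<le> sqrt (expectation (\<lambda>x. (A x - B x)\<^sup>2))"
proof -
  have i1: "integrable M (\<lambda>x. A x - B x)" by (rule square_integrable_imp_integrable[OF _ i]) simp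
  have e: "integrable M (\<lambda>x. iexp (A x))" "integrable M (\<lambda>x. iexp (B x))"
    by (auto intro!: integrable_const_bound[of _ 1])
  have "(\<integral>x. iexp (A x) \<partial>M) - (\<integral>x. iexp (B x) \<partial>M) = (\<integral>x. iexp (A x) - iexp (B x) \<partial>M)" using e by simp
  also have "cmod \<dots> \<le> (\<integral>x. cmod (iexp (A x) - iexp (B x)) \<partial>M)" by (rule integral_norm_bound)
  also have "\<dots> \<le> (\<integral>x. \<bar>A x - B x\<bar> \<partial>M)"
    using e i1 by (intro integral_mono iexp_lipschitz) auto
  also have "\<dots> \<le> sqrt (expectation (\<lambda>x. (A x - B x)\<^sup>2))" using i by (intro L1_le_L2) auto
  finally show ?thesis .
qed

lemma binomial_shift_limit:
  "(\<lambda>n. real ((n - d) choose k) / real n ^ k) \<longlonglongrightarrow> 1 / fact k"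
proof -
  have "(\<lambda>n. \<Prod>i=0..<k. (real n - real (d + i)) / real n / real (k - i)) \<longlonglongrightarrow> (\<Prod>i=0..<k. 1 / real (k - i))"
  proof (intro tendsto_prod tendsto_divide tendsto_const)
    show "(\<lambda>n. (real n - real (d + i)) / real n) \<longlonglongrightarrow> 1" for i by real_asymp
  qed auto
  moreover have "(\<Prod>i=0..<k. 1 / real (k - i)) = 1 / fact k"
    by (simp add: fact_prod_rev prod_dividef)
  moreover have "\<forall>\<^sub>F n in sequentially. (\<Prod>i=0..<k. (real n - real (d + i)) / real n / real (k - i)) = real ((n - d) choose k) / real n ^ k"
    using eventually_gt_at_top[of "d + k"]
  proof eventually_elim
    case (elim n)
    have "real ((n - d) choose k) = (\<Prod>i=0..<k. real (n - d - i) / real (k - i))"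
      using elim by (subst binomial_altdef_of_nat) auto
    also have "\<dots> = (\<Prod>i=0..<k. (real n - real (d + i)) / real (k - i))"
      using elim by (intro prod.cong refl) (auto simp: of_nat_diff)
    finally have "real ((n - d) choose k) / real n ^ k = (\<Prod>i=0..<k. (real n - real (d + i)) / real (k - i)) / (\<Prod>i=0..<k. real n)"
      by simp
    also have "\<dots> = (\<Prod>i=0..<k. (real n - real (d + i)) / real n / real (k - i))"
      unfolding prod_dividef[symmetric] by (intro prod.cong refl) (simp add: mult.commute)
    finally show ?case by simp
  qed
  ultimately show ?thesis by (simp add: tendsto_cong)
qed

text \<open>\<open>W\<close> is the Borel version on which all computations are done,
  \<open>W0\<close> the given graphon; they are linked only off the set \<open>N\<close>, almost all
  of whose sections are null.\<close>

locale graphon_version = borel_graphon W r for W r +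
  fixes W0 :: "real \<Rightarrow> real \<Rightarrow> real" and N :: "(real \<times> real) set"
  assumes N_sets: "N \<in> sets (borel \<Otimes>\<^sub>M borel)"
    and N_null: "AE x in unif01. AE y in unif01. (x, y) \<notin> N"
    and W0_eq: "(x, y) \<notin> N \<Longrightarrow> W0 x y = W x y"
begin

section \<open>Graph quantities as expectations over the uniform variables\<close>

definition graph :: "nat \<Rightarrow> (nat set \<Rightarrow> real) \<Rightarrow> nat set set" where
  "graph n \<omega> = Ugraph n (\<lambda>i. \<omega> {i}) (\<lambda>p. \<omega> {fst p, snd p})"

lemma graph_measurable [measurable]: "graph n \<in> measurable unifs (count_space UNIV)"
  unfolding graph_def[abs_def] Ugraph_def
proof (rule measurable_edge_set)
  fix p :: "nat \<times> nat"
  have [measurable]: "(\<lambda>\<omega>. W (\<omega> {fst p}) (\<omega> {snd p})) \<in> borel_measurable unifs" by (intro W_meas2) measurable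
  show "Measurable.pred unifs (\<lambda>\<omega>. \<omega> {fst p, snd p} \<le> W (\<omega> {fst p}) (\<omega> {snd p}))"
    unfolding pred_def by (rule borel_measurable_le) measurable
qed

lemma GnW_law: "GnW n W0 = distr unifs (count_space UNIV) (graph n)"
proof -
  have id: "distr unif01 borel (\<lambda>x. x) = unif01" by (rule distr_id2) simp
  have "rand_graph W0 n (completion (PiM {..<n} (\<lambda>i. distr unif01 borel (\<lambda>x. x))))
    = distr unifs (count_space UNIV) (\<lambda>\<omega>. Ugraph n (\<lambda>i. \<omega> {i}) (\<lambda>p. \<omega> {fst p, snd p}))"
  proof (rule rand_graph_uniform[of "\<lambda>_ x. x" N W0 n, OF _ N_sets W0_eq])
    show "AE \<omega> in unifs. (\<omega> {i}, \<omega> {j}) \<notin> N" if "i < j" for i j :: nat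
      by (rule AE_two_coordinates[OF N_sets _ N_null]) (use that in auto)
  qed auto
  then show ?thesis unfolding GnW_def id by (simp add: graph_def[abs_def])
qed

lemma edge_in_graph:
  assumes "i \<noteq> j" "i < n" "j < n"
  shows "{i, j} \<in> graph n \<omega> \<longleftrightarrow> edge \<omega> {i, j} = 1"
proof -
  have *: "{i, j} \<in> graph n \<omega> \<longleftrightarrow> edge \<omega> {i, j} = 1" if ij: "i < j" "j < n" for i j
  proof -
    have "{i, j} \<in> graph n \<omega> \<longleftrightarrow> \<omega> {i, j} \<le> W (\<omega> {i}) (\<omega> {j})"
      unfolding graph_def Ugraph_def edge_set_def using ij by (auto simp: doubleton_eq_iff)
    then show ?thesis using ij by (simp add: edge_doubleton)
  qed
  show ?thesis using *[of i j] *[of j i] assms by (cases "i < j") (auto simp: insert_commute)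
qed

lemma H_alt: "finite S \<Longrightarrow> H S \<omega> = (if \<forall>i\<in>S. \<forall>j\<in>S. i \<noteq> j \<longrightarrow> edge \<omega> {i, j} = 1 then 1 else 0)"
proof -
  assume S: "finite S"
  have p: "(\<forall>p\<in>pairs S. edge \<omega> p = 1) \<longleftrightarrow> (\<forall>i\<in>S. \<forall>j\<in>S. i \<noteq> j \<longrightarrow> edge \<omega> {i, j} = 1)"
  proof (intro iffI ballI impI)
    fix i j assume "\<forall>p\<in>pairs S. edge \<omega> p = 1" "i \<in> S" "j \<in> S" "i \<noteq> j"
    then show "edge \<omega> {i, j} = 1" by (auto simp: pairs_def)
  next
    fix p assume a: "\<forall>i\<in>S. \<forall>j\<in>S. i \<noteq> j \<longrightarrow> edge \<omega> {i, j} = 1" and "p \<in> pairs S"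
    then obtain i j where "p = {i, j}" "i \<noteq> j" "i \<in> S" "j \<in> S" by (auto simp: pairs_def card_2_iff)
    then show "edge \<omega> p = 1" using a by auto
  qed
  show ?thesis
  proof (cases "\<forall>p\<in>pairs S. edge \<omega> p = 1")
    case True
    then show ?thesis using p by (simp add: H_def)
  next
    case False
    then obtain q where "q \<in> pairs S" "edge \<omega> q = 0" using edge_01 by blast
    then show ?thesis using False S p unfolding H_def by (subst prod_zero) auto
  qed
qed

lemma clique_count_graph: "real (clique_count n r (graph n \<omega>)) = X n \<omega>"
proof -
  have "{S. S \<subseteq> {..<n} \<and> card S = r \<and> (\<forall>i\<in>S. \<forall>j\<in>S. i \<noteq> j \<longrightarrow> {i, j} \<in> graph n \<omega>)}
     = {S \<in> ksubsets n r. \<forall>i\<in>S. \<forall>j\<in>S. i \<noteq> j \<longrightarrow> edge \<omega> {i, j} = 1}"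
  proof (intro Collect_cong)
    fix S
    have "(\<forall>i\<in>S. \<forall>j\<in>S. i \<noteq> j \<longrightarrow> {i, j} \<in> graph n \<omega>) \<longleftrightarrow> (\<forall>i\<in>S. \<forall>j\<in>S. i \<noteq> j \<longrightarrow> edge \<omega> {i, j} = 1)" if "S \<subseteq> {..<n}"
    proof (intro ball_cong refl imp_cong)
      fix i j assume "i \<in> S" "j \<in> S" "i \<noteq> j"
      then show "{i, j} \<in> graph n \<omega> \<longleftrightarrow> edge \<omega> {i, j} = 1" using that by (intro edge_in_graph) auto
    qed
    then show "S \<subseteq> {..<n} \<and> card S = r \<and> (\<forall>i\<in>S. \<forall>j\<in>S. i \<noteq> j \<longrightarrow> {i, j} \<in> graph n \<omega>) \<longleftrightarrow>
      S \<in> ksubsets n r \<and> (\<forall>i\<in>S. \<forall>j\<in>S. i \<noteq> j \<longrightarrow> edge \<omega> {i, j} = 1)"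
      unfolding ksubsets_def by blast
  qed
  then have "real (clique_count n r (graph n \<omega>)) = (\<Sum>S\<in>{S \<in> ksubsets n r. \<forall>i\<in>S. \<forall>j\<in>S. i \<noteq> j \<longrightarrow> edge \<omega> {i, j} = 1}. 1)"
    by (simp add: clique_count_def)
  also have "\<dots> = X n \<omega>"
    unfolding X_def by (subst sum.inter_filter) (auto simp: H_alt ksubsets_finite intro!: sum.cong)
  finally show ?thesis .
qed

lemma complete_graph_iff: "graph r \<omega> = complete_graph r \<longleftrightarrow> H {..<r} \<omega> = 1"
proof -
  have "graph r \<omega> \<subseteq> complete_graph r"
    by (auto simp: graph_def Ugraph_def edge_set_def complete_graph_def)
  moreover have "complete_graph r \<subseteq> graph r \<omega> \<longleftrightarrow> (\<forall>i\<in>{..<r}. \<forall>j\<in>{..<r}. i \<noteq> j \<longrightarrow> {i, j} \<in> graph r \<omega>)"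
  proof (intro iffI ballI impI)
    fix i j assume c: "complete_graph r \<subseteq> graph r \<omega>" and ij: "i \<in> {..<r}" "j \<in> {..<r}" "i \<noteq> j"
    have "{i, j} \<in> complete_graph r"
    proof (cases "i < j")
      case True
      then show ?thesis unfolding complete_graph_def using ij by blast
    next
      case False
      then have "j < i" "{i, j} = {j, i}" using ij by auto
      then show ?thesis unfolding complete_graph_def using ij by blast
    qed
    then show "{i, j} \<in> graph r \<omega>" using c by blast
  qed (auto simp: complete_graph_def)
  moreover have "(\<forall>i\<in>{..<r}. \<forall>j\<in>{..<r}. i \<noteq> j \<longrightarrow> {i, j} \<in> graph r \<omega>) \<longleftrightarrow> H {..<r} \<omega> = 1"
    by (auto simp: H_alt edge_in_graph)
  ultimately show ?thesis by blast
qed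

lemma measure_H_eq_1:
  assumes [measurable]: "g \<in> measurable unifs unifs" and "finite S"
  shows "measure unifs {\<omega> \<in> space unifs. H S (g \<omega>) = 1} = (\<integral>\<omega>. H S (g \<omega>) \<partial>unifs)"
proof -
  have "(\<integral>\<omega>. H S (g \<omega>) \<partial>unifs) = (\<integral>\<omega>. indicator {\<omega> \<in> space unifs. H S (g \<omega>) = 1} \<omega> \<partial>unifs)"
    using assms(2) by (intro Bochner_Integration.integral_cong refl) (auto simp: H_alt indicator_def)
  also have "\<dots> = measure unifs {\<omega> \<in> space unifs. H S (g \<omega>) = 1}" by simp
  finally show ?thesis by simp
qed

lemma tK_eq: "tK r W0 = tt"
proof -
  have "tK r W0 = measure unifs {\<omega> \<in> space unifs. H {..<r} \<omega> = 1}"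
    unfolding tK_def GnW_law by (subst measure_distr) (auto simp: complete_graph_iff[symmetric] intro!: arg_cong[where f="measure unifs"])
  also have "\<dots> = tt" unfolding tt_def by (rule measure_H_eq_1[of "\<lambda>x. x"]) auto
  finally show ?thesis .
qed

text \<open>\<open>J {0}\<close> reads only the coordinate of vertex 0, so it may be evaluated at a
  constant family.\<close>

definition tau :: "real \<Rightarrow> real" where
  "tau x = J {0} (\<lambda>_. x)"

lemma const_measurable [measurable]: "(\<lambda>x. (\<lambda>_. x)) \<in> measurable borel (unifs :: (nat set \<Rightarrow> real) measure)"
  by (rule measurable_PiM_single') auto

lemma tau_measurable [measurable]: "tau \<in> borel_measurable borel"
  unfolding tau_def[abs_def] by (rule measurable_compose[OF const_measurable J_measurable])

lemma tau_bounds: "0 \<le> tau x" "tau x \<le> 1"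
  unfolding tau_def by (rule J_bounds)+

lemma J_0: "J {0} \<omega> = (\<integral>y. H {..<r} (fun_upd y {0} (\<omega> {0})) \<partial>unifs)"
proof -
  have "J {0} \<omega> = Cond {0} (H {..<r}) \<omega>" using r2 by (intro Cond_H_subset[symmetric]) auto
  also have "\<dots> = (\<integral>y. H {..<r} (fun_upd y {0} (\<omega> {0})) \<partial>unifs)"
    unfolding Cond_def by (intro Bochner_Integration.integral_cong refl H_cong) (auto simp: mix_def)
  finally show ?thesis .
qed

text \<open>Relabelling by the transposition of 0 and \<open>i\<close>.\<close>

lemma J_single: "J {i} \<omega> = tau (\<omega> {i})"
proof -
  define \<pi> where "\<pi> k = (if k = 0 then i else if k = i then 0 else k)" for k
  have pi: "inj \<pi>" by (auto simp: inj_def \<pi>_def split: if_splits)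
  have "J {i} \<omega> = J {0} (act \<pi> \<omega>)"
    using r2 J_act[OF _ _ pi, of "{0}" \<omega>] by (simp add: \<pi>_def)
  also have "\<dots> = tau (\<omega> {i})" unfolding tau_def by (subst (1 2) J_0) (simp add: act_def \<pi>_def)
  finally show ?thesis .
qed

lemma integral_tau: "(\<integral>x. tau x \<partial>unif01) = tt"
proof -
  have "tt = (\<integral>\<omega>. J {0} \<omega> \<partial>unifs)" using r2 by (simp add: integral_J)
  also have "\<dots> = (\<integral>x. tau x \<partial>unif01)"
    unfolding J_single by (rule unifs.integral_coordinate) measurable
  finally show ?thesis by simp
qed

lemma upd_meas: "(\<lambda>\<omega>. fun_upd \<omega> {0} x) \<in> measurable unifs (unifs :: (nat set \<Rightarrow> real) measure)"
proof (rule measurable_PiM_single')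
  fix s :: "nat set"
  show "(\<lambda>\<omega>. (fun_upd \<omega> {0} x) s) \<in> measurable unifs unif01" by (cases "s = {0}") auto
qed auto

text \<open>Freezing the type of vertex 0 at \<open>x\<close> leaves the clique probability computed
  from \<open>W\<close> correct whenever the section of \<open>N\<close> at \<open>x\<close> is
  null, hence for almost every \<open>x\<close>.\<close>

lemma tcond_eq: "AE x in unif01. tcond r W0 x = tau x"
  using N_null
proof eventually_elim
  case (elim x)
  define \<phi> where "\<phi> i = (if i = 0 then (\<lambda>_. x) else (\<lambda>u. u))" for i :: nat
  have phi: "\<phi> i \<in> borel_measurable borel" for i by (auto simp: \<phi>_def)
  have D: "(\<lambda>i. if i = 0 then return borel x else unif01) = (\<lambda>i. distr unif01 borel (\<phi> i))"
  proof
    fix i :: nat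
    have "distr unif01 borel (\<lambda>_. x) = return borel x" by (rule unifs.M.distr_const) simp
    moreover have "distr unif01 borel (\<lambda>u. u) = unif01" by (rule distr_id2) simp
    ultimately show "(if i = 0 then return borel x else unif01) = distr unif01 borel (\<phi> i)" by (simp add: \<phi>_def)
  qed
  have "rand_graph W0 r (completion (PiM {..<r} (\<lambda>i. distr unif01 borel (\<phi> i))))
    = distr unifs (count_space UNIV) (\<lambda>\<omega>. Ugraph r (\<lambda>i. \<phi> i (\<omega> {i})) (\<lambda>p. \<omega> {fst p, snd p}))"
  proof (rule rand_graph_uniform[OF phi N_sets W0_eq])
    fix i j :: nat assume ij: "i < j" "j < r"
    show "AE \<omega> in unifs. (\<phi> i (\<omega> {i}), \<phi> j (\<omega> {j})) \<notin> N"
    proof (cases "i = 0")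
      case True
      have "AE \<omega> in unifs. (x, \<omega> {j}) \<notin> N" using unifs.AE_component[of "{j}"] elim by simp
      then show ?thesis using True ij by (simp add: \<phi>_def)
    next
      case False
      then show ?thesis using ij AE_two_coordinates[OF N_sets _ N_null, of "{i}" "{j}"] by (simp add: \<phi>_def)
    qed
  qed
  moreover have "Ugraph r (\<lambda>i. \<phi> i (\<omega> {i})) (\<lambda>p. \<omega> {fst p, snd p}) = graph r (fun_upd \<omega> {0} x)" for \<omega> :: "nat set \<Rightarrow> real"
  proof -
    have "\<phi> i (\<omega> {i}) = (fun_upd \<omega> {0} x) {i}" for i by (simp add: \<phi>_def)
    moreover have "\<omega> {fst p, snd p} = (fun_upd \<omega> {0} x) {fst p, snd p}" if "p \<in> vpairs r" for p
      using that by (auto simp: vpairs_def)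
    ultimately have "(\<omega> {fst p, snd p} \<le> W (\<phi> (fst p) (\<omega> {fst p})) (\<phi> (snd p) (\<omega> {snd p}))) \<longleftrightarrow>
        (fun_upd \<omega> {0} x {fst p, snd p} \<le> W (fun_upd \<omega> {0} x {fst p}) (fun_upd \<omega> {0} x {snd p}))" if "p \<in> vpairs r" for p
      using that by (simp only:)
    then show ?thesis unfolding graph_def Ugraph_def edge_set_image
      by (intro arg_cong[where f="image _"] Collect_cong conj_cong refl)
  qed
  ultimately have "tcond r W0 x = measure (distr unifs (count_space UNIV) (\<lambda>\<omega>. graph r (fun_upd \<omega> {0} x))) {complete_graph r}"
    unfolding tcond_def D by simp
  also have "\<dots> = measure unifs {\<omega> \<in> space unifs. H {..<r} (fun_upd \<omega> {0} x) = 1}"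
  proof (subst measure_distr)
    show "(\<lambda>\<omega>. graph r (fun_upd \<omega> {0} x)) \<in> measurable unifs (count_space UNIV)"
      by (rule measurable_compose[OF upd_meas graph_measurable])
  qed (auto simp: complete_graph_iff[symmetric] intro!: arg_cong[where f="measure unifs"])
  also have "\<dots> = (\<integral>\<omega>. H {..<r} (fun_upd \<omega> {0} x) \<partial>unifs)" by (rule measure_H_eq_1[OF upd_meas]) simp
  also have "\<dots> = tau x" unfolding tau_def J_0 by simp
  finally show ?case .
qed

lemma mean_cliques_eq: "mean_cliques n r W0 = real (n choose r) * tt"
  unfolding mean_cliques_def GnW_law by (subst integral_distr) (auto simp: clique_count_graph integral_X)

lemma normalized_law_eq:
  "normalized_law n r W0 a = distr unifs borel (\<lambda>\<omega>. (X n \<omega> - real (n choose r) * tt) / real n powr a)"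
  unfolding normalized_law_def mean_cliques_eq GnW_law
  by (subst distr_distr) (auto simp: o_def clique_count_graph)

lemma real_distribution_normalized: "real_distribution (normalized_law n r W0 a)"
  unfolding normalized_law_eq by (rule unifs.P.real_distribution_distr) measurable

lemma char_normalized:
  "char (normalized_law n r W0 a) t = (\<integral>\<omega>. iexp (t * ((X n \<omega> - real (n choose r) * tt) / real n powr a)) \<partial>unifs)"
  unfolding normalized_law_eq char_def by (subst integral_distr) auto

subsection \<open>Degenerate densities\<close>

lemma bm_X: "bm unifs (X n)"
  unfolding X_def[abs_def] by (intro bm_sum bm_H)

lemma X_zero: assumes "tt = 0" shows "AE E in GnW n W0. clique_count n r E = 0"
proof -
  have "(\<integral>\<omega>. X n \<omega> \<partial>unifs) = 0" using assms by (simp add: integral_X)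
  moreover have "integrable unifs (X n)" by (intro unifs.P.bm_integrable bm_X)
  moreover have "0 \<le> X n \<omega>" for \<omega> unfolding X_def by (intro sum_nonneg H_nonneg)
  ultimately have "AE \<omega> in unifs. X n \<omega> = 0" using integral_nonneg_eq_0_iff_AE[of unifs "X n"] by simp
  then have "AE \<omega> in unifs. clique_count n r (graph n \<omega>) = 0"
    by eventually_elim (simp add: clique_count_graph[symmetric])
  then show ?thesis unfolding GnW_law by (subst AE_distr_iff) auto
qed

lemma X_full: assumes "tt = 1" shows "AE E in GnW n W0. clique_count n r E = n choose r"
proof -
  have i: "integrable unifs (X n)" by (intro unifs.P.bm_integrable bm_X)
  have "(\<integral>\<omega>. real (n choose r) - X n \<omega> \<partial>unifs) = 0" using assms i by (simp add: integral_X unifs.P.prob_space[simplified])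
  moreover have "integrable unifs (\<lambda>\<omega>. real (n choose r) - X n \<omega>)" using i by simp
  moreover have "0 \<le> real (n choose r) - X n \<omega>" for \<omega>
  proof -
    have "X n \<omega> \<le> (\<Sum>S\<in>ksubsets n r. 1)" unfolding X_def by (intro sum_mono H_le)
    then show ?thesis by (simp add: card_ksubsets)
  qed
  ultimately have "AE \<omega> in unifs. real (n choose r) - X n \<omega> = 0" using integral_nonneg_eq_0_iff_AE[of unifs "\<lambda>\<omega>. real (n choose r) - X n \<omega>"] by simp
  then have "AE \<omega> in unifs. clique_count n r (graph n \<omega>) = n choose r"
    by eventually_elim (simp add: clique_count_graph[symmetric])
  then show ?thesis unfolding GnW_law by (subst AE_distr_iff) auto
qed

subsection \<open>Reduction to the leading projection\<close>

lemma J_orthogonal: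
  assumes deg: "\<And>D. finite D \<Longrightarrow> card D < d \<Longrightarrow> AE \<omega> in unifs. J D \<omega> = tt"
    and S: "finite S" "card S \<le> r" and ST: "card (S \<inter> T) < d"
  shows "(\<integral>\<omega>. (J T \<omega> - tt) * (J S \<omega> - tt) \<partial>unifs) = 0"
proof -
  have "Cond T (\<lambda>\<omega>. J S \<omega> - tt) x = J (T \<inter> S) x - tt" for x
  proof -
    have "integrable unifs (\<lambda>y. J S (mix (- Pow T) x y))" by (intro unifs.P.bm_integrable bm_mix bm_J)
    then have "Cond T (\<lambda>\<omega>. J S \<omega> - tt) x = Cond T (J S) x - tt"
      unfolding Cond_def by (simp add: unifs.P.prob_space[simplified])
    then show ?thesis using Cond_J[OF S] by simp
  qed
  moreover have "(\<integral>\<omega>. (J T \<omega> - tt) * (J S \<omega> - tt) \<partial>unifs) = (\<integral>\<omega>. (J T \<omega> - tt) * Cond T (\<lambda>\<omega>. J S \<omega> - tt) \<omega> \<partial>unifs)"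
    unfolding Cond_def by (intro unifs.integral_mult_resample unifs.P.bm_integrable bm_mult bm_diff bm_J bm_const) (simp add: J_mix)
  ultimately have "(\<integral>\<omega>. (J T \<omega> - tt) * (J S \<omega> - tt) \<partial>unifs) = (\<integral>\<omega>. (J T \<omega> - tt) * (J (T \<inter> S) \<omega> - tt) \<partial>unifs)" by simp
  also have "\<dots> = (\<integral>\<omega>. 0 \<partial>(unifs :: (nat set \<Rightarrow> real) measure))"
  proof (rule integral_cong_AE)
    have "AE \<omega> in unifs. J (T \<inter> S) \<omega> = tt" using S(1) ST by (intro deg) (auto simp: Int_commute)
    then show "AE \<omega> in unifs. (J T \<omega> - tt) * (J (T \<inter> S) \<omega> - tt) = 0" by eventually_elim simp
  qed measurable
  finally show ?thesis by simp
qed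

text \<open>Distinct \<open>d\<close>-sets share fewer than \<open>d\<close> vertices, and
  conditioning on one reduces the projection of the other to a degenerate lower level; only the
  diagonal is left, so the sum has order \<open>n\<close> to the power \<open>d / 2\<close>.\<close>

lemma J_second_moment:
  assumes deg: "\<And>D. finite D \<Longrightarrow> card D < d \<Longrightarrow> AE \<omega> in unifs. J D \<omega> = tt" and "d \<le> r"
  shows "(\<integral>\<omega>. (\<Sum>D\<in>ksubsets n d. J D \<omega> - tt)\<^sup>2 \<partial>unifs) \<le> 2 ^ d * real n ^ d"
proof -
  have "(\<integral>\<omega>. (\<Sum>D\<in>ksubsets n d. J D \<omega> - tt)\<^sup>2 \<partial>unifs) \<le> 1 * 2 ^ d * real n ^ (2 * d - d)"
  proof (rule unifs.P.second_moment_sum_ksubsets(2))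
    show "integrable unifs (\<lambda>x. (J S x - tt)\<^sup>2)" for S by (intro unifs.P.bm_integrable bm_power bm_diff bm_J bm_const)
    show "(\<integral>x. (J S x - tt)\<^sup>2 \<partial>unifs) \<le> 1" for S
    proof -
      have "(\<integral>x. (J S x - tt)\<^sup>2 \<partial>unifs) \<le> (\<integral>x. 1 \<partial>(unifs :: (nat set \<Rightarrow> real) measure))"
      proof (intro integral_mono unifs.P.bm_integrable bm_power bm_diff bm_J bm_const)
        fix x
        have "\<bar>J S x - tt\<bar> \<le> 1" using J_bounds[of S x] tt_bounds by (simp add: abs_le_iff)
        then show "(J S x - tt)\<^sup>2 \<le> 1" by (simp add: abs_square_le_1)
      qed
      then show ?thesis by (simp add: unifs.P.prob_space[simplified])
    qed
    show "(\<integral>x. (J T x - tt) * (J S x - tt) \<partial>unifs) = 0" if "S \<in> ksubsets n d" "T \<in> ksubsets n d" "card (S \<inter> T) < d" for S T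
      using that ksubsets_finite[OF that(1)] ksubsets_card[OF that(1)] \<open>d \<le> r\<close> by (intro J_orthogonal deg) auto
  qed auto
  then show ?thesis by simp
qed

text \<open>Two mean square errors vanish after normalisation: the remainder of the projection,
  which is smaller by a factor \<open>n\<close>, and the replacement of the binomial weight by its
  limit, which the second moment of the leading sum controls. The levels 1 and 2 give the exponents
  \<open>r - 1/2\<close> and \<open>r - 1\<close>.\<close>

lemma char_projection:
  assumes deg: "\<And>D. finite D \<Longrightarrow> card D < d \<Longrightarrow> AE \<omega> in unifs. J D \<omega> = tt" and d: "d \<le> r"
    and lim: "(\<lambda>n. \<integral>\<omega>. iexp (t / fact (r - d) * ((\<Sum>D\<in>ksubsets n d. J D \<omega> - tt) / real n powr (d / 2))) \<partial>unifs) \<longlonglongrightarrow> L"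
  shows "(\<lambda>n. char (normalized_law n r W0 (real r - d / 2)) t) \<longlonglongrightarrow> L"
proof -
  define C where "C = (2 + 2 ^ r)\<^sup>2 * (2::real) ^ r"
  \<comment> \<open>The scaled number of \<open>r\<close>-sets through a given \<open>d\<close>-set;
    its limit \<open>1 / fact (r - d)\<close> explains the factor in the assumption on the leading
    sum.\<close>
  define B where "B n = real ((n - d) choose (r - d)) / real n ^ (r - d)" for n
  let ?S = "\<lambda>n \<omega>. \<Sum>D\<in>ksubsets n d. J D \<omega> - tt"
  let ?Y = "\<lambda>n \<omega>. t * ((X n \<omega> - real (n choose r) * tt) / real n powr (real r - d / 2))"
  let ?Z = "\<lambda>n \<omega>. t / fact (r - d) * (?S n \<omega> / real n powr (d / 2))"
  have bS: "bm unifs (?S n)" for n by (intro bm_sum bm_diff bm_J bm_const)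
  have [measurable]: "?S n \<in> borel_measurable unifs" for n using bS by (simp add: bm_def)
  have bYZ: "bm unifs (\<lambda>\<omega>. ?Y n \<omega> - ?Z n \<omega>)" for n
    by (intro bm_diff bm_mult bm_divide bm_const bm_X bS)
  have bnd: "cmod (char (normalized_law n r W0 (real r - d / 2)) t - (\<integral>\<omega>. iexp (?Z n \<omega>) \<partial>unifs))
     \<le> sqrt (2 * t\<^sup>2 * (C / n + 2 ^ d * (B n - 1 / fact (r - d))\<^sup>2))" if n: "n > 0" for n
  proof -
    let ?e = "\<lambda>\<omega>. (X n \<omega> - real (n choose r) * tt - real ((n - d) choose (r - d)) * ?S n \<omega>)"
    define p where "p = real n powr (real r - d / 2)"
    have p0: "p > 0" using n by (simp add: p_def)
    have psq: "p\<^sup>2 = real n ^ (2 * r - d)"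
    proof -
      have "p\<^sup>2 = real n powr (2 * (real r - d / 2))" using n by (simp add: p_def powr_power)
      also have "2 * (real r - d / 2) = real (2 * r - d)" using d by (simp add: of_nat_diff)
      finally show ?thesis using n by (simp add: powr_realpow)
    qed
    have pB: "real ((n - d) choose (r - d)) / p = B n / real n powr (d / 2)"
    proof -
      have "p = real n powr (real (r - d)) * real n powr (d / 2)"
        unfolding p_def powr_add[symmetric] using d by (simp add: of_nat_diff field_simps)
      then show ?thesis using n by (simp add: B_def powr_realpow)
    qed
    have ptw: "(?Y n \<omega> - ?Z n \<omega>)\<^sup>2 \<le> 2 * t\<^sup>2 * ((?e \<omega>)\<^sup>2 / p\<^sup>2 + (B n - 1 / fact (r - d))\<^sup>2 * ((?S n \<omega>)\<^sup>2 / real n ^ d))" for \<omega>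
    proof -
      have "?Y n \<omega> - ?Z n \<omega> = t * (?e \<omega> / p + (B n - 1 / fact (r - d)) * (?S n \<omega> / real n powr (d / 2)))"
      proof -
        have "(X n \<omega> - real (n choose r) * tt) / p = ?e \<omega> / p + (real ((n - d) choose (r - d)) / p) * ?S n \<omega>"
          using p0 by (simp add: field_simps)
        then have 1: "(X n \<omega> - real (n choose r) * tt) / p = ?e \<omega> / p + B n * (?S n \<omega> / real n powr (d / 2))"
          unfolding pB by simp
        have 2: "t * (a + B n * c) - t / fact (r - d) * c = t * (a + (B n - 1 / fact (r - d)) * c)" for a c
          by (simp add: algebra_simps)
        show ?thesis unfolding p_def[symmetric] 1 by (rule 2)
      qed
      then have "(?Y n \<omega> - ?Z n \<omega>)\<^sup>2 = t\<^sup>2 * (?e \<omega> / p + (B n - 1 / fact (r - d)) * (?S n \<omega> / real n powr (d / 2)))\<^sup>2"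
        by (simp add: power_mult_distrib)
      also have "\<dots> \<le> t\<^sup>2 * (2 * (?e \<omega> / p)\<^sup>2 + 2 * ((B n - 1 / fact (r - d)) * (?S n \<omega> / real n powr (d / 2)))\<^sup>2)"
      proof (rule mult_left_mono)
        show "(u + v)\<^sup>2 \<le> 2 * u\<^sup>2 + 2 * v\<^sup>2" for u v :: real
          using zero_le_power2[of "u - v"] by (simp add: power2_diff power2_sum)
      qed simp
      also have "(real n powr (d / 2))\<^sup>2 = real n ^ d"
        using n by (simp add: powr_power powr_realpow)
      then have "(?S n \<omega> / real n powr (d / 2))\<^sup>2 = (?S n \<omega>)\<^sup>2 / real n ^ d" by (simp add: power_divide)
      then have "t\<^sup>2 * (2 * (?e \<omega> / p)\<^sup>2 + 2 * ((B n - 1 / fact (r - d)) * (?S n \<omega> / real n powr (d / 2)))\<^sup>2)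
        = 2 * t\<^sup>2 * ((?e \<omega>)\<^sup>2 / p\<^sup>2 + (B n - 1 / fact (r - d))\<^sup>2 * ((?S n \<omega>)\<^sup>2 / real n ^ d))"
        by (simp only: power_mult_distrib power_divide) (simp add: algebra_simps)
      finally show ?thesis .
    qed
    have be: "bm unifs ?e" by (intro bm_diff bm_mult bm_const bm_X bS)
    have "(\<integral>\<omega>. (?Y n \<omega> - ?Z n \<omega>)\<^sup>2 \<partial>unifs) \<le> (\<integral>\<omega>. 2 * t\<^sup>2 * ((?e \<omega>)\<^sup>2 / p\<^sup>2 + (B n - 1 / fact (r - d))\<^sup>2 * ((?S n \<omega>)\<^sup>2 / real n ^ d)) \<partial>unifs)"
      by (intro integral_mono unifs.P.bm_integrable bm_power bYZ bm_mult bm_add bm_divide be bS bm_const ptw)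
    also have "\<dots> = 2 * t\<^sup>2 * ((\<integral>\<omega>. (?e \<omega>)\<^sup>2 \<partial>unifs) / p\<^sup>2 + (B n - 1 / fact (r - d))\<^sup>2 * ((\<integral>\<omega>. (?S n \<omega>)\<^sup>2 \<partial>unifs) / real n ^ d))"
      using unifs.P.bm_integrable[OF bm_power[OF be, of 2]] unifs.P.bm_integrable[OF bm_power[OF bS, of n 2]]
      by simp
    also have "\<dots> \<le> 2 * t\<^sup>2 * (C * real n ^ (2 * r - (d + 1)) / p\<^sup>2 + (B n - 1 / fact (r - d))\<^sup>2 * (2 ^ d * real n ^ d / real n ^ d))"
      using projection_error[OF deg d, of n] J_second_moment[OF deg d, of n]
      by (intro mult_left_mono add_mono divide_right_mono) (auto simp: C_def)
    also have "C * real n ^ (2 * r - (d + 1)) / p\<^sup>2 = C / n"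
    proof -
      have "2 * r - d = Suc (2 * r - (d + 1))" using d r2 by simp
      then show ?thesis unfolding psq using n by simp
    qed
    also have "2 ^ d * real n ^ d / real n ^ d = 2 ^ d" using n by simp
    finally have "(\<integral>\<omega>. (?Y n \<omega> - ?Z n \<omega>)\<^sup>2 \<partial>unifs) \<le> 2 * t\<^sup>2 * (C / n + 2 ^ d * (B n - 1 / fact (r - d))\<^sup>2)"
      by (simp add: mult.commute)
    moreover have "cmod ((\<integral>\<omega>. iexp (?Y n \<omega>) \<partial>unifs) - (\<integral>\<omega>. iexp (?Z n \<omega>) \<partial>unifs)) \<le> sqrt (\<integral>\<omega>. (?Y n \<omega> - ?Z n \<omega>)\<^sup>2 \<partial>unifs)"
      by (intro unifs.P.char_diff_L2 unifs.P.bm_integrable bm_power bYZ) measurable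
    ultimately show ?thesis unfolding char_normalized by (meson order_trans real_sqrt_le_mono)
  qed
  have ev: "\<forall>\<^sub>F n in sequentially. cmod (char (normalized_law n r W0 (real r - d / 2)) t - (\<integral>\<omega>. iexp (?Z n \<omega>) \<partial>unifs))
     \<le> sqrt (2 * t\<^sup>2 * (C / n + 2 ^ d * (B n - 1 / fact (r - d))\<^sup>2))"
    by (rule eventually_mono[OF eventually_gt_at_top[of 0]]) (rule bnd)
  have g: "(\<lambda>n. sqrt (2 * t\<^sup>2 * (C / n + 2 ^ d * (B n - 1 / fact (r - d))\<^sup>2))) \<longlonglongrightarrow> sqrt (2 * t\<^sup>2 * (0 + 2 ^ d * (1 / fact (r - d) - 1 / fact (r - d))\<^sup>2))"
  proof (intro tendsto_intros)
    show "B \<longlonglongrightarrow> 1 / fact (r - d)" unfolding B_def by (rule binomial_shift_limit)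
  qed
  have "(\<lambda>n. char (normalized_law n r W0 (real r - d / 2)) t - (\<integral>\<omega>. iexp (?Z n \<omega>) \<partial>unifs)) \<longlonglongrightarrow> 0"
    by (rule Lim_null_comparison[OF ev]) (use g in simp)
  from tendsto_add[OF this lim] show ?thesis by (simp only: diff_add_cancel add_0)
qed

end

section \<open>Limit theorems\<close>

lemma exp_minus_lipschitz:
  fixes a b :: real assumes "0 \<le> a" "0 \<le> b" shows "\<bar>exp (- a) - exp (- b)\<bar> \<le> \<bar>a - b\<bar>"
proof -
  have *: "\<bar>exp (- a) - exp (- b)\<bar> \<le> \<bar>a - b\<bar>" if "0 \<le> a" "a \<le> b" for a b :: real
  proof -
    have "exp (- a) - exp (- b) = exp (- a) * (1 - exp (- (b - a)))"
      by (simp add: algebra_simps flip: exp_add)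
    moreover have "0 \<le> 1 - exp (- (b - a))" "1 - exp (- (b - a)) \<le> b - a"
      using that exp_ge_add_one_self[of "- (b - a)"] by (auto simp: algebra_simps)
    moreover have "exp (- a) \<le> 1" "0 \<le> exp (- a)" using that by auto
    ultimately have "0 \<le> exp (- a) - exp (- b)" "exp (- a) - exp (- b) \<le> 1 * (b - a)"
      using mult_mono[of "exp (- a)" 1 "1 - exp (- (b - a))" "b - a"] by auto
    then show ?thesis using that by simp
  qed
  show ?thesis using *[of a b] *[of b a] assms by (cases "a \<le> b") auto
qed

lemma ksubsets_1: "ksubsets n 1 = (\<lambda>i. {i}) ` {..<n}"
  by (auto simp: ksubsets_def card_1_singleton_iff)

lemma ksubsets_2_Suc: "ksubsets (Suc n) 2 = ksubsets n 2 \<union> (\<lambda>i. {i, n}) ` {..<n}"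
proof (intro set_eqI iffI)
  fix p assume p: "p \<in> ksubsets (Suc n) 2"
  then obtain i j where ij: "p = {i, j}" "i \<noteq> j" "i < Suc n" "j < Suc n" by (auto simp: ksubsets_def card_2_iff)
  show "p \<in> ksubsets n 2 \<union> (\<lambda>i. {i, n}) ` {..<n}"
  proof (cases "n \<in> p")
    case True
    then show ?thesis using ij by (auto simp: insert_commute less_Suc_eq)
  next
    case False
    then show ?thesis using ij by (auto simp: ksubsets_def less_Suc_eq)
  qed
next
  fix p assume "p \<in> ksubsets n 2 \<union> (\<lambda>i. {i, n}) ` {..<n}"
  then show "p \<in> ksubsets (Suc n) 2" by (auto simp: ksubsets_def less_Suc_eq)
qed

text \<open>The square of the sum minus its diagonal counts every unordered pair twice. This turns a
  sum over vertex pairs into the quadratic form whose limit is known.\<close>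

lemma sum_pairs_product:
  fixes f :: "nat \<Rightarrow> real"
  shows "(\<Sum>p\<in>ksubsets n 2. f (Min p) * f (Max p)) = ((\<Sum>j<n. f j)\<^sup>2 - (\<Sum>j<n. (f j)\<^sup>2)) / 2"
proof (induction n)
  case 0
  show ?case by (auto simp: ksubsets_def intro!: sum.neutral)
next
  case (Suc n)
  have "(\<Sum>p\<in>ksubsets (Suc n) 2. f (Min p) * f (Max p)) = (\<Sum>p\<in>ksubsets n 2. f (Min p) * f (Max p)) + (\<Sum>p\<in>(\<lambda>i. {i, n}) ` {..<n}. f (Min p) * f (Max p))"
    unfolding ksubsets_2_Suc by (rule sum.union_disjoint) (auto simp: ksubsets_def)
  also have "(\<Sum>p\<in>(\<lambda>i. {i, n}) ` {..<n}. f (Min p) * f (Max p)) = (\<Sum>i<n. f i * f n)"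
    by (subst sum.reindex) (auto simp: inj_on_def doubleton_eq_iff min_def max_def intro!: sum.cong)
  finally show ?case using Suc by (simp add: power2_sum sum_distrib_right[symmetric] field_simps)
qed

text \<open>The compactness argument for coefficients needs them in decreasing order of modulus and
  padded by zeros; symmetric sums and products do not notice the rearrangement.\<close>

lemma sorted_by_abs:
  fixes l :: "nat \<Rightarrow> real"
  obtains a :: "nat \<Rightarrow> real" where "\<And>i. i \<ge> m \<Longrightarrow> a i = 0" "\<And>i j. i \<le> j \<Longrightarrow> \<bar>a j\<bar> \<le> \<bar>a i\<bar>"
    "\<And>f :: real \<Rightarrow> complex. (\<Prod>i<m. f (a i)) = (\<Prod>i<m. f (l i))"
    "\<And>g :: real \<Rightarrow> real. (\<Sum>i<m. g (a i)) = (\<Sum>i<m. g (l i))"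
proof -
  define xs where "xs = sort_key (\<lambda>x. - \<bar>x\<bar>) (map l [0..<m])"
  have len: "length xs = m" and mset: "mset xs = mset (map l [0..<m])" by (simp_all add: xs_def)
  have srt: "sorted (map (\<lambda>x. - \<bar>x\<bar>) xs)" unfolding xs_def by (rule sorted_sort_key)
  define a where "a i = (if i < m then xs ! i else 0)" for i
  have dec: "\<bar>a j\<bar> \<le> \<bar>a i\<bar>" if "i \<le> j" for i j
  proof (cases "j < m")
    case True
    then have "map (\<lambda>x. - \<bar>x\<bar>) xs ! i \<le> map (\<lambda>x. - \<bar>x\<bar>) xs ! j" using that len by (intro sorted_nth_mono[OF srt]) auto
    then show ?thesis using True that len by (simp add: a_def)
  qed (simp add: a_def)
  have am: "map a [0..<m] = xs" by (rule nth_equalityI) (auto simp: len a_def)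
  have pr: "(\<Prod>i<m. f (b i)) = prod_mset (image_mset f (mset (map b [0..<m])))" for f :: "real \<Rightarrow> complex" and b
    by (simp add: prod_unfold_prod_mset atLeast0LessThan[symmetric] image_mset.compositionality o_def)
  have sm: "(\<Sum>i<m. g (b i)) = sum_mset (image_mset g (mset (map b [0..<m])))" for g :: "real \<Rightarrow> real" and b
    by (simp add: sum_unfold_sum_mset atLeast0LessThan[symmetric] image_mset.compositionality o_def)
  show thesis
  proof (rule that)
    show "a i = 0" if "i \<ge> m" for i using that by (simp add: a_def)
    show "\<bar>a j\<bar> \<le> \<bar>a i\<bar>" if "i \<le> j" for i j using that by (rule dec)
    show "(\<Prod>i<m. f (a i)) = (\<Prod>i<m. f (l i))" for f :: "real \<Rightarrow> complex" unfolding pr am mset ..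
    show "(\<Sum>i<m. g (a i)) = (\<Sum>i<m. g (l i))" for g :: "real \<Rightarrow> real" unfolding sm am mset ..
  qed
qed

lemma integral_threshold:
  assumes "0 \<le> w" "w \<le> 1"
  shows "(\<integral>u. (if u \<le> w then c else 0) \<partial>unif01) = w * (c :: real)"
proof -
  have "(\<integral>u. (if u \<le> w then c else 0) \<partial>unif01) = (\<integral>u. c * indicator {..w} u \<partial>unif01)"
    by (intro Bochner_Integration.integral_cong refl) (auto simp: indicator_def)
  also have "\<dots> = w * c" using measure_unif01_atMost[OF assms] by simp
  finally show ?thesis .
qed

text \<open>An unordered pair has no first element, so its types are taken in the order of the
  vertices; for symmetric \<open>f\<close> this choice is immaterial.\<close>

definition pf :: "(real \<Rightarrow> real \<Rightarrow> real) \<Rightarrow> nat set \<Rightarrow> (nat set \<Rightarrow> real) \<Rightarrow> real" where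
  "pf f p \<omega> = f (\<omega> {Min p}) (\<omega> {Max p})"

lemma pf_doubleton: "(\<And>x y. f x y = f y x) \<Longrightarrow> i \<noteq> j \<Longrightarrow> pf f {i, j} \<omega> = f (\<omega> {i}) (\<omega> {j})"
  by (cases "i < j") (auto simp: pf_def min_def max_def)

section \<open>Statistics of a symmetric function of pairs of types\<close>

locale pair_function =
  fixes f :: "real \<Rightarrow> real \<Rightarrow> real"
  assumes f_bm: "bm (borel \<Otimes>\<^sub>M borel) (\<lambda>p. f (fst p) (snd p))" and f_sym: "f x y = f y x"
begin

lemma f_meas2 [measurable (raw)]:
  assumes "g \<in> borel_measurable M" "h \<in> borel_measurable M"
  shows "(\<lambda>x. f (g x) (h x)) \<in> borel_measurable M"
  using measurable_compose[OF measurable_Pair[OF assms] bm_measurable[OF f_bm]] by simp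

lemma f_bound: obtains K where "\<And>x y. \<bar>f x y\<bar> \<le> K"
  using f_bm unfolding bm_def by (metis fst_conv snd_conv)

lemma bm_pf [simp]: "bm unifs (pf f p)"
proof -
  obtain K where K: "\<And>x y. \<bar>f x y\<bar> \<le> K" by (rule f_bound) (rule that)
  have "(\<lambda>\<omega>. f (\<omega> {Min p}) (\<omega> {Max p})) \<in> borel_measurable unifs" by (intro f_meas2) measurable
  then show ?thesis unfolding pf_def[abs_def] using K by (intro bmI[of _ _ K]) auto
qed

lemma integral_pf: assumes "card p = 2"
  shows "(\<integral>\<omega>. pf f p \<omega> \<partial>unifs) = (\<integral>x. (\<integral>y. f x y \<partial>unif01) \<partial>unif01)"
proof -
  obtain K where K: "\<And>x y. \<bar>f x y\<bar> \<le> K" by (rule f_bound) (rule that)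
  obtain i j where p: "p = {i, j}" "i \<noteq> j" using assms by (auto simp: card_2_iff)
  have "(\<integral>\<omega>. pf f p \<omega> \<partial>unifs) = (\<integral>\<omega>. f (\<omega> {i}) (\<omega> {j}) \<partial>unifs)"
    unfolding p(1) using pf_doubleton[OF f_sym p(2)] by simp
  also have "\<dots> = (\<integral>x. (\<integral>y. f x y \<partial>unif01) \<partial>unif01)"
    using p(2) bm_measurable[OF f_bm] K by (intro integral_two_coordinates[of f K]) auto
  finally show ?thesis .
qed

lemma pf_orthogonal_disjoint:
  assumes "(\<integral>x. (\<integral>y. f x y \<partial>unif01) \<partial>unif01) = 0" "card p = 2" "card q = 2" "p \<inter> q = {}"
  shows "(\<integral>\<omega>. pf f q \<omega> * pf f p \<omega> \<partial>unifs) = 0"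
proof -
  obtain i j where p: "p = {i, j}" "i \<noteq> j" using assms by (auto simp: card_2_iff)
  obtain k l where q: "q = {k, l}" "k \<noteq> l" using assms by (auto simp: card_2_iff)
  have "(\<integral>\<omega>. pf f q \<omega> * pf f p \<omega> \<partial>unifs) = (\<integral>\<omega>. pf f q \<omega> \<partial>unifs) * (\<integral>\<omega>. pf f p \<omega> \<partial>unifs)"
  proof (rule unifs.integral_mult_indep[where A="{{i}, {j}}"])
    show "integrable unifs (\<lambda>\<omega>. pf f q \<omega> * pf f p \<omega>)" by (intro unifs.P.bm_integrable bm_mult bm_pf)
    show "pf f q (mix {{i}, {j}} x y) = pf f q x" for x y
      using assms(4) unfolding p q by (subst (1 2) pf_doubleton[OF f_sym q(2)]) (auto simp: mix_def)
    show "pf f p (mix {{i}, {j}} x y) = pf f p y" for x y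
      unfolding p by (subst (1 2) pf_doubleton[OF f_sym p(2)]) (auto simp: mix_def)
  qed
  then show ?thesis using integral_pf[OF assms(2)] assms(1) by simp
qed

text \<open>Some vertex of \<open>p\<close> is missing from \<open>q\<close>; resampling its type
  alone leaves the factor of \<open>q\<close> fixed and integrates the factor of \<open>p\<close> to
  0.\<close>

lemma pf_orthogonal_degenerate:
  assumes deg: "AE x in unif01. (\<integral>y. f x y \<partial>unif01) = 0" and "card p = 2" "card q = 2" "card (p \<inter> q) < 2"
  shows "(\<integral>\<omega>. pf f q \<omega> * pf f p \<omega> \<partial>unifs) = 0"
proof -
  have "\<not> p \<subseteq> q"
  proof
    assume "p \<subseteq> q"
    then have "p \<inter> q = p" by auto
    then show False using assms by simp
  qed
  then obtain j where j: "j \<in> p" "j \<notin> q" by auto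
  obtain i where p: "p = {i, j}" "i \<noteq> j"
  proof -
    obtain a b where "p = {a, b}" "a \<noteq> b" using assms by (auto simp: card_2_iff)
    then show thesis using j(1) that[of a] that[of b] by (auto simp: insert_commute)
  qed
  obtain k l where q: "q = {k, l}" "k \<noteq> l" using assms by (auto simp: card_2_iff)
  have "(\<integral>\<omega>. pf f q \<omega> * pf f p \<omega> \<partial>unifs) = (\<integral>x. pf f q x * (\<integral>y. pf f p (mix {{j}} x y) \<partial>unifs) \<partial>unifs)"
  proof (rule unifs.integral_mult_resample)
    show "integrable unifs (\<lambda>\<omega>. pf f q \<omega> * pf f p \<omega>)" by (intro unifs.P.bm_integrable bm_mult bm_pf)
    show "pf f q (mix {{j}} x y) = pf f q x" for x y
      using j(2) unfolding q by (subst (1 2) pf_doubleton[OF f_sym q(2)]) (auto simp: mix_def)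
  qed
  also have "\<dots> = (\<integral>x. 0 \<partial>(unifs :: (nat set \<Rightarrow> real) measure))"
  proof (rule integral_cong_AE)
    have "AE x in unifs. (\<integral>y. f (x {i}) y \<partial>unif01) = 0" using unifs.AE_component[of "{i}"] deg by simp
    then show "AE x in unifs. pf f q x * (\<integral>y. pf f p (mix {{j}} x y) \<partial>unifs) = 0"
    proof eventually_elim
      case (elim x)
      have "(\<integral>y. pf f p (mix {{j}} x y) \<partial>unifs) = (\<integral>y. f (x {i}) (y {j}) \<partial>unifs)"
        unfolding p using p(2) by (subst pf_doubleton[OF f_sym p(2)]) (simp add: mix_def)
      also have "\<dots> = (\<integral>y. f (x {i}) y \<partial>unif01)" by (rule unifs.integral_coordinate) measurable
      finally show ?case using elim by simp
    qed
    show "(\<lambda>x. pf f q x * (\<integral>y. pf f p (mix {{j}} x y) \<partial>unifs)) \<in> borel_measurable unifs"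
      by (intro borel_measurable_times unifs.borel_measurable_resample bm_measurable bm_pf)
  qed simp
  finally show ?thesis by simp
qed

lemma integral_pf_sq:
  assumes "card p = 2"
  shows "(\<integral>\<omega>. (pf f p \<omega>)\<^sup>2 \<partial>unifs) = (\<integral>x. (\<integral>y. (f x y)\<^sup>2 \<partial>unif01) \<partial>unif01)"
proof -
  interpret sq: pair_function "\<lambda>x y. (f x y)\<^sup>2"
    by standard (use f_bm f_sym in auto)
  have "pf (\<lambda>x y. (f x y)\<^sup>2) p \<omega> = (pf f p \<omega>)\<^sup>2" for \<omega> by (simp add: pf_def)
  then show ?thesis using sq.integral_pf[OF assms] by simp
qed

text \<open>\<open>q = 1\<close> is the case of a centred function, where only disjoint pairs are
  orthogonal and the variance has order \<open>n ^ 3\<close>; \<open>q = 2\<close> is the degenerate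
  case of order \<open>n\<^sup>2\<close>.\<close>

lemma sum_pf_second_moment:
  assumes K: "(\<integral>x. (\<integral>y. (f x y)\<^sup>2 \<partial>unif01) \<partial>unif01) \<le> K" "0 \<le> K" and q: "q \<le> 2"
    and ort: "\<And>p p'. card p = 2 \<Longrightarrow> card p' = 2 \<Longrightarrow> card (p \<inter> p') < q \<Longrightarrow> (\<integral>\<omega>. pf f p' \<omega> * pf f p \<omega> \<partial>unifs) = 0"
  shows "(\<integral>\<omega>. (\<Sum>p\<in>ksubsets n 2. pf f p \<omega>)\<^sup>2 \<partial>unifs) \<le> K * 4 * real n ^ (4 - q)"
proof -
  have "(\<integral>\<omega>. (\<Sum>p\<in>ksubsets n 2. pf f p \<omega>)\<^sup>2 \<partial>unifs) \<le> K * 2\<^sup>2 * real n ^ (2 * 2 - q)"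
    using K q ort by (intro unifs.P.second_moment_sum_ksubsets(2) bm_measurable unifs.P.bm_integrable bm_power bm_pf)
      (auto simp: integral_pf_sq ksubsets_def)
  then show ?thesis by simp
qed

end

section \<open>The normal limit from the sum over the vertices\<close>

context graphon_version
begin

theorem normal_limit:
  assumes nc: "\<not> (AE x in unif01. tau x = tt)"
  shows "\<exists>\<sigma>>0. weak_conv_m (\<lambda>n. normalized_law n r W0 (real r - 1 / 2)) (distr std_normal borel (\<lambda>z. \<sigma> * z))"
proof -
  define v where "v = (\<integral>x. (tau x - tt)\<^sup>2 \<partial>unif01)"
  have atau: "\<bar>tau x\<bar> \<le> 1" for x using tau_bounds[of x] by simp
  have btau: "bm unif01 tau" using atau by (intro bmI[of _ _ 1]) auto
  have bsq: "integrable unif01 (\<lambda>x. (tau x - tt)\<^sup>2)" by (intro unifs.M.bm_integrable bm_power bm_diff btau bm_const)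
  have v: "v > 0"
  proof (rule ccontr)
    assume "\<not> v > 0"
    then have "v = 0" unfolding v_def by (simp add: order_less_le)
    then have "AE x in unif01. (tau x - tt)\<^sup>2 = 0" unfolding v_def using integral_nonneg_eq_0_iff_AE[OF bsq] by simp
    then show False using nc by (auto elim!: eventually_mono)
  qed
  define \<sigma>0 where "\<sigma>0 = sqrt v"
  \<comment> \<open>About \<open>n ^ (r - 1) / fact (r - 1)\<close> of the \<open>r\<close>-sets
    contain a given vertex, so this is the weight of one centred variable
    \<open>tau - tt\<close>.\<close>
  define \<sigma> where "\<sigma> = \<sigma>0 / fact (r - 1)"
  have s0: "\<sigma>0 > 0" "\<sigma>0\<^sup>2 = v" using v by (auto simp: \<sigma>0_def)
  let ?X = "\<lambda>(i::nat) x. tau (x i) - tt"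
  let ?D = "\<lambda>n. distr unifs borel (\<lambda>x. (\<Sum>i<n. ?X i x) / sqrt (real n * \<sigma>0\<^sup>2))"
  have mean: "(\<integral>x. ?X j x \<partial>unifs) = 0" for j
  proof -
    have "(\<integral>x. ?X j x \<partial>unifs) = (\<integral>x. tau x - tt \<partial>unif01)" by (rule unifs.integral_coordinate) measurable
    also have "\<dots> = 0" using unifs.M.bm_integrable[OF btau] by (simp add: integral_tau unifs.M.prob_space[simplified])
    finally show ?thesis .
  qed
  have sq: "(\<integral>x. (?X j x)\<^sup>2 \<partial>unifs) = v" for j
    unfolding v_def by (rule unifs.integral_coordinate) measurable
  have "weak_conv_m ?D std_normal_distribution"
  proof (rule unifs.P.central_limit_theorem_zero_mean[where \<mu>="distr unif01 borel (\<lambda>x. tau x - tt)"])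
    show "unifs.P.indep_vars (\<lambda>_. borel) ?X UNIV"
      by (rule unifs.P.indep_vars_compose2[OF unifs.indep_vars_coordinates]) auto
    show "distr unifs borel (?X n) = distr unif01 borel (\<lambda>x. tau x - tt)" for n :: nat
    proof -
      have "distr (distr unifs unif01 (\<lambda>x. x n)) borel (\<lambda>x. tau x - tt) = distr unifs borel ((\<lambda>x. tau x - tt) \<circ> (\<lambda>x. x n))"
        by (rule distr_distr) auto
      then show ?thesis using unifs.PiM_component[of n] by (simp add: o_def)
    qed
    show "unifs.P.variance (?X n) = \<sigma>0\<^sup>2" for n :: nat
      unfolding mean using sq s0 by simp
    show "integrable unifs (\<lambda>x. (?X n x)\<^sup>2)" for n :: nat
    proof (intro unifs.P.bm_integrable bm_power bm_diff bm_const)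
      show "bm unifs (\<lambda>x. tau (x n))"
        using atau by (intro bmI[of _ _ 1]) auto
    qed
  qed (use s0 mean in auto)
  then have cD: "(\<lambda>n. char (?D n) t) \<longlonglongrightarrow> char std_normal_distribution t" for t
    by (intro levy_continuity1 real_dist_normal_dist unifs.P.real_distribution_distr) auto
  have "weak_conv_m (\<lambda>n. normalized_law n r W0 (real r - 1 / 2)) (distr std_normal borel (\<lambda>z. \<sigma> * z))"
  proof (rule levy_continuity)
    show "real_distribution (distr std_normal borel (\<lambda>z. \<sigma> * z))"
      by (rule prob_space.real_distribution_distr[OF prob_space_std_normal]) simp
    fix t
    have "(\<lambda>n. char (normalized_law n r W0 (real r - real 1 / 2)) t) \<longlonglongrightarrow> char std_normal_distribution (t * \<sigma>)"
    proof (rule char_projection)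
      show "AE \<omega> in unifs. J D \<omega> = tt" if "finite D" "card D < 1" for D
        using that J_empty by (simp add: card_eq_0_iff)
      have "(\<integral>\<omega>. iexp (t / fact (r - 1) * ((\<Sum>D\<in>ksubsets n 1. J D \<omega> - tt) / real n powr (real 1 / 2))) \<partial>unifs) = char (?D n) (t * \<sigma>)" for n
      proof -
        have "(\<integral>\<omega>. iexp (t / fact (r - 1) * ((\<Sum>D\<in>ksubsets n 1. J D \<omega> - tt) / real n powr (real 1 / 2))) \<partial>unifs)
          = (\<integral>\<omega>. iexp (t * \<sigma> * ((\<Sum>i<n. tau (\<omega> {i}) - tt) / sqrt (real n * \<sigma>0\<^sup>2))) \<partial>unifs)"
        proof (intro Bochner_Integration.integral_cong refl)
          fix \<omega> :: "nat set \<Rightarrow> real"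
          have "(\<Sum>D\<in>ksubsets n 1. J D \<omega> - tt) = (\<Sum>i<n. tau (\<omega> {i}) - tt)"
            unfolding ksubsets_1 by (subst sum.reindex) (auto simp: J_single)
          moreover have "t / fact (r - 1) * (S / real n powr (real 1 / 2)) = t * \<sigma> * (S / sqrt (real n * \<sigma>0\<^sup>2))" for S
            using s0(1) by (simp add: \<sigma>_def real_sqrt_mult powr_half_sqrt)
          ultimately show "iexp (t / fact (r - 1) * ((\<Sum>D\<in>ksubsets n 1. J D \<omega> - tt) / real n powr (real 1 / 2)))
            = iexp (t * \<sigma> * ((\<Sum>i<n. tau (\<omega> {i}) - tt) / sqrt (real n * \<sigma>0\<^sup>2)))" by (simp only:)
        qed
        also have "\<dots> = (\<integral>x. iexp (t * \<sigma> * ((\<Sum>i<n. tau (x i) - tt) / sqrt (real n * \<sigma>0\<^sup>2))) \<partial>(unifs :: (nat \<Rightarrow> real) measure))"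
          by (rule integral_unifs_reindex[of "\<lambda>i. {i}" "\<lambda>x. iexp (t * \<sigma> * ((\<Sum>i<n. tau (x i) - tt) / sqrt (real n * \<sigma>0\<^sup>2)))"])
             (auto simp: inj_on_def)
        also have "\<dots> = char (?D n) (t * \<sigma>)" unfolding char_def by (subst integral_distr) auto
        finally show ?thesis .
      qed
      then show "(\<lambda>n. \<integral>\<omega>. iexp (t / fact (r - 1) * ((\<Sum>D\<in>ksubsets n 1. J D \<omega> - tt) / real n powr (real 1 / 2))) \<partial>unifs) \<longlonglongrightarrow> char std_normal_distribution (t * \<sigma>)"
        using cD[of "t * \<sigma>"] by simp
    qed (use r2 in auto)
    moreover have "char (distr std_normal borel (\<lambda>z. \<sigma> * z)) t = char std_normal_distribution (t * \<sigma>)"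
      unfolding char_def by (subst integral_distr) (auto simp: std_normal_def mult.assoc)
    ultimately show "(\<lambda>n. char (normalized_law n r W0 (real r - 1 / 2)) t) \<longlonglongrightarrow> char (distr std_normal borel (\<lambda>z. \<sigma> * z)) t"
      by simp
  qed (rule real_distribution_normalized)
  then show ?thesis using s0 by (intro exI[of _ \<sigma>]) (auto simp: \<sigma>_def)
qed

end

section \<open>Degenerate kernels\<close>

context pair_function
begin

text \<open>The kernel error \<open>g\<close> is again degenerate, so its sum over the pairs is of
  order \<open>n\<close> times the square root of \<epsilon>, and the error bound holds for every
  \<open>n > 0\<close> alike. Each product over a pair occurs once, which turns the eigenvalues
  \<open>l i\<close> into the coefficients \<open>l i / 2\<close> and the squared norm into a
  quarter of it.\<close>

lemma degenerate_approximation: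
  assumes deg: "AE x in unif01. (\<integral>y. f x y \<partial>unif01) = 0" and e: "\<epsilon> > 0"
  shows "\<exists>(m::nat) a :: nat \<Rightarrow> real. (\<forall>i\<ge>m. a i = 0) \<and> (\<forall>i j. i \<le> j \<longrightarrow> \<bar>a j\<bar> \<le> \<bar>a i\<bar>) \<and>
    \<bar>(\<Sum>i<m. (a i)\<^sup>2) - (\<integral>x. (\<integral>y. (f x y)\<^sup>2 \<partial>unif01) \<partial>unif01) / 4\<bar> \<le> \<epsilon> \<and>
    (\<forall>s. \<exists>\<psi>. \<psi> \<longlonglongrightarrow> (\<Prod>i<m. chi_cf (s * a i)) \<and>
      (\<forall>n>0. cmod ((\<integral>\<omega>. iexp (s / real n * (\<Sum>p\<in>ksubsets n 2. pf f p \<omega>)) \<partial>unifs) - \<psi> n) \<le> \<bar>s\<bar> * sqrt (4 * \<epsilon>)))"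
proof -
  interpret U: pair_prob_space unif01 unif01 ..
  let ?h = "\<lambda>p. f (fst p) (snd p)"
  have cross: "bm (borel \<Otimes>\<^sub>M borel) g \<Longrightarrow> bm (unif01 \<Otimes>\<^sub>M unif01) g" for g :: "real \<times> real \<Rightarrow> real"
    unfolding bm_def by (auto simp: measurable_cong_sets[OF sets_pair_measure_cong[OF sets_unif01 sets_unif01] refl])
  have fub: "(\<integral>p. (g (fst p) (snd p))\<^sup>2 \<partial>(unif01 \<Otimes>\<^sub>M unif01)) = (\<integral>x. (\<integral>y. (g x y)\<^sup>2 \<partial>unif01) \<partial>unif01)"
    if "bm (borel \<Otimes>\<^sub>M borel) (\<lambda>p. g (fst p) (snd p))" for g :: "real \<Rightarrow> real \<Rightarrow> real"
    using U.integral_fst'[OF U.P.bm_integrable[OF bm_power[OF cross[OF that], of 2]]] by simp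
  have hsym: "?h (x, y) = ?h (y, x)" for x y using f_sym by simp
  have hdeg: "AE x in unif01. (\<integral>y. ?h (x, y) \<partial>unif01) = 0" using deg by simp
  obtain m :: nat and l w where
    w: "\<And>i. i < m \<Longrightarrow> bm unif01 (w i)" "\<And>i. i < m \<Longrightarrow> (\<integral>x. w i x \<partial>unif01) = 0"
    "\<And>i j. i < m \<Longrightarrow> j < m \<Longrightarrow> (\<integral>x. w i x * w j x \<partial>unif01) = (if i = j then 1 else 0)"
    and err: "(\<integral>p. (?h p - (\<Sum>i<m. l i * (w i (fst p) * w i (snd p))))\<^sup>2 \<partial>(unif01 \<Otimes>\<^sub>M unif01)) \<le> \<epsilon>"
    "(\<integral>p. (?h p - (\<Sum>i<m. l i * (w i (fst p) * w i (snd p))))\<^sup>2 \<partial>(unif01 \<Otimes>\<^sub>M unif01)) = (\<integral>p. (?h p)\<^sup>2 \<partial>(unif01 \<Otimes>\<^sub>M unif01)) - (\<Sum>i<m. (l i)\<^sup>2)"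
    by (rule unifs.M.kernel_diagonal_approx[OF cross[OF f_bm] hsym hdeg e]) (rule that)
  have wb: "bm borel (w i)" if "i < m" for i
    using w(1)[OF that] by (simp add: bm_def measurable_unif01)
  define k where "k x y = (\<Sum>i<m. l i * (w i x * w i y))" for x y
  define g where "g x y = f x y - k x y" for x y
  interpret k: pair_function k
    by standard (auto simp: k_def mult.commute intro!: bm_sum bm_mult bm_fst bm_snd wb)
  interpret g: pair_function g
    by standard (use f_bm k.f_bm f_sym k.f_sym in \<open>auto simp: g_def\<close>)
  have gsq: "(\<integral>x. (\<integral>y. (g x y)\<^sup>2 \<partial>unif01) \<partial>unif01) \<le> \<epsilon>"
    using err(1) fub[OF g.f_bm] by (simp add: g_def k_def)
  have lsum: "(\<integral>x. (\<integral>y. (f x y)\<^sup>2 \<partial>unif01) \<partial>unif01) - (\<Sum>i<m. (l i)\<^sup>2) = (\<integral>x. (\<integral>y. (g x y)\<^sup>2 \<partial>unif01) \<partial>unif01)"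
    using err(2) fub[OF g.f_bm] fub[OF f_bm] by (simp add: g_def k_def)
  have gnn: "0 \<le> (\<integral>x. (\<integral>y. (g x y)\<^sup>2 \<partial>unif01) \<partial>unif01)" by simp
  have bf: "bm unif01 (f x)" for x
  proof -
    obtain K where "\<And>x y. \<bar>f x y\<bar> \<le> K" by (rule f_bound) (rule that)
    then show ?thesis by (intro bmI[of _ _ K] f_meas2) auto
  qed
  have gdeg: "AE x in unif01. (\<integral>y. g x y \<partial>unif01) = 0"
    using deg
  proof eventually_elim
    case (elim x)
    have bk: "bm unif01 (\<lambda>y. l i * (w i x * w i y))" if "i < m" for i using w(1)[OF that] by auto
    have "(\<integral>y. k x y \<partial>unif01) = (\<Sum>i<m. \<integral>y. l i * (w i x * w i y) \<partial>unif01)"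
      unfolding k_def using bk by (intro Bochner_Integration.integral_sum unifs.M.bm_integrable) auto
    also have "\<dots> = 0" using w(2) by (intro sum.neutral) auto
    finally have k0: "(\<integral>y. k x y \<partial>unif01) = 0" .
    have "integrable unif01 (k x)" unfolding k_def using bk by (intro unifs.M.bm_integrable bm_sum) auto
    then show ?case using elim k0 unifs.M.bm_integrable[OF bf[of x]] by (simp add: g_def)
  qed
  have mom: "(\<integral>\<omega>. (\<Sum>p\<in>ksubsets n 2. pf g p \<omega>)\<^sup>2 \<partial>unifs) \<le> \<epsilon> * 4 * real n ^ 2" for n
  proof -
    have "(\<integral>\<omega>. (\<Sum>p\<in>ksubsets n 2. pf g p \<omega>)\<^sup>2 \<partial>unifs) \<le> \<epsilon> * 4 * real n ^ (4 - 2)"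
      by (rule g.sum_pf_second_moment[OF gsq]) (use e in simp, simp, rule g.pf_orthogonal_degenerate[OF gdeg])
    then show ?thesis by simp
  qed
  obtain a :: "nat \<Rightarrow> real" where a: "\<And>i. i \<ge> m \<Longrightarrow> a i = 0" "\<And>i j. i \<le> j \<Longrightarrow> \<bar>a j\<bar> \<le> \<bar>a i\<bar>"
    "\<And>f :: real \<Rightarrow> complex. (\<Prod>i<m. f (a i)) = (\<Prod>i<m. f (l i / 2))"
    "\<And>g :: real \<Rightarrow> real. (\<Sum>i<m. g (a i)) = (\<Sum>i<m. g (l i / 2))"
    by (rule sorted_by_abs[of m "\<lambda>i. l i / 2"]) (rule that)
  have "(\<Sum>i<m. (a i)\<^sup>2) = (\<Sum>i<m. (l i)\<^sup>2) / 4"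
    using a(4)[of "\<lambda>x. x\<^sup>2"] by (simp add: power_divide sum_divide_distrib)
  then have as: "\<bar>(\<Sum>i<m. (a i)\<^sup>2) - (\<integral>x. (\<integral>y. (f x y)\<^sup>2 \<partial>unif01) \<partial>unif01) / 4\<bar> \<le> \<epsilon>"
    using lsum gsq gnn e unfolding abs_le_iff by linarith
  have psi: "\<exists>\<psi>. \<psi> \<longlonglongrightarrow> (\<Prod>i<m. chi_cf (s * a i)) \<and>
      (\<forall>n>0. cmod ((\<integral>\<omega>. iexp (s / real n * (\<Sum>p\<in>ksubsets n 2. pf f p \<omega>)) \<partial>unifs) - \<psi> n) \<le> \<bar>s\<bar> * sqrt (4 * \<epsilon>))" for s
  proof -
    let ?\<psi> = "\<lambda>n. \<integral>\<omega>. iexp (s / real n * (\<Sum>p\<in>ksubsets n 2. pf k p \<omega>)) \<partial>unifs"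
    let ?G = "\<lambda>n x. iexp (s / real n * (\<Sum>i<m. l i / 2 * ((\<Sum>j<n. w i (x j))\<^sup>2 - (\<Sum>j<n. (w i (x j))\<^sup>2))))"
    have "?\<psi> n = (\<integral>x. ?G n x \<partial>(unifs :: (nat \<Rightarrow> real) measure))" for n
    proof -
      have "(\<Sum>p\<in>ksubsets n 2. pf k p \<omega>) = (\<Sum>i<m. l i / 2 * ((\<Sum>j<n. w i (\<omega> {j}))\<^sup>2 - (\<Sum>j<n. (w i (\<omega> {j}))\<^sup>2)))" for \<omega>
      proof -
        have "(\<Sum>p\<in>ksubsets n 2. pf k p \<omega>) = (\<Sum>i<m. \<Sum>p\<in>ksubsets n 2. l i * (w i (\<omega> {Min p}) * w i (\<omega> {Max p})))"
          unfolding pf_def k_def by (rule sum.swap)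
        also have "\<dots> = (\<Sum>i<m. l i * (\<Sum>p\<in>ksubsets n 2. w i (\<omega> {Min p}) * w i (\<omega> {Max p})))"
          by (simp add: sum_distrib_left)
        also have "\<dots> = (\<Sum>i<m. l i / 2 * ((\<Sum>j<n. w i (\<omega> {j}))\<^sup>2 - (\<Sum>j<n. (w i (\<omega> {j}))\<^sup>2)))"
        proof (intro sum.cong refl)
          show "l i * (\<Sum>p\<in>ksubsets n 2. w i (\<omega> {Min p}) * w i (\<omega> {Max p})) = l i / 2 * ((\<Sum>j<n. w i (\<omega> {j}))\<^sup>2 - (\<Sum>j<n. (w i (\<omega> {j}))\<^sup>2))" for i
            unfolding sum_pairs_product[of "\<lambda>j. w i (\<omega> {j})" n] by simp
        qed
        finally show ?thesis .
      qed
      then have "?\<psi> n = (\<integral>\<omega>. ?G n (\<lambda>i. \<omega> {i}) \<partial>(unifs :: (nat set \<Rightarrow> real) measure))" by simp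
      also have "\<dots> = (\<integral>x. ?G n x \<partial>(unifs :: (nat \<Rightarrow> real) measure))"
      proof (rule integral_unifs_reindex[of "\<lambda>i. {i}" "?G n"])
        have "(\<lambda>x :: nat \<Rightarrow> real. w i (x j)) \<in> borel_measurable unifs" if "i < m" for i j
          using wb[OF that] by (auto dest: bm_measurable)
        then have "(\<lambda>x :: nat \<Rightarrow> real. \<Sum>i<m. l i / 2 * ((\<Sum>j<n. w i (x j))\<^sup>2 - (\<Sum>j<n. (w i (x j))\<^sup>2))) \<in> borel_measurable unifs"
          by (intro borel_measurable_sum borel_measurable_times borel_measurable_diff borel_measurable_power borel_measurable_const) auto
        then show "?G n \<in> borel_measurable unifs" by measurable
      qed simp
      finally show ?thesis .
    qed
    moreover have "(\<lambda>n. \<integral>x. ?G n x \<partial>(unifs :: (nat \<Rightarrow> real) measure)) \<longlonglongrightarrow> (\<Prod>i<m. chi_cf (s * l i / 2))"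
      by (rule degenerate_quadratic_limit) (fact w)+
    ultimately have lim: "?\<psi> \<longlonglongrightarrow> (\<Prod>i<m. chi_cf (s * a i))" using a(3)[of "\<lambda>x. chi_cf (s * x)"] by simp
    have "cmod ((\<integral>\<omega>. iexp (s / real n * (\<Sum>p\<in>ksubsets n 2. pf f p \<omega>)) \<partial>unifs) - ?\<psi> n) \<le> \<bar>s\<bar> * sqrt (4 * \<epsilon>)" if n: "n > 0" for n
    proof -
      have bs: "bm unifs (\<lambda>\<omega>. \<Sum>p\<in>ksubsets n 2. pf f p \<omega>)" "bm unifs (\<lambda>\<omega>. \<Sum>p\<in>ksubsets n 2. pf k p \<omega>)"
        by (intro bm_sum bm_pf k.bm_pf)+
      have dif: "(s / real n * (\<Sum>p\<in>ksubsets n 2. pf f p \<omega>) - s / real n * (\<Sum>p\<in>ksubsets n 2. pf k p \<omega>))\<^sup>2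
        = (s / real n)\<^sup>2 * (\<Sum>p\<in>ksubsets n 2. pf g p \<omega>)\<^sup>2" for \<omega>
      proof -
        have "(\<Sum>p\<in>ksubsets n 2. pf g p \<omega>) = (\<Sum>p\<in>ksubsets n 2. pf f p \<omega>) - (\<Sum>p\<in>ksubsets n 2. pf k p \<omega>)"
          by (simp add: pf_def g_def sum_subtractf)
        then show ?thesis by (simp only: right_diff_distrib[symmetric] power_mult_distrib)
      qed
      have "cmod ((\<integral>\<omega>. iexp (s / real n * (\<Sum>p\<in>ksubsets n 2. pf f p \<omega>)) \<partial>unifs) - ?\<psi> n)
        \<le> sqrt (\<integral>\<omega>. (s / real n * (\<Sum>p\<in>ksubsets n 2. pf f p \<omega>) - s / real n * (\<Sum>p\<in>ksubsets n 2. pf k p \<omega>))\<^sup>2 \<partial>unifs)"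
        by (intro unifs.P.char_diff_L2 unifs.P.bm_integrable bm_power bm_diff bm_mult bm_const bs bm_measurable)
      also have "\<dots> = sqrt ((s / real n)\<^sup>2 * (\<integral>\<omega>. (\<Sum>p\<in>ksubsets n 2. pf g p \<omega>)\<^sup>2 \<partial>unifs))"
        unfolding dif by simp
      also have "\<dots> \<le> sqrt ((s / real n)\<^sup>2 * (\<epsilon> * 4 * real n ^ 2))"
        by (intro real_sqrt_le_mono mult_left_mono mom) simp
      also have "\<dots> = \<bar>s\<bar> * sqrt (4 * \<epsilon>)" using n by (simp add: real_sqrt_mult)
      finally show ?thesis .
    qed
    then have "\<forall>n>0. cmod ((\<integral>\<omega>. iexp (s / real n * (\<Sum>p\<in>ksubsets n 2. pf f p \<omega>)) \<partial>unifs) - ?\<psi> n) \<le> \<bar>s\<bar> * sqrt (4 * \<epsilon>)"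
      by (intro allI impI)
    with lim show ?thesis by (intro exI[of _ ?\<psi>] conjI)
  qed
  have a1: "\<forall>i\<ge>m. a i = 0" by (rule allI, rule impI, erule a(1))
  have a2: "\<forall>i j. i \<le> j \<longrightarrow> \<bar>a j\<bar> \<le> \<bar>a i\<bar>" by (rule allI, rule allI, rule impI, erule a(2))
  show ?thesis
    by (rule exI[of _ m], rule exI[of _ a], rule conjI[OF a1], rule conjI[OF a2], rule conjI[OF as], rule allI, rule psi)
qed

text \<open>Approximations with errors tending to 0 are taken along a subsequence with convergent
  coefficients; as their error is uniform in \<open>n\<close>, the statistic itself converges along
  all \<open>n\<close>. The value \<open>L\<close> of the infinite product is left to the caller,
  who obtains its existence from the chaos series.\<close>

theorem degenerate_U_statistic_limit:
  assumes deg: "AE x in unif01. (\<integral>y. f x y \<partial>unif01) = 0"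
  defines "Q \<equiv> (\<integral>x. (\<integral>y. (f x y)\<^sup>2 \<partial>unif01) \<partial>unif01) / 4"
  obtains c where "summable (\<lambda>l. (c l)\<^sup>2)" "(\<Sum>l. (c l)\<^sup>2) \<le> Q"
    "\<And>s L. (\<lambda>N. \<Prod>l<N. chi_cf (s * c l)) \<longlonglongrightarrow> L \<Longrightarrow>
      (\<lambda>n. \<integral>\<omega>. iexp (s / real n * (\<Sum>p\<in>ksubsets n 2. pf f p \<omega>)) \<partial>unifs) \<longlonglongrightarrow> complex_of_real (exp (- s\<^sup>2 * (Q - (\<Sum>l. (c l)\<^sup>2)))) * L"
proof -
  define F where "F s n = (\<integral>\<omega>. iexp (s / real n * (\<Sum>p\<in>ksubsets n 2. pf f p \<omega>)) \<partial>unifs)" for s and n :: nat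
  define \<epsilon> where "\<epsilon> k = 1 / real (Suc k)" for k
  define P where "P k m a \<longleftrightarrow> (\<forall>i\<ge>m. a i = (0::real)) \<and> (\<forall>i j. i \<le> j \<longrightarrow> \<bar>a j\<bar> \<le> \<bar>a i\<bar>) \<and>
    \<bar>(\<Sum>i<m. (a i)\<^sup>2) - Q\<bar> \<le> \<epsilon> k \<and>
    (\<forall>s. \<exists>\<psi>. \<psi> \<longlonglongrightarrow> (\<Prod>i<m. chi_cf (s * a i)) \<and> (\<forall>n>0. cmod (F s n - \<psi> n) \<le> \<bar>s\<bar> * sqrt (4 * \<epsilon> k)))" for k and m :: nat and a
  have "0 < \<epsilon> k" for k by (simp add: \<epsilon>_def)
  then have "\<forall>k. \<exists>m a. P k m a"
    unfolding P_def F_def Q_def by (intro allI degenerate_approximation[OF deg])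
  then have "\<exists>m. \<forall>k. \<exists>a. P k (m k) a" by (rule choice)
  then obtain m where "\<forall>k. \<exists>a. P k (m k) a" ..
  then have "\<exists>a. \<forall>k. P k (m k) (a k)" by (rule choice)
  then obtain a where a: "\<forall>k. P k (m k) (a k)" ..
  have P: "\<And>i k. i \<ge> m k \<Longrightarrow> a k i = 0" "\<And>k i j. i \<le> j \<Longrightarrow> \<bar>a k j\<bar> \<le> \<bar>a k i\<bar>"
    "\<And>k. \<bar>(\<Sum>i<m k. (a k i)\<^sup>2) - Q\<bar> \<le> \<epsilon> k"
    "\<And>k s. \<exists>\<psi>. \<psi> \<longlonglongrightarrow> (\<Prod>i<m k. chi_cf (s * a k i)) \<and> (\<forall>n>0. cmod (F s n - \<psi> n) \<le> \<bar>s\<bar> * sqrt (4 * \<epsilon> k))"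
    using a unfolding P_def by simp_all
  have e0: "\<epsilon> \<longlonglongrightarrow> 0" unfolding \<epsilon>_def by real_asymp
  have "(\<lambda>k. (\<Sum>i<m k. (a k i)\<^sup>2) - Q) \<longlonglongrightarrow> 0"
    by (rule Lim_null_comparison[OF _ e0]) (use P(3) in simp)
  then have lim: "(\<lambda>k. \<Sum>i<m k. (a k i)\<^sup>2) \<longlonglongrightarrow> Q" by (rule LIM_zero_cancel)
  obtain \<rho> c where rc: "strict_mono \<rho>" "summable (\<lambda>l. (c l)\<^sup>2)" "(\<Sum>l. (c l)\<^sup>2) \<le> Q"
    "\<And>s L. (\<lambda>N. \<Prod>l<N. chi_cf (s * c l)) \<longlonglongrightarrow> L \<Longrightarrow>
      (\<lambda>k. \<Prod>l<m (\<rho> k). chi_cf (s * a (\<rho> k) l)) \<longlonglongrightarrow> complex_of_real (exp (- s\<^sup>2 * (Q - (\<Sum>l. (c l)\<^sup>2)))) * L"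
    by (rule chi_products_subsequence[of m a Q]) (erule P(1), erule P(2), rule lim, rule that)
  show thesis
  proof (rule that[OF rc(2,3)])
    fix s L assume L: "(\<lambda>N. \<Prod>l<N. chi_cf (s * c l)) \<longlonglongrightarrow> L"
    define E where "E = complex_of_real (exp (- s\<^sup>2 * (Q - (\<Sum>l. (c l)\<^sup>2)))) * L"
    have "F s \<longlonglongrightarrow> E"
    proof (rule tendstoI)
      fix e :: real assume e: "e > 0"
      have "(\<lambda>k. \<bar>s\<bar> * sqrt (4 * \<epsilon> (\<rho> k))) \<longlonglongrightarrow> \<bar>s\<bar> * sqrt (4 * 0)"
        by (intro tendsto_intros LIMSEQ_subseq_LIMSEQ[OF e0 rc(1), unfolded o_def])
      then have "\<forall>\<^sub>F k in sequentially. \<bar>s\<bar> * sqrt (4 * \<epsilon> (\<rho> k)) < e / 3"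
        using e by (intro order_tendstoD(2)) auto
      moreover have "\<forall>\<^sub>F k in sequentially. dist (\<Prod>l<m (\<rho> k). chi_cf (s * a (\<rho> k) l)) E < e / 3"
        unfolding E_def using e by (intro tendstoD[OF rc(4)[OF L]]) simp
      ultimately have "\<forall>\<^sub>F k in sequentially. \<bar>s\<bar> * sqrt (4 * \<epsilon> (\<rho> k)) < e / 3 \<and> dist (\<Prod>l<m (\<rho> k). chi_cf (s * a (\<rho> k) l)) E < e / 3"
        by (rule eventually_conj)
      \<comment> \<open>One approximation is fixed that is good for all \<open>n\<close> and whose
        limiting product is near the target; only then does \<open>n\<close> grow.\<close>
      then obtain k where k: "\<bar>s\<bar> * sqrt (4 * \<epsilon> (\<rho> k)) < e / 3" "dist (\<Prod>l<m (\<rho> k). chi_cf (s * a (\<rho> k) l)) E < e / 3"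
        using eventually_happens[of _ sequentially] by auto
      obtain \<psi> where psi: "\<psi> \<longlonglongrightarrow> (\<Prod>i<m (\<rho> k). chi_cf (s * a (\<rho> k) i))"
        "\<forall>n>0. cmod (F s n - \<psi> n) \<le> \<bar>s\<bar> * sqrt (4 * \<epsilon> (\<rho> k))" using P(4)[where k="\<rho> k" and s=s] by auto
      have "\<forall>\<^sub>F n in sequentially. dist (\<psi> n) (\<Prod>i<m (\<rho> k). chi_cf (s * a (\<rho> k) i)) < e / 3"
        using e by (intro tendstoD[OF psi(1)]) simp
      then show "\<forall>\<^sub>F n in sequentially. dist (F s n) E < e"
        using eventually_gt_at_top[of 0]
      proof eventually_elim
        case (elim n)
        have "cmod (F s n - \<psi> n) \<le> \<bar>s\<bar> * sqrt (4 * \<epsilon> (\<rho> k))" using psi(2) elim(2) by blast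
        then have "dist (F s n) (\<psi> n) < e / 3" using k(1) unfolding dist_norm by linarith
        then show ?case using elim(1) k(2) dist_triangle[of "F s n" E "\<psi> n"]
          dist_triangle[of "\<psi> n" E "\<Prod>i<m (\<rho> k). chi_cf (s * a (\<rho> k) i)"] by linarith
      qed
    qed
    then show "(\<lambda>n. \<integral>\<omega>. iexp (s / real n * (\<Sum>p\<in>ksubsets n 2. pf f p \<omega>)) \<partial>unifs) \<longlonglongrightarrow> complex_of_real (exp (- s\<^sup>2 * (Q - (\<Sum>l. (c l)\<^sup>2)))) * L"
      unfolding F_def[symmetric] E_def .
  qed
qed

end

text \<open>A centred Bernoulli variable scaled by \<open>v\<close> is bounded by 1 and has variance
  \<open>v\<^sup>2 * w * (1 - w)\<close>. With \<theta> of order \<open>1 / n\<close> the cubic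
  error stays negligible after summation over all pairs.\<close>

lemma bernoulli_char_approx:
  fixes \<theta> w v :: real
  assumes w: "0 \<le> w" "w \<le> 1" and v: "0 \<le> v" "v \<le> 1"
  shows "cmod ((\<integral>u. iexp (\<theta> * ((if u \<le> w then v else 0) - w * v)) \<partial>unif01) - complex_of_real (exp (- \<theta>\<^sup>2 / 2 * (v\<^sup>2 * w * (1 - w)))))
    \<le> \<bar>\<theta>\<bar> ^ 3 / 6 + \<theta> ^ 4 / 8"
proof -
  let ?Y = "\<lambda>u. \<theta> * ((if u \<le> w then v else 0) - w * v)"
  have wv: "0 \<le> w * v" "w * v \<le> v" "w * v \<le> 1"
    using assms mult_right_mono[of w 1 v] mult_mono[of w 1 v 1] by auto
  have b: "\<bar>?Y u\<bar> \<le> \<bar>\<theta>\<bar>" for u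
    using wv v mult_left_mono[of "\<bar>(if u \<le> w then v else 0) - w * v\<bar>" 1 "\<bar>\<theta>\<bar>"] by (auto simp: abs_mult)
  have bY: "bm unif01 ?Y" using b by (intro bmI[of _ _ "\<bar>\<theta>\<bar>"]) auto
  have bI: "bm unif01 (\<lambda>u. if u \<le> w then c else 0)" for c :: real by (intro bmI[of _ _ "\<bar>c\<bar>"]) auto
  have mean: "(\<integral>u. ?Y u \<partial>unif01) = 0"
    using unifs.M.bm_integrable[OF bI[of v]] by (simp add: integral_threshold[OF w] unifs.M.prob_space[simplified])
  have sq: "(\<integral>u. (?Y u)\<^sup>2 \<partial>unif01) = \<theta>\<^sup>2 * (v\<^sup>2 * w * (1 - w))"
  proof -
    have "(?Y u)\<^sup>2 = \<theta>\<^sup>2 * ((if u \<le> w then v\<^sup>2 - 2 * w * v\<^sup>2 else 0) + (w * v)\<^sup>2)" for u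
      by (simp add: power_mult_distrib power2_diff) (simp add: power2_eq_square algebra_simps)
    then have "(\<integral>u. (?Y u)\<^sup>2 \<partial>unif01) = \<theta>\<^sup>2 * (w * (v\<^sup>2 - 2 * w * v\<^sup>2) + (w * v)\<^sup>2)"
      using unifs.M.bm_integrable[OF bI[of "v\<^sup>2 - 2 * w * v\<^sup>2"]]
      by (simp add: integral_threshold[OF w] unifs.M.prob_space[simplified])
    then show ?thesis by (simp add: power2_eq_square algebra_simps)
  qed
  have c3: "\<bar>?Y u\<bar> ^ 3 \<le> \<bar>\<theta>\<bar> ^ 3" for u using b by (intro power_mono) auto
  have i3: "integrable unif01 (\<lambda>u. \<bar>?Y u\<bar> ^ 3)"
    using c3 by (intro unifs.M.bm_integrable bmI[of _ _ "\<bar>\<theta>\<bar> ^ 3"]) auto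
  have "(\<integral>u. \<bar>?Y u\<bar> ^ 3 \<partial>unif01) \<le> (\<integral>u. \<bar>\<theta>\<bar> ^ 3 \<partial>unif01)"
    by (intro integral_mono i3 c3) simp
  then have m3: "(\<integral>u. \<bar>?Y u\<bar> ^ 3 \<partial>unif01) \<le> \<bar>\<theta>\<bar> ^ 3" by (simp add: unifs.M.prob_space[simplified])
  have "(\<integral>u. (?Y u)\<^sup>2 \<partial>unif01) \<le> (\<integral>u. \<theta>\<^sup>2 \<partial>unif01)"
  proof (intro integral_mono unifs.M.bm_integrable bm_power bY bm_const)
    show "(?Y u)\<^sup>2 \<le> \<theta>\<^sup>2" for u using b[of u] by (simp only: abs_le_square_iff)
  qed
  then have m2: "(\<integral>u. (?Y u)\<^sup>2 \<partial>unif01) \<le> \<theta>\<^sup>2" by (simp add: unifs.M.prob_space[simplified])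
  have "cmod ((\<integral>u. iexp (?Y u) \<partial>unif01) - exp (- (\<integral>u. (?Y u)\<^sup>2 \<partial>unif01) / 2))
    \<le> (\<integral>u. \<bar>?Y u\<bar> ^ 3 \<partial>unif01) / 6 + (\<integral>u. (?Y u)\<^sup>2 \<partial>unif01)\<^sup>2 / 8"
    by (rule unifs.M.iexp_normal_approx[OF bm_measurable[OF bY] i3 mean])
  also have "\<dots> \<le> \<bar>\<theta>\<bar> ^ 3 / 6 + (\<theta>\<^sup>2)\<^sup>2 / 8"
    by (intro add_mono divide_right_mono m3 power_mono m2) auto
  also have "(\<theta>\<^sup>2)\<^sup>2 = \<theta> ^ 4" by (simp add: power_mult[symmetric])
  finally show ?thesis unfolding sq by (simp add: exp_of_real)
qed

section \<open>The conditional clique probability of a pair\<close>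

context graphon_version
begin

lemma J_cong:
  assumes "\<And>s. s \<subseteq> D \<Longrightarrow> s \<noteq> {} \<Longrightarrow> x s = y s" shows "J D x = J D y"
  unfolding J_def Cond_def using assms
  by (intro Bochner_Integration.integral_cong refl H_cong) (auto simp: mix_def)

text \<open>The value \<open>0\<close> at the coordinate \<open>{0, 1}\<close> forces the edge \<open>{0, 1}\<close> to be present.\<close>

definition V :: "real \<Rightarrow> real \<Rightarrow> real" where
  "V x y = J {0, 1} (\<lambda>s. if s = {0} then x else if s = {1} then y else 0)"

text \<open>The edge between 0 and 1 is one factor of the clique indicator, and the other factors do
  not read its coordinate. Setting this coordinate to 0 therefore isolates their conditional mean,
  which is \<open>V\<close> at the two types.\<close>

lemma J_01: "J {0, 1} \<omega> = edge \<omega> {0, 1} * V (\<omega> {0}) (\<omega> {1})"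
proof -
  let ?S = "{..<r}" and ?A = "- Pow {0, 1::nat}"
  let ?R = "\<lambda>z. \<Prod>p\<in>pairs ?S - {{0, 1}}. edge z p"
  have mem: "{0, 1} \<in> pairs ?S" using r2 by (auto simp: pairs_def)
  have H: "H ?S z = edge z {0, 1} * ?R z" for z
    unfolding H_def by (rule prod.remove) (use mem in auto)
  have e: "edge (mix ?A \<omega> y) {0, 1} = edge \<omega> {0, 1}" for \<omega> y
    by (subst (1 2) edge_doubleton) (auto simp: mix_def)
  have J: "J {0, 1} \<omega> = edge \<omega> {0, 1} * (\<integral>y. ?R (mix ?A \<omega> y) \<partial>unifs)" for \<omega>
  proof -
    have "J {0, 1} \<omega> = Cond {0, 1} (H ?S) \<omega>" using r2 by (intro Cond_H_subset[symmetric]) auto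
    then show ?thesis unfolding Cond_def H e by simp
  qed
  let ?\<omega> = "fun_upd \<omega> {0, 1} 0"
  have "?R (mix ?A ?\<omega> y) = ?R (mix ?A \<omega> y)" for y
  proof (intro prod.cong refl)
    fix p assume "p \<in> pairs ?S - {{0, 1}}"
    then have p: "p \<noteq> {0, 1}" "card p = 2" by (simp_all add: pairs_def)
    obtain i j where ij: "p = {i, j}" "i \<noteq> j" using p(2) by (auto simp: card_2_iff)
    have ij3: "{i, j} \<noteq> {0, 1}" using p(1) unfolding ij(1) .
    have ne: "{k} \<noteq> {0, 1::nat}" for k by auto
    show "edge (mix ?A ?\<omega> y) p = edge (mix ?A \<omega> y) p"
      unfolding ij(1) edge_doubleton[OF ij(2)] using ij3 ne by (simp add: mix_def)
  qed
  moreover have "edge ?\<omega> {0, 1} = 1" by (subst edge_doubleton) (auto simp: W_nonneg)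
  ultimately have "J {0, 1} ?\<omega> = (\<integral>y. ?R (mix ?A \<omega> y) \<partial>unifs)" unfolding J[of ?\<omega>] by simp
  moreover have "J {0, 1} ?\<omega> = V (\<omega> {0}) (\<omega> {1})"
    unfolding V_def
  proof (rule J_cong)
    fix s :: "nat set" assume s: "s \<subseteq> {0, 1}" "s \<noteq> {}"
    have ne: "{0, 1} \<noteq> {0::nat}" "{0, 1} \<noteq> {1::nat}" "{0} \<noteq> {0, 1::nat}" "{1} \<noteq> {0, 1::nat}" "{1} \<noteq> {0::nat}" by auto
    have "s \<in> Pow {0, 1}" using s by simp
    then consider "s = {0}" | "s = {1}" | "s = {0, 1}" using s(2) by (auto simp: Pow_insert)
    then show "?\<omega> s = (if s = {0} then \<omega> {0} else if s = {1} then \<omega> {1} else 0)"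
      by cases (use ne in simp_all)
  qed
  ultimately show ?thesis unfolding J[of \<omega>] by simp
qed

lemma J_pair:
  assumes "i \<noteq> j" shows "J {i, j} \<omega> = edge \<omega> {i, j} * V (\<omega> {i}) (\<omega> {j})"
proof -
  \<comment> \<open>A vertex \<open>k\<close> other than 0 and 1 goes to \<open>k + i + j\<close>,
    which exceeds both \<open>i\<close> and \<open>j\<close>, so the map is injective.\<close>
  define \<pi> where "\<pi> k = (if k = 0 then i else if k = 1 then j else k + i + j)" for k
  have pi: "inj \<pi>" using assms by (auto simp: inj_def \<pi>_def split: if_splits)
  have im: "\<pi> ` {0, 1} = {i, j}" "\<pi> ` {0} = {i}" "\<pi> ` {1} = {j}" by (auto simp: \<pi>_def)
  have "J {i, j} \<omega> = J {0, 1} (act \<pi> \<omega>)"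
    using J_act[OF _ _ pi, of "{0, 1}" \<omega>] r2 unfolding im by simp
  also have "\<dots> = edge (act \<pi> \<omega>) {0, 1} * V (act \<pi> \<omega> {0}) (act \<pi> \<omega> {1})" by (rule J_01)
  also have "edge (act \<pi> \<omega>) {0, 1} = edge \<omega> {i, j}" using edge_act[OF pi, of "{0, 1}" \<omega>] unfolding im by simp
  finally show ?thesis by (simp only: act_def im)
qed

lemma V_sym: "V x y = V y x"
proof -
  let ?\<omega> = "\<lambda>s. if s = {0} then x else if s = {1::nat} then y else 0"
  have "V x y = J {1, 0} ?\<omega>" unfolding V_def by (simp add: insert_commute)
  also have "\<dots> = edge ?\<omega> {1, 0} * V (?\<omega> {1}) (?\<omega> {0})" by (rule J_pair) simp
  also have "edge ?\<omega> {1, 0} = 1" by (subst edge_doubleton) (auto simp: W_nonneg)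
  finally show ?thesis by simp
qed

lemma V_bounds: "0 \<le> V x y" "V x y \<le> 1"
  unfolding V_def by (rule J_bounds)+

lemma bm_V: "bm (borel \<Otimes>\<^sub>M borel) (\<lambda>p. V (fst p) (snd p))"
proof (rule bmI)
  have "(\<lambda>p. (\<lambda>s. if s = {0} then fst p else if s = {1} then snd p else 0)) \<in> measurable (borel \<Otimes>\<^sub>M borel) (unifs :: (nat set \<Rightarrow> real) measure)"
  proof (rule measurable_PiM_single')
    fix s :: "nat set"
    show "(\<lambda>p. if s = {0} then fst p else if s = {1} then snd p else 0) \<in> measurable (borel \<Otimes>\<^sub>M borel) unif01"
      by (cases "s = {0}"; cases "s = {1}") auto
  qed auto
  then show "(\<lambda>p. V (fst p) (snd p)) \<in> borel_measurable (borel \<Otimes>\<^sub>M borel)"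
    unfolding V_def by (rule measurable_compose) (rule J_measurable)
  show "\<bar>V (fst p) (snd p)\<bar> \<le> 1" for p using V_bounds[of "fst p" "snd p"] by simp
qed

lemma bm_W: "bm (borel \<Otimes>\<^sub>M borel) (\<lambda>p. W (fst p) (snd p))"
  using W_meas W_nonneg W_le by (intro bmI[of _ _ 1]) (auto simp: abs_of_nonneg)

definition h :: "real \<Rightarrow> real \<Rightarrow> real" where
  "h x y = W x y * V x y - tt"

definition vv :: "real \<Rightarrow> real \<Rightarrow> real" where
  "vv x y = (V x y)\<^sup>2 * W x y * (1 - W x y)"

definition vbar :: real where
  "vbar = (\<integral>x. (\<integral>y. vv x y \<partial>unif01) \<partial>unif01)"

sublocale h: pair_function h
  by standard (auto simp: h_def W_sym V_sym intro!: bm_diff bm_mult bm_const bm_V bm_W)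

sublocale vv: pair_function vv
  by standard (auto simp: vv_def W_sym V_sym intro!: bm_diff bm_mult bm_power bm_const bm_V bm_W)

sublocale V: pair_function V
  by standard (auto simp: V_sym intro!: bm_V)

lemma vv_bounds: "0 \<le> vv x y" "vv x y \<le> 1"
proof -
  have v: "0 \<le> (V x y)\<^sup>2" "(V x y)\<^sup>2 \<le> 1" using V_bounds[of x y] by (auto simp: power_le_one)
  show "0 \<le> vv x y" unfolding vv_def using v W_nonneg[of x y] W_le[of x y] by simp
  have "(V x y)\<^sup>2 * W x y \<le> 1 * 1" using v W_nonneg[of x y] W_le[of x y] by (intro mult_mono) auto
  then have "(V x y)\<^sup>2 * W x y * (1 - W x y) \<le> 1 * 1"
    using v W_nonneg[of x y] W_le[of x y] by (intro mult_mono) auto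
  then show "vv x y \<le> 1" by (simp add: vv_def)
qed

lemma vbar_bounds: "0 \<le> vbar" "vbar \<le> 1"
proof -
  show "0 \<le> vbar" unfolding vbar_def by (intro integral_nonneg_AE AE_I2 vv_bounds)
  have "vbar = (\<integral>\<omega>. pf vv {0, 1} \<omega> \<partial>unifs)" unfolding vbar_def by (rule vv.integral_pf[symmetric]) simp
  also have "\<dots> \<le> (\<integral>\<omega>. 1 \<partial>(unifs :: (nat set \<Rightarrow> real) measure))"
    by (intro integral_mono unifs.P.bm_integrable vv.bm_pf bm_const) (simp add: pf_def vv_bounds)
  finally show "vbar \<le> 1" by (simp add: unifs.P.prob_space[simplified])
qed

text \<open>Tower property: condition first on the pair \<open>{0, 1}\<close>, then average over the
  edge variable, which contributes \<open>W\<close>, and over the type of vertex 1. It makes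
  degeneracy of \<open>h\<close> the same as constancy of \<open>tau\<close>.\<close>

lemma tau_eq: "tau x = (\<integral>y. W x y * V x y \<partial>unif01)"
proof -
  let ?f = "\<lambda>v u. if u \<le> W x v then V x v else 0"
  have "tau x = Cond {0} (J {0, 1}) (\<lambda>_. x)"
    unfolding tau_def using Cond_J[of "{0, 1}" "{0}" "\<lambda>_. x"] r2 by simp
  also have "\<dots> = (\<integral>y. ?f (y {1}) (y {0, 1}) \<partial>(unifs :: (nat set \<Rightarrow> real) measure))"
    unfolding Cond_def J_01
  proof (intro Bochner_Integration.integral_cong refl)
    fix y :: "nat set \<Rightarrow> real"
    show "edge (mix (- Pow {0}) (\<lambda>_. x) y) {0, 1} * V (mix (- Pow {0}) (\<lambda>_. x) y {0}) (mix (- Pow {0}) (\<lambda>_. x) y {1}) = ?f (y {1}) (y {0, 1})"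
      by (subst edge_doubleton) (auto simp: mix_def)
  qed
  also have "\<dots> = (\<integral>v. (\<integral>u. ?f v u \<partial>unif01) \<partial>unif01)"
  proof (rule integral_two_coordinates[of ?f 1])
    have [measurable]: "(\<lambda>p. V x (fst p)) \<in> borel_measurable (borel \<Otimes>\<^sub>M borel)"
      "(\<lambda>p. W x (fst p)) \<in> borel_measurable (borel \<Otimes>\<^sub>M borel)"
      by (intro V.f_meas2 W_meas2; measurable)+
    show "(\<lambda>p. ?f (fst p) (snd p)) \<in> borel_measurable (borel \<Otimes>\<^sub>M borel)" by measurable
    show "norm (?f v u) \<le> 1" for v u using V_bounds[of x v] by auto
  qed auto
  also have "\<dots> = (\<integral>y. W x y * V x y \<partial>unif01)"
    by (simp add: integral_threshold W_nonneg W_le)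
  finally show ?thesis .
qed

lemma h_degenerate:
  assumes "AE x in unif01. tau x = tt" shows "AE x in unif01. (\<integral>y. h x y \<partial>unif01) = 0"
  using assms
proof eventually_elim
  case (elim x)
  have "bm unif01 (\<lambda>y. W x y * V x y)"
  proof (rule bmI)
    show "(\<lambda>y. W x y * V x y) \<in> borel_measurable unif01" by (intro borel_measurable_times W_meas2 V.f_meas2) auto
    show "\<bar>W x y * V x y\<bar> \<le> 1" for y
      using V_bounds[of x y] W_nonneg[of x y] W_le[of x y] by (simp add: mult_le_one)
  qed
  then show ?case using elim unifs.M.bm_integrable[of "\<lambda>y. W x y * V x y"]
    by (simp add: h_def tau_eq unifs.M.prob_space[simplified])
qed

end

section \<open>The noise of the pair variables\<close>

context graphon_version
begin

text \<open>Only the coordinates of two-element sets are resampled, that is, the types are fixed.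
  The terms are then independent, each a constant plus a scaled centred Bernoulli variable, and the
  difference of the two products is at most the sum of the differences of the factors.\<close>

lemma conditional_char_approx:
  fixes x :: "nat set \<Rightarrow> real" and \<theta> :: real
  defines "A \<equiv> {p :: nat set. card p = 2}"
  shows "cmod ((\<integral>y. iexp (\<theta> * (\<Sum>p\<in>ksubsets n 2. J p (mix A x y) - tt)) \<partial>unifs)
      - iexp (\<theta> * (\<Sum>p\<in>ksubsets n 2. pf h p x)) * complex_of_real (exp (- \<theta>\<^sup>2 / 2 * (\<Sum>p\<in>ksubsets n 2. pf vv p x))))
    \<le> real (n choose 2) * (\<bar>\<theta>\<bar> ^ 3 / 6 + \<theta> ^ 4 / 8)"
proof -
  \<comment> \<open>The centred noise that the pair variable \<open>u\<close> produces once the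
    types in \<open>x\<close> are fixed.\<close>
  define b where "b p u = (if u \<le> pf W p x then pf V p x else 0) - pf W p x * pf V p x" for p and u :: real
  define z where "z p = (\<integral>u. iexp (\<theta> * b p u) \<partial>unif01)" for p
  define e where "e p = exp (- \<theta>\<^sup>2 / 2 * pf vv p x)" for p
  let ?K = "ksubsets n 2" and ?a = "iexp (\<theta> * (\<Sum>p\<in>ksubsets n 2. pf h p x))"
  have fin: "finite ?K" by (simp add: ksubsets_def)
  have J: "J p (mix A x y) - tt = pf h p x + b p (y p)" if pK: "p \<in> ?K" for p y
  proof -
    obtain i j where p: "p = {i, j}" "i \<noteq> j" using pK by (auto simp: ksubsets_def card_2_iff)
    have m: "mix A x y {i, j} = y {i, j}" "mix A x y {i} = x {i}" "mix A x y {j} = x {j}"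
      using p(2) by (simp_all add: mix_def A_def)
    have "J p (mix A x y) = (if y p \<le> pf W p x then pf V p x else 0)"
      unfolding p(1) J_pair[OF p(2)] edge_doubleton[OF p(2)] m pf_doubleton[OF W_sym p(2)] pf_doubleton[OF V_sym p(2)] by simp
    then show ?thesis by (simp add: b_def pf_def h_def)
  qed
  have bb: "b p \<in> borel_measurable borel" for p unfolding b_def[abs_def] by measurable
  have ig: "integrable unif01 (\<lambda>u. iexp (\<theta> * b p u))" for p
    using bb[of p] by (intro unifs.M.integrable_const_bound[of _ 1]) auto
  have inner: "iexp (\<theta> * (\<Sum>p\<in>?K. J p (mix A x y) - tt)) = ?a * (\<Prod>p\<in>?K. iexp (\<theta> * b p (y p)))" for y
  proof -
    have "(\<Sum>p\<in>?K. J p (mix A x y) - tt) = (\<Sum>p\<in>?K. pf h p x) + (\<Sum>p\<in>?K. b p (y p))"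
      using J by (simp add: sum.distrib)
    then have "\<i> * complex_of_real (\<theta> * (\<Sum>p\<in>?K. J p (mix A x y) - tt))
      = \<i> * complex_of_real (\<theta> * (\<Sum>p\<in>?K. pf h p x)) + (\<Sum>p\<in>?K. \<i> * complex_of_real (\<theta> * b p (y p)))"
      by (simp add: distrib_left sum_distrib_left)
    then show ?thesis by (simp only: exp_add exp_sum[OF fin])
  qed
  have "(\<integral>y. iexp (\<theta> * (\<Sum>p\<in>?K. J p (mix A x y) - tt)) \<partial>unifs) = ?a * (\<integral>y. (\<Prod>p\<in>?K. iexp (\<theta> * b p (y p))) \<partial>unifs)"
    unfolding inner by simp
  also have "(\<integral>y. (\<Prod>p\<in>?K. iexp (\<theta> * b p (y p))) \<partial>unifs) = (\<Prod>p\<in>?K. z p)"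
    unfolding z_def by (rule unifs.integral_prod_coordinates[OF fin ig])
  finally have I: "(\<integral>y. iexp (\<theta> * (\<Sum>p\<in>?K. J p (mix A x y) - tt)) \<partial>unifs) = ?a * (\<Prod>p\<in>?K. z p)" .
  have "complex_of_real (exp (- \<theta>\<^sup>2 / 2 * (\<Sum>p\<in>?K. pf vv p x))) = (\<Prod>p\<in>?K. complex_of_real (e p))"
    unfolding sum_distrib_left exp_sum[OF fin] e_def by simp
  then have "cmod ((\<integral>y. iexp (\<theta> * (\<Sum>p\<in>?K. J p (mix A x y) - tt)) \<partial>unifs)
      - ?a * complex_of_real (exp (- \<theta>\<^sup>2 / 2 * (\<Sum>p\<in>?K. pf vv p x))))
    = cmod ?a * cmod ((\<Prod>p\<in>?K. z p) - (\<Prod>p\<in>?K. complex_of_real (e p)))"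
    unfolding I by (simp only: right_diff_distrib[symmetric] norm_mult)
  also have "\<dots> = cmod ((\<Prod>p\<in>?K. z p) - (\<Prod>p\<in>?K. complex_of_real (e p)))"
    by (simp only: norm_exp_i_times mult_1)
  also have "\<dots> \<le> (\<Sum>p\<in>?K. cmod (z p - complex_of_real (e p)))"
  proof (rule norm_prod_diff)
    fix p
    have "cmod (z p) \<le> (\<integral>u. cmod (iexp (\<theta> * b p u)) \<partial>unif01)" unfolding z_def by (rule integral_norm_bound)
    then show "cmod (z p) \<le> 1" by (simp add: unifs.M.prob_space[simplified])
    show "cmod (complex_of_real (e p)) \<le> 1" unfolding e_def using vv_bounds by (simp add: pf_def)
  qed
  also have "\<dots> \<le> (\<Sum>p\<in>?K. \<bar>\<theta>\<bar> ^ 3 / 6 + \<theta> ^ 4 / 8)"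
  proof (rule sum_mono)
    fix p
    show "cmod (z p - complex_of_real (e p)) \<le> \<bar>\<theta>\<bar> ^ 3 / 6 + \<theta> ^ 4 / 8"
      unfolding z_def e_def b_def pf_def vv_def by (rule bernoulli_char_approx) (rule W_nonneg W_le V_bounds)+
  qed
  also have "\<dots> = real (n choose 2) * (\<bar>\<theta>\<bar> ^ 3 / 6 + \<theta> ^ 4 / 8)" by (simp add: card_ksubsets)
  finally show ?thesis .
qed

text \<open>Centred functions of disjoint pairs are orthogonal, so the fluctuation has order
  \<open>n\<close> to the power \<open>3/2\<close>, negligible against the order
  \<open>n\<^sup>2\<close> of the sum of the conditional variances.\<close>

lemma vv_concentration:
  "(\<integral>\<omega>. \<bar>(\<Sum>p\<in>ksubsets n 2. pf vv p \<omega> - vbar)\<bar> \<partial>unifs) \<le> 2 * sqrt (real n ^ 3)"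
proof -
  define u where "u x y = vv x y - vbar" for x y
  interpret u: pair_function u
    by standard (auto simp: u_def vv.f_sym intro!: bm_diff bm_const vv.f_bm)
  have pfu: "pf u p \<omega> = pf vv p \<omega> - vbar" for p \<omega> by (simp add: pf_def u_def)
  have "(\<integral>x. (\<integral>y. u x y \<partial>unif01) \<partial>unif01) = (\<integral>\<omega>. pf u {0, 1} \<omega> \<partial>unifs)"
    by (rule u.integral_pf[symmetric]) simp
  also have "\<dots> = (\<integral>\<omega>. pf vv {0, 1} \<omega> \<partial>unifs) - vbar"
    unfolding pfu using unifs.P.bm_integrable[OF vv.bm_pf[of "{0, 1}"]] by (simp add: unifs.P.prob_space[simplified])
  also have "(\<integral>\<omega>. pf vv {0, 1} \<omega> \<partial>unifs) = vbar" unfolding vbar_def by (rule vv.integral_pf) simp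
  finally have u0: "(\<integral>x. (\<integral>y. u x y \<partial>unif01) \<partial>unif01) = 0" by simp
  have usq: "(u x y)\<^sup>2 \<le> 1" for x y
    using vv_bounds[of x y] vbar_bounds by (simp add: u_def abs_square_le_1)
  have "(\<integral>x. (\<integral>y. (u x y)\<^sup>2 \<partial>unif01) \<partial>unif01) = (\<integral>\<omega>. (pf u {0, 1} \<omega>)\<^sup>2 \<partial>unifs)"
    by (rule u.integral_pf_sq[symmetric]) simp
  also have "\<dots> \<le> (\<integral>\<omega>. 1 \<partial>(unifs :: (nat set \<Rightarrow> real) measure))"
    by (intro integral_mono unifs.P.bm_integrable bm_power u.bm_pf bm_const) (simp add: pf_def usq)
  finally have K: "(\<integral>x. (\<integral>y. (u x y)\<^sup>2 \<partial>unif01) \<partial>unif01) \<le> 1" by (simp add: unifs.P.prob_space[simplified])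
  have "(\<integral>\<omega>. (\<Sum>p\<in>ksubsets n 2. pf u p \<omega>)\<^sup>2 \<partial>unifs) \<le> 1 * 4 * real n ^ (4 - 1)"
  proof (rule u.sum_pf_second_moment[OF K])
    fix p p' :: "nat set" assume p: "card p = 2" "card p' = 2" "card (p \<inter> p') < 1"
    then have "finite p" by (intro card_ge_0_finite) simp
    then have "p \<inter> p' = {}" using p(3) by simp
    then show "(\<integral>\<omega>. pf u p' \<omega> * pf u p \<omega> \<partial>unifs) = 0" using p by (intro u.pf_orthogonal_disjoint[OF u0])
  qed auto
  then have m: "(\<integral>\<omega>. (\<Sum>p\<in>ksubsets n 2. pf u p \<omega>)\<^sup>2 \<partial>unifs) \<le> 4 * real n ^ 3" by simp
  have "(\<integral>\<omega>. \<bar>\<Sum>p\<in>ksubsets n 2. pf u p \<omega>\<bar> \<partial>unifs) \<le> sqrt (\<integral>\<omega>. (\<Sum>p\<in>ksubsets n 2. pf u p \<omega>)\<^sup>2 \<partial>unifs)"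
    by (intro unifs.P.L1_le_L2 unifs.P.bm_integrable bm_power bm_measurable bm_sum u.bm_pf)
  also have "\<dots> \<le> sqrt (4 * real n ^ 3)" by (rule real_sqrt_le_mono[OF m])
  also have "\<dots> = 2 * sqrt (real n ^ 3)" by (simp add: real_sqrt_mult)
  finally show ?thesis unfolding pfu .
qed

text \<open>Given the types, the noise contributes a normal factor whose variance concentrates at a
  constant: about \<open>n\<^sup>2 / 2\<close> pairs of mean variance \<open>vbar\<close>, scaled by
  \<open>(s / n)\<^sup>2 / 2\<close>, give the exponent \<open>s\<^sup>2 * vbar / 4\<close>. A
  deterministic limit of this factor is what makes the noise asymptotically independent of the
  kernel sum.\<close>

lemma edge_noise_limit:
  "(\<lambda>n. (\<integral>\<omega>. iexp (s / real n * (\<Sum>p\<in>ksubsets n 2. J p \<omega> - tt)) \<partial>unifs)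
    - complex_of_real (exp (- s\<^sup>2 * vbar / 4)) * (\<integral>\<omega>. iexp (s / real n * (\<Sum>p\<in>ksubsets n 2. pf h p \<omega>)) \<partial>unifs)) \<longlonglongrightarrow> 0"
proof -
  define A where "A = {p :: nat set. card p = 2}"
  define I1 where "I1 n = (\<integral>\<omega>. iexp (s / real n * (\<Sum>p\<in>ksubsets n 2. J p \<omega> - tt)) \<partial>unifs)" for n
  define g where "g n \<omega> = iexp (s / real n * (\<Sum>p\<in>ksubsets n 2. pf h p \<omega>))" for n :: nat and \<omega>
  define w where "w n \<omega> = exp (- (s / real n)\<^sup>2 / 2 * (\<Sum>p\<in>ksubsets n 2. pf vv p \<omega>))" for n :: nat and \<omega>
  define c where "c = exp (- s\<^sup>2 * vbar / 4)"
  \<comment> \<open>The first two terms come from the normal approximation of single pairs, the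
    third from the fluctuation of the conditional variance, the last from \<open>n * (n - 1)\<close>
    in place of \<open>n\<^sup>2\<close>.\<close>
  define B where "B n = \<bar>s\<bar> ^ 3 / 6 * (1 / real n) + s ^ 4 / 8 * (1 / real n ^ 2) + s\<^sup>2 * (sqrt (real n ^ 3) / real n ^ 2) + s\<^sup>2 / 4 * (1 / real n)" for n :: nat
  have mJ [measurable]: "(\<lambda>\<omega>. \<Sum>p\<in>ksubsets n 2. J p \<omega> - tt) \<in> borel_measurable unifs" for n by measurable
  have bh: "bm unifs (\<lambda>\<omega>. \<Sum>p\<in>ksubsets n 2. pf h p \<omega>)" for n by (intro bm_sum h.bm_pf)
  have bv: "bm unifs (\<lambda>\<omega>. \<Sum>p\<in>ksubsets n 2. pf vv p \<omega>)" for n by (intro bm_sum vv.bm_pf)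
  have [measurable]: "g n \<in> borel_measurable unifs" for n unfolding g_def[abs_def] using bm_measurable[OF bh[of n]] by measurable
  have [measurable]: "w n \<in> borel_measurable unifs" for n unfolding w_def[abs_def] using bm_measurable[OF bv[of n]] by measurable
  have g1: "cmod (g n \<omega>) = 1" for n \<omega> unfolding g_def by (rule norm_exp_i_times)
  have vs: "0 \<le> (\<Sum>p\<in>ksubsets n 2. pf vv p \<omega>)" for n \<omega> using vv_bounds by (intro sum_nonneg) (simp add: pf_def)
  have w1: "0 \<le> w n \<omega>" "w n \<omega> \<le> 1" for n \<omega> using vs[of \<omega> n] by (simp_all add: w_def)
  have c1: "0 \<le> c" "c \<le> 1" using vbar_bounds by (simp_all add: c_def)
  have ig: "integrable unifs (g n)" for n by (rule unifs.P.integrable_const_bound[of _ 1]) (simp_all add: g1)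
  have igw: "integrable unifs (\<lambda>\<omega>. g n \<omega> * complex_of_real (w n \<omega>))" for n
    by (rule unifs.P.integrable_const_bound[of _ 1]) (simp_all add: norm_mult g1 w1)
  have choose2: "real (n choose 2) = real n * (real n - 1) / 2" for n
    by (cases n) (simp_all add: choose_two field_simps real_of_nat_div)
  have bound: "cmod (I1 n - complex_of_real c * (\<integral>\<omega>. g n \<omega> \<partial>unifs)) \<le> B n" if n: "n > 0" for n
  proof -
    define \<theta> where "\<theta> = s / real n"
    define G where "G \<omega> = iexp (\<theta> * (\<Sum>p\<in>ksubsets n 2. J p \<omega> - tt))" for \<omega>
    have Gm: "G \<in> borel_measurable unifs" unfolding G_def[abs_def] by measurable
    have G1: "cmod (G \<omega>) = 1" for \<omega> unfolding G_def by (rule norm_exp_i_times)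
    have Gi: "integrable unifs G" using Gm by (rule unifs.P.integrable_const_bound[of _ 1, rotated]) (simp add: G1)
    let ?i = "\<lambda>x. \<integral>y. G (mix A x y) \<partial>unifs"
    have im: "?i \<in> borel_measurable unifs" using Gm by (rule unifs.borel_measurable_resample)
    have i1: "cmod (?i x) \<le> 1" for x
      using integral_norm_bound[of unifs "\<lambda>y. G (mix A x y)"] by (simp add: G1 unifs.P.prob_space[simplified])
    have ii: "integrable unifs ?i" using im by (rule unifs.P.integrable_const_bound[of _ 1, rotated]) (simp add: i1)
    have cc: "cmod (?i x - g n x * complex_of_real (w n x)) \<le> real (n choose 2) * (\<bar>\<theta>\<bar> ^ 3 / 6 + \<theta> ^ 4 / 8)" for x
      unfolding G_def g_def w_def \<theta>_def[symmetric] A_def by (rule conditional_char_approx)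
    have "I1 n = (\<integral>x. ?i x \<partial>unifs)"
      unfolding I1_def \<theta>_def[symmetric] G_def[symmetric] by (rule unifs.integral_mix[OF Gi])
    then have "cmod (I1 n - (\<integral>x. g n x * complex_of_real (w n x) \<partial>unifs)) = cmod (\<integral>x. ?i x - g n x * complex_of_real (w n x) \<partial>unifs)"
      using ii igw[of n] by simp
    also have "\<dots> \<le> (\<integral>x. cmod (?i x - g n x * complex_of_real (w n x)) \<partial>unifs)" by (rule integral_norm_bound)
    also have "\<dots> \<le> (\<integral>x. real (n choose 2) * (\<bar>\<theta>\<bar> ^ 3 / 6 + \<theta> ^ 4 / 8) \<partial>(unifs :: (nat set \<Rightarrow> real) measure))"
      using ii igw[of n] cc by (intro integral_mono) auto
    also have "\<dots> = real (n choose 2) * (\<bar>\<theta>\<bar> ^ 3 / 6 + \<theta> ^ 4 / 8)" by (simp add: unifs.P.prob_space[simplified])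
    also have "\<dots> \<le> real n ^ 2 * (\<bar>\<theta>\<bar> ^ 3 / 6 + \<theta> ^ 4 / 8)"
    proof (rule mult_right_mono)
      have "real n * (real n - 1) \<le> real n * real n" by (intro mult_left_mono) auto
      also have "\<dots> \<le> 2 * (real n * real n)" by simp
      finally show "real (n choose 2) \<le> real n ^ 2" unfolding choose2 power2_eq_square by simp
    qed simp
    also have "\<dots> = \<bar>s\<bar> ^ 3 / 6 * (1 / real n) + s ^ 4 / 8 * (1 / real n ^ 2)"
      using n by (simp add: \<theta>_def power_divide distrib_left) (simp add: power_numeral_reduce)
    finally have p1: "cmod (I1 n - (\<integral>x. g n x * complex_of_real (w n x) \<partial>unifs)) \<le> \<bar>s\<bar> ^ 3 / 6 * (1 / real n) + s ^ 4 / 8 * (1 / real n ^ 2)" .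
    let ?S = "\<lambda>\<omega>. \<Sum>p\<in>ksubsets n 2. pf vv p \<omega> - vbar"
    have bS: "bm unifs ?S" by (intro bm_sum bm_diff vv.bm_pf bm_const)
    have iS: "integrable unifs (\<lambda>\<omega>. \<bar>?S \<omega>\<bar>)" using unifs.P.bm_integrable[OF bS] by (rule integrable_abs)
    have ptw: "cmod (g n \<omega> * complex_of_real (w n \<omega>) - complex_of_real c * g n \<omega>) \<le> \<theta>\<^sup>2 / 2 * \<bar>?S \<omega>\<bar> + s\<^sup>2 / 4 * (1 / real n)" for \<omega>
    proof -
      have "g n \<omega> * complex_of_real (w n \<omega>) - complex_of_real c * g n \<omega> = g n \<omega> * complex_of_real (w n \<omega> - c)"
        by (simp add: algebra_simps)
      then have "cmod (g n \<omega> * complex_of_real (w n \<omega>) - complex_of_real c * g n \<omega>) = \<bar>w n \<omega> - c\<bar>"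
        by (simp only: norm_mult g1 norm_of_real mult_1)
      also have "\<dots> = \<bar>exp (- (\<theta>\<^sup>2 / 2 * (\<Sum>p\<in>ksubsets n 2. pf vv p \<omega>))) - exp (- (s\<^sup>2 * vbar / 4))\<bar>"
        by (simp add: w_def c_def \<theta>_def)
      also have "\<dots> \<le> \<bar>\<theta>\<^sup>2 / 2 * (\<Sum>p\<in>ksubsets n 2. pf vv p \<omega>) - s\<^sup>2 * vbar / 4\<bar>"
        using vs[of \<omega> n] vbar_bounds by (intro exp_minus_lipschitz) auto
      \<comment> \<open>Centring the variances subtracts
        \<open>s\<^sup>2 / 4 * (1 - 1 / n) * vbar\<close>, since there are \<open>n choose 2\<close>
        pairs; the defect against the limit is the term with \<open>1 / n\<close>.\<close>
      also have "\<theta>\<^sup>2 / 2 * (\<Sum>p\<in>ksubsets n 2. pf vv p \<omega>) - s\<^sup>2 * vbar / 4 = \<theta>\<^sup>2 / 2 * ?S \<omega> - s\<^sup>2 / 4 * (1 / real n) * vbar"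
      proof -
        have "?S \<omega> = (\<Sum>p\<in>ksubsets n 2. pf vv p \<omega>) - real n * (real n - 1) / 2 * vbar"
          by (simp add: sum_subtractf card_ksubsets choose2)
        moreover have "\<theta>\<^sup>2 / 2 * T - s\<^sup>2 * vbar / 4 = \<theta>\<^sup>2 / 2 * (T - real n * (real n - 1) / 2 * vbar) - s\<^sup>2 / 4 * (1 / real n) * vbar" for T
          using n by (simp add: \<theta>_def power2_eq_square field_simps)
        ultimately show ?thesis by (simp only:)
      qed
      also have "\<bar>\<theta>\<^sup>2 / 2 * ?S \<omega> - s\<^sup>2 / 4 * (1 / real n) * vbar\<bar> \<le> \<bar>\<theta>\<^sup>2 / 2 * ?S \<omega>\<bar> + \<bar>s\<^sup>2 / 4 * (1 / real n) * vbar\<bar>"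
        by (rule abs_triangle_ineq4)
      also have "\<dots> \<le> \<theta>\<^sup>2 / 2 * \<bar>?S \<omega>\<bar> + s\<^sup>2 / 4 * (1 / real n)"
      proof (rule add_mono)
        show "\<bar>\<theta>\<^sup>2 / 2 * ?S \<omega>\<bar> \<le> \<theta>\<^sup>2 / 2 * \<bar>?S \<omega>\<bar>" by (simp add: abs_mult)
        have "s\<^sup>2 / 4 * (1 / real n) * \<bar>vbar\<bar> \<le> s\<^sup>2 / 4 * (1 / real n) * 1"
          using vbar_bounds by (intro mult_left_mono) auto
        then show "\<bar>s\<^sup>2 / 4 * (1 / real n) * vbar\<bar> \<le> s\<^sup>2 / 4 * (1 / real n)" by (simp add: abs_mult)
      qed
      finally show ?thesis .
    qed
    have "cmod ((\<integral>x. g n x * complex_of_real (w n x) \<partial>unifs) - complex_of_real c * (\<integral>\<omega>. g n \<omega> \<partial>unifs))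
      = cmod (\<integral>x. g n x * complex_of_real (w n x) - complex_of_real c * g n x \<partial>unifs)"
      using igw[of n] ig[of n] by simp
    also have "\<dots> \<le> (\<integral>x. cmod (g n x * complex_of_real (w n x) - complex_of_real c * g n x) \<partial>unifs)" by (rule integral_norm_bound)
    also have "\<dots> \<le> (\<integral>\<omega>. \<theta>\<^sup>2 / 2 * \<bar>?S \<omega>\<bar> + s\<^sup>2 / 4 * (1 / real n) \<partial>unifs)"
      using igw[of n] ig[of n] iS by (intro integral_mono ptw) auto
    also have "\<dots> = \<theta>\<^sup>2 / 2 * (\<integral>\<omega>. \<bar>?S \<omega>\<bar> \<partial>unifs) + s\<^sup>2 / 4 * (1 / real n)"
      using iS by (simp add: unifs.P.prob_space[simplified])
    also have "\<dots> \<le> \<theta>\<^sup>2 / 2 * (2 * sqrt (real n ^ 3)) + s\<^sup>2 / 4 * (1 / real n)"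
      by (intro add_right_mono mult_left_mono vv_concentration) simp
    also have "\<theta>\<^sup>2 / 2 * (2 * sqrt (real n ^ 3)) = s\<^sup>2 * (sqrt (real n ^ 3) / real n ^ 2)"
      by (simp add: \<theta>_def power_divide)
    finally have p2: "cmod ((\<integral>x. g n x * complex_of_real (w n x) \<partial>unifs) - complex_of_real c * (\<integral>\<omega>. g n \<omega> \<partial>unifs))
      \<le> s\<^sup>2 * (sqrt (real n ^ 3) / real n ^ 2) + s\<^sup>2 / 4 * (1 / real n)" .
    show ?thesis unfolding B_def
      using p1 p2 norm_triangle_ineq[of "I1 n - (\<integral>x. g n x * complex_of_real (w n x) \<partial>unifs)" "(\<integral>x. g n x * complex_of_real (w n x) \<partial>unifs) - complex_of_real c * (\<integral>\<omega>. g n \<omega> \<partial>unifs)"]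
      by simp
  qed
  have l: "(\<lambda>n. 1 / real n) \<longlonglongrightarrow> 0" "(\<lambda>n. 1 / real n ^ 2) \<longlonglongrightarrow> 0" "(\<lambda>n. sqrt (real n ^ 3) / real n ^ 2) \<longlonglongrightarrow> 0"
    by real_asymp+
  have "B \<longlonglongrightarrow> \<bar>s\<bar> ^ 3 / 6 * 0 + s ^ 4 / 8 * 0 + s\<^sup>2 * 0 + s\<^sup>2 / 4 * 0"
    unfolding B_def by (intro tendsto_add tendsto_mult tendsto_const l)
  then have B0: "B \<longlonglongrightarrow> 0" by simp
  have ev: "\<forall>\<^sub>F n in sequentially. norm (I1 n - complex_of_real c * (\<integral>\<omega>. g n \<omega> \<partial>unifs)) \<le> B n"
    by (rule eventually_mono[OF eventually_gt_at_top[of 0]]) (rule bound)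
  show ?thesis
    using Lim_null_comparison[OF ev B0] unfolding I1_def g_def c_def .
qed

end

section \<open>The limit law in the degenerate case\<close>

context graphon_version
begin

text \<open>If \<open>h\<close> vanishes almost everywhere then \<open>W * V\<close> equals
  \<open>tt\<close>, which is not 0, so neither factor is 0; vanishing of \<open>vv\<close> then
  forces \<open>W = 1\<close>, and every edge is present almost surely.\<close>

lemma complete_if_no_variance:
  assumes h0: "(\<integral>x. (\<integral>y. (h x y)\<^sup>2 \<partial>unif01) \<partial>unif01) = 0" and v0: "vbar = 0" and t0: "tt \<noteq> 0"
  shows "tt = 1"
proof -
  have e1: "AE \<omega> in unifs. edge \<omega> p = 1" if p: "card p = 2" for p
  proof -
    obtain i j where ij: "p = {i, j}" "i \<noteq> j" using p by (auto simp: card_2_iff)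
    have "(\<integral>\<omega>. (pf h p \<omega>)\<^sup>2 \<partial>unifs) = 0" using h.integral_pf_sq[OF p] h0 by simp
    then have "AE \<omega> in unifs. (pf h p \<omega>)\<^sup>2 = 0"
      using integral_nonneg_eq_0_iff_AE[OF unifs.P.bm_integrable[OF bm_power[OF h.bm_pf[of p], of 2]]] by simp
    moreover have "(\<integral>\<omega>. pf vv p \<omega> \<partial>unifs) = 0" using vv.integral_pf[OF p] v0 by (simp add: vbar_def)
    then have "AE \<omega> in unifs. pf vv p \<omega> = 0"
      by (subst (asm) integral_nonneg_eq_0_iff_AE[OF unifs.P.bm_integrable[OF vv.bm_pf]]) (simp_all add: pf_def vv_bounds)
    \<comment> \<open>With \<open>W = 1\<close> an edge is present as soon as its uniform variable
      is at most 1, which holds only almost surely.\<close>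
    moreover have "AE u in unif01. u \<le> 1" unfolding AE_unif01_iff by simp
    then have "AE \<omega> in unifs. \<omega> p \<le> 1" using unifs.AE_component[of p] by simp
    ultimately show ?thesis
    proof eventually_elim
      case (elim \<omega>)
      let ?w = "W (\<omega> {i}) (\<omega> {j})" and ?v = "V (\<omega> {i}) (\<omega> {j})"
      have "?w * ?v = tt" using elim(1) unfolding ij(1) pf_doubleton[OF h.f_sym ij(2)] by (simp add: h_def)
      then have "?w \<noteq> 0" "?v \<noteq> 0" using t0 by auto
      moreover have "?v\<^sup>2 * ?w * (1 - ?w) = 0" using elim(2) unfolding ij(1) pf_doubleton[OF vv.f_sym ij(2)] by (simp add: vv_def)
      ultimately have "?w = 1" by simp
      then show ?case using elim(3) unfolding ij(1) edge_doubleton[OF ij(2)] by simp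
    qed
  qed
  have "AE \<omega> in unifs. \<forall>p\<in>pairs {..<r}. edge \<omega> p = 1"
    using e1 by (intro AE_finite_allI) (auto simp: pairs_def)
  then have "AE \<omega> in unifs. H {..<r} \<omega> = 1" by eventually_elim (simp add: H_def)
  then have "(\<integral>\<omega>. H {..<r} \<omega> \<partial>unifs) = (\<integral>\<omega>. 1 \<partial>(unifs :: (nat set \<Rightarrow> real) measure))"
    by (intro integral_cong_AE) auto
  then show ?thesis by (simp add: tt_def unifs.P.prob_space[simplified])
qed

text \<open>The limiting characteristic function is a product of the noise factor, the normal factor
  for the lost sum of squares, and the chi-square factors; the first two merge into the linear
  summand. If all coefficients vanished, the noise and the whole norm of \<open>h\<close> would
  vanish too, which forces \<open>tt = 1\<close>.\<close>

theorem chaos_limit: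
  assumes deg: "AE x in unif01. tau x = tt" and t0: "tt \<noteq> 0" and t1: "tt \<noteq> 1"
  obtains c :: "nat \<Rightarrow> real" where "summable (\<lambda>i. (c i)\<^sup>2)" "(\<Sum>i. (c i)\<^sup>2) > 0"
    "weak_conv_m (\<lambda>n. normalized_law n r W0 (real r - 1))
       (distr normals borel (\<lambda>z. c 0 * z 0 + (\<Sum>i. c (Suc i) * ((z (Suc i))\<^sup>2 - 1))))"
proof -
  define Q where "Q = (\<integral>x. (\<integral>y. (h x y)\<^sup>2 \<partial>unif01) \<partial>unif01) / 4"
  obtain b where b: "summable (\<lambda>l. (b l)\<^sup>2)" "(\<Sum>l. (b l)\<^sup>2) \<le> Q"
    and lim: "\<And>s L. (\<lambda>N. \<Prod>l<N. chi_cf (s * b l)) \<longlonglongrightarrow> L \<Longrightarrow>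
      (\<lambda>n. \<integral>\<omega>. iexp (s / real n * (\<Sum>p\<in>ksubsets n 2. pf h p \<omega>)) \<partial>unifs) \<longlonglongrightarrow> complex_of_real (exp (- s\<^sup>2 * (Q - (\<Sum>l. (b l)\<^sup>2)))) * L"
    by (rule h.degenerate_U_statistic_limit[OF h_degenerate[OF deg], folded Q_def]) (rule that)
  define q where "q = Q - (\<Sum>l. (b l)\<^sup>2)"
  define f where "f = 1 / (fact (r - 2) :: real)"
  \<comment> \<open>\<open>f\<close> is the weight of a pair, \<open>1 / fact (r - 2)\<close>. The
    variance of the linear part is \<open>vbar / 2\<close> from the noise plus \<open>2 * q\<close>,
    because the lost sum of squares \<open>q\<close> enters as
    \<open>exp (- s\<^sup>2 * q)\<close>.\<close>
  define c where "c i = (case i of 0 \<Rightarrow> f * sqrt (vbar / 2 + 2 * q) | Suc l \<Rightarrow> f * b l)" for i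
  have q0: "q \<ge> 0" using b(2) by (simp add: q_def)
  have f0: "f > 0" by (simp add: f_def)
  have c0: "c 0 = f * sqrt (vbar / 2 + 2 * q)" and cS: "c (Suc l) = f * b l" for l by (simp_all add: c_def)
  have sc: "summable (\<lambda>i. (c i)\<^sup>2)"
    by (subst summable_Suc_iff[symmetric]) (simp add: cS power_mult_distrib b(1) summable_mult)
  have pos: "(\<Sum>i. (c i)\<^sup>2) > 0"
  proof (rule ccontr)
    assume "\<not> ?thesis"
    then have "(\<Sum>i. (c i)\<^sup>2) = 0" using suminf_nonneg[OF sc] by simp
    then have z: "c i = 0" for i using suminf_eq_zero_iff[OF sc] by simp
    have "vbar / 2 + 2 * q = 0" using z[of 0] f0 by (simp add: c0)
    then have vq: "vbar = 0" "q = 0" using vbar_bounds(1) q0 by linarith+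
    have "b l = 0" for l using z[of "Suc l"] f0 by (simp add: cS)
    then have "Q = 0" using vq(2) by (simp add: q_def)
    then have "tt = 1" using vq(1) t0 by (intro complete_if_no_variance) (simp_all add: Q_def)
    then show False using t1 by simp
  qed
  let ?L = "\<lambda>c. distr normals borel (\<lambda>z. c 0 * z 0 + (\<Sum>i. c (Suc i) * ((z (Suc i))\<^sup>2 - 1)))"
  have wc: "weak_conv_m (\<lambda>n. normalized_law n r W0 (real r - 1)) (?L c)"
  proof (rule levy_continuity[OF real_distribution_normalized real_distribution_chaos])
    fix t :: real
    define s where "s = t * f"
    \<comment> \<open>The same chaos without its linear part; its characteristic function provides
      the limit \<open>L\<close> of the chi-square products.\<close>
    define c' where "c' i = (case i of 0 \<Rightarrow> 0 | Suc l \<Rightarrow> c (Suc l))" for i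
    have sc': "summable (\<lambda>i. (c' i)\<^sup>2)"
      using sc by (subst summable_Suc_iff[symmetric], subst (asm) summable_Suc_iff[symmetric]) (simp add: c'_def)
    define L where "L = char (?L c') t"
    have "(\<lambda>N. complex_of_real (exp (- (t * c' 0)\<^sup>2 / 2)) * (\<Prod>i<N. chi_cf (t * c' (Suc i)))) \<longlonglongrightarrow> L"
      unfolding L_def by (rule chaos_char[OF sc'])
    then have prodL: "(\<lambda>N. \<Prod>l<N. chi_cf (s * b l)) \<longlonglongrightarrow> L"
      by (simp add: c'_def cS s_def mult.assoc)
    then have "(\<lambda>N. complex_of_real (exp (- (t * c 0)\<^sup>2 / 2)) * (\<Prod>i<N. chi_cf (t * c (Suc i)))) \<longlonglongrightarrow> complex_of_real (exp (- (t * c 0)\<^sup>2 / 2)) * L"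
      unfolding cS s_def mult.assoc by (rule tendsto_mult_left)
    then have ch: "char (?L c) t = complex_of_real (exp (- (t * c 0)\<^sup>2 / 2)) * L"
      by (rule LIMSEQ_unique[OF chaos_char[OF sc]])
    have "(\<lambda>n. complex_of_real (exp (- s\<^sup>2 * vbar / 4)) * (\<integral>\<omega>. iexp (s / real n * (\<Sum>p\<in>ksubsets n 2. pf h p \<omega>)) \<partial>unifs))
      \<longlonglongrightarrow> complex_of_real (exp (- s\<^sup>2 * vbar / 4)) * (complex_of_real (exp (- s\<^sup>2 * (Q - (\<Sum>l. (b l)\<^sup>2)))) * L)"
      by (rule tendsto_mult_left[OF lim[OF prodL]])
    from tendsto_add[OF edge_noise_limit[of s] this]
    have "(\<lambda>n. \<integral>\<omega>. iexp (s / real n * (\<Sum>p\<in>ksubsets n 2. J p \<omega> - tt)) \<partial>unifs)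
      \<longlonglongrightarrow> complex_of_real (exp (- s\<^sup>2 * vbar / 4)) * (complex_of_real (exp (- s\<^sup>2 * (Q - (\<Sum>l. (b l)\<^sup>2)))) * L)"
      by (simp only: diff_add_cancel add_0)
    also have "complex_of_real (exp (- s\<^sup>2 * vbar / 4)) * (complex_of_real (exp (- s\<^sup>2 * (Q - (\<Sum>l. (b l)\<^sup>2)))) * L) = char (?L c) t"
    proof -
      have "(t * c 0)\<^sup>2 = s\<^sup>2 * (vbar / 2 + 2 * q)"
        using vbar_bounds(1) q0 by (simp add: c0 s_def power_mult_distrib)
      then have "exp (- (t * c 0)\<^sup>2 / 2) = exp (- s\<^sup>2 * vbar / 4 + - s\<^sup>2 * q)"
        by (simp add: field_simps)
      then show ?thesis unfolding ch q_def[symmetric] by (simp only: exp_add of_real_mult mult.assoc)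
    qed
    finally have J2: "(\<lambda>n. \<integral>\<omega>. iexp (s / real n * (\<Sum>p\<in>ksubsets n 2. J p \<omega> - tt)) \<partial>unifs) \<longlonglongrightarrow> char (?L c) t" .
    have "(\<lambda>n. char (normalized_law n r W0 (real r - real 2 / 2)) t) \<longlonglongrightarrow> char (?L c) t"
    proof (rule char_projection[OF _ r2])
      fix D :: "nat set" assume D: "finite D" "card D < 2"
      then consider "D = {}" | i where "D = {i}"
        by (metis card_0_eq card_1_singletonE less_2_cases One_nat_def)
      then show "AE \<omega> in unifs. J D \<omega> = tt"
      proof cases
        case 1
        then show ?thesis using J_empty by simp
      next
        case 2
        then show ?thesis unfolding 2 J_single using unifs.AE_component[of "{i}"] deg by simp
      qed
    next
      have "t / fact (r - 2) * (S / real n powr (real 2 / 2)) = s / real n * S" for S and n :: nat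
        by (simp add: s_def f_def)
      then show "(\<lambda>n. \<integral>\<omega>. iexp (t / fact (r - 2) * ((\<Sum>D\<in>ksubsets n 2. J D \<omega> - tt) / real n powr (real 2 / 2))) \<partial>unifs) \<longlonglongrightarrow> char (?L c) t"
        using J2 by (simp only:)
    qed
    then show "(\<lambda>n. char (normalized_law n r W0 (real r - 1)) t) \<longlonglongrightarrow> char (?L c) t" by simp
  qed
  show thesis by (rule that[OF sc pos wc])
qed

text \<open>A constant value of \<open>tau\<close> must be its mean, which is
  \<open>tt\<close>.\<close>

lemma ae_const_tcond: "ae_const01 (tcond r W0) \<longleftrightarrow> (AE x in unif01. tau x = tt)"
proof -
  have "ae_const01 (tcond r W0) \<longleftrightarrow> (\<exists>c. AE x in unif01. tcond r W0 x = c)"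
    by (simp only: ae_const01_def AE_unif01_iff)
  also have "\<dots> \<longleftrightarrow> (\<exists>c. AE x in unif01. tau x = c)"
  proof -
    have "(AE x in unif01. tcond r W0 x = c) \<longleftrightarrow> (AE x in unif01. tau x = c)" for c
      by (rule eventually_subst) (use tcond_eq in \<open>eventually_elim, simp\<close>)
    then show ?thesis by (simp only:)
  qed
  also have "\<dots> \<longleftrightarrow> (AE x in unif01. tau x = tt)"
  proof
    assume "\<exists>c. AE x in unif01. tau x = c"
    then obtain c where c: "AE x in unif01. tau x = c" ..
    then have "(\<integral>x. tau x \<partial>unif01) = (\<integral>x. c \<partial>unif01)" by (intro integral_cong_AE) auto
    then have "c = tt" by (simp add: integral_tau unifs.M.prob_space[simplified])
    then show "AE x in unif01. tau x = tt" using c by simp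
  qed (rule exI)
  finally show ?thesis .
qed

end

theorem theorem1p1:
  fixes W :: "real \<Rightarrow> real \<Rightarrow> real" and r :: nat
  assumes "graphon W" and "r \<ge> 2"
  shows
    "((tK r W = 0 \<longrightarrow> (\<forall>n. AE E in GnW n W. clique_count n r E = 0)) \<and>
     (tK r W = 1 \<longrightarrow> (\<forall>n. AE E in GnW n W. clique_count n r E = n choose r))) \<and>
     (\<not> ae_const01 (tcond r W) \<longrightarrow>
       (\<exists>\<sigma>::real. \<sigma> > 0 \<and> weak_conv_m (\<lambda>n. normalized_law n r W (real r - 1/2))
                          (distr std_normal borel (\<lambda>z. \<sigma> * z)))) \<and>
     (ae_const01 (tcond r W) \<and> tK r W \<notin> {0, 1} \<longrightarrow>
       (\<exists>c :: nat \<Rightarrow> real.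
         summable (\<lambda>i. (c i)\<^sup>2) \<and> (\<Sum>i. (c i)\<^sup>2) > 0 \<and>
         (AE z in PiM UNIV (\<lambda>_::nat. std_normal).
            summable (\<lambda>i. c (Suc i) * ((z (Suc i))\<^sup>2 - 1))) \<and>
         ((\<lambda>N. \<integral>z. ((\<Sum>i<N. c (Suc i) * ((z (Suc i))\<^sup>2 - 1))
                      - (\<Sum>i. c (Suc i) * ((z (Suc i))\<^sup>2 - 1)))\<^sup>2
                 \<partial>PiM UNIV (\<lambda>_::nat. std_normal)) \<longlonglongrightarrow> 0) \<and>
         weak_conv_m (\<lambda>n. normalized_law n r W (real r - 1))
           (distr (PiM UNIV (\<lambda>_::nat. std_normal)) borel
              (\<lambda>z. c 0 * z 0 + (\<Sum>i. c (Suc i) * ((z (Suc i))\<^sup>2 - 1))))))"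
proof -
  obtain W' N where W': "borel_graphon W' r" "N \<in> sets (borel \<Otimes>\<^sub>M borel)"
    "AE x in unif01. AE y in unif01. (x, y) \<notin> N" "\<And>x y. (x, y) \<notin> N \<Longrightarrow> W x y = W' x y"
    by (rule graphon_borel_version[OF assms]) (rule that)
  interpret graphon_version W' r W N
    by (intro graphon_version.intro graphon_version_axioms.intro W')
  show ?thesis
  proof (intro conjI impI allI)
    show "AE E in GnW n W. clique_count n r E = 0" if "tK r W = 0" for n
      using that X_zero by (simp add: tK_eq)
    show "AE E in GnW n W. clique_count n r E = n choose r" if "tK r W = 1" for n
      using that X_full by (simp add: tK_eq)
    show "\<exists>\<sigma>::real. \<sigma> > 0 \<and> weak_conv_m (\<lambda>n. normalized_law n r W (real r - 1/2)) (distr std_normal borel (\<lambda>z. \<sigma> * z))"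
      if "\<not> ae_const01 (tcond r W)"
      using that unfolding ae_const_tcond by (rule normal_limit)
    assume "ae_const01 (tcond r W) \<and> tK r W \<notin> {0, 1}"
    then have "AE x in unif01. tau x = tt" "tt \<noteq> 0" "tt \<noteq> 1" unfolding ae_const_tcond tK_eq by auto
    then obtain c :: "nat \<Rightarrow> real" where c: "summable (\<lambda>i. (c i)\<^sup>2)" "(\<Sum>i. (c i)\<^sup>2) > 0"
      "weak_conv_m (\<lambda>n. normalized_law n r W (real r - 1))
         (distr normals borel (\<lambda>z. c 0 * z 0 + (\<Sum>i. c (Suc i) * ((z (Suc i))\<^sup>2 - 1))))"
      by (rule chaos_limit) (rule that)
    show "\<exists>c :: nat \<Rightarrow> real.
         summable (\<lambda>i. (c i)\<^sup>2) \<and> (\<Sum>i. (c i)\<^sup>2) > 0 \<and>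
         (AE z in PiM UNIV (\<lambda>_::nat. std_normal).
            summable (\<lambda>i. c (Suc i) * ((z (Suc i))\<^sup>2 - 1))) \<and>
         ((\<lambda>N. \<integral>z. ((\<Sum>i<N. c (Suc i) * ((z (Suc i))\<^sup>2 - 1))
                      - (\<Sum>i. c (Suc i) * ((z (Suc i))\<^sup>2 - 1)))\<^sup>2
                 \<partial>PiM UNIV (\<lambda>_::nat. std_normal)) \<longlonglongrightarrow> 0) \<and>
         weak_conv_m (\<lambda>n. normalized_law n r W (real r - 1))
           (distr (PiM UNIV (\<lambda>_::nat. std_normal)) borel
              (\<lambda>z. c 0 * z 0 + (\<Sum>i. c (Suc i) * ((z (Suc i))\<^sup>2 - 1))))"
      by (intro exI[of _ c] conjI c chaos_AE_summable[OF c(1)] chaos_L2_convergence[OF c(1)])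
  qed
qed

end
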